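(* Let $K$ be a number field with algebraic closure $\overline K$. For every integer $N>1$, the moduli space $M_2(N)$ is geometrically irreducible.
   Context: A rational map $\phi:\mathbb P^1\to\mathbb P^1$ of degree $d$ is written homogeneously as $\phi(x,y)=[F_1(x,y):G_1(x,y)]$ with $F_1,G_1$ homogeneous of degree $d$ without common factor; it is identified with its coefficient vector in $\mathbb P^{2d+1}$, and $\mathrm{Rat}_d=\mathbb P^{2d+1}\smallsetminus\{\mathrm{Res}(F_1,G_1)=0\}$ is the space of degree-$d$ rational maps. Iterates are $\phi^N=[F_N:G_N]$ with $F_N=F_{N-1}(F_1,G_1)$, $G_N=G_{N-1}(F_1,G_1)$. Put $\Phi_{N,\phi}(x,y)=yF_N(x,y)-xG_N(x,y)$ and the $N$-th dynatomic polynomial $\Phi^*_{N,\phi}=\prod_{k\mid N}\Phi_{k,\phi}^{\mu(N/k)}$ ($\mu$ the Möbius function); it is a polynomial, and its roots in $\mathbb P^1(\overline K)$ are the points of formal period $N$ for $\phi$. Define $\mathrm{Rat}_d(N)=\{(\alpha,\phi)\in\mathbb P^1\times\mathrm{Rat}_d:\alpha\text{ is a point of formal period }N\text{ for }\phi\}$, with $\mathrm{PGL}_2$ acting by $f\cdot(\alpha,\phi)=(f^{-1}(\alpha),f^{-1}\circ\phi\circ f)$, and $M_d(N)=\mathrm{Rat}_d(N)/\mathrm{PGL}_2$ (a geometric quotient scheme). *)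

theory Defs
  imports
    "HOL-Analysis.Abstract_Topology"
    "HOL-Algebra.Algebraic_Closure_Type"
    "HOL-Library.Poly_Mapping"
    "HOL-Computational_Algebra.Computational_Algebra"
    "Subresultants.Resultant_Prelim"
begin

text \<open>
  Geometric irreducibility of a scheme of finite type over \<open>K\<close> is irreducibility of its base
  change to an algebraic closure, and the latter is a property of the Zariski topology on the
  \<open>K\<close>-bar-valued points.  All spaces below are therefore spaces of points over a field \<open>'a\<close>;
  they are to be read over an algebraically closed \<open>'a\<close>, such as \<open>'k alg_closure\<close>.
\<close>

subsection \<open>Number fields, irreducible spaces, quotient topology\<close>

definition number_field :: "'k::field_char_0 itself \<Rightarrow> bool" where
  "number_field _ \<longleftrightarrow>
     (\<exists>B :: 'k set. finite B \<and> Modules.module.span (\<lambda>(q::rat) x. of_rat q * x) B = UNIV)"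

definition irreducible_space :: "'a topology \<Rightarrow> bool" where
  "irreducible_space Q \<longleftrightarrow> topspace Q \<noteq> {} \<and>
     (\<forall>C D. closedin Q C \<and> closedin Q D \<and> C \<union> D = topspace Q \<longrightarrow>
            C = topspace Q \<or> D = topspace Q)"

definition quotient_topology :: "'a topology \<Rightarrow> ('a \<Rightarrow> 'b) \<Rightarrow> 'b topology" where
  "quotient_topology Q q =
     topology (\<lambda>U. U \<subseteq> q ` topspace Q \<and> openin Q {x \<in> topspace Q. q x \<in> U})"

lemma istopology_quotient:
  "istopology (\<lambda>U. U \<subseteq> q ` topspace Q \<and> openin Q {x \<in> topspace Q. q x \<in> U})"
  unfolding istopology_def
proof (intro conjI allI impI; (elim conjE)?)
  fix S U
  assume "openin Q {x \<in> topspace Q. q x \<in> S}" "openin Q {x \<in> topspace Q. q x \<in> U}"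
  then have "openin Q ({x \<in> topspace Q. q x \<in> S} \<inter> {x \<in> topspace Q. q x \<in> U})"
    by (rule openin_Int)
  also have "{x \<in> topspace Q. q x \<in> S} \<inter> {x \<in> topspace Q. q x \<in> U}
      = {x \<in> topspace Q. q x \<in> S \<inter> U}"
    by blast
  finally show "openin Q {x \<in> topspace Q. q x \<in> S \<inter> U}" .
next
  fix \<K>
  assume *: "\<forall>K\<in>\<K>. K \<subseteq> q ` topspace Q \<and> openin Q {x \<in> topspace Q. q x \<in> K}"
  then have "openin Q (\<Union>K\<in>\<K>. {x \<in> topspace Q. q x \<in> K})"
    by blast
  also have "(\<Union>K\<in>\<K>. {x \<in> topspace Q. q x \<in> K}) = {x \<in> topspace Q. q x \<in> \<Union>\<K>}"
    by blast
  finally show "openin Q {x \<in> topspace Q. q x \<in> \<Union>\<K>}" .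
qed blast+

lemma openin_quotient_topology:
  "openin (quotient_topology Q q) U \<longleftrightarrow>
     U \<subseteq> q ` topspace Q \<and> openin Q {x \<in> topspace Q. q x \<in> U}"
  unfolding quotient_topology_def by (simp add: topology_inverse'[OF istopology_quotient])

lemma topspace_quotient_topology: "topspace (quotient_topology Q q) = q ` topspace Q"
proof -
  have "{x \<in> topspace Q. q x \<in> q ` topspace Q} = topspace Q"
    by blast
  then have "openin (quotient_topology Q q) (q ` topspace Q)"
    by (simp add: openin_quotient_topology)
  moreover have "openin (quotient_topology Q q) (topspace (quotient_topology Q q))"
    by simp
  ultimately show ?thesis
    by (meson openin_quotient_topology openin_subset subset_antisym)
qed

lemma quotient_map_quotient_topology: "quotient_map Q (quotient_topology Q q) q"
  unfolding quotient_map_def topspace_quotient_topology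
  by (simp add: openin_quotient_topology)


subsection \<open>Projective space and the Zariski topology on a product of two projective spaces\<close>

text \<open>
  A vector of length \<open>n + 1\<close> is a function \<open>nat \<Rightarrow> 'a\<close> vanishing above \<open>n\<close>; a point of projective
  space is the class of all nonzero multiples of a nonzero vector.
\<close>

type_synonym 'a proj_point = "(nat \<Rightarrow> 'a) set"

definition proj_class :: "(nat \<Rightarrow> 'a::field) \<Rightarrow> 'a proj_point" where
  "proj_class v = {\<lambda>i. c * v i | c. c \<noteq> 0}"

definition proj_space :: "nat \<Rightarrow> 'a::field proj_point set" where
  "proj_space n = {proj_class v | v. v \<noteq> (\<lambda>_. 0) \<and> (\<forall>i>n. v i = 0)}"

text \<open>
  Polynomials in two blocks of variables \<open>x\<^sub>i\<close> (index \<open>Inl i\<close>) and \<open>y\<^sub>j\<close> (index \<open>Inr j\<close>),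
  as finitely supported functions from exponent vectors to coefficients.
\<close>

type_synonym 'a bipoly = "((nat + nat) \<Rightarrow>\<^sub>0 nat) \<Rightarrow>\<^sub>0 'a"

definition bipoly_eval :: "'a::field bipoly \<Rightarrow> (nat \<Rightarrow> 'a) \<Rightarrow> (nat \<Rightarrow> 'a) \<Rightarrow> 'a" where
  "bipoly_eval p v w = (\<Sum>e \<in> Poly_Mapping.keys p. Poly_Mapping.lookup p e *
     (\<Prod>k \<in> Poly_Mapping.keys e. case_sum v w k ^ Poly_Mapping.lookup e k))"

definition bihomogeneous :: "nat \<Rightarrow> nat \<Rightarrow> 'a::field bipoly \<Rightarrow> bool" where
  "bihomogeneous m n p \<longleftrightarrow> (\<exists>a b. \<forall>e \<in> Poly_Mapping.keys p.
     Poly_Mapping.keys e \<subseteq> Inl ` {..m} \<union> Inr ` {..n} \<and>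
     (\<Sum>i\<le>m. Poly_Mapping.lookup e (Inl i)) = a \<and>
     (\<Sum>j\<le>n. Poly_Mapping.lookup e (Inr j)) = b)"

definition zero_locus :: "nat \<Rightarrow> nat \<Rightarrow> 'a::field bipoly set
    \<Rightarrow> ('a proj_point \<times> 'a proj_point) set" where
  "zero_locus m n S = {(\<alpha>, \<beta>) \<in> proj_space m \<times> proj_space n.
     \<forall>p\<in>S. \<forall>v\<in>\<alpha>. \<forall>w\<in>\<beta>. bipoly_eval p v w = 0}"

definition zariski_topology :: "nat \<Rightarrow> nat \<Rightarrow> ('a::field proj_point \<times> 'a proj_point) topology"
  where
  "zariski_topology m n = topology (\<lambda>U. U \<subseteq> proj_space m \<times> proj_space n \<and>
     (\<exists>S. (\<forall>p\<in>S. bihomogeneous m n p) \<and>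
          proj_space m \<times> proj_space n - U = zero_locus m n S))"

lemma bipoly_eval_superset:
  assumes "finite A" "Poly_Mapping.keys p \<subseteq> A"
  shows "bipoly_eval p v w = (\<Sum>e \<in> A. Poly_Mapping.lookup p e *
     (\<Prod>k \<in> Poly_Mapping.keys e. case_sum v w k ^ Poly_Mapping.lookup e k))"
  unfolding bipoly_eval_def
  by (rule sum.mono_neutral_left) (use assms in \<open>auto simp: in_keys_iff\<close>)

lemma bipoly_eval_add: "bipoly_eval (p + q) v w = bipoly_eval p v w + bipoly_eval q v w"
proof -
  let ?A = "Poly_Mapping.keys p \<union> Poly_Mapping.keys q"
  have "finite ?A" "Poly_Mapping.keys (p + q) \<subseteq> ?A"
    by (auto simp: Poly_Mapping.keys_add)
  then show ?thesis
    by (simp add: bipoly_eval_superset[of ?A] lookup_add distrib_right sum.distrib)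
qed

lemma bipoly_eval_0 [simp]: "bipoly_eval 0 v w = 0"
  by (simp add: bipoly_eval_def)

lemma bipoly_eval_sum: "bipoly_eval (sum f A) v w = (\<Sum>a\<in>A. bipoly_eval (f a) v w)"
  by (induction A rule: infinite_finite_induct) (simp_all add: bipoly_eval_add)

lemma bipoly_eval_single: "bipoly_eval (Poly_Mapping.single e c) v w =
    c * (\<Prod>k \<in> Poly_Mapping.keys e. case_sum v w k ^ Poly_Mapping.lookup e k)"
  by (simp add: bipoly_eval_superset[of "{e}"])

lemma bipoly_sum_single:
  "(\<Sum>e\<in>Poly_Mapping.keys p. Poly_Mapping.single e (Poly_Mapping.lookup p e)) = p"
proof (rule poly_mapping_eqI)
  fix k
  have "Poly_Mapping.lookup
        (\<Sum>e\<in>Poly_Mapping.keys p. Poly_Mapping.single e (Poly_Mapping.lookup p e)) k =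
      (\<Sum>e\<in>Poly_Mapping.keys p. if e = k then Poly_Mapping.lookup p e else 0)"
    by (simp add: lookup_sum lookup_single when_def)
  also have "\<dots> = Poly_Mapping.lookup p k"
    by (simp add: in_keys_iff)
  finally show "Poly_Mapping.lookup
        (\<Sum>e\<in>Poly_Mapping.keys p. Poly_Mapping.single e (Poly_Mapping.lookup p e)) k =
      Poly_Mapping.lookup p k" .
qed

lemma bipoly_eval_mult: "bipoly_eval (p * q) v w = bipoly_eval p v w * bipoly_eval q v w"
proof -
  let ?M = "\<lambda>e. \<Prod>k \<in> Poly_Mapping.keys e. case_sum v w k ^ Poly_Mapping.lookup e k"
  have M: "?M e = (\<Prod>k \<in> A. case_sum v w k ^ Poly_Mapping.lookup e k)"
    if "finite A" "Poly_Mapping.keys e \<subseteq> A" for e A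
    by (rule prod.mono_neutral_left) (use that in \<open>auto simp: in_keys_iff\<close>)
  have M_add: "?M (e + e') = ?M e * ?M e'" for e e'
  proof -
    let ?A = "Poly_Mapping.keys e \<union> Poly_Mapping.keys e'"
    have A: "finite ?A" "Poly_Mapping.keys (e + e') \<subseteq> ?A"
      by (auto simp: Poly_Mapping.keys_add)
    have "?M (e + e') = (\<Prod>k \<in> ?A. case_sum v w k ^ Poly_Mapping.lookup (e + e') k)"
      by (rule M[OF A])
    also have "\<dots> = (\<Prod>k \<in> ?A. case_sum v w k ^ Poly_Mapping.lookup e k) *
        (\<Prod>k \<in> ?A. case_sum v w k ^ Poly_Mapping.lookup e' k)"
      by (simp add: lookup_add power_add prod.distrib)
    also have "(\<Prod>k \<in> ?A. case_sum v w k ^ Poly_Mapping.lookup e k) = ?M e"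
      by (rule M[symmetric]) auto
    also have "(\<Prod>k \<in> ?A. case_sum v w k ^ Poly_Mapping.lookup e' k) = ?M e'"
      by (rule M[symmetric]) auto
    finally show ?thesis .
  qed
  have "p * q = (\<Sum>e\<in>Poly_Mapping.keys p. Poly_Mapping.single e (Poly_Mapping.lookup p e)) *
      (\<Sum>e\<in>Poly_Mapping.keys q. Poly_Mapping.single e (Poly_Mapping.lookup q e))"
    by (simp add: bipoly_sum_single)
  also have "bipoly_eval \<dots> v w = bipoly_eval p v w * bipoly_eval q v w"
    unfolding sum_product bipoly_eval_sum mult_single bipoly_eval_single M_add
    unfolding bipoly_eval_def sum_product by (simp add: mult_ac)
  finally show ?thesis .
qed

lemma bihomogeneous_mult:
  assumes "bihomogeneous m n p" "bihomogeneous m n q"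
  shows "bihomogeneous m n (p * q)"
proof -
  let ?P = "\<lambda>e a b. Poly_Mapping.keys e \<subseteq> Inl ` {..m} \<union> Inr ` {..n} \<and>
     (\<Sum>i\<le>m. Poly_Mapping.lookup e (Inl i)) = a \<and>
     (\<Sum>j\<le>n. Poly_Mapping.lookup e (Inr j)) = b"
  obtain a b where p: "\<forall>e \<in> Poly_Mapping.keys p. ?P e a b"
    using assms(1) unfolding bihomogeneous_def by blast
  obtain a' b' where q: "\<forall>e \<in> Poly_Mapping.keys q. ?P e a' b'"
    using assms(2) unfolding bihomogeneous_def by blast
  have "?P e (a + a') (b + b')" if pq: "e \<in> Poly_Mapping.keys (p * q)" for e
  proof -
    obtain e1 e2 where e: "e = e1 + e2" "e1 \<in> Poly_Mapping.keys p" "e2 \<in> Poly_Mapping.keys q"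
      using keys_mult[of p q] pq by blast
    have "Poly_Mapping.keys e \<subseteq> Poly_Mapping.keys e1 \<union> Poly_Mapping.keys e2"
      unfolding e(1) by (rule Poly_Mapping.keys_add)
    also have "\<dots> \<subseteq> Inl ` {..m} \<union> Inr ` {..n}"
      using p q e by blast
    finally have "Poly_Mapping.keys e \<subseteq> Inl ` {..m} \<union> Inr ` {..n}" .
    then show ?thesis
      using p q e(2,3) by (simp add: e(1) lookup_add sum.distrib)
  qed
  then show ?thesis
    unfolding bihomogeneous_def by blast
qed

lemma bipoly_eval_scale:
  assumes "\<forall>e \<in> Poly_Mapping.keys p. Poly_Mapping.keys e \<subseteq> Inl ` {..m} \<union> Inr ` {..n} \<and>
     (\<Sum>i\<le>m. Poly_Mapping.lookup e (Inl i)) = a \<and>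
     (\<Sum>j\<le>n. Poly_Mapping.lookup e (Inr j)) = b"
  shows "bipoly_eval p (\<lambda>i. s * v i) (\<lambda>j. t * w j) = s ^ a * t ^ b * bipoly_eval p v w"
proof -
  have M: "(\<Prod>k \<in> Poly_Mapping.keys e. case_sum v w k ^ Poly_Mapping.lookup e k) =
      (\<Prod>i\<le>m. v i ^ Poly_Mapping.lookup e (Inl i)) * (\<Prod>j\<le>n. w j ^ Poly_Mapping.lookup e (Inr j))"
    if "e \<in> Poly_Mapping.keys p" for e v w
  proof -
    have "(\<Prod>k \<in> Poly_Mapping.keys e. case_sum v w k ^ Poly_Mapping.lookup e k) =
        (\<Prod>k \<in> Inl ` {..m} \<union> Inr ` {..n}. case_sum v w k ^ Poly_Mapping.lookup e k)"
      by (rule prod.mono_neutral_left) (use that assms in \<open>auto simp: in_keys_iff\<close>)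
    also have "\<dots> = (\<Prod>k \<in> Inl ` {..m}. case_sum v w k ^ Poly_Mapping.lookup e k) *
        (\<Prod>k \<in> Inr ` {..n}. case_sum v w k ^ Poly_Mapping.lookup e k)"
      by (rule prod.union_disjoint) auto
    finally show ?thesis
      by (simp add: prod.reindex)
  qed
  show ?thesis
    unfolding bipoly_eval_def sum_distrib_left
  proof (rule sum.cong)
    fix e assume e: "e \<in> Poly_Mapping.keys p"
    have "(\<Prod>i\<le>m. s ^ Poly_Mapping.lookup e (Inl i)) = s ^ a"
      "(\<Prod>j\<le>n. t ^ Poly_Mapping.lookup e (Inr j)) = t ^ b"
      using assms e by (auto simp: power_sum)
    then show "Poly_Mapping.lookup p e * (\<Prod>k \<in> Poly_Mapping.keys e.
          case_sum (\<lambda>i. s * v i) (\<lambda>j. t * w j) k ^ Poly_Mapping.lookup e k) =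
        s ^ a * t ^ b * (Poly_Mapping.lookup p e *
          (\<Prod>k \<in> Poly_Mapping.keys e. case_sum v w k ^ Poly_Mapping.lookup e k))"
      unfolding M[OF e] power_mult_distrib prod.distrib by simp
  qed simp
qed

lemma bipoly_eval_proj_class:
  assumes "bihomogeneous m n p"
  shows "(\<forall>v'\<in>proj_class v. \<forall>w'\<in>proj_class w. bipoly_eval p v' w' = 0) \<longleftrightarrow>
    bipoly_eval p v w = 0"
proof -
  obtain a b where ab: "\<And>s t. bipoly_eval p (\<lambda>i. s * v i) (\<lambda>j. t * w j) =
      s ^ a * t ^ b * bipoly_eval p v w"
    using bipoly_eval_scale assms unfolding bihomogeneous_def by blast
  have "v \<in> proj_class v" "w \<in> proj_class w"
    unfolding proj_class_def by (auto intro!: exI[of _ 1])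
  then show ?thesis
    by (auto simp: proj_class_def ab)
qed

lemma zero_locus_Un:
  assumes "\<forall>p\<in>S. bihomogeneous m n p" "\<forall>p\<in>T. bihomogeneous m n p"
  shows "zero_locus m n S \<union> zero_locus m n T = zero_locus m n {p * q | p q. p \<in> S \<and> q \<in> T}"
    (is "?L = ?R")
proof
  show "?L \<subseteq> ?R"
    by (auto simp: zero_locus_def bipoly_eval_mult)
  show "?R \<subseteq> ?L"
  proof clarify
    fix \<alpha> \<beta>
    assume R: "(\<alpha>, \<beta>) \<in> ?R" and notT: "(\<alpha>, \<beta>) \<notin> zero_locus m n T"
    then obtain v w where ab: "\<alpha> = proj_class v" "\<beta> = proj_class w"
        "\<alpha> \<in> proj_space m" "\<beta> \<in> proj_space n"
      by (auto simp: zero_locus_def proj_space_def)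
    obtain q where q: "q \<in> T" "bipoly_eval q v w \<noteq> 0"
      using notT ab assms(2) bipoly_eval_proj_class[of m n]
      unfolding zero_locus_def by blast
    have "bipoly_eval p v w = 0" if "p \<in> S" for p
    proof -
      have "bihomogeneous m n (p * q)"
        using assms that q by (simp add: bihomogeneous_mult)
      moreover have "\<forall>v'\<in>\<alpha>. \<forall>w'\<in>\<beta>. bipoly_eval (p * q) v' w' = 0"
        using R that q unfolding zero_locus_def by blast
      ultimately have "bipoly_eval (p * q) v w = 0"
        using bipoly_eval_proj_class ab by blast
      then show ?thesis
        using q by (simp add: bipoly_eval_mult)
    qed
    then show "(\<alpha>, \<beta>) \<in> zero_locus m n S"
      using ab assms(1) bipoly_eval_proj_class[of m n]
      unfolding zero_locus_def by blast
  qed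
qed

lemma istopology_zariski:
  "istopology (\<lambda>U :: ('a::field proj_point \<times> 'a proj_point) set.
     U \<subseteq> proj_space m \<times> proj_space n \<and>
     (\<exists>S. (\<forall>p\<in>S. bihomogeneous m n p) \<and>
          proj_space m \<times> proj_space n - U = zero_locus m n S))"
  (is "istopology (\<lambda>U. U \<subseteq> ?X \<and> ?C U)")
  unfolding istopology_def
proof (intro conjI allI impI; (elim conjE)?)
  fix U V :: "('a proj_point \<times> 'a proj_point) set"
  assume "?C U" "?C V"
  then obtain S T where S: "\<forall>p\<in>S. bihomogeneous m n p" "?X - U = zero_locus m n S"
    and T: "\<forall>p\<in>T. bihomogeneous m n p" "?X - V = zero_locus m n T"
    by blast
  let ?ST = "{p * q | p q. p \<in> S \<and> q \<in> T}"
  have "?X - U \<inter> V = zero_locus m n ?ST"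
    using zero_locus_Un[OF S(1) T(1)] S(2) T(2) by blast
  moreover have "\<forall>p\<in>?ST. bihomogeneous m n p"
    using S(1) T(1) bihomogeneous_mult by blast
  ultimately show "?C (U \<inter> V)"
    by blast
next
  fix \<K> :: "('a proj_point \<times> 'a proj_point) set set"
  assume *: "\<forall>U\<in>\<K>. U \<subseteq> ?X \<and> ?C U"
  then obtain S where S: "\<And>U. U \<in> \<K> \<Longrightarrow> \<forall>p\<in>S U. bihomogeneous m n p"
      "\<And>U. U \<in> \<K> \<Longrightarrow> ?X - U = zero_locus m n (S U)"
    by metis
  have "?X - \<Union>\<K> = zero_locus m n (\<Union>U\<in>\<K>. S U)"
  proof (rule Set.set_eqI)
    fix x
    have "x \<in> ?X - \<Union>\<K> \<longleftrightarrow> x \<in> ?X \<and> (\<forall>U\<in>\<K>. x \<in> ?X - U)"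
      by blast
    also have "\<dots> \<longleftrightarrow> x \<in> ?X \<and> (\<forall>U\<in>\<K>. x \<in> zero_locus m n (S U))"
      using S(2) by auto
    also have "\<dots> \<longleftrightarrow> x \<in> zero_locus m n (\<Union>U\<in>\<K>. S U)"
      unfolding zero_locus_def by auto
    finally show "x \<in> ?X - \<Union>\<K> \<longleftrightarrow> x \<in> zero_locus m n (\<Union>U\<in>\<K>. S U)" .
  qed
  then show "?C (\<Union>\<K>)"
    using S(1) by blast
qed blast+

lemma openin_zariski_topology:
  "openin (zariski_topology m n) U \<longleftrightarrow> U \<subseteq> proj_space m \<times> proj_space n \<and>
     (\<exists>S. (\<forall>p\<in>S. bihomogeneous m n p) \<and>
          proj_space m \<times> proj_space n - U = zero_locus m n S)"
  unfolding zariski_topology_def by (simp add: topology_inverse'[OF istopology_zariski])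

lemma topspace_zariski_topology:
  "topspace (zariski_topology m n) = (proj_space m \<times> proj_space n
     :: ('a::field proj_point \<times> 'a proj_point) set)"
proof -
  have "bihomogeneous m n (1 :: 'a bipoly)"
    by (auto simp: bihomogeneous_def)
  moreover have "bipoly_eval (1 :: 'a bipoly) v w = 1" for v w
    by (simp add: bipoly_eval_def lookup_one)
  then have "zero_locus m n {1 :: 'a bipoly} = {}"
    by (auto simp: zero_locus_def proj_space_def proj_class_def)
  ultimately have "openin (zariski_topology m n)
      (proj_space m \<times> proj_space n :: ('a proj_point \<times> 'a proj_point) set)"
    unfolding openin_zariski_topology by (intro conjI exI[of _ "{1}"]) auto
  then show ?thesis
    by (metis openin_subset openin_topspace openin_zariski_topology subset_antisym)
qed

lemma closedin_zariski_topology: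
  "closedin (zariski_topology m n) Z \<longleftrightarrow>
     (\<exists>S. (\<forall>p\<in>S. bihomogeneous m n p) \<and> Z = zero_locus m n S)"
proof -
  have "zero_locus m n S \<subseteq> proj_space m \<times> proj_space n" for S
    by (auto simp: zero_locus_def)
  then show ?thesis
    unfolding closedin_def openin_zariski_topology topspace_zariski_topology
    by (metis Diff_subset double_diff subset_refl)
qed


subsection \<open>Binary forms, iterates and dynatomic polynomials\<close>

text \<open>
  A polynomial in \<open>x, y\<close> is an element of \<open>'a poly poly\<close>: the inner variable is \<open>x\<close>, the outer
  one is \<open>y\<close>.
\<close>

type_synonym 'a poly2 = "'a poly poly"

definition varX :: "'a::field poly2" where "varX = [:[:0, 1:]:]"
definition varY :: "'a::field poly2" where "varY = [:0, 1:]"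
definition const2 :: "'a::field \<Rightarrow> 'a poly2" where "const2 c = [:[:c:]:]"

definition eval2 :: "'a::field poly2 \<Rightarrow> 'a \<Rightarrow> 'a \<Rightarrow> 'a" where
  "eval2 P x y = poly (poly P [:y:]) x"

definition subst2 :: "'a::field poly2 \<Rightarrow> 'a poly2 \<Rightarrow> 'a poly2 \<Rightarrow> 'a poly2" where
  "subst2 P A B = poly (map_poly (\<lambda>q. poly (map_poly const2 q) A) P) B"

text \<open>
  The coefficient vector \<open>w\<close> of length \<open>2 d + 2\<close> stands for \<open>[F\<^sub>1 : G\<^sub>1]\<close> with
  \<open>F\<^sub>1 = w\<^sub>0 x\<^sup>d + \<dots> + w\<^sub>d y\<^sup>d\<close> and \<open>G\<^sub>1 = w\<^bsub>d+1\<^esub> x\<^sup>d + \<dots> + w\<^bsub>2d+1\<^esub> y\<^sup>d\<close>.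
\<close>

definition num_form :: "nat \<Rightarrow> (nat \<Rightarrow> 'a::field) \<Rightarrow> 'a poly2" where
  "num_form d w = (\<Sum>i\<le>d. const2 (w i) * varX ^ (d - i) * varY ^ i)"

definition den_form :: "nat \<Rightarrow> (nat \<Rightarrow> 'a::field) \<Rightarrow> 'a poly2" where
  "den_form d w = (\<Sum>i\<le>d. const2 (w (d + 1 + i)) * varX ^ (d - i) * varY ^ i)"

definition form_coeffs :: "nat \<Rightarrow> 'a::field poly2 \<Rightarrow> 'a poly2 \<Rightarrow> nat \<Rightarrow> 'a" where
  "form_coeffs d F G i =
     (if i \<le> d then coeff (coeff F i) (d - i)
      else if i \<le> 2 * d + 1 then coeff (coeff G (i - (d + 1))) (d - (i - (d + 1)))
      else 0)"

text \<open>
  Resultant of two binary forms of degree \<open>d\<close>: the \<open>2 d \<times> 2 d\<close> Sylvester determinant, taken with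
  formal degree \<open>d\<close> even if the dehomogenisations at \<open>y = 1\<close> have smaller degree.
\<close>

definition form_resultant :: "nat \<Rightarrow> 'a::field poly2 \<Rightarrow> 'a poly2 \<Rightarrow> 'a" where
  "form_resultant d F G = Determinant.det (sylvester_mat_sub d d (poly F 1) (poly G 1))"

definition Rat :: "nat \<Rightarrow> 'a::field proj_point set" where
  "Rat d = {\<phi> \<in> proj_space (2 * d + 1).
     \<forall>w\<in>\<phi>. form_resultant d (num_form d w) (den_form d w) \<noteq> 0}"

fun iterate :: "'a::field poly2 \<Rightarrow> 'a poly2 \<Rightarrow> nat \<Rightarrow> 'a poly2 \<times> 'a poly2" where
  "iterate F G 0 = (varX, varY)"
| "iterate F G (Suc n) = (subst2 (fst (iterate F G n)) F G, subst2 (snd (iterate F G n)) F G)"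

definition period_poly :: "'a::field poly2 \<Rightarrow> 'a poly2 \<Rightarrow> nat \<Rightarrow> 'a poly2" where
  "period_poly F G n = varY * fst (iterate F G n) - varX * snd (iterate F G n)"

definition moebius :: "nat \<Rightarrow> int" where
  "moebius n = (if squarefree n then (- 1) ^ card (prime_factors n) else 0)"

text \<open>The product is formed in the fraction field of \<open>'a[x, y]\<close>.\<close>

definition dynatomic_poly :: "'a::field poly2 \<Rightarrow> 'a poly2 \<Rightarrow> nat \<Rightarrow> 'a poly2" where
  "dynatomic_poly F G N = (THE P. Fraction_Field.Fract P 1 =
     (\<Prod>k | k dvd N. Fraction_Field.Fract (period_poly F G k) 1 powi moebius (N div k)))"

definition formal_period :: "nat \<Rightarrow> nat \<Rightarrow> 'a::field proj_point \<Rightarrow> 'a proj_point \<Rightarrow> bool" where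
  "formal_period d N \<alpha> \<phi> \<longleftrightarrow> (\<forall>v\<in>\<alpha>. \<forall>w\<in>\<phi>.
     eval2 (dynatomic_poly (num_form d w) (den_form d w) N) (v 0) (v 1) = 0)"

definition Rat_period :: "nat \<Rightarrow> nat \<Rightarrow> ('a::field proj_point \<times> 'a proj_point) set" where
  "Rat_period d N = {(\<alpha>, \<phi>) \<in> proj_space 1 \<times> Rat d. formal_period d N \<alpha> \<phi>}"


subsection \<open>The action of \<open>PGL\<^sub>2\<close> and the moduli space\<close>

text \<open>\<open>(a, b, c, e)\<close> is the matrix with rows \<open>(a, b)\<close> and \<open>(c, e)\<close>.\<close>

type_synonym 'a mat2 = "'a \<times> 'a \<times> 'a \<times> 'a"

definition GL2 :: "'a::field mat2 set" where
  "GL2 = {(a, b, c, e). a * e - b * c \<noteq> 0}"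

definition PGL2 :: "'a::field mat2 set set" where
  "PGL2 = {{(t * a, t * b, t * c, t * e) | t. t \<noteq> 0} | a b c e. (a, b, c, e) \<in> GL2}"

fun mat2_inverse :: "'a::field mat2 \<Rightarrow> 'a mat2" where
  "mat2_inverse (a, b, c, e) =
     (let D = a * e - b * c in (e / D, - b / D, - c / D, a / D))"

fun mat2_apply :: "'a::field mat2 \<Rightarrow> (nat \<Rightarrow> 'a) \<Rightarrow> nat \<Rightarrow> 'a" where
  "mat2_apply (a, b, c, e) v i =
     (if i = 0 then a * v 0 + b * v 1 else if i = 1 then c * v 0 + e * v 1 else 0)"

fun precompose :: "'a::field mat2 \<Rightarrow> 'a poly2 \<Rightarrow> 'a poly2" where
  "precompose (a, b, c, e) F =
     subst2 F (const2 a * varX + const2 b * varY) (const2 c * varX + const2 e * varY)"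

fun postcompose :: "'a::field mat2 \<Rightarrow> 'a poly2 \<times> 'a poly2 \<Rightarrow> 'a poly2 \<times> 'a poly2" where
  "postcompose (a, b, c, e) (F, G) =
     (const2 a * F + const2 b * G, const2 c * F + const2 e * G)"

definition conjugate_map :: "nat \<Rightarrow> 'a::field mat2 \<Rightarrow> (nat \<Rightarrow> 'a) \<Rightarrow> nat \<Rightarrow> 'a" where
  "conjugate_map d M w = case_prod (form_coeffs d)
     (postcompose (mat2_inverse M)
        (precompose M (num_form d w), precompose M (den_form d w)))"

text \<open>
  \<open>f \<cdot> (\<alpha>, \<phi>) = (f\<^sup>-\<^sup>1(\<alpha>), f\<^sup>-\<^sup>1 \<circ> \<phi> \<circ> f)\<close>, computed on all representatives; changing the
  representatives only rescales the resulting vectors, so each component is again one class.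
\<close>

definition PGL2_action :: "nat \<Rightarrow> 'a::field mat2 set \<Rightarrow> 'a proj_point \<times> 'a proj_point
    \<Rightarrow> 'a proj_point \<times> 'a proj_point" where
  "PGL2_action d f = (\<lambda>(\<alpha>, \<phi>).
     ({mat2_apply (mat2_inverse M) v | M v. M \<in> f \<and> v \<in> \<alpha>},
      {conjugate_map d M w | M w. M \<in> f \<and> w \<in> \<phi>}))"

definition PGL2_orbit :: "nat \<Rightarrow> 'a::field proj_point \<times> 'a proj_point
    \<Rightarrow> ('a proj_point \<times> 'a proj_point) set" where
  "PGL2_orbit d x = {PGL2_action d f x | f. f \<in> PGL2}"

text \<open>
  The underlying space of a geometric quotient is the orbit space with the quotient topology.
\<close>

definition moduli_space :: "nat \<Rightarrow> nat \<Rightarrow> ('a::field proj_point \<times> 'a proj_point) set topology"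
  where
  "moduli_space d N =
     quotient_topology (subtopology (zariski_topology 1 (2 * d + 1)) (Rat_period d N))
       (PGL2_orbit d)"

end

theory Submission
  imports Defs "HOL-Analysis.Analysis"
begin

text \<open>
  The orbit space is a quotient of the incidence variety \<open>Rat\<^sub>2(N)\<close>, so the latter has to be shown to
  be irreducible. Two points of it are joined to the family \<open>z\<^sup>2 + c\<close> by a two-parameter family of
  quadratic maps; the dynatomic equation of that family is a polynomial over \<open>L[c, t]\<close> whose
  specialisation at \<open>t = 0\<close> is the dynatomic polynomial \<open>\<Phi>\<^sup>*\<^sub>N(c, z)\<close> of \<open>z\<^sup>2 + c\<close>, without loss of degree.
  If \<open>\<Phi>\<^sup>*\<^sub>N\<close> is irreducible, then a product of two functions vanishing on the zero set of the
  dynatomic equation has a factor that vanishes there.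

  For the irreducibility of \<open>\<Phi>\<^sup>*\<^sub>N\<close> embed the coefficients of a factorisation \<open>P\<^sub>1 P\<^sub>2\<close> into \<open>\<complex>\<close>. By
  Thurston-type transversality (a quadratic differential with double poles along an indifferent cycle
  cannot be invariant, because push-forward contracts area), \<open>P\<^sub>1\<close> and \<open>P\<^sub>2\<close> have no common zero, so
  the norm of \<open>P\<^sub>2\<close> modulo \<open>P\<^sub>1\<close> is a non-zero constant. For \<open>c = - s\<^sup>2\<close> and \<open>s \<rightarrow> \<infinity>\<close> the periodic
  points correspond to periodic sign sequences, and two of them that first differ at place \<open>t\<close> have
  distance of order \<open>s\<close> to the power \<open>1 - t\<close>. Comparing exponents in the norms yields inequalities
  for the energies of the two sets of sign sequences, which contradict a lower bound for the energy
  unless one of the sets is empty.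
\<close>

section \<open>Energy of sets of binary sequences\<close>

text \<open>Each factor of a norm is a difference of two periodic points, so the exponent of
  \<open>s\<close> in a norm is a sum of \<open>wt\<close> over pairs. Transversality makes the
  pairs between the two factors contribute at most 0; the energy of each factor is then paid for by
  its pairs with points of smaller formal period. For each prime \<open>p\<close> dividing
  \<open>N\<close> these contribute at most 1 per point, because f^(N/p)(z) - z is only of order
  \<open>s\<close>. On the other side, many sequences must share prefixes, so pairs inside a set
  have small exponents; as all pairs from one point sum to \<open>N\<close>, the energy is large.
  The passage from z^2 + c to arbitrary maps meets one obstacle: at \<open>t = 0\<close> the point
  at infinity of the chart becomes fixed, and every period polynomial loses one degree. The losses
  cancel in the dynatomic quotient, since for \<open>N > 1\<close> as many divisors carry the
  Moebius value 1 as the value -1. The free parameter \<open>\<kappa>\<close> keeps infinity from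
  being periodic at \<open>t = 1\<close> and \<open>t = - 1\<close>.\<close>

definition Per :: "nat \<Rightarrow> (nat \<Rightarrow> bool) set" where
  "Per d = {b. \<forall>i. b (i + d) = b i}"

text \<open>For \<open>a = b\<close> the value is unspecified; the sums below are only evaluated
  over pairs of different sequences.\<close>

definition fdiff :: "(nat \<Rightarrow> bool) \<Rightarrow> (nat \<Rightarrow> bool) \<Rightarrow> nat" where
  "fdiff a b = (LEAST i. a i \<noteq> b i)"

definition agree :: "nat \<Rightarrow> (nat \<Rightarrow> bool) \<Rightarrow> (nat \<Rightarrow> bool) \<Rightarrow> bool" where
  "agree k a b \<longleftrightarrow> (\<forall>i<k. a i = b i)"

abbreviation wt :: "(nat \<Rightarrow> bool) \<Rightarrow> (nat \<Rightarrow> bool) \<Rightarrow> int" where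
  "wt a b \<equiv> 1 - int (fdiff a b)"

lemma fdiff_commute: "fdiff a b = fdiff b a"
  unfolding fdiff_def by metis

lemma agree_iff_le_fdiff:
  assumes "a \<noteq> b"
  shows "agree k a b \<longleftrightarrow> k \<le> fdiff a b"
proof -
  obtain i where i: "a i \<noteq> b i" using assms by blast
  have 1: "a (fdiff a b) \<noteq> b (fdiff a b)" unfolding fdiff_def using i by (rule LeastI)
  have 2: "a j = b j" if "j < fdiff a b" for j
    using that not_less_Least unfolding fdiff_def by blast
  show ?thesis unfolding agree_def using 1 2 by (meson leI le_less_trans less_le_trans)
qed

lemma Per_mult:
  assumes "b \<in> Per d"
  shows "b (i + k * d) = b i"
proof (induction k)
  case (Suc k)
  have "b ((i + k * d) + d) = b (i + k * d)" using assms by (simp only: Per_def mem_Collect_eq)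
  moreover have "i + Suc k * d = (i + k * d) + d" by simp
  ultimately show ?case using Suc by (simp only:)
qed simp

lemma Per_mod: "b \<in> Per d \<Longrightarrow> b (i mod d) = b i"
  using Per_mult[of b d "i mod d" "i div d"] by simp

lemma Per_mono: "d dvd n \<Longrightarrow> Per d \<subseteq> Per n"
proof
  fix b assume "d dvd n" "b \<in> Per d"
  then obtain k where "n = k * d" by (metis dvd_def mult.commute)
  then show "b \<in> Per n" using Per_mult[OF \<open>b \<in> Per d\<close>] by (simp add: Per_def)
qed

lemma Per_eqI:
  assumes "a \<in> Per d" "b \<in> Per d" "d > 0" "agree d a b"
  shows "a = b"
proof
  fix i
  have "a (i mod d) = b (i mod d)" using assms by (simp add: agree_def)
  then show "a i = b i" using assms by (simp only: Per_mod)
qed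

text \<open>A member of \<open>Per d\<close> is determined by its first \<open>d\<close> entries, of
  which \<open>k\<close> are prescribed here.\<close>

lemma card_Per_agree:
  assumes "d > 0" "k \<le> d"
  shows "finite {b \<in> Per d. agree k a b}" "card {b \<in> Per d. agree k a b} = 2 ^ (d - k)"
proof -
  let ?B = "{b \<in> Per d. agree k a b}" and ?g = "\<lambda>b::nat\<Rightarrow>bool. {i \<in> {k..<d}. b i}"
  have "bij_betw ?g ?B (Pow {k..<d})"
  proof (rule bij_betwI')
    fix x y assume x: "x \<in> ?B" and y: "y \<in> ?B"
    show "?g x = ?g y \<longleftrightarrow> x = y"
    proof
      assume eq: "?g x = ?g y"
      have "x i = y i" if "i < d" for i
      proof (cases "i < k")
        case True then show ?thesis using x y by (simp add: agree_def)
      next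
        case False
        then have "i \<in> {k..<d}" using that by simp
        then show ?thesis using eq by blast
      qed
      then show "x = y" using x y assms Per_eqI[of x d y] by (simp add: agree_def)
    qed simp
  next
    fix y assume y: "y \<in> Pow {k..<d}"
    define b where "b i = (if i mod d < k then a (i mod d) else i mod d \<in> y)" for i
    have "b \<in> ?B" using assms by (auto simp: Per_def agree_def b_def)
    moreover have "?g b = y" using y assms by (auto simp: b_def)
    ultimately show "\<exists>x\<in>?B. y = ?g x" by blast
  qed auto
  then show "finite ?B" "card ?B = 2 ^ (d - k)"
    by (simp_all add: bij_betw_finite bij_betw_same_card card_Pow)
qed

lemma Per_agree_0: "{b \<in> Per d. agree 0 a b} = Per d"
  by (simp add: agree_def)

lemma finite_Per: "d > 0 \<Longrightarrow> finite (Per d)" and card_Per: "d > 0 \<Longrightarrow> card (Per d) = 2 ^ d"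
  using card_Per_agree[of d 0] by (simp_all only: Per_agree_0 diff_zero le0)

lemma fdiff_less:
  assumes "a \<in> Per d" "b \<in> Per d" "d > 0" "a \<noteq> b"
  shows "fdiff a b < d"
proof (rule ccontr)
  assume "\<not> fdiff a b < d"
  then have "agree d a b" using agree_iff_le_fdiff[OF assms(4)] by simp
  then show False using Per_eqI assms by blast
qed

text \<open>Layer-cake form: the first difference counts the lengths of common non-empty prefixes.
  This turns sums of \<open>fdiff\<close> into counts of agreeing pairs.\<close>

lemma fdiff_eq_sum_agree:
  assumes "a \<in> Per d" "b \<in> Per d" "d > 0" "a \<noteq> b"
  shows "int (fdiff a b) = (\<Sum>k=1..d-1. of_bool (agree k a b))"
proof -
  have "{1..d-1} \<inter> {k. k \<le> fdiff a b} = {1..fdiff a b}"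
    using fdiff_less[OF assms] by auto
  then show ?thesis
    using assms by (simp add: agree_iff_le_fdiff sum.If_cases of_bool_def)
qed

lemma sum_pow2_desc: 
  assumes "d > 0"
  shows "(\<Sum>k=1..d-1. 2 ^ (d - k)) = (2::int) ^ d - 2"
proof -
  have "(\<Sum>k=1..n. 2 ^ (Suc n - k)) = (2::int) ^ Suc n - 2" for n
  proof (induction n)
    case (Suc n)
    have e: "(2::int) ^ (Suc (Suc n) - k) = 2 * 2 ^ (Suc n - k)" if "k \<in> {1..n}" for k
    proof -
      have "Suc (Suc n) - k = Suc (Suc n - k)" using that by auto
      then show ?thesis by (metis power_Suc)
    qed
    have "(\<Sum>k=1..n. 2 ^ (Suc (Suc n) - k)) = (\<Sum>k=1..n. 2 * (2::int) ^ (Suc n - k))"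
      by (rule sum.cong[OF refl e])
    also have "\<dots> = 2 * (\<Sum>k=1..n. 2 ^ (Suc n - k))"
      by (rule sum_distrib_left[symmetric])
    finally show ?case unfolding Suc.IH by (simp del: power_Suc) (simp)
  qed simp
  from this[of "d - 1"] show ?thesis using assms by (metis Suc_pred' One_nat_def Suc_diff_1)
qed

text \<open>Analytically this is the exponent of the derivative of f^d(z) - z at a root: the product
  of the distances to all other roots has order \<open>s ^ d\<close>. Combinatorially,
  \<open>2 ^ (d - k) - 1\<close> other members share a prefix of length \<open>k\<close> with
  \<open>a\<close>.\<close>

lemma sum_wt_Per:
  assumes d: "d > 0" and a: "a \<in> Per d"
  shows "(\<Sum>b \<in> Per d - {a}. wt a b) = int d"
proof -
  have fin: "finite (Per d)" by (rule finite_Per[OF d])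
  have "(\<Sum>b \<in> Per d - {a}. int (fdiff a b)) = (\<Sum>b \<in> Per d - {a}. \<Sum>k=1..d-1. of_bool (agree k a b))"
    by (intro sum.cong refl fdiff_eq_sum_agree) (use a d in auto)
  also have "\<dots> = (\<Sum>k=1..d-1. \<Sum>b \<in> Per d - {a}. of_bool (agree k a b))"
    by (rule sum.swap)
  also have "\<dots> = (\<Sum>k=1..d-1. 2 ^ (d - k) - 1)"
  proof (rule sum.cong)
    fix k assume k: "k \<in> {1..d-1}"
    have "(\<Sum>b \<in> Per d - {a}. of_bool (agree k a b)) = int (card ({b \<in> Per d. agree k a b} - {a}))"
      using fin by (simp add: of_bool_def sum.If_cases Int_def set_diff_eq conj_commute conj_left_commute)
    also have "card ({b \<in> Per d. agree k a b} - {a}) = 2 ^ (d - k) - 1"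
      using card_Per_agree[of d k a] k a d
      by (subst card_Diff_singleton) (auto simp: agree_def)
    finally show "(\<Sum>b \<in> Per d - {a}. of_bool (agree k a b)) = 2 ^ (d - k) - (1::int)"
      by (simp add: of_nat_diff)
  qed simp
  also have "\<dots> = 2 ^ d - 2 - int (d - 1)"
    using sum_pow2_desc[OF d] by (simp add: sum_subtractf)
  finally have "(\<Sum>b \<in> Per d - {a}. int (fdiff a b)) = 2 ^ d - 2 - int (d - 1)" .
  moreover have "card (Per d - {a}) = 2 ^ d - 1"
    using a card_Per[OF d] by (simp add: card_Diff_singleton)
  ultimately show ?thesis
    using d by (simp add: sum_subtractf of_nat_diff)
qed

text \<open>Cauchy-Schwarz for the fibres of the map to prefixes of length \<open>k\<close>, of
  which there are \<open>2 ^ k\<close>.\<close>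

lemma card_agree_pairs:
  assumes "finite S"
  shows "real (card S) ^ 2 \<le> 2 ^ k * real (card {(a, b) \<in> S \<times> S. agree k a b})"
proof -
  let ?g = "\<lambda>a::nat\<Rightarrow>bool. {i \<in> {..<k}. a i}"
  define n where "n w = card {a \<in> S. ?g a = w}" for w
  have ag: "agree k a b \<longleftrightarrow> ?g a = ?g b" for a b unfolding agree_def by auto
  have "card S = (\<Sum>w\<in>Pow {..<k}. n w)"
    unfolding n_def using assms by (subst card_UN_disjoint[symmetric]) (auto intro!: arg_cong[where f=card])
  moreover have "card {(a, b) \<in> S \<times> S. agree k a b} = (\<Sum>w\<in>Pow {..<k}. n w ^ 2)"
  proof -
    have "{(a, b) \<in> S \<times> S. agree k a b} = (\<Union>w\<in>Pow {..<k}. {a \<in> S. ?g a = w} \<times> {a \<in> S. ?g a = w})"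
    proof (intro Set.set_eqI iffI)
      fix x assume "x \<in> {(a, b) \<in> S \<times> S. agree k a b}"
      then obtain a b where x: "x = (a, b)" "a \<in> S" "b \<in> S" "?g a = ?g b" using ag by blast
      show "x \<in> (\<Union>w\<in>Pow {..<k}. {a \<in> S. ?g a = w} \<times> {a \<in> S. ?g a = w})"
        by (rule UN_I[of "?g a"]) (use x in simp_all, blast)
    next
      fix x assume "x \<in> (\<Union>w\<in>Pow {..<k}. {a \<in> S. ?g a = w} \<times> {a \<in> S. ?g a = w})"
      then obtain a b where x: "x = (a, b)" "a \<in> S" "b \<in> S" "?g a = ?g b" by (elim UN_E SigmaE) simp
      then show "x \<in> {(a, b) \<in> S \<times> S. agree k a b}" using ag by blast
    qed
    also have "card \<dots> = (\<Sum>w\<in>Pow {..<k}. card ({a \<in> S. ?g a = w} \<times> {a \<in> S. ?g a = w}))"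
      using assms by (intro card_UN_disjoint) auto
    finally show ?thesis by (simp add: n_def card_cartesian_product power2_eq_square)
  qed
  moreover have "(\<Sum>w\<in>Pow {..<k}. real (n w)) ^ 2 \<le> (\<Sum>w\<in>Pow {..<k}. real (n w) ^ 2) * card (Pow {..<k})"
    by (rule sum_squared_le_sum_of_squares) 
  ultimately show ?thesis by (simp add: card_Pow mult.commute)
qed

text \<open>Exponent of \<open>s\<close> in the product of all distances between the periodic points
  with sequences in \<open>S\<close> and the remaining ones, that is, in a resultant.\<close>

definition energy :: "nat \<Rightarrow> (nat \<Rightarrow> bool) set \<Rightarrow> int" where
  "energy N S = (\<Sum>a\<in>S. \<Sum>b\<in>Per N - S. wt a b)"

lemma energy_compl: "S \<subseteq> Per N \<Longrightarrow> energy N (Per N - S) = energy N S"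
  unfolding energy_def by (subst sum.swap) (simp add: double_diff fdiff_commute)

lemma sum_half_powers: "(\<Sum>k=1..j. (1/2::real) ^ k) = 1 - (1/2) ^ j"
  by (induction j) (auto simp: field_simps)

text \<open>By \<open>sum_wt_Per\<close> the weight leaving \<open>S\<close> is \<open>N\<close> per
  point minus the weight inside \<open>S\<close>. Common prefixes reduce the latter, and
  \<open>card_agree_pairs\<close> shows how many there must be. Only prefixes up to the free length
  \<open>j\<close> are counted, since the estimate is worthless once \<open>2 ^ k\<close> exceeds
  the size of \<open>S\<close>.\<close>

lemma energy_lower_bound:
  assumes N: "N > 0" and S: "S \<subseteq> Per N" and j: "j \<le> N - 1"
  shows "real_of_int (energy N S) \<ge> real (N + 1 - j) * real (card S) - real (card S) ^ 2 / 2 ^ j"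
proof -
  have fin: "finite S" using S finite_Per[OF N] finite_subset by blast
  let ?M = "real (card S)"
  have e1: "energy N S = int (card S) * int N - (\<Sum>a\<in>S. \<Sum>b\<in>S - {a}. wt a b)"
  proof -
    have "(\<Sum>b\<in>Per N - S. wt a b) = int N - (\<Sum>b\<in>S - {a}. wt a b)" if a: "a \<in> S" for a
    proof -
      have "(\<Sum>b \<in> Per N - {a}. wt a b) = (\<Sum>b\<in>Per N - S. wt a b) + (\<Sum>b\<in>S - {a}. wt a b)"
        using a S fin finite_Per[OF N]
        by (subst sum.union_disjoint[symmetric]) (auto intro!: sum.cong)
      then show ?thesis using sum_wt_Per[OF N, of a] a S by auto
    qed
    then show ?thesis by (simp add: energy_def sum_subtractf)
  qed
  have "real_of_int (\<Sum>a\<in>S. \<Sum>b\<in>S - {a}. wt a b) =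
     ?M ^ 2 - ?M - (\<Sum>a\<in>S. \<Sum>b\<in>S - {a}. real (fdiff a b))"
  proof -
    have "(\<Sum>b\<in>S - {a}. real_of_int (wt a b)) = ?M - 1 - (\<Sum>b\<in>S - {a}. real (fdiff a b))" if a: "a \<in> S" for a
    proof -
      have "(\<Sum>b\<in>S - {a}. real_of_int (wt a b)) = real (card (S - {a})) - (\<Sum>b\<in>S - {a}. real (fdiff a b))"
        by (simp add: sum_subtractf)
      moreover have "card S = Suc (card (S - {a}))" using fin a by (rule card.remove)
      ultimately show ?thesis by simp
    qed
    then have "(\<Sum>a\<in>S. \<Sum>b\<in>S - {a}. real_of_int (wt a b)) = (\<Sum>a\<in>S. ?M - 1 - (\<Sum>b\<in>S - {a}. real (fdiff a b)))"
      by (intro sum.cong refl)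
    also have "\<dots> = ?M * (?M - 1) - (\<Sum>a\<in>S. \<Sum>b\<in>S - {a}. real (fdiff a b))"
      by (simp only: sum_subtractf[of "\<lambda>_. ?M - 1"] sum_constant)
    finally show ?thesis by (simp only: of_int_sum power2_eq_square right_diff_distrib mult_1_right)
  qed
  moreover have "(\<Sum>a\<in>S. \<Sum>b\<in>S - {a}. real (fdiff a b)) \<ge> (\<Sum>k=1..j. ?M ^ 2 / 2 ^ k - ?M)"
  proof -
    have "(\<Sum>a\<in>S. \<Sum>b\<in>S - {a}. real (fdiff a b)) \<ge> (\<Sum>a\<in>S. \<Sum>b\<in>S - {a}. \<Sum>k=1..j. of_bool (agree k a b))"
    proof (intro sum_mono)
      fix a b assume ab: "a \<in> S" "b \<in> S - {a}"
      then have "real (fdiff a b) = real_of_int (\<Sum>k=1..N-1. of_bool (agree k a b))"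
        using fdiff_eq_sum_agree[of a N b] S N
        by (metis Diff_iff insertCI of_int_of_nat_eq subsetD)
      also have "\<dots> = (\<Sum>k=1..N-1. of_bool (agree k a b))" by simp
      also have "\<dots> \<ge> (\<Sum>k=1..j. of_bool (agree k a b) :: real)"
        using j by (intro sum_mono2) auto
      finally show "(\<Sum>k=1..j. of_bool (agree k a b)) \<le> real (fdiff a b)" .
    qed
    also have "(\<Sum>a\<in>S. \<Sum>b\<in>S - {a}. \<Sum>k=1..j. of_bool (agree k a b)) =
        (\<Sum>a\<in>S. \<Sum>k=1..j. \<Sum>b\<in>S - {a}. of_bool (agree k a b) :: real)"
      by (intro sum.cong refl sum.swap)
    also have "\<dots> = (\<Sum>k=1..j. \<Sum>a\<in>S. \<Sum>b\<in>S - {a}. of_bool (agree k a b))"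
      by (rule sum.swap)
    also have "\<dots> \<ge> (\<Sum>k=1..j. ?M ^ 2 / 2 ^ k - ?M)"
    proof (rule sum_mono)
      fix k
      have "(\<Sum>a\<in>S. \<Sum>b\<in>S - {a}. of_bool (agree k a b)) = (\<Sum>a\<in>S. (\<Sum>b\<in>S. of_bool (agree k a b)) - (1::real))"
      proof (rule sum.cong[OF refl])
        fix a assume a: "a \<in> S"
        have "(\<Sum>b\<in>S. of_bool (agree k a b)) = of_bool (agree k a a) + (\<Sum>b\<in>S - {a}. of_bool (agree k a b) :: real)"
          using fin a by (rule sum.remove)
        moreover have "agree k a a" by (simp add: agree_def)
        ultimately show "(\<Sum>b\<in>S - {a}. of_bool (agree k a b)) = (\<Sum>b\<in>S. of_bool (agree k a b)) - (1::real)"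
          by (simp only: of_bool_eq)
      qed
      also have "\<dots> = (\<Sum>a\<in>S. \<Sum>b\<in>S. of_bool (agree k a b)) - ?M"
        by (simp add: sum_subtractf)
      also have "(\<Sum>a\<in>S. \<Sum>b\<in>S. of_bool (agree k a b)) = real (card {(a, b) \<in> S \<times> S. agree k a b})"
      proof -
        have "(\<Sum>a\<in>S. \<Sum>b\<in>S. of_bool (agree k a b)) = (\<Sum>x\<in>S \<times> S. of_bool (case x of (a, b) \<Rightarrow> agree k a b) :: real)"
          by (simp only: sum.cartesian_product) (simp add: case_prod_beta)
        also have "\<dots> = real (card ((S \<times> S) \<inter> {x. case x of (a, b) \<Rightarrow> agree k a b}))"
          using fin by (subst sum_of_bool_eq) auto
        also have "(S \<times> S) \<inter> {x. case x of (a, b) \<Rightarrow> agree k a b} = {(a, b) \<in> S \<times> S. agree k a b}" by auto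
        finally show ?thesis .
      qed
      finally have "(\<Sum>a\<in>S. \<Sum>b\<in>S - {a}. of_bool (agree k a b)) = real (card {(a, b) \<in> S \<times> S. agree k a b}) - ?M" .
      moreover have "?M ^ 2 / 2 ^ k \<le> real (card {(a, b) \<in> S \<times> S. agree k a b})"
        using card_agree_pairs[OF fin, of k] by (simp add: divide_le_eq mult.commute)
      ultimately show "?M ^ 2 / 2 ^ k - ?M \<le> (\<Sum>a\<in>S. \<Sum>b\<in>S - {a}. of_bool (agree k a b))"
        by linarith
    qed
    finally show ?thesis by simp
  qed
  moreover have "(\<Sum>k=1..j. ?M ^ 2 / 2 ^ k - ?M) = ?M ^ 2 * (1 - 1 / 2 ^ j) - j * ?M"
  proof -
    have "(\<Sum>k=1..j. ?M ^ 2 / 2 ^ k) = ?M ^ 2 * (\<Sum>k=1..j. (1/2) ^ k)"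
      unfolding sum_distrib_left by (rule sum.cong) (simp_all add: power_one_over)
    also have "\<dots> = ?M ^ 2 * (1 - 1 / 2 ^ j)"
      unfolding sum_half_powers by (simp only: power_one_over)
    finally show ?thesis by (simp add: sum_subtractf)
  qed
  ultimately show ?thesis using j N
    unfolding e1 by (simp add: of_nat_diff algebra_simps)
qed

text \<open>Exponent of \<open>s\<close> in f^d(z) - z at the periodic point with sequence
  \<open>b\<close>, written as the product of its distances to the points of period
  \<open>d\<close>.\<close>

definition contact :: "nat \<Rightarrow> (nat \<Rightarrow> bool) \<Rightarrow> int" where
  "contact d b = (\<Sum>a\<in>Per d. wt a b)"

text \<open>The periodic continuation \<open>a'\<close> of the first \<open>d\<close> entries of
  \<open>b\<close> is the closest member of \<open>Per d\<close>. Every other member separates from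
  \<open>b\<close> exactly where it separates from \<open>a'\<close>, so these contribute
  \<open>d\<close> in total, while \<open>a'\<close> contributes at most
  \<open>1 - d\<close>.\<close>

lemma contact_le_1:
  assumes "d > 0" "b \<notin> Per d"
  shows "contact d b \<le> 1"
proof -
  define a' where "a' i = b (i mod d)" for i
  have a': "a' \<in> Per d" by (simp add: a'_def Per_def)
  have ag: "agree d a' b" by (simp add: a'_def agree_def)
  have ne: "a \<noteq> b" if "a \<in> Per d" for a using that assms by auto
  have "fdiff a b = fdiff a a'" if a: "a \<in> Per d" "a \<noteq> a'" for a
  proof -
    have "fdiff a a' < d" using fdiff_less[OF a(1) a' _ a(2)] assms by simp
    then have "agree k a b \<longleftrightarrow> agree k a a'" if "k \<le> Suc (fdiff a a')" for k
      using ag that unfolding agree_def by (metis less_le_trans not_less_eq_eq not_less)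
    then show ?thesis
      using agree_iff_le_fdiff[OF ne[OF a(1)]] agree_iff_le_fdiff[OF a(2)]
      by (metis Suc_n_not_le_n eq_iff le_Suc_eq not_less_eq_eq)
  qed
  then have "contact d b = wt a' b + (\<Sum>a\<in>Per d - {a'}. wt a' a)"
    unfolding contact_def using a' finite_Per[OF assms(1)]
    by (simp add: sum.remove fdiff_commute)
  also have "\<dots> = wt a' b + int d" using sum_wt_Per[OF assms(1) a'] by simp
  also have "\<dots> \<le> 1" using ag agree_iff_le_fdiff[OF ne[OF a']] by simp
  finally show ?thesis .
qed

text \<open>After exchanging the sums, each \<open>a\<close> sees the total weight \<open>N\<close>
  in \<open>Per N\<close> and \<open>d\<close> in \<open>Per d\<close>.\<close>

lemma sum_contact:
  assumes "N > 0" "d > 0" "d dvd N"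
  shows "(\<Sum>b\<in>Per N - Per d. contact d b) = 2 ^ d * (int N - int d)"
proof -
  have "(\<Sum>b\<in>Per N - Per d. contact d b) = (\<Sum>a\<in>Per d. \<Sum>b\<in>Per N - Per d. wt a b)"
    unfolding contact_def by (rule sum.swap)
  also have "\<dots> = (\<Sum>a\<in>Per d. int N - int d)"
  proof (rule sum.cong)
    fix a assume a: "a \<in> Per d"
    have sub: "Per d \<subseteq> Per N" using Per_mono assms by blast
    have "(\<Sum>b \<in> Per N - {a}. wt a b) = (\<Sum>b\<in>Per N - Per d. wt a b) + (\<Sum>b\<in>Per d - {a}. wt a b)"
      using a sub finite_Per assms
      by (subst sum.union_disjoint[symmetric]) (auto intro!: sum.cong)
    then show "(\<Sum>b\<in>Per N - Per d. wt a b) = int N - int d"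
      using sum_wt_Per[of N a] sum_wt_Per[of d a] a sub assms by auto
  qed simp
  finally show ?thesis using card_Per[OF assms(2)] by simp
qed

section \<open>Estimates for the number of prime factors\<close>

lemma fact_le_prod:
  assumes "finite (S :: nat set)" "\<forall>p\<in>S. p \<ge> 2"
  shows "fact (card S + 1) \<le> \<Prod>S"
  using assms
proof (induction "card S" arbitrary: S)
  case (Suc n)
  then have ne: "S \<noteq> {}" by auto
  \<comment> \<open>The largest element is at least \<open>card S + 1\<close>, because
    \<open>S\<close> lies in \<open>{2..Max S}\<close>; removing it splits off the last factor of
    the factorial.\<close>
  let ?m = "Max S"
  have m: "?m \<in> S" using ne Suc.prems by simp
  have "S \<subseteq> {2..?m}" using Suc.prems by auto
  then have "card S \<le> card {2..?m}" by (rule card_mono[rotated]) simp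
  then have "Suc (Suc n) \<le> ?m" using Suc.hyps(2) by simp
  moreover have "fact (card (S - {?m}) + 1) \<le> \<Prod>(S - {?m})"
    using Suc.hyps(2) Suc.prems m by (intro Suc.hyps(1)) auto
  moreover have "card (S - {?m}) = n" using Suc.hyps(2) Suc.prems m by simp
  ultimately have "Suc (Suc n) * fact (n + 1) \<le> ?m * \<Prod>(S - {?m})" by (intro mult_mono) auto
  also have "\<dots> = \<Prod>S" using m Suc.prems by (simp add: prod.remove)
  finally show ?case using Suc.hyps(2) by (metis Suc_eq_plus1 fact_Suc of_nat_id)
qed simp

text \<open>Induction in steps of 2: the right side doubles, and from 20 on the cube grows by a
  factor of at most 2.\<close>

lemma cube_less_pow2: "20 \<le> n \<Longrightarrow> n ^ 3 < (2::nat) ^ ((n + 1) div 2 + 3)"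
proof (induction n rule: less_induct)
  case (less n)
  show ?case
  proof (cases "n < 22")
    case True
    then have "n = 20 \<or> n = 21" using less.prems by auto
    then show ?thesis by auto
  next
    case False
    then obtain m where m: "n = m + 2" "m \<ge> 20" using that[of "n - 2"] by simp
    have "(m + 2) ^ 3 \<le> 2 * m ^ 3"
    proof -
      have "6 * (m * m) + 12 * m + 8 \<le> m * (m * m)"
      proof -
        have "20 * (m * m) \<le> m * (m * m)" using m by (intro mult_right_mono) auto
        moreover have "20 * m \<le> m * m" using m by simp
        ultimately show ?thesis using m(2) by linarith
      qed
      then show ?thesis by (simp add: power3_eq_cube algebra_simps)
    qed
    also have "\<dots> < 2 * 2 ^ ((m + 1) div 2 + 3)" using less.IH[of m] m by simp
    also have "\<dots> = 2 ^ ((n + 1) div 2 + 3)"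
    proof -
      have "(n + 1) div 2 + 3 = Suc ((m + 1) div 2 + 3)" using m by simp
      then show ?thesis by (simp only: power_Suc)
    qed
    finally show ?thesis using m by (simp only:)
  qed
qed

lemma less_pow2_half: "5 \<le> n \<Longrightarrow> n < (2::nat) ^ ((n + 1) div 2)"
proof (induction n rule: less_induct)
  case (less n)
  show ?case
  proof (cases "n < 7")
    case True
    then have "n = 5 \<or> n = 6" using less.prems by auto
    then show ?thesis by auto
  next
    case False
    then have m: "n = (n - 2) + 2" "n - 2 \<ge> 5" by auto
    have "n \<le> 2 * (n - 2)" using False by simp
    also have "\<dots> < 2 * 2 ^ ((n - 2 + 1) div 2)" using less.IH[of "n - 2"] m by simp
    also have "\<dots> = 2 ^ ((n + 1) div 2)"
    proof -
      have "(n + 1) div 2 = Suc ((n - 2 + 1) div 2)" using m by linarith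
      then show ?thesis by (simp only: power_Suc)
    qed
    finally show ?thesis .
  qed
qed

lemma fact_omega_le:
  assumes "N > 0"
  shows "fact (card (prime_factors N) + 1) \<le> (N::nat)"
proof -
  have "fact (card (prime_factors N) + 1) \<le> \<Prod>(prime_factors N)"
    by (rule fact_le_prod) (auto dest: in_prime_factors_imp_prime prime_ge_2_nat)
  also have "\<dots> dvd N"
  proof -
    have "(\<Prod>p\<in>prime_factors N. p) dvd (\<Prod>p\<in>prime_factors N. p ^ multiplicity p N)"
      by (intro prod_dvd_prod dvd_power) (auto simp: prime_factors_multiplicity)
    also have "\<dots> = N" using assms by (simp add: prime_factorization_nat[symmetric])
    finally show ?thesis by simp
  qed
  then have "\<Prod>(prime_factors N) \<le> N" using assms by (simp add: dvd_imp_le)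
  finally show ?thesis .
qed

text \<open>Each summand is at most half of \<open>N * 2 ^ (N div 2)\<close>, so the left side is
  about the square root of \<open>2 ^ N\<close> up to the factor \<open>N\<close> and the number of
  prime factors. That number is tiny, since the factorial of its successor is at most
  \<open>N\<close>.\<close>

lemma contact_total_bound:
  assumes "N > 0" and om: "card (prime_factors N) \<ge> 2"
  shows "(\<Sum>p\<in>prime_factors N. 2 ^ (N div p) * (int N - int (N div p))) < 2 ^ (N - card (prime_factors N) + 2)"
proof -
  let ?om = "card (prime_factors N)"
  have f: "fact (?om + 1) \<le> N" by (rule fact_omega_le[OF assms(1)])
  have N6: "N \<ge> 6"
  proof -
    have "fact 3 \<le> (fact (?om + 1) :: nat)" using om by (intro fact_mono) simp
    also have "fact 3 = (6::nat)" by (simp add: eval_nat_numeral)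
    finally show ?thesis using f by simp
  qed
  have om_pow: "2 ^ ?om \<le> (fact (?om + 1) :: nat)"
  proof -
    have "2 ^ n \<le> (fact (n + 1) :: nat)" for n by (induction n) (auto intro: mult_mono)
    then show ?thesis .
  qed
  have omN: "?om \<le> N" using om_pow f by (meson le_trans less_exp less_imp_le)
  have each: "2 * (2 ^ (N div p) * (int N - int (N div p))) \<le> int N * 2 ^ (N div 2)"
    if p: "p \<in> prime_factors N" for p
  proof -
    have pr: "prime p" "p dvd N" using p by auto
    show ?thesis
    proof (cases "p = 2")
      case True
      then have "int N - int (N div p) = int (N div 2)" "2 * (N div 2) = N" using pr by auto
      then show ?thesis using True by (simp add: algebra_simps flip: of_nat_mult)
    next
      case False
      then have "p \<ge> 3" using prime_ge_2_nat[OF pr(1)] by simp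
      then have "N div p \<le> N div 3" by (simp add: div_le_mono2)
      also have "N div 3 + 1 \<le> N div 2" using N6 by linarith
      finally have le: "N div p + 1 \<le> N div 2" by simp
      have "2 * (2 ^ (N div p) * (int N - int (N div p))) \<le> 2 ^ (N div p + 1) * int N" by simp
      also have "\<dots> \<le> 2 ^ (N div 2) * int N" using le by (intro mult_right_mono power_increasing) auto
      finally show ?thesis by (simp add: mult.commute)
    qed
  qed
  have "2 * (\<Sum>p\<in>prime_factors N. 2 ^ (N div p) * (int N - int (N div p))) \<le> int ?om * (int N * 2 ^ (N div 2))"
    unfolding sum_distrib_left using sum_mono[OF each] by simp
  also have "\<dots> < 2 * 2 ^ (N - ?om + 2)"
  proof -
    \<comment> \<open>With at least three prime factors \<open>N\<close> is at least 24, and the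
      crude bound \<open>N ^ 3\<close> suffices. Two prime factors need the sharper
      \<open>less_pow2_half\<close>, as \<open>N\<close> may be as small as 6.\<close>
    have "?om * N * 2 ^ ?om < 2 ^ ((N + 1) div 2 + 3)"
    proof (cases "?om = 2")
      case True
      then show ?thesis using less_pow2_half[of N] N6 by (simp add: power_add)
    next
      case False
      then have "fact 4 \<le> (fact (?om + 1) :: nat)" using om by (intro fact_mono) simp
      also have "fact 4 = (24::nat)" by (simp add: eval_nat_numeral)
      finally have N24: "N \<ge> 24" using f by simp
      have "?om * N * 2 ^ ?om \<le> N * N * N" using omN om_pow f by (intro mult_mono) auto
      also have "\<dots> < 2 ^ ((N + 1) div 2 + 3)" using cube_less_pow2[of N] N24 by (simp add: power3_eq_cube)
      finally show ?thesis .
    qed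
    then have "?om * N * 2 ^ ?om * 2 ^ (N div 2) < 2 ^ ((N + 1) div 2 + 3) * 2 ^ (N div 2)" by simp
    also have "\<dots> = (2::nat) ^ (N + 3)"
    proof -
      have "(N + 1) div 2 + 3 + N div 2 = N + 3" by linarith
      then show ?thesis by (simp only: power_add[symmetric])
    qed
    also have "\<dots> = 2 * 2 ^ (N - ?om + 2) * 2 ^ ?om"
    proof -
      have "N + 3 = Suc (N - ?om + 2) + ?om" using omN by simp
      then show ?thesis by (metis power_Suc power_add)
    qed
    finally have "?om * N * 2 ^ (N div 2) * 2 ^ ?om < 2 * 2 ^ (N - ?om + 2) * 2 ^ ?om" by (simp add: mult_ac)
    then have "?om * N * 2 ^ (N div 2) < 2 * 2 ^ (N - ?om + 2)" by simp
    then have "int (?om * N * 2 ^ (N div 2)) < int (2 * 2 ^ (N - ?om + 2))" by (rule of_nat_less_iff[THEN iffD2])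
    then show ?thesis by (simp add: mult.assoc)
  qed
  finally show ?thesis by simp
qed

text \<open>The expression is concave in \<open>M\<close>, so its minimum on an interval is attained
  at an end point; at \<open>b\<close> its value is \<open>b\<close>.\<close>

lemma quadratic_lower_bound:
  fixes M a b :: real
  assumes "a \<le> M" "M \<le> b" "b > 0" 
  shows "3 * M - 2 * M ^ 2 / b \<ge> min (3 * a - 2 * a ^ 2 / b) b"
proof -
  have "(3 * M - 2 * M ^ 2 / b) - b = (b - M) * (2 * M - b) / b"
    using assms by (simp add: field_simps power2_eq_square)
  moreover have "(3 * M - 2 * M ^ 2 / b) - (3 * a - 2 * a ^ 2 / b) = (M - a) * (3 * b - 2 * (M + a)) / b"
    using assms by (simp add: field_simps power2_eq_square)
  moreover have "0 \<le> (b - M) * (2 * M - b) / b \<or> 0 \<le> (M - a) * (3 * b - 2 * (M + a)) / b"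
  proof (cases "2 * M \<ge> b")
    case True then show ?thesis using assms by simp
  next
    case False then show ?thesis using assms by simp
  qed
  ultimately show ?thesis by linarith
qed

text \<open>\<open>H1\<close>, \<open>H2\<close> and \<open>H3\<close> compare exponents in three
  norms: of one factor at the zeros of the other, of the cofactor at the zeros of a factor, and of a
  lower period polynomial at the rest of the cofactor. They bound the two energies from above. A
  small \<open>S1\<close> contradicts the bound of one per point and prime factor; otherwise both
  energies are large, and their sum exceeds the total contact with the lower periods.\<close>

lemma energy_contradiction_ordered:
  assumes N: "N > 1"
    and S: "S1 \<subseteq> Per N" "S2 \<subseteq> Per N" "S1 \<inter> S2 = {}" "S1 \<noteq> {}" "S2 \<noteq> {}"
    and S0: "S0 = Per N - (S1 \<union> S2)"
    and low: "\<And>p. p \<in> prime_factors N \<Longrightarrow> Per (N div p) \<subseteq> S0"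
    and H1: "(\<Sum>a\<in>S1. \<Sum>b\<in>S2. wt a b) \<le> 0"
    and H2: "\<And>S. S \<in> {S1, S2} \<Longrightarrow> (\<Sum>b\<in>S. \<Sum>a\<in>S0. wt b a) \<le> (\<Sum>p\<in>prime_factors N. \<Sum>b\<in>S. contact (N div p) b)"
    and H3: "\<And>p. p \<in> prime_factors N \<Longrightarrow> 0 \<le> (\<Sum>b\<in>S0 - Per (N div p). contact (N div p) b)"
    and le: "card S1 \<le> card S2"
  shows False
proof -
  define om where "om = card (prime_factors N)"
  have N0: "N > 0" using N by simp
  have fin: "finite (Per N)" "finite S1" "finite S2" "finite S0"
    using finite_Per[OF N0] finite_subset[OF S(1)] finite_subset[OF S(2)] S0 by auto
  have dpos: "N div p > 0" "N div p dvd N" if "p \<in> prime_factors N" for p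
    using that N by (auto simp: div_greater_zero_iff dvd_imp_le div_dvd_iff_mult prime_factors_dvd prime_gt_0_nat intro: dvdI[of _ _ p])
  have om1: "om \<ge> 1"
  proof -
    obtain p where "prime p" "p dvd N" using N prime_factor_nat[of N] by auto
    then have "p \<in> prime_factors N" using N by (simp add: prime_factors_dvd)
    then have "om > 0" unfolding om_def by (auto simp: card_gt_0_iff)
    then show ?thesis by simp
  qed
  have omN: "om < N"
  proof -
    have "om < 2 ^ om" by (rule less_exp)
    also have "2 ^ n \<le> (fact (n + 1) :: nat)" for n by (induction n) (auto intro: mult_mono)
    then have "2 ^ om \<le> (fact (om + 1) :: nat)" .
    also have "\<dots> \<le> N" unfolding om_def by (rule fact_omega_le[OF N0])
    finally show ?thesis .
  qed
  have X1: "energy N S1 \<le> (\<Sum>p\<in>prime_factors N. \<Sum>b\<in>S1. contact (N div p) b)"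
  proof -
    have "energy N S1 = (\<Sum>a\<in>S1. (\<Sum>b\<in>S2. wt a b) + (\<Sum>b\<in>S0. wt a b))"
      unfolding energy_def using S S0 fin
      by (intro sum.cong refl, subst sum.union_disjoint[symmetric]) (auto intro!: sum.cong)
    also have "\<dots> \<le> (\<Sum>a\<in>S1. \<Sum>b\<in>S0. wt a b)" using H1 by (simp only: sum.distrib)
    also have "\<dots> \<le> (\<Sum>p\<in>prime_factors N. \<Sum>b\<in>S1. contact (N div p) b)" using H2[of S1] by simp
    finally show ?thesis .
  qed
  have X2: "energy N S2 \<le> (\<Sum>p\<in>prime_factors N. \<Sum>b\<in>S2. contact (N div p) b)"
  proof -
    have "energy N S2 = (\<Sum>a\<in>S2. (\<Sum>b\<in>S1. wt a b) + (\<Sum>b\<in>S0. wt a b))"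
      unfolding energy_def using S S0 fin
      by (intro sum.cong refl, subst sum.union_disjoint[symmetric]) (auto intro!: sum.cong)
    also have "\<dots> = (\<Sum>a\<in>S2. \<Sum>b\<in>S1. wt a b) + (\<Sum>a\<in>S2. \<Sum>b\<in>S0. wt a b)" by (simp only: sum.distrib)
    also have "(\<Sum>a\<in>S2. \<Sum>b\<in>S1. wt a b) = (\<Sum>b\<in>S1. \<Sum>a\<in>S2. wt b a)"
      by (subst sum.swap) (simp add: fdiff_commute)
    also have "\<dots> + (\<Sum>a\<in>S2. \<Sum>b\<in>S0. wt a b) \<le> (\<Sum>a\<in>S2. \<Sum>b\<in>S0. wt a b)" using H1 by simp
    also have "\<dots> \<le> (\<Sum>p\<in>prime_factors N. \<Sum>b\<in>S2. contact (N div p) b)" using H2[of S2] by simp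
    finally show ?thesis .
  qed
  have X1om: "energy N S1 \<le> int om * int (card S1)"
  proof -
    have "(\<Sum>b\<in>S1. contact (N div p) b) \<le> int (card S1)" if p: "p \<in> prime_factors N" for p
    proof -
      have "contact (N div p) b \<le> 1" if "b \<in> S1" for b
        using contact_le_1[OF dpos(1)[OF p], of b] low[OF p] that S0 by blast
      then show ?thesis using sum_mono[of S1 "contact (N div p)" "\<lambda>_. 1"] by simp
    qed
    then have "(\<Sum>p\<in>prime_factors N. \<Sum>b\<in>S1. contact (N div p) b) \<le> (\<Sum>p\<in>prime_factors N. int (card S1))"
      by (rule sum_mono)
    then show ?thesis using X1 by (simp add: om_def)
  qed
  let ?M1 = "real (card S1)" and ?M2 = "real (card S2)"
  have M1pos: "?M1 > 0" using S fin by (simp add: card_gt_0_iff)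
  have tot: "card S1 + card S2 < 2 ^ N"
  proof -
    have "(\<lambda>_. True) \<in> Per N" by (simp add: Per_def)
    moreover obtain p where p: "p \<in> prime_factors N" using om1 unfolding om_def by fastforce
    have "(\<lambda>_. True) \<in> Per (N div p)" by (simp add: Per_def)
    then have "(\<lambda>_. True) \<in> S0" by (rule subsetD[OF low[OF p]])
    ultimately have "S1 \<union> S2 \<subset> Per N" using S S0 by blast
    then have "card (S1 \<union> S2) < card (Per N)" using fin by (simp add: psubset_card_mono)
    then show ?thesis using S fin card_Per[OF N0] by (simp add: card_Un_disjoint)
  qed
  have pow_half: "(2::nat) ^ N = 2 * 2 ^ (N - 1)" using N by (simp add: power_eq_if)
  show False
  \<comment> \<open>Below this threshold the lower bound with \<open>j = N - om\<close> is strictly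
    larger than \<open>om\<close> per point.\<close>
  proof (cases "card S1 < 2 ^ (N - om)")
    case True
    then have lt: "?M1 < 2 ^ (N - om)" by (metis of_nat_less_iff of_nat_numeral of_nat_power)
    have "real_of_int (energy N S1) \<ge> real (N + 1 - (N - om)) * ?M1 - ?M1 ^ 2 / 2 ^ (N - om)"
      using energy_lower_bound[OF N0 S(1), of "N - om"] om1 by simp
    moreover have "N + 1 - (N - om) = om + 1" using omN by simp
    moreover have "?M1 ^ 2 / 2 ^ (N - om) < ?M1"
      using lt M1pos by (simp add: divide_simps power2_eq_square)
    moreover have "real_of_int (energy N S1) \<le> real om * ?M1"
      using X1om by (metis of_int_le_iff of_int_mult of_int_of_nat_eq)
    ultimately show False by (simp add: algebra_simps)
  next
    case False
    then have ge: "card S1 \<ge> 2 ^ (N - om)" by simp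
    have lt: "card S1 < 2 ^ (N - 1)" using tot le pow_half by linarith
    then have om2: "om \<ge> 2" using ge om1 by (cases "om = 1") auto
    then have N2: "N \<ge> 3" using omN by simp
    let ?b = "2 ^ (N - 1) :: real" and ?a = "2 ^ (N - om) :: real"
    have ab: "2 * ?a \<le> ?b"
    proof -
      have "2 * ?a = 2 ^ (N - om + 1)" by simp
      also have "\<dots> \<le> ?b" using om2 omN by (intro power_increasing) auto
      finally show ?thesis .
    qed
    \<comment> \<open>With \<open>j = N - 2\<close> the lower bound is
      \<open>3 * M - 2 * M ^ 2 / ?b\<close>, so it suffices to look at the two ends
      \<open>?a\<close> and \<open>?b\<close> of the range of \<open>M\<close>.\<close>
    have key: "real_of_int (energy N S) \<ge> 2 * ?a"
      if SP: "S \<subseteq> Per N" and c: "?a \<le> real (card S)" "real (card S) \<le> ?b" for S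
    proof -
      have e2: "2 ^ (N - 1) = 2 * (2::real) ^ (N - 2)" using N2 by (simp add: power_eq_if numeral_2_eq_2 Suc_diff_Suc)
      have "real_of_int (energy N S) \<ge> real (N + 1 - (N - 2)) * real (card S) - real (card S) ^ 2 / 2 ^ (N - 2)"
        using energy_lower_bound[OF N0 SP, of "N - 2"] by simp
      also have "real (N + 1 - (N - 2)) = 3" using N2 by simp
      finally have "real_of_int (energy N S) \<ge> 3 * real (card S) - 2 * real (card S) ^ 2 / ?b"
        unfolding e2 by simp
      moreover have "3 * ?a - 2 * ?a ^ 2 / ?b \<ge> 2 * ?a"
        using ab by (simp add: divide_simps power2_eq_square mult_left_mono)
      ultimately show ?thesis using quadratic_lower_bound[OF c, of] ab by (simp add: min_def split: if_splits)
    qed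
    have r1: "?a \<le> ?M1" "?M1 \<le> ?b" using ge lt by (metis of_nat_le_iff of_nat_numeral of_nat_power less_imp_le)+
    have E1: "real_of_int (energy N S1) \<ge> 2 * ?a" using key[OF S(1) r1] .
    have E2: "real_of_int (energy N S2) \<ge> 2 * ?a"
    proof (cases "?M2 \<le> ?b")
      case True
      then show ?thesis using key[OF S(2)] r1(1) le by simp
    next
      \<comment> \<open>A set with more than half of all sequences is replaced by its complement,
        which has the same energy and contains \<open>S1\<close>.\<close>
      case f: False
      have "card (Per N - S2) = 2 ^ N - card S2"
        using S(2) fin card_Per[OF N0] by (simp add: card_Diff_subset)
      moreover have "card S2 \<le> 2 ^ N" using tot by simp
      ultimately have c: "real (card (Per N - S2)) = 2 * ?b - ?M2"
        using pow_half by (simp add: of_nat_diff)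
      have "?M1 + ?M2 < 2 * ?b" using tot pow_half by (metis of_nat_add of_nat_less_iff of_nat_mult of_nat_numeral of_nat_power)
      then have "real_of_int (energy N (Per N - S2)) \<ge> 2 * ?a"
      proof (intro key)
        show "?a \<le> real (card (Per N - S2))" unfolding c using \<open>?M1 + ?M2 < 2 * ?b\<close> r1(1) by linarith
        show "real (card (Per N - S2)) \<le> ?b" unfolding c using f by linarith
      qed simp
      then show ?thesis by (simp add: energy_compl[OF S(2)])
    qed
    \<comment> \<open>By \<open>H3\<close> the points of \<open>S0\<close> outside
      \<open>Per (N div p)\<close> have non-negative total contact. The two sets together therefore
      have at most the total computed in \<open>sum_contact\<close>.\<close>
    have "energy N S1 + energy N S2 \<le> (\<Sum>p\<in>prime_factors N. 2 ^ (N div p) * (int N - int (N div p)))"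
    proof -
      have "energy N S1 + energy N S2 \<le> (\<Sum>p\<in>prime_factors N. (\<Sum>b\<in>S1. contact (N div p) b) + (\<Sum>b\<in>S2. contact (N div p) b))"
        using X1 X2 by (simp add: sum.distrib)
      also have "\<dots> \<le> (\<Sum>p\<in>prime_factors N. 2 ^ (N div p) * (int N - int (N div p)))"
      proof (rule sum_mono)
        fix p assume p: "p \<in> prime_factors N"
        have "Per N - Per (N div p) = (S1 \<union> S2) \<union> (S0 - Per (N div p))"
          using low[OF p] S S0 by blast
        then have split: "(\<Sum>b\<in>Per N - Per (N div p). contact (N div p) b) =
            (\<Sum>b\<in>S1. contact (N div p) b) + (\<Sum>b\<in>S2. contact (N div p) b) + (\<Sum>b\<in>S0 - Per (N div p). contact (N div p) b)"
        proof -
          assume eq: "Per N - Per (N div p) = (S1 \<union> S2) \<union> (S0 - Per (N div p))"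
          have "(S1 \<union> S2) \<inter> (S0 - Per (N div p)) = {}" using S0 by blast
          then have "(\<Sum>b\<in>(S1 \<union> S2) \<union> (S0 - Per (N div p)). contact (N div p) b) =
              (\<Sum>b\<in>S1 \<union> S2. contact (N div p) b) + (\<Sum>b\<in>S0 - Per (N div p). contact (N div p) b)"
            using fin by (intro sum.union_disjoint) simp_all
          moreover have "(\<Sum>b\<in>S1 \<union> S2. contact (N div p) b) = (\<Sum>b\<in>S1. contact (N div p) b) + (\<Sum>b\<in>S2. contact (N div p) b)"
            by (rule sum.union_disjoint[OF fin(2,3) S(3)])
          ultimately show ?thesis unfolding eq by (simp only:)
        qed
        then show "(\<Sum>b\<in>S1. contact (N div p) b) + (\<Sum>b\<in>S2. contact (N div p) b) \<le> 2 ^ (N div p) * (int N - int (N div p))"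
          using sum_contact[OF N0 dpos[OF p]] H3[OF p] split by linarith
      qed
      finally show ?thesis .
    qed
    also have "\<dots> < 2 ^ (N - om + 2)"
      using contact_total_bound[OF N0] om2 unfolding om_def by simp
    finally have "real_of_int (energy N S1 + energy N S2) < real_of_int (2 ^ (N - om + 2))" by (simp only: of_int_less_iff)
    then show False using E1 E2 by simp
  qed
qed

lemma energy_contradiction:
  assumes N: "N > 1"
    and S: "S1 \<subseteq> Per N" "S2 \<subseteq> Per N" "S1 \<inter> S2 = {}" "S1 \<noteq> {}" "S2 \<noteq> {}"
    and S0: "S0 = Per N - (S1 \<union> S2)"
    and low: "\<And>p. p \<in> prime_factors N \<Longrightarrow> Per (N div p) \<subseteq> S0"
    and H1: "(\<Sum>a\<in>S1. \<Sum>b\<in>S2. wt a b) \<le> 0"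
    and H2: "\<And>S. S \<in> {S1, S2} \<Longrightarrow> (\<Sum>b\<in>S. \<Sum>a\<in>S0. wt b a) \<le> (\<Sum>p\<in>prime_factors N. \<Sum>b\<in>S. contact (N div p) b)"
    and H3: "\<And>p. p \<in> prime_factors N \<Longrightarrow> 0 \<le> (\<Sum>b\<in>S0 - Per (N div p). contact (N div p) b)"
  shows False
proof (cases "card S1 \<le> card S2")
  case True
  then show False using energy_contradiction_ordered[OF assms] by simp
next
  case False
  have "(\<Sum>a\<in>S2. \<Sum>b\<in>S1. wt a b) = (\<Sum>a\<in>S1. \<Sum>b\<in>S2. wt a b)"
    by (subst sum.swap) (simp add: fdiff_commute)
  then show False
    by (intro energy_contradiction_ordered[OF N S(2,1) _ S(5,4), of S0])
      (use S(3) S0 low H1 H2 H3 False in \<open>simp_all add: Un_commute Int_commute insert_commute\<close>)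
qed

section \<open>Transversality for indifferent cycles of quadratic polynomials\<close>

definition cplx :: "real^2 \<Rightarrow> complex" where
  "cplx v = Complex (v $ 1) (v $ 2)"

definition vec2 :: "complex \<Rightarrow> real^2" where
  "vec2 z = vector [Re z, Im z]"

lemma cplx_vec2 [simp]: "cplx (vec2 z) = z"
  by (simp add: cplx_def vec2_def)

lemma vec2_cplx [simp]: "vec2 (cplx v) = v"
  by (simp add: cplx_def vec2_def vec_eq_iff forall_2)

lemma Re_cplx: "Re (cplx v) = v $ 1" and Im_cplx: "Im (cplx v) = v $ 2"
  by (simp_all add: cplx_def)

lemma cplx_uminus: "cplx (- v) = - cplx v"
  by (simp add: cplx_def complex_eq_iff)

lemma cplx_diff: "cplx (v - w) = cplx v - cplx w"
  by (simp add: cplx_def complex_eq_iff)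

lemma norm_cplx: "cmod (cplx v) = norm v"
  by (simp add: cplx_def cmod_def norm_vec_def L2_set_def sum_2)

lemma dist_cplx: "dist (cplx v) (cplx w) = dist v w"
  by (simp add: dist_norm norm_cplx flip: cplx_diff)

lemma bounded_linear_cplx: "bounded_linear cplx"
  unfolding cplx_def complex_eq_iff
  by (intro bounded_linear_intro[where K=1])
     (auto simp: complex_eq_iff cplx_def norm_cplx[unfolded cplx_def])

lemma bounded_linear_vec2: "bounded_linear vec2"
proof (intro bounded_linear_intro[where K=1])
  show "norm (vec2 x) \<le> norm x * 1" for x
    by (metis cplx_vec2 mult.right_neutral norm_cplx order_refl)
qed (auto simp: vec2_def vec_eq_iff forall_2)

lemma continuous_on_cplx: "continuous_on A cplx"
  by (simp add: bounded_linear_cplx linear_continuous_on)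

lemma continuous_on_vec2: "continuous_on A vec2"
  by (simp add: bounded_linear_vec2 linear_continuous_on)

lemma vimage_cplx_eq: "cplx -` A = vec2 ` A"
  by (force simp: image_iff)

lemma compact_vimage_cplx: "compact A \<Longrightarrow> compact (cplx -` A)"
  unfolding vimage_cplx_eq by (intro compact_continuous_image continuous_on_vec2)

lemma vimage_cplx_ball: "cplx -` ball z r = ball (vec2 z) r"
  by (auto simp: dist_cplx[symmetric])

lemma vimage_cplx_cball: "cplx -` cball z r = cball (vec2 z) r"
  by (auto simp: dist_cplx[symmetric])

definition sqmap :: "complex \<Rightarrow> real^2 \<Rightarrow> real^2" where
  "sqmap c v = vec2 ((cplx v)\<^sup>2 + c)"

lemma sqmap_derivative:
  "(sqmap c has_derivative (\<lambda>h. vec2 (2 * cplx v * cplx h))) (at v within S)"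
proof -
  have "((\<lambda>v. (cplx v)\<^sup>2 + c) has_derivative (\<lambda>h. 2 * cplx v * cplx h)) (at v within S)"
    by (auto intro!: derivative_eq_intros bounded_linear.has_derivative[OF bounded_linear_cplx])
  then show ?thesis
    unfolding sqmap_def by (rule bounded_linear.has_derivative[OF bounded_linear_vec2])
qed

lemma det_sqmap: "Determinants.det (matrix (\<lambda>h. vec2 (2 * cplx v * cplx h))) = 4 * (norm v)\<^sup>2"
proof -
  have n: "(norm v)\<^sup>2 = (v $ 1)\<^sup>2 + (v $ 2)\<^sup>2"
    by (simp flip: norm_cplx add: cplx_def cmod_power2)
  show ?thesis
    unfolding n by (simp add: det_2 matrix_def vec2_def cplx_def axis_def power2_eq_square)
qed

lemma det_uminus: "Determinants.det (matrix (\<lambda>h::real^2. - h)) = 1"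
  by (simp add: det_2 matrix_def axis_def)

text \<open>The vector-valued change of variables is applied to the \<open>real^1\<close>-valued
  function \<open>F\<close>, and the result is projected back.\<close>

lemma abs_integral_change_of_variables_real:
  fixes f :: "real^2 \<Rightarrow> real" and g :: "real^2 \<Rightarrow> real^2"
  assumes S: "S \<in> sets lebesgue"
    and der: "\<And>x. x \<in> S \<Longrightarrow> (g has_derivative g' x) (at x within S)"
    and inj: "inj_on g S"
    and f: "f absolutely_integrable_on (g ` S)"
  shows "(\<lambda>x. \<bar>Determinants.det (matrix (g' x))\<bar> * f (g x)) absolutely_integrable_on S"
    and "integral S (\<lambda>x. \<bar>Determinants.det (matrix (g' x))\<bar> * f (g x)) = integral (g ` S) f"
proof -
  define F :: "real^2 \<Rightarrow> real^1" where "F = (\<lambda>x. \<chi> i. f x)"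
  let ?D = "\<lambda>x. \<bar>Determinants.det (matrix (g' x))\<bar>"
  have bl: "bounded_linear (\<lambda>x::real. \<chi> i::1. x)"
    by (intro bounded_linear_intro[where K=1]) (auto simp: vec_eq_iff norm_vec_def)
  have bl1: "bounded_linear (\<lambda>x::real^1. x $ 1)" by (rule bounded_linear_vec_nth)
  have "((\<lambda>x::real. \<chi> i::1. x) \<circ> f) absolutely_integrable_on (g ` S)"
    by (rule absolutely_integrable_linear[OF f bl])
  then have F: "F absolutely_integrable_on (g ` S)"
    unfolding F_def o_def .
  have I: "(\<lambda>x. ?D x *\<^sub>R F (g x)) absolutely_integrable_on S"
      "integral S (\<lambda>x. ?D x *\<^sub>R F (g x)) = integral (g ` S) F"
    using has_absolute_integral_change_of_variables[OF S der inj, of F "integral (g ` S) F"] F by simp_all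
  have eq: "(\<lambda>x. ?D x * f (g x)) = (\<lambda>x. x $ 1) \<circ> (\<lambda>x. ?D x *\<^sub>R F (g x))"
    by (simp add: F_def o_def)
  have eq2: "f = (\<lambda>x. x $ 1) \<circ> F" by (simp add: F_def o_def)
  show "(\<lambda>x. ?D x * f (g x)) absolutely_integrable_on S"
    unfolding eq by (rule absolutely_integrable_linear[OF I(1) bl1])
  have "integral S ((\<lambda>x. x $ 1) \<circ> (\<lambda>x. ?D x *\<^sub>R F (g x))) = integral S (\<lambda>x. ?D x *\<^sub>R F (g x)) $ 1"
    using I(1) by (intro integral_linear bl1) (simp add: absolutely_integrable_on_def)
  moreover have "integral (g ` S) ((\<lambda>x. x $ 1) \<circ> F) = integral (g ` S) F $ 1"
    using F by (intro integral_linear bl1) (simp add: absolutely_integrable_on_def)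
  ultimately show "integral S (\<lambda>x. ?D x * f (g x)) = integral (g ` S) f"
    unfolding eq using I(2) eq2 by simp
qed

lemma absolutely_integrable_continuous_compact:
  fixes h :: "real^2 \<Rightarrow> real"
  assumes "compact S" "continuous_on S h"
  shows "h absolutely_integrable_on S"
proof -
  have L: "S \<in> lmeasurable" using assms lmeasurable_compact by blast
  obtain B where B: "\<And>x. x \<in> S \<Longrightarrow> norm (h x) \<le> B"
    using compact_imp_bounded[OF compact_continuous_image[OF assms(2,1)]] by (auto simp: bounded_iff)
  show ?thesis
  proof (rule measurable_bounded_by_integrable_imp_absolutely_integrable[where g="\<lambda>_. B"])
    show "h \<in> borel_measurable (lebesgue_on S)"
      using assms L by (intro continuous_imp_measurable_on_sets_lebesgue) (auto simp: fmeasurableD)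
  qed (use B L in \<open>auto simp: fmeasurableD integrable_on_const\<close>)
qed

text \<open>\<open>h\<close> stands for the modulus of a quadratic differential. Substitution on the
  right half of the preimage turns its integral over \<open>K\<close> into that of the left side of
  \<open>rel\<close>, and \<open>rel\<close> is the triangle inequality for push-forward over the
  two branches \<open>y\<close> and \<open>- y\<close>. Hence the image cannot carry more mass than
  the preimage.\<close>

lemma area_contraction:
  fixes h :: "complex \<Rightarrow> real" and c :: complex
  defines "pre \<equiv> \<lambda>K. {y. y\<^sup>2 + c \<in> K}"
  assumes K: "compact K" and preK: "compact (pre K)"
    and cont: "continuous_on K h" "continuous_on (pre K) h"
    and nonneg: "\<And>y. h y \<ge> 0"
    and rel: "\<And>y. y \<in> pre K \<Longrightarrow> Re y > 0 \<Longrightarrow> 4 * (cmod y)\<^sup>2 * h (y\<^sup>2 + c) \<le> h y + h (- y)"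
  shows "integral (cplx -` K) (h \<circ> cplx) \<le> integral (cplx -` pre K) (h \<circ> cplx)"
proof -
  let ?h = "h \<circ> cplx"
  define P where "P = cplx -` pre K"
  define S where "S = P \<inter> {v. v $ 1 > 0}"
  define S' where "S' = P \<inter> {v. v $ 1 < 0}"
  have cP: "compact P" unfolding P_def using preK by (rule compact_vimage_cplx)
  have hP: "?h absolutely_integrable_on P"
    using cP cont(2) unfolding P_def
    by (intro absolutely_integrable_continuous_compact continuous_on_compose continuous_on_cplx)
       (auto elim: continuous_on_subset)
  have Pm: "P \<in> sets lebesgue" using cP lmeasurable_compact fmeasurableD by blast
  have op: "{v::real^2. v $ 1 > 0} \<in> sets lebesgue" "{v::real^2. v $ 1 < 0} \<in> sets lebesgue"
    using open_halfspace_component_gt_cart[of 0 1] open_halfspace_component_lt_cart[of 1 0]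
    by (auto intro!: lborelD_Collect simp: borel_open)
  have Sm: "S \<in> sets lebesgue" "S' \<in> sets lebesgue"
    unfolding S_def S'_def using Pm op by blast+
  have hS: "?h absolutely_integrable_on S" "?h absolutely_integrable_on S'"
    using hP Sm by (auto intro: set_integrable_subset simp: S_def S'_def)
  have img: "sqmap c ` S \<subseteq> cplx -` K"
    by (auto simp: S_def P_def pre_def sqmap_def)
  \<comment> \<open>The right half plane misses only those \<open>w\<close> for which the square
    root of \<open>w - c\<close> is imaginary; they lie on a horizontal line, which has measure
    zero.\<close>
  have dif: "cplx -` K - sqmap c ` S \<subseteq> {w. w $ 2 = Im c}"
  proof
    fix w assume w: "w \<in> cplx -` K - sqmap c ` S"
    define y where "y = csqrt (cplx w - c)"
    have y2: "y\<^sup>2 + c = cplx w" by (simp add: y_def)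
    have "\<not> Re y > 0"
    proof
      assume r: "Re y > 0"
      have "vec2 y \<in> S" using w y2 r by (simp add: S_def P_def pre_def Re_cplx[symmetric])
      moreover have "sqmap c (vec2 y) = w" by (simp add: sqmap_def y2)
      ultimately show False using w by (auto simp: image_iff)
    qed
    moreover have "Re y \<ge> 0" using csqrt_principal[of "cplx w - c"] unfolding y_def by auto
    ultimately have "Re y = 0" by simp
    then have "Im (y\<^sup>2) = 0" by (simp add: power2_eq_square)
    then have "Im (cplx w) = Im c" using y2 by (metis add.commute add.right_neutral plus_complex.simps(2))
    then show "w \<in> {w. w $ 2 = Im c}" by (simp add: Im_cplx)
  qed
  have neg: "negligible {w::real^2. w $ 2 = Im c}"
    by (simp add: cart_eq_inner_axis negligible_standard_hyperplane)
  have hK: "?h absolutely_integrable_on (cplx -` K)"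
    using K cont(1)
    by (intro absolutely_integrable_continuous_compact compact_vimage_cplx continuous_on_compose continuous_on_cplx)
       (auto elim: continuous_on_subset)
  have symd: "negligible (cplx -` K - sqmap c ` S)" "negligible (sqmap c ` S - cplx -` K)"
    using negligible_subset[OF neg dif] img by (auto simp: Diff_eq_empty_iff[THEN iffD2])
  have himg: "?h absolutely_integrable_on (sqmap c ` S)"
    by (rule absolutely_integrable_spike_set[OF hK negligible_subset[OF symd(1)] negligible_subset[OF symd(2)]]) auto
  have inj: "inj_on (sqmap c) S"
  proof (rule inj_onI)
    fix v w assume v: "v \<in> S" and w: "w \<in> S" and eq: "sqmap c v = sqmap c w"
    have "(cplx v)\<^sup>2 = (cplx w)\<^sup>2"
      using arg_cong[OF eq, of cplx] by (simp add: sqmap_def)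
    then have "cplx v = cplx w \<or> cplx v = - cplx w" by (simp add: power2_eq_iff)
    moreover have "cplx v \<noteq> - cplx w"
    proof
      assume "cplx v = - cplx w"
      then have "Re (cplx v) = - Re (cplx w)" by simp
      then show False using v w by (simp add: S_def Re_cplx)
    qed
    ultimately show "v = w" by (metis vec2_cplx)
  qed
  note cv = abs_integral_change_of_variables_real[OF Sm(1) sqmap_derivative inj himg]
  have e1: "integral (cplx -` K) ?h = integral S (\<lambda>v. \<bar>4 * (norm v)\<^sup>2\<bar> * ?h (sqmap c v))"
  proof -
    have "integral (cplx -` K) ?h = integral (sqmap c ` S) ?h"
      by (rule integral_spike_set[OF negligible_subset[OF symd(1)] negligible_subset[OF symd(2)]]) auto
    also have "\<dots> = integral S (\<lambda>v. \<bar>4 * (norm v)\<^sup>2\<bar> * ?h (sqmap c v))"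
      using cv(2) unfolding det_sqmap by (rule sym)
    finally show ?thesis .
  qed
  have refl: "(\<lambda>v. ?h (- v)) absolutely_integrable_on S" "integral S (\<lambda>v. ?h (- v)) = integral S' ?h"
  proof -
    have P: "- v \<in> P \<longleftrightarrow> v \<in> P" for v by (simp add: P_def pre_def cplx_uminus)
    have im: "uminus ` S = S'"
    proof (intro Set.set_eqI iffI)
      fix v assume "v \<in> uminus ` S"
      then show "v \<in> S'" using P unfolding S_def S'_def by auto
    next
      fix v assume "v \<in> S'"
      then have "- v \<in> S" using P unfolding S_def S'_def by auto
      then show "v \<in> uminus ` S" by (rule rev_image_eqI) simp
    qed
    have d: "((\<lambda>h. - h) has_derivative (\<lambda>h. - h)) (at x within S)" for x :: "real^2"
      by (auto intro!: derivative_eq_intros)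
    have i: "inj_on uminus S" by simp
    note r = abs_integral_change_of_variables_real[OF Sm(1) d i, of ?h, unfolded im det_uminus, OF hS(2)]
    show "(\<lambda>v. ?h (- v)) absolutely_integrable_on S" "integral S (\<lambda>v. ?h (- v)) = integral S' ?h"
      using r by simp_all
  qed
  have i1: "(\<lambda>v. \<bar>4 * (norm v)\<^sup>2\<bar> * ?h (sqmap c v)) integrable_on S"
    using cv(1) unfolding det_sqmap absolutely_integrable_on_def by blast
  have i2: "(\<lambda>v. ?h v + ?h (- v)) integrable_on S"
    using hS(1) refl(1) unfolding absolutely_integrable_on_def o_def by (intro Henstock_Kurzweil_Integration.integrable_add) auto
  have "integral S (\<lambda>v. \<bar>4 * (norm v)\<^sup>2\<bar> * ?h (sqmap c v)) \<le> integral S (\<lambda>v. ?h v + ?h (- v))"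
  proof (rule integral_le[OF i1 i2])
    fix v assume v: "v \<in> S"
    then have "cplx v \<in> pre K" "Re (cplx v) > 0" by (simp_all add: S_def P_def Re_cplx)
    from rel[OF this] show "\<bar>4 * (norm v)\<^sup>2\<bar> * ?h (sqmap c v) \<le> ?h v + ?h (- v)"
      by (simp add: sqmap_def norm_cplx cplx_uminus)
  qed
  also have "\<dots> = integral S ?h + integral S' ?h"
  proof -
    have "integral S (\<lambda>v. ?h v + ?h (- v)) = integral S ?h + integral S (\<lambda>v. ?h (- v))"
      using hS(1) refl(1) unfolding absolutely_integrable_on_def o_def
      by (intro Henstock_Kurzweil_Integration.integral_add) auto
    then show ?thesis using refl(2) by simp
  qed
  also have "\<dots> = integral (S \<union> S') ?h"
    using hS unfolding absolutely_integrable_on_def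
    by (intro Henstock_Kurzweil_Integration.integral_Un[symmetric] empty_imp_negligible) (auto simp: S_def S'_def)
  also have "\<dots> \<le> integral P ?h"
    using absolutely_integrable_Un[OF hS] hP nonneg unfolding absolutely_integrable_on_def
    by (intro integral_subset_le) (auto simp: S_def S'_def)
  finally show ?thesis unfolding e1 P_def .
qed

lemma measure_vimage_ball: "r \<ge> 0 \<Longrightarrow> measure lebesgue (cplx -` ball z r) = pi * r\<^sup>2"
  and measure_vimage_cball: "r \<ge> 0 \<Longrightarrow> measure lebesgue (cplx -` cball z r) = pi * r\<^sup>2"
  by (simp_all add: vimage_cplx_ball vimage_cplx_cball content_ball content_cball unit_ball_vol_2)

lemma lmeasurable_vimage_ball: "cplx -` ball z r \<in> lmeasurable"
  by (simp add: vimage_cplx_ball)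

text \<open>Since \<open>\<lambda>\<close> has modulus 1 along the cycle, discs with radii proportional to \<open>\<rho>\<close> can be cut out
  around a double pole with an error of order \<open>\<epsilon>\<close>, although the differential is not integrable there.\<close>

lemma invariant_differential_vanishes:
  fixes z \<gamma> :: "nat \<Rightarrow> complex" and c \<alpha> :: complex and d :: nat and \<rho> :: "nat \<Rightarrow> real"
  defines "Q \<equiv> \<lambda>y. \<Sum>i<d. \<alpha> / (y - z i)\<^sup>2 + \<gamma> i / (y - z i)"
  assumes z: "\<And>i. i < d \<Longrightarrow> z (Suc i mod d) = (z i)\<^sup>2 + c"
    and \<rho>: "\<And>i. i < d \<Longrightarrow> \<rho> i > 0" "\<And>i. i < d \<Longrightarrow> \<rho> (Suc i mod d) = 2 * cmod (z i) * \<rho> i"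
    and rel: "\<And>y. y \<noteq> 0 \<Longrightarrow> y\<^sup>2 + c \<notin> z ` {..<d} \<Longrightarrow> 4 * y\<^sup>2 * Q (y\<^sup>2 + c) = Q y + Q (- y)"
  shows "\<exists>R0. \<forall>y. cmod y \<ge> R0 \<longrightarrow> Q y = 0"
proof -
  define R0 where "R0 = 3 + cmod c + (\<Sum>i<d. cmod (z i))"
  have zR: "cmod (z i) + 3 \<le> R0" if "i < d" for i
    using member_le_sum[of i "{..<d}" "\<lambda>i. cmod (z i)"] that norm_ge_zero[of c] unfolding R0_def
    by (simp add: add_increasing)
  have R03: "R0 \<ge> 3 + cmod c" unfolding R0_def by (simp add: sum_nonneg)
  \<comment> \<open>A critical point on the cycle would make the next radius zero.\<close>
  have z0: "z i \<noteq> 0" if "i < d" for i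
  proof
    assume "z i = 0"
    then have "\<rho> (Suc i mod d) = 0" using \<rho>(2)[OF that] by simp
    moreover have "Suc i mod d < d" using that by simp
    ultimately show False using \<rho>(1) by fastforce
  qed
  \<comment> \<open>Far out the map at least doubles absolute values. This confines the preimage of
    a large disc to that disc and makes \<open>ys\<close> escape from it.\<close>
  have esc: "cmod (y\<^sup>2 + c) \<ge> 2 * cmod y" if "cmod y \<ge> 2 + cmod c" for y
  proof -
    have "cmod (y\<^sup>2 + c) \<ge> cmod (y\<^sup>2) - cmod c" by (metis norm_diff_ineq add.commute)
    moreover have "cmod (y\<^sup>2) = cmod y * cmod y" by (simp add: norm_mult power2_eq_square)
    moreover have "cmod y * cmod y \<ge> cmod y * (2 + cmod c)" using that by (intro mult_left_mono) auto
    moreover have "cmod y * cmod c \<ge> 1 * cmod c"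
    proof (intro mult_right_mono)
      show "1 \<le> cmod y" using that norm_ge_zero[of c] by linarith
    qed simp
    ultimately show ?thesis by (simp add: distrib_left)
  qed
  define h where "h y = cmod (Q y)" for y
  have Qcont: "continuous_on A h" if "\<And>i. i < d \<Longrightarrow> z i \<notin> A" for A
    unfolding h_def Q_def using that by (intro continuous_intros) auto
  have "Q ys = 0" if ys: "cmod ys \<ge> R0" for ys
  proof (rule ccontr)
    assume "Q ys \<noteq> 0"
    then have hpos: "h ys > 0" by (simp add: h_def)
    \<comment> \<open>The offset \<open>1/2\<close> puts \<open>ys\<close> inside the disc of radius
      \<open>R\<close> while its image lies outside. The set \<open>\<Omega>\<close> around
      \<open>ys\<close> is disjoint from the preimage of the disc, so the mass of \<open>h\<close>
      there is lost in the comparison.\<close>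
    define R where "R = cmod ys + 1/2"
    have escR: "cmod (y\<^sup>2 + c) > R" if "cmod y > R" for y
      using esc[of y] that ys R03 norm_ge_zero[of c] unfolding R_def by linarith
    define \<Omega> where "\<Omega> = {y. cmod y < R \<and> cmod y > cmod ys - 1 \<and> cmod (y\<^sup>2 + c) > R}"
    have "open \<Omega>" unfolding \<Omega>_def by (intro open_Collect_conj open_Collect_less continuous_intros)
    have "cmod (ys\<^sup>2 + c) > R" using esc[of ys] ys R03 norm_ge_zero[of c] unfolding R_def by linarith
    then have ys\<Omega>: "ys \<in> \<Omega>" by (simp add: \<Omega>_def R_def)
    have far: "cmod (y - z i) > 1" if "y \<in> \<Omega>" "i < d" for y i
      using norm_triangle_ineq2[of y "z i"] zR[OF that(2)] that(1) ys unfolding \<Omega>_def by simp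
    have "continuous_on \<Omega> h" using far by (intro Qcont) fastforce
    then have "open (\<Omega> \<inter> h -` {h ys / 2 <..})"
      using \<open>open \<Omega>\<close> by (simp add: continuous_on_open_vimage open_Int)
        (metis continuous_on_open_vimage open_greaterThan inf_commute)
    moreover have "ys \<in> \<Omega> \<inter> h -` {h ys / 2 <..}" using ys\<Omega> hpos by simp
    ultimately obtain \<delta> where \<delta>: "\<delta> > 0" "cball ys \<delta> \<subseteq> \<Omega> \<inter> h -` {h ys / 2 <..}"
      using open_contains_cball by blast
    define B where "B = cball ys \<delta>"
    \<comment> \<open>\<open>C\<close> controls the quadratic term of the map at the cycle points:
      the disc of radius \<open>\<epsilon> * \<rho> i * (1 - C * \<epsilon>)\<close> is mapped into
      the one of radius \<open>\<epsilon> * \<rho> (Suc i mod d)\<close>, because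
      \<open>(1 - C * \<epsilon>) * (1 + C * \<epsilon>) \<le> 1\<close>. Off the small discs
      \<open>h\<close> is at most \<open>C1 / \<epsilon>\<^sup>2\<close>, and \<open>C2\<close>
      combines this with the areas of the annuli.\<close>
    define C where "C = (\<Sum>i<d. \<rho> i / (2 * cmod (z i)))"
    have Ci: "\<rho> i / (2 * cmod (z i)) \<le> C" if "i < d" for i
      unfolding C_def using that \<rho>(1) by (intro member_le_sum) (auto simp: less_imp_le)
    have C0: "C \<ge> 0" unfolding C_def using \<rho>(1) by (intro sum_nonneg) (auto simp: less_imp_le)
    define C1 where "C1 = (\<Sum>i<d. 4 * cmod \<alpha> / (\<rho> i)\<^sup>2 + 2 * cmod (\<gamma> i) / \<rho> i)"
    have C10: "C1 \<ge> 0" unfolding C1_def using \<rho>(1) by (intro sum_nonneg) (auto simp: less_imp_le)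
    define C2 where "C2 = C1 * (\<Sum>i<d. pi * (\<rho> i)\<^sup>2 * (2 * C))"
    have C20: "C2 \<ge> 0" unfolding C2_def using C10 C0 by (intro mult_nonneg_nonneg sum_nonneg) auto
    define S\<rho> where "S\<rho> = (\<Sum>i<d. \<rho> i)"
    have S\<rho>: "\<rho> i \<le> S\<rho>" if "i < d" for i
      unfolding S\<rho>_def using that \<rho>(1) by (intro member_le_sum) (auto simp: less_imp_le)
    have S\<rho>0: "S\<rho> \<ge> 0" unfolding S\<rho>_def using \<rho>(1) by (intro sum_nonneg) (auto simp: less_imp_le)
    \<comment> \<open>The mass near \<open>ys\<close> is at most the mass on the annuli between the
      two families of discs: an area of order \<open>\<epsilon> ^ 3\<close> times a height of order
      \<open>1 / \<epsilon>\<^sup>2\<close>.\<close>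
    have key: "h ys / 2 * (pi * \<delta>\<^sup>2) \<le> C2 * \<epsilon>"
      if \<epsilon>: "\<epsilon> > 0" "\<epsilon> \<le> 1" "C * \<epsilon> \<le> 1/2" "S\<rho> * \<epsilon> \<le> 1" for \<epsilon>
    proof -
      define \<eta> where "\<eta> i = \<epsilon> * \<rho> i * (1 - C * \<epsilon>)" for i
      have \<eta>: "\<eta> i \<ge> \<epsilon> * \<rho> i / 2" "\<eta> i \<le> \<epsilon> * \<rho> i" "\<eta> i > 0" "\<epsilon> * \<rho> i \<le> 1" if i: "i < d" for i
      proof -
        have p: "\<epsilon> * \<rho> i > 0" using \<epsilon> \<rho>(1)[OF i] by simp
        have "\<epsilon> * \<rho> i * (1/2) \<le> \<epsilon> * \<rho> i * (1 - C * \<epsilon>)" using p \<epsilon> by (intro mult_left_mono) auto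
        then show 1: "\<eta> i \<ge> \<epsilon> * \<rho> i / 2" unfolding \<eta>_def by simp
        have "\<epsilon> * \<rho> i * (1 - C * \<epsilon>) \<le> \<epsilon> * \<rho> i * 1" using p \<epsilon> C0 by (intro mult_left_mono) auto
        then show "\<eta> i \<le> \<epsilon> * \<rho> i" unfolding \<eta>_def by simp
        show "\<eta> i > 0" using 1 p by linarith
        have "\<rho> i * \<epsilon> \<le> S\<rho> * \<epsilon>" using S\<rho>[OF i] \<epsilon> by (intro mult_right_mono) auto
        then show "\<epsilon> * \<rho> i \<le> 1" using \<epsilon>(4) by (simp add: mult.commute)
      qed
      define K where "K = cball 0 R - (\<Union>i<d. ball (z i) (\<epsilon> * \<rho> i))"
      define L where "L = cball 0 R - (\<Union>i<d. ball (z i) (\<eta> i))"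
      let ?pre = "{y. y\<^sup>2 + c \<in> K}"
      have cK: "compact K" unfolding K_def by (intro compact_diff compact_cball open_UN) auto
      have cL: "compact L" unfolding L_def by (intro compact_diff compact_cball open_UN) auto
      have preL: "?pre \<subseteq> L"
      proof
        fix y assume "y \<in> ?pre"
        then have "y\<^sup>2 + c \<in> cball 0 R" "\<And>i. i < d \<Longrightarrow> y\<^sup>2 + c \<notin> ball (z i) (\<epsilon> * \<rho> i)"
          unfolding K_def by blast+
        then have y: "cmod (y\<^sup>2 + c) \<le> R" "\<And>i. i < d \<Longrightarrow> cmod (z i - (y\<^sup>2 + c)) \<ge> \<epsilon> * \<rho> i"
          by (simp_all add: dist_norm[of "z _"] not_less)
        have "cmod y \<le> R" using escR[of y] y(1) by linarith
        moreover have "y \<notin> ball (z i) (\<eta> i)" if i: "i < d" for i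
        proof
          assume "y \<in> ball (z i) (\<eta> i)"
          then have lt: "cmod (y - z i) < \<eta> i" by (simp add: dist_norm norm_minus_commute)
          let ?u = "cmod (y - z i)"
          have zi: "cmod (z i) > 0" using z0[OF i] by simp
          have j: "Suc i mod d < d" using i by simp
          have "cmod (z (Suc i mod d) - (y\<^sup>2 + c)) = cmod ((y - z i) * (y + z i))"
            unfolding z[OF i] by (subst norm_minus_commute) (simp add: power2_eq_square algebra_simps)
          also have "\<dots> = ?u * cmod (2 * z i + (y - z i))"
            unfolding norm_mult by (simp add: add.commute)
          also have "\<dots> \<le> ?u * (2 * cmod (z i) + ?u)"
            by (intro mult_left_mono order_trans[OF norm_triangle_ineq]) (auto simp: norm_mult)
          also have "\<dots> \<le> ?u * (2 * cmod (z i) + \<epsilon> * \<rho> i)"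
            using lt \<eta>(2)[OF i] by (intro mult_left_mono) auto
          also have "\<dots> < \<eta> i * (2 * cmod (z i) + \<epsilon> * \<rho> i)"
            using lt zi \<epsilon> \<rho>(1)[OF i] by (intro mult_strict_right_mono add_pos_pos) auto
          also have "\<dots> = \<epsilon> * \<rho> i * (2 * cmod (z i)) * ((1 - C * \<epsilon>) * (1 + \<epsilon> * (\<rho> i / (2 * cmod (z i)))))"
            using zi by (simp add: \<eta>_def field_simps)
          also have "\<dots> \<le> \<epsilon> * \<rho> i * (2 * cmod (z i)) * ((1 - C * \<epsilon>) * (1 + \<epsilon> * C))"
            using Ci[OF i] \<epsilon> \<rho>(1)[OF i] zi by (intro mult_left_mono add_left_mono) auto
          also have "\<dots> \<le> \<epsilon> * \<rho> i * (2 * cmod (z i)) * 1"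
          proof (intro mult_left_mono)
            have "(1 - C * \<epsilon>) * (1 + \<epsilon> * C) = 1 - (C * \<epsilon>)\<^sup>2" by (simp add: algebra_simps power2_eq_square)
            then show "(1 - C * \<epsilon>) * (1 + \<epsilon> * C) \<le> 1" by simp
          qed (use \<epsilon> \<rho>(1)[OF i] in auto)
          also have "\<dots> = \<epsilon> * \<rho> (Suc i mod d)" using \<rho>(2)[OF i] by simp
          finally show False using y(2)[OF j] by simp
        qed
        ultimately show "y \<in> L" unfolding L_def by auto
      qed
      have cpre: "compact ?pre"
      proof -
        have "closed ((\<lambda>y. y\<^sup>2 + c) -` K)"
          using cK by (intro continuous_closed_vimage compact_imp_closed) (auto intro!: continuous_intros)
        moreover have "bounded ?pre" using preL cL bounded_subset compact_imp_bounded by blast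
        ultimately show ?thesis by (simp add: compact_eq_bounded_closed vimage_def)
      qed
      have zL: "z i \<notin> L" "z i \<notin> K" if "i < d" for i
      proof -
        have "z i \<in> ball (z i) (\<eta> i)" "z i \<in> ball (z i) (\<epsilon> * \<rho> i)" using \<eta>(3)[OF that] \<epsilon> \<rho>(1)[OF that] by auto
        then show "z i \<notin> L" "z i \<notin> K" using that unfolding L_def K_def by blast+
      qed
      have hK: "continuous_on K h" and hL: "continuous_on L h" and hpre: "continuous_on ?pre h"
        using zL preL by (auto intro!: Qcont)
      have step: "integral (cplx -` K) (h \<circ> cplx) \<le> integral (cplx -` ?pre) (h \<circ> cplx)"
      proof (rule area_contraction[OF cK cpre hK hpre])
        show "h y \<ge> 0" for y by (simp add: h_def)
        fix y assume y: "y \<in> ?pre" "Re y > 0"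
        then have "y \<noteq> 0" by auto
        moreover have "y\<^sup>2 + c \<notin> z ` {..<d}" using y zL by auto
        ultimately have "4 * y\<^sup>2 * Q (y\<^sup>2 + c) = Q y + Q (- y)" by (rule rel)
        then have "cmod (4 * y\<^sup>2 * Q (y\<^sup>2 + c)) \<le> cmod (Q y) + cmod (Q (- y))"
          by (simp add: norm_triangle_ineq)
        then show "4 * (cmod y)\<^sup>2 * h (y\<^sup>2 + c) \<le> h y + h (- y)"
          by (simp add: h_def norm_mult norm_power)
      qed
      have ai: "(h \<circ> cplx) integrable_on (cplx -` A)" if "compact A" "A \<subseteq> L" for A
      proof -
        have "(h \<circ> cplx) absolutely_integrable_on (cplx -` A)"
          using that hL by (intro absolutely_integrable_continuous_compact compact_vimage_cplx
              continuous_on_compose continuous_on_cplx) (auto elim: continuous_on_subset)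
        then show ?thesis by (simp add: absolutely_integrable_on_def)
      qed
      have KL: "K \<subseteq> L" unfolding K_def L_def using \<eta>(2) by fastforce
      have BL: "B \<subseteq> L"
      proof
        fix y assume "y \<in> B"
        then have y: "y \<in> \<Omega>" using \<delta>(2) unfolding B_def by blast
        have "y \<notin> ball (z i) (\<eta> i)" if i: "i < d" for i
          using far[OF y i] \<eta>(2,4)[OF i] by (auto simp: dist_norm norm_minus_commute)
        then show "y \<in> L" using y unfolding L_def \<Omega>_def by auto
      qed
      have cB: "compact B" unfolding B_def by simp
      have disj: "?pre \<inter> B = {}" using \<delta>(2) unfolding B_def K_def \<Omega>_def by fastforce
      have hnn: "\<And>v. (h \<circ> cplx) v \<ge> 0" by (simp add: h_def)
      have "integral (cplx -` ?pre) (h \<circ> cplx) + integral (cplx -` B) (h \<circ> cplx)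
          = integral (cplx -` ?pre \<union> cplx -` B) (h \<circ> cplx)"
        using ai[OF cpre preL] ai[OF cB BL] disj
        by (intro Henstock_Kurzweil_Integration.integral_Un[symmetric] empty_imp_negligible) auto
      also have "\<dots> \<le> integral (cplx -` L) (h \<circ> cplx)"
        using ai[OF compact_Un[OF cpre cB]] ai[OF cL] preL BL hnn
        by (intro integral_subset_le) (auto simp: vimage_Un)
      finally have A1: "integral (cplx -` B) (h \<circ> cplx) \<le> integral (cplx -` L) (h \<circ> cplx) - integral (cplx -` K) (h \<circ> cplx)"
        using step by linarith
      have A2: "integral (cplx -` B) (h \<circ> cplx) \<ge> h ys / 2 * (pi * \<delta>\<^sup>2)"
      proof -
        have "((\<lambda>_. 1::real) has_integral measure lebesgue (cplx -` B)) (cplx -` B)"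
          using lmeasurable_compact[OF compact_vimage_cplx[OF cB]] by (simp add: has_integral_iff lmeasure_integral integrable_on_const)
        then have "((\<lambda>_. h ys / 2 * 1) has_integral (h ys / 2 * measure lebesgue (cplx -` B))) (cplx -` B)"
          by (rule has_integral_mult_right)
        then have "h ys / 2 * measure lebesgue (cplx -` B) \<le> integral (cplx -` B) (h \<circ> cplx)"
          using ai[OF cB BL] \<delta>(2)
          by (intro has_integral_le[OF _ integrable_integral]) (auto simp: B_def less_imp_le)
        then show ?thesis using \<delta>(1) unfolding B_def by (simp add: measure_vimage_cball)
      qed
      have LKm: "cplx -` (L - K) \<in> lmeasurable"
        using lmeasurable_compact[OF compact_vimage_cplx[OF cL]] lmeasurable_compact[OF compact_vimage_cplx[OF cK]]
        by (simp add: vimage_Diff fmeasurable.Diff)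
      have A3: "integral (cplx -` L) (h \<circ> cplx) - integral (cplx -` K) (h \<circ> cplx) \<le> C1 / \<epsilon>\<^sup>2 * measure lebesgue (cplx -` (L - K))"
      proof -
        have e: "integral (cplx -` (L - K)) (h \<circ> cplx) = integral (cplx -` L) (h \<circ> cplx) - integral (cplx -` K) (h \<circ> cplx)"
          using ai[OF cL] ai[OF cK KL] KL unfolding vimage_Diff by (intro integral_setdiff empty_imp_negligible) auto
        have int: "(h \<circ> cplx) integrable_on (cplx -` (L - K))"
          using ai[OF cL] ai[OF cK KL] KL unfolding vimage_Diff by (intro integrable_setdiff empty_imp_negligible) auto
        have "((\<lambda>_. 1::real) has_integral measure lebesgue (cplx -` (L - K))) (cplx -` (L - K))"
          using LKm by (simp add: has_integral_iff lmeasure_integral integrable_on_const)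
        then have "((\<lambda>_. C1 / \<epsilon>\<^sup>2 * 1) has_integral (C1 / \<epsilon>\<^sup>2 * measure lebesgue (cplx -` (L - K)))) (cplx -` (L - K))"
          by (rule has_integral_mult_right)
        then have "integral (cplx -` (L - K)) (h \<circ> cplx) \<le> C1 / \<epsilon>\<^sup>2 * measure lebesgue (cplx -` (L - K))"
        proof (rule has_integral_le[OF integrable_integral[OF int]])
          fix v assume "v \<in> cplx -` (L - K)"
          then have y: "cplx v \<in> L" by simp
          have "h (cplx v) \<le> (\<Sum>i<d. cmod (\<alpha> / (cplx v - z i)\<^sup>2 + \<gamma> i / (cplx v - z i)))"
            unfolding h_def Q_def by (rule norm_sum)
          also have "\<dots> \<le> (\<Sum>i<d. (4 * cmod \<alpha> / (\<rho> i)\<^sup>2 + 2 * cmod (\<gamma> i) / \<rho> i) / \<epsilon>\<^sup>2)"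
          proof (rule sum_mono)
            fix i assume "i \<in> {..<d}"
            then have i: "i < d" by simp
            let ?u = "cmod (cplx v - z i)"
            have u: "?u \<ge> \<epsilon> * \<rho> i / 2"
            proof -
              have "cplx v \<notin> ball (z i) (\<eta> i)" using y i unfolding L_def by blast
              then have "?u \<ge> \<eta> i" by (simp add: dist_norm norm_minus_commute)
              then show ?thesis using \<eta>(1)[OF i] by linarith
            qed
            have p: "\<epsilon> * \<rho> i / 2 > 0" using \<epsilon> \<rho>(1)[OF i] by simp
            have "cmod (\<alpha> / (cplx v - z i)\<^sup>2) \<le> cmod \<alpha> / (\<epsilon> * \<rho> i / 2)\<^sup>2"
              unfolding norm_divide norm_power using u p by (intro divide_left_mono power_mono mult_pos_pos) auto
            moreover have "cmod (\<gamma> i / (cplx v - z i)) \<le> cmod (\<gamma> i) / (\<epsilon> * \<rho> i / 2)"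
              unfolding norm_divide using u p by (intro divide_left_mono mult_pos_pos) auto
            moreover have "cmod (\<gamma> i) / (\<epsilon> * \<rho> i / 2) \<le> (2 * cmod (\<gamma> i) / \<rho> i) / \<epsilon>\<^sup>2"
            proof -
              have "cmod (\<gamma> i) / (\<epsilon> * \<rho> i / 2) = (2 * cmod (\<gamma> i) / \<rho> i) / \<epsilon>" by (simp add: field_simps)
              also have "\<dots> \<le> (2 * cmod (\<gamma> i) / \<rho> i) / \<epsilon>\<^sup>2"
                using \<epsilon> \<rho>(1)[OF i] by (intro divide_left_mono) (auto simp: power2_eq_square mult_le_cancel_left1 less_imp_le)
              finally show ?thesis .
            qed
            moreover have "cmod \<alpha> / (\<epsilon> * \<rho> i / 2)\<^sup>2 = (4 * cmod \<alpha> / (\<rho> i)\<^sup>2) / \<epsilon>\<^sup>2"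
              by (simp add: field_simps power2_eq_square)
            ultimately show "cmod (\<alpha> / (cplx v - z i)\<^sup>2 + \<gamma> i / (cplx v - z i)) \<le> (4 * cmod \<alpha> / (\<rho> i)\<^sup>2 + 2 * cmod (\<gamma> i) / \<rho> i) / \<epsilon>\<^sup>2"
              unfolding add_divide_distrib using norm_triangle_ineq[of "\<alpha> / (cplx v - z i)\<^sup>2" "\<gamma> i / (cplx v - z i)"] by linarith
          qed
          also have "\<dots> = C1 / \<epsilon>\<^sup>2" unfolding C1_def by (simp add: sum_divide_distrib)
          finally show "(h \<circ> cplx) v \<le> C1 / \<epsilon>\<^sup>2 * 1" by simp
        qed
        then show ?thesis using e by simp
      qed
      have A4: "measure lebesgue (cplx -` (L - K)) \<le> (\<Sum>i<d. pi * (\<rho> i)\<^sup>2 * (2 * C)) * \<epsilon> ^ 3"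
      proof -
        let ?A = "\<lambda>i. cplx -` ball (z i) (\<epsilon> * \<rho> i) - cplx -` ball (z i) (\<eta> i)"
        have Am: "?A i \<in> lmeasurable" for i by (intro fmeasurable.Diff lmeasurable_vimage_ball)
        have "cplx -` (L - K) \<subseteq> (\<Union>i<d. ?A i)" unfolding L_def K_def by auto
        then have "measure lebesgue (cplx -` (L - K)) \<le> measure lebesgue (\<Union>i<d. ?A i)"
          using LKm Am by (intro measure_mono_fmeasurable fmeasurable.finite_UN) (auto simp: fmeasurableD)
        also have "\<dots> \<le> (\<Sum>i<d. measure lebesgue (?A i))"
          using Am by (intro measure_UNION_le) (auto simp: fmeasurableD)
        also have "\<dots> \<le> (\<Sum>i<d. pi * (\<rho> i)\<^sup>2 * (2 * C) * \<epsilon> ^ 3)"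
        proof (rule sum_mono)
          fix i assume "i \<in> {..<d}"
          then have i: "i < d" by simp
          have "cplx -` ball (z i) (\<eta> i) \<subseteq> cplx -` ball (z i) (\<epsilon> * \<rho> i)"
            using \<eta>(2)[OF i] by (intro vimage_mono subset_ball)
          then have "measure lebesgue (?A i) = measure lebesgue (cplx -` ball (z i) (\<epsilon> * \<rho> i)) - measure lebesgue (cplx -` ball (z i) (\<eta> i))"
            by (intro measurable_measure_Diff lmeasurable_vimage_ball) (simp_all add: fmeasurableD lmeasurable_vimage_ball)
          also have "\<dots> = pi * (\<epsilon> * \<rho> i)\<^sup>2 - pi * (\<eta> i)\<^sup>2"
            using \<eta>(3)[OF i] \<epsilon> \<rho>(1)[OF i] by (simp add: measure_vimage_ball)
          also have "\<dots> = pi * (\<rho> i)\<^sup>2 * \<epsilon>\<^sup>2 * (1 - (1 - C * \<epsilon>)\<^sup>2)"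
            unfolding \<eta>_def power_mult_distrib by (simp add: algebra_simps)
          also have "\<dots> \<le> pi * (\<rho> i)\<^sup>2 * \<epsilon>\<^sup>2 * (2 * C * \<epsilon>)"
          proof (intro mult_left_mono)
            have "1 - (1 - C * \<epsilon>)\<^sup>2 = 2 * C * \<epsilon> - (C * \<epsilon>)\<^sup>2" by (simp add: power2_eq_square algebra_simps)
            then show "1 - (1 - C * \<epsilon>)\<^sup>2 \<le> 2 * C * \<epsilon>" by simp
          qed simp
          also have "\<dots> = pi * (\<rho> i)\<^sup>2 * (2 * C) * \<epsilon> ^ 3" by (simp add: power2_eq_square power3_eq_cube)
          finally show "measure lebesgue (?A i) \<le> pi * (\<rho> i)\<^sup>2 * (2 * C) * \<epsilon> ^ 3" .
        qed
        finally show ?thesis by (simp add: sum_distrib_right)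
      qed
      have "C1 / \<epsilon>\<^sup>2 * measure lebesgue (cplx -` (L - K)) \<le> C1 / \<epsilon>\<^sup>2 * ((\<Sum>i<d. pi * (\<rho> i)\<^sup>2 * (2 * C)) * \<epsilon> ^ 3)"
        using A4 C10 by (intro mult_left_mono) auto
      also have "\<dots> = C2 * \<epsilon>" unfolding C2_def using \<epsilon> by (simp add: power2_eq_square power3_eq_cube)
      finally show ?thesis using A1 A2 A3 by linarith
    qed
    define t where "t = h ys / 2 * (pi * \<delta>\<^sup>2)"
    have tpos: "t > 0" unfolding t_def using hpos \<delta>(1) by simp
    \<comment> \<open>The minimum meets the side conditions of \<open>key\<close> and makes
      \<open>C2 * \<epsilon>\<close> smaller than \<open>t\<close>.\<close>
    define \<epsilon> where "\<epsilon> = min 1 (min (1 / (2 * (C + 1))) (min (1 / (S\<rho> + 1)) (t / (2 * (C2 + 1)))))"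
    have e0: "\<epsilon> > 0" unfolding \<epsilon>_def using C0 S\<rho>0 C20 tpos by auto
    have "\<epsilon> \<le> 1 / (2 * (C + 1))" "\<epsilon> \<le> 1 / (S\<rho> + 1)" "\<epsilon> \<le> t / (2 * (C2 + 1))" "\<epsilon> \<le> 1"
      unfolding \<epsilon>_def by auto
    then have "\<epsilon> * (2 * (C + 1)) \<le> 1" "\<epsilon> * (S\<rho> + 1) \<le> 1" "\<epsilon> * (2 * (C2 + 1)) \<le> t" "\<epsilon> \<le> 1"
      using C0 S\<rho>0 C20 by (simp_all add: pos_le_divide_eq)
    then have "t \<le> C2 * \<epsilon>" "\<epsilon> * (2 * (C2 + 1)) \<le> t"
      using key[of \<epsilon>] e0 unfolding t_def by (auto simp: algebra_simps)
    moreover have "C2 * \<epsilon> \<ge> 0" using C20 e0 by simp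
    ultimately show False using e0 by (simp add: algebra_simps)
  qed
  then show ?thesis by blast
qed

section \<open>Rational quadratic differentials with poles along a cycle\<close>

lemma sum_mod_shift:
  fixes g :: "nat \<Rightarrow> 'a::comm_monoid_add"
  assumes "d > 0"
  shows "(\<Sum>i<d. g (Suc i mod d)) = (\<Sum>i<d. g i)"
proof -
  obtain e where d: "d = Suc e" using assms by (cases d) auto
  have "(\<Sum>i<d. g (Suc i mod d)) = (\<Sum>i<e. g (Suc i mod d)) + g (Suc e mod d)"
    unfolding d by simp
  also have "(\<Sum>i<e. g (Suc i mod d)) = (\<Sum>i<e. g (Suc i))" using d by (intro sum.cong) auto
  also have "\<dots> + g (Suc e mod d) = g 0 + (\<Sum>i<e. g (Suc i))" using d by (simp add: add.commute)
  also have "\<dots> = (\<Sum>i<d. g i)" unfolding d by (simp only: sum.lessThan_Suc_shift)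
  finally show ?thesis .
qed

text \<open>Push-forward under squaring moves the pole from \<open>a\<close> to its square: the
  coefficient of the double pole is kept, that of the simple pole changes affinely, and the constant
  term corresponds to an additional simple pole at the critical value. The parts with
  \<open>\<gamma>\<close> and \<open>\<alpha>\<close> are treated separately over the common
  denominator \<open>D\<close>.\<close>

lemma pushforward_pole:
  fixes y a \<alpha> \<gamma> :: complex
  assumes "y \<noteq> 0" "a \<noteq> 0" "y\<^sup>2 \<noteq> a\<^sup>2"
  shows "(\<alpha> / (y - a)\<^sup>2 + \<gamma> / (y - a)) + (\<alpha> / (- y - a)\<^sup>2 + \<gamma> / (- y - a)) =
    4 * y\<^sup>2 * (\<alpha> / (y\<^sup>2 - a\<^sup>2)\<^sup>2 + (\<gamma> / (2 * a) - \<alpha> / (2 * a\<^sup>2)) / (y\<^sup>2 - a\<^sup>2))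
      - 4 * (\<gamma> / (2 * a) - \<alpha> / (2 * a\<^sup>2))"
proof -
  have ne: "y - a \<noteq> 0" "y + a \<noteq> 0" using assms(3) by (auto simp: add_eq_0_iff)
  have f: "y\<^sup>2 - a\<^sup>2 = (y - a) * (y + a)" by (simp add: power2_eq_square algebra_simps)
  have m: "- y - a = - (y + a)" by simp
  define D where "D = (y - a) * (y + a)"
  have D0: "D \<noteq> 0" unfolding D_def using ne by simp
  have DD: "D\<^sup>2 = D * D" "D\<^sup>2 \<noteq> 0" using D0 by (simp_all add: power2_eq_square)
  have g1: "\<gamma> / (y - a) - \<gamma> / (y + a) = 2 * a * \<gamma> / D"
  proof -
    have 1: "\<gamma> / (y - a) = \<gamma> * (y + a) / D"
      unfolding D_def by (rule nonzero_mult_divide_mult_cancel_right[symmetric, OF ne(2)])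
    have 2: "\<gamma> / (y + a) = (y - a) * \<gamma> / D"
      unfolding D_def by (rule nonzero_mult_divide_mult_cancel_left[symmetric, OF ne(1)])
    have 3: "\<gamma> * (y + a) - (y - a) * \<gamma> = 2 * a * \<gamma>" by (simp add: algebra_simps)
    show ?thesis unfolding 1 2 diff_divide_distrib[symmetric] 3 ..
  qed
  have a1: "\<alpha> / (y - a)\<^sup>2 + \<alpha> / (y + a)\<^sup>2 = \<alpha> * (2 * y\<^sup>2 + 2 * a\<^sup>2) / D\<^sup>2"
  proof -
    have sq: "(y - a)\<^sup>2 \<noteq> 0" "(y + a)\<^sup>2 \<noteq> 0" using ne by simp_all
    have 1: "\<alpha> / (y - a)\<^sup>2 = \<alpha> * (y + a)\<^sup>2 / D\<^sup>2"
      unfolding D_def power_mult_distrib by (rule nonzero_mult_divide_mult_cancel_right[symmetric, OF sq(2)])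
    have 2: "\<alpha> / (y + a)\<^sup>2 = (y - a)\<^sup>2 * \<alpha> / D\<^sup>2"
      unfolding D_def power_mult_distrib by (rule nonzero_mult_divide_mult_cancel_left[symmetric, OF sq(1)])
    have 3: "\<alpha> * (y + a)\<^sup>2 + (y - a)\<^sup>2 * \<alpha> = \<alpha> * (2 * y\<^sup>2 + 2 * a\<^sup>2)" by (simp add: power2_eq_square algebra_simps)
    show ?thesis unfolding 1 2 add_divide_distrib[symmetric] 3 ..
  qed
  define K where "K = \<gamma> / (2 * a)"
  define J where "J = \<alpha> / (2 * a\<^sup>2)"
  have \<gamma>K: "\<gamma> = 2 * a * K" and \<alpha>J: "\<alpha> = 2 * a\<^sup>2 * J" using assms(2) unfolding K_def J_def by simp_all
  have g2: "4 * y\<^sup>2 * (K / D) - 4 * K = 2 * a * \<gamma> / D"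
  proof -
    have 1: "4 * K = 4 * K * D / D" by (rule nonzero_mult_div_cancel_right[symmetric, OF D0])
    have 2: "4 * y\<^sup>2 * K - 4 * K * D = 2 * a * \<gamma>" unfolding \<gamma>K D_def by (simp add: power2_eq_square algebra_simps)
    have "4 * y\<^sup>2 * (K / D) - 4 * K = 4 * y\<^sup>2 * K / D - 4 * K * D / D" using 1 by (simp only: times_divide_eq_right)
    then show ?thesis unfolding diff_divide_distrib[symmetric] 2 .
  qed
  have a2: "4 * y\<^sup>2 * (\<alpha> / D\<^sup>2 - J / D) + 4 * J = \<alpha> * (2 * y\<^sup>2 + 2 * a\<^sup>2) / D\<^sup>2"
  proof -
    have 1: "4 * J = 4 * J * D\<^sup>2 / D\<^sup>2" by (rule nonzero_mult_div_cancel_right[symmetric, OF DD(2)])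
    have 2: "J / D = J * D / D\<^sup>2" unfolding DD(1) by (rule nonzero_mult_divide_mult_cancel_right[symmetric, OF D0])
    have 3: "4 * y\<^sup>2 * (\<alpha> - J * D) + 4 * J * D\<^sup>2 = \<alpha> * (2 * y\<^sup>2 + 2 * a\<^sup>2)"
      unfolding \<alpha>J D_def by (simp add: power2_eq_square algebra_simps)
    have "4 * y\<^sup>2 * (\<alpha> / D\<^sup>2 - J / D) + 4 * J = 4 * y\<^sup>2 * (\<alpha> - J * D) / D\<^sup>2 + 4 * J * D\<^sup>2 / D\<^sup>2"
      using 1 unfolding 2 by (simp only: diff_divide_distrib[symmetric] times_divide_eq_right)
    then show ?thesis unfolding add_divide_distrib[symmetric] 3 .
  qed
  have "(\<alpha> / (y - a)\<^sup>2 + \<gamma> / (y - a)) + (\<alpha> / (- y - a)\<^sup>2 + \<gamma> / (- y - a)) =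
     (\<alpha> / (y - a)\<^sup>2 + \<alpha> / (y + a)\<^sup>2) + (\<gamma> / (y - a) - \<gamma> / (y + a))"
    unfolding m power2_minus divide_minus_right by simp
  also have "\<dots> = (4 * y\<^sup>2 * (\<alpha> / D\<^sup>2 - J / D) + 4 * J) + (4 * y\<^sup>2 * (K / D) - 4 * K)"
    unfolding g1 a1 g2 a2 ..
  also have "\<dots> = 4 * y\<^sup>2 * (\<alpha> / D\<^sup>2 + (K - J) / D) - 4 * (K - J)"
  proof -
    have "(4 * t * (p - q) + 4 * J) + (4 * t * r - 4 * K) = 4 * t * (p + (r - q)) - 4 * (K - J)" for t p q r :: complex
      by (simp add: algebra_simps)
    then show ?thesis unfolding diff_divide_distrib .
  qed
  also have "\<dots> = 4 * y\<^sup>2 * (\<alpha> / (y\<^sup>2 - a\<^sup>2)\<^sup>2 + (\<gamma> / (2 * a) - \<alpha> / (2 * a\<^sup>2)) / (y\<^sup>2 - a\<^sup>2))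
      - 4 * (\<gamma> / (2 * a) - \<alpha> / (2 * a\<^sup>2))"
    unfolding f D_def K_def J_def ..
  finally show ?thesis .
qed

text \<open>The recursion for \<open>\<gamma>\<close> says that push-forward carries each pole to
  the next one on the cycle, and \<open>s0\<close> removes the pole at the critical value, so the
  differential is invariant. The multiplier condition makes the radii \<open>\<rho>\<close> close
  up. The differential then vanishes near infinity, hence identically after clearing denominators,
  and the value at \<open>z 0\<close> isolates a coefficient that \<open>nz\<close> declares
  non-zero.\<close>

lemma no_invariant_differential:
  fixes z \<gamma> :: "nat \<Rightarrow> complex" and c \<alpha> :: complex and d :: nat
  assumes d: "d > 0" and inj: "inj_on z {..<d}"
    and z: "\<And>i. z (Suc i) = (z i)\<^sup>2 + c" "z d = z 0"
    and lam: "cmod (\<Prod>i<d. 2 * z i) = 1"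
    and \<gamma>: "\<And>i. \<gamma> (Suc i) = \<gamma> i / (2 * z i) - \<alpha> / (2 * (z i)\<^sup>2)" "\<gamma> d = \<gamma> 0"
    and s0: "(\<Sum>i<d. \<gamma> i) = 0"
    and nz: "\<alpha> \<noteq> 0 \<or> \<gamma> 0 \<noteq> 0"
  shows False
proof -
  define \<rho> where "\<rho> i = cmod (\<Prod>j<i. 2 * z j)" for i
  define Q where "Q y = (\<Sum>i<d. \<alpha> / (y - z i)\<^sup>2 + \<gamma> i / (y - z i))" for y
  have sm: "g (Suc i mod d) = g (Suc i)" if "i < d" "g d = g 0" for g :: "nat \<Rightarrow> 'b" and i
    using that by (cases "Suc i = d") auto
  have z0: "z i \<noteq> 0" if "i < d" for i
  proof
    assume "z i = 0"
    then have "(\<Prod>i<d. 2 * z i) = 0" using that by (intro prod_zero) auto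
    then have "cmod (\<Prod>i<d. 2 * z i) = 0" by (simp only: norm_zero)
    then show False using lam by linarith
  qed
  have zmod: "z (Suc i mod d) = (z i)\<^sup>2 + c" if "i < d" for i
    using sm[of i z, OF that z(2)] z(1) by simp
  have \<rho>1: "\<rho> i > 0" if "i < d" for i
    unfolding \<rho>_def using z0 that by simp
  have \<rho>2: "\<rho> (Suc i mod d) = 2 * cmod (z i) * \<rho> i" if "i < d" for i
  proof -
    have "\<rho> d = \<rho> 0" unfolding \<rho>_def lam by (simp only: lessThan_0 prod.empty norm_one)
    from sm[of i \<rho>, OF that this] show ?thesis by (simp add: \<rho>_def norm_mult)
  qed
  have rel: "4 * y\<^sup>2 * Q (y\<^sup>2 + c) = Q y + Q (- y)" if y: "y \<noteq> 0" "y\<^sup>2 + c \<notin> z ` {..<d}" for y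
  proof -
    have "Q y + Q (- y) = (\<Sum>i<d. 4 * y\<^sup>2 * (\<alpha> / (y\<^sup>2 + c - z (Suc i mod d))\<^sup>2 + \<gamma> (Suc i mod d) / (y\<^sup>2 + c - z (Suc i mod d)))
        - 4 * \<gamma> (Suc i mod d))"
      unfolding Q_def sum.distrib[symmetric]
    proof (rule sum.cong[OF refl])
      fix i assume "i \<in> {..<d}"
      then have i: "i < d" by simp
      have zi: "y\<^sup>2 + c - z (Suc i mod d) = y\<^sup>2 - (z i)\<^sup>2" unfolding zmod[OF i] by simp
      have "Suc i mod d < d" using d by simp
      then have "y\<^sup>2 + c \<noteq> z (Suc i mod d)" using y(2) by blast
      then have "y\<^sup>2 \<noteq> (z i)\<^sup>2" unfolding zmod[OF i] by simp
      moreover have "\<gamma> (Suc i mod d) = \<gamma> i / (2 * z i) - \<alpha> / (2 * (z i)\<^sup>2)"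
        using sm[of i \<gamma>, OF i \<gamma>(2)] \<gamma>(1) by simp
      ultimately show "\<alpha> / (y - z i)\<^sup>2 + \<gamma> i / (y - z i) + (\<alpha> / (- y - z i)\<^sup>2 + \<gamma> i / (- y - z i)) =
          4 * y\<^sup>2 * (\<alpha> / (y\<^sup>2 + c - z (Suc i mod d))\<^sup>2 + \<gamma> (Suc i mod d) / (y\<^sup>2 + c - z (Suc i mod d)))
          - 4 * \<gamma> (Suc i mod d)"
        unfolding zi using pushforward_pole[OF y(1) z0[OF i], of \<alpha> "\<gamma> i"] by simp
    qed
    also have "\<dots> = (\<Sum>i<d. 4 * y\<^sup>2 * (\<alpha> / (y\<^sup>2 + c - z i)\<^sup>2 + \<gamma> i / (y\<^sup>2 + c - z i)) - 4 * \<gamma> i)"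
      by (rule sum_mod_shift[OF d])
    also have "\<dots> = 4 * y\<^sup>2 * Q (y\<^sup>2 + c) - 4 * (\<Sum>i<d. \<gamma> i)"
      unfolding Q_def by (simp only: sum_subtractf sum_distrib_left)
    finally show ?thesis using s0 by simp
  qed
  obtain R0 where R0: "\<And>y. cmod y \<ge> R0 \<Longrightarrow> Q y = 0"
    using invariant_differential_vanishes[where z=z and \<gamma>=\<gamma> and c=c and \<alpha>=\<alpha> and d=d and \<rho>=\<rho>,
        OF zmod \<rho>1 \<rho>2 rel[unfolded Q_def]] unfolding Q_def by blast
  define R1 where "R1 = max R0 (1 + (\<Sum>i<d. cmod (z i)))"
  have big: "Q y = 0 \<and> (\<forall>i<d. y \<noteq> z i)" if "cmod y \<ge> R1" for y
  proof -
    have "y \<noteq> z i" if "i < d" for i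
      using member_le_sum[of i "{..<d}" "\<lambda>i. cmod (z i)"] that \<open>cmod y \<ge> R1\<close> unfolding R1_def by auto
    then show ?thesis using R0 that unfolding R1_def by simp
  qed
  have inf: "infinite {y::complex. cmod y \<ge> R1}"
  proof
    assume "finite {y::complex. cmod y \<ge> R1}"
    then have "finite (complex_of_real ` {max R1 0..})" by (rule rev_finite_subset) auto
    then have "finite {max R1 0..}" by (rule finite_imageD) (simp add: inj_on_def)
    then show False using infinite_Ici by blast
  qed
  have vanish: "p = 0" if "\<And>y. cmod y \<ge> R1 \<Longrightarrow> poly p y = 0" for p :: "complex poly"
  proof (rule ccontr)
    assume "p \<noteq> 0"
    then have "finite {y. poly p y = 0}" by (rule poly_roots_finite)
    moreover have "{y. cmod y \<ge> R1} \<subseteq> {y. poly p y = 0}" using that by blast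
    ultimately show False using inf finite_subset by blast
  qed
  show False
  proof (cases "\<alpha> = 0")
    case False
    define p where "p = (\<Sum>i<d. [:\<alpha> - \<gamma> i * z i, \<gamma> i:] * (\<Prod>j\<in>{..<d} - {i}. [:- z j, 1:]\<^sup>2))"
    have "poly p y = 0" if y: "cmod y \<ge> R1" for y
    proof -
      have ny: "y - z i \<noteq> 0" if "i < d" for i using big[OF y] that by simp
      have "poly p y = (\<Sum>i<d. (\<alpha> / (y - z i)\<^sup>2 + \<gamma> i / (y - z i)) * (\<Prod>j<d. (y - z j)\<^sup>2))"
        unfolding p_def poly_sum
      proof (rule sum.cong[OF refl])
        fix i assume "i \<in> {..<d}"
        then have i: "i \<in> {..<d}" "i < d" by auto
        have "(\<Prod>j<d. (y - z j)\<^sup>2) = (y - z i)\<^sup>2 * (\<Prod>j\<in>{..<d} - {i}. (y - z j)\<^sup>2)"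
          using i by (simp add: prod.remove)
        moreover have "(\<alpha> / (y - z i)\<^sup>2 + \<gamma> i / (y - z i)) * (y - z i)\<^sup>2 = \<alpha> + \<gamma> i * (y - z i)"
          using ny[OF i(2)] by (simp add: distrib_right power2_eq_square del: right_minus_eq)
        ultimately have "(\<alpha> / (y - z i)\<^sup>2 + \<gamma> i / (y - z i)) * (\<Prod>j<d. (y - z j)\<^sup>2) =
            (\<alpha> + \<gamma> i * (y - z i)) * (\<Prod>j\<in>{..<d} - {i}. (y - z j)\<^sup>2)"
          by (simp only: mult.assoc[symmetric])
        then show "poly ([:\<alpha> - \<gamma> i * z i, \<gamma> i:] * (\<Prod>j\<in>{..<d} - {i}. [:- z j, 1:]\<^sup>2)) y =
            (\<alpha> / (y - z i)\<^sup>2 + \<gamma> i / (y - z i)) * (\<Prod>j<d. (y - z j)\<^sup>2)"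
          by (simp add: poly_prod) (simp add: algebra_simps)
      qed
      also have "\<dots> = Q y * (\<Prod>j<d. (y - z j)\<^sup>2)" unfolding Q_def by (simp add: sum_distrib_right)
      finally show ?thesis using big[OF y] by simp
    qed
    then have "p = 0" by (rule vanish)
    then have "poly p (z 0) = 0" by simp
    moreover have "poly p (z 0) = \<alpha> * (\<Prod>j\<in>{..<d} - {0}. (z 0 - z j)\<^sup>2)"
    proof -
      have "poly p (z 0) = (\<Sum>i<d. if i = 0 then \<alpha> * (\<Prod>j\<in>{..<d} - {0}. (z 0 - z j)\<^sup>2) else 0)"
        unfolding p_def poly_sum
      proof (rule sum.cong[OF refl])
        fix i assume "i \<in> {..<d}"
        have "i \<noteq> 0 \<Longrightarrow> (\<Prod>j\<in>{..<d} - {i}. (z 0 - z j)\<^sup>2) = 0"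
          using d by (intro prod_zero) (auto intro!: bexI[of _ 0])
        then show "poly ([:\<alpha> - \<gamma> i * z i, \<gamma> i:] * (\<Prod>j\<in>{..<d} - {i}. [:- z j, 1:]\<^sup>2)) (z 0) =
          (if i = 0 then \<alpha> * (\<Prod>j\<in>{..<d} - {0}. (z 0 - z j)\<^sup>2) else 0)"
          by (cases "i = 0") (simp_all add: poly_prod algebra_simps del: prod_zero_iff)
      qed
      then show ?thesis using d by simp
    qed
    moreover have "z 0 \<noteq> z j" if "j \<in> {..<d} - {0}" for j using inj_onD[OF inj, of 0 j] that d by auto
    ultimately show False using False by auto
  next
    case True
    define p where "p = (\<Sum>i<d. [:\<gamma> i:] * (\<Prod>j\<in>{..<d} - {i}. [:- z j, 1:]))"
    have "poly p y = 0" if y: "cmod y \<ge> R1" for y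
    proof -
      have ny: "y - z i \<noteq> 0" if "i < d" for i using big[OF y] that by simp
      have "poly p y = (\<Sum>i<d. (\<gamma> i / (y - z i)) * (\<Prod>j<d. (y - z j)))"
        unfolding p_def poly_sum
      proof (rule sum.cong[OF refl])
        fix i assume "i \<in> {..<d}"
        then have i: "i \<in> {..<d}" "i < d" by auto
        have "(\<Prod>j<d. (y - z j)) = (y - z i) * (\<Prod>j\<in>{..<d} - {i}. (y - z j))"
          using i by (simp add: prod.remove)
        then show "poly ([:\<gamma> i:] * (\<Prod>j\<in>{..<d} - {i}. [:- z j, 1:])) y =
            (\<gamma> i / (y - z i)) * (\<Prod>j<d. (y - z j))"
          using ny[OF i(2)] by (simp add: poly_prod)
      qed
      also have "\<dots> = Q y * (\<Prod>j<d. (y - z j))" unfolding Q_def True by (simp add: sum_distrib_right)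
      finally show ?thesis using big[OF y] by simp
    qed
    then have "p = 0" by (rule vanish)
    then have "poly p (z 0) = 0" by simp
    moreover have "poly p (z 0) = \<gamma> 0 * (\<Prod>j\<in>{..<d} - {0}. (z 0 - z j))"
    proof -
      have "poly p (z 0) = (\<Sum>i<d. if i = 0 then \<gamma> 0 * (\<Prod>j\<in>{..<d} - {0}. (z 0 - z j)) else 0)"
        unfolding p_def poly_sum
      proof (rule sum.cong[OF refl])
        fix i assume "i \<in> {..<d}"
        show "poly ([:\<gamma> i:] * (\<Prod>j\<in>{..<d} - {i}. [:- z j, 1:])) (z 0) =
          (if i = 0 then \<gamma> 0 * (\<Prod>j\<in>{..<d} - {0}. (z 0 - z j)) else 0)"
          using d by (auto simp: poly_prod intro!: bexI[of _ 0])
      qed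
      then show ?thesis using d by simp
    qed
    moreover have "z 0 \<noteq> z j" if "j \<in> {..<d} - {0}" for j using inj_onD[OF inj, of 0 j] that d by auto
    ultimately show False using nz True by auto
  qed
qed

lemma telescope_cycle:
  fixes g :: "nat \<Rightarrow> complex"
  shows "(\<Sum>i<d. g (Suc i) - g i) = g d - g 0"
  by (rule sum_lessThan_telescope)

text \<open>A cycle of multiplier 1 does not persist to first order in \<open>c\<close>.\<close>

lemma parabolic_transversality:
  fixes z a :: "nat \<Rightarrow> complex" and c :: complex
  assumes d: "d > 0" and inj: "inj_on z {..<d}"
    and z: "\<And>i. z (Suc i) = (z i)\<^sup>2 + c" "z d = z 0"
    and lam: "(\<Prod>i<d. 2 * z i) = 1"
    and a: "\<And>i. a (Suc i) = 2 * z i * a i + 1" "a d = a 0"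
  shows False
proof -
  \<comment> \<open>\<open>\<gamma> i\<close> is the inverse derivative of the \<open>i\<close>-th
    iterate at \<open>z 0\<close>. It solves the recursion with \<open>\<alpha> = 0\<close> and
    closes up because the multiplier is 1; paired with the variation \<open>a\<close> of the cycle
    it telescopes to a vanishing sum.\<close>
  define \<gamma> where "\<gamma> i = inverse (\<Prod>j<i. 2 * z j)" for i
  have z0: "z i \<noteq> 0" for i
  proof
    assume i: "z i = 0"
    have "z (i mod d) = z i"
    proof -
      have "z (j + k * d) = z j" for j k
      proof (induction k arbitrary: j)
        case (Suc k)
        have "z (j + d) = z j" by (induction j) (auto simp: z)
        moreover have "j + Suc k * d = (j + d) + k * d" by simp
        ultimately show ?case using Suc[of "j + d"] by (simp only:)
      qed simp
      from this[of "i mod d" "i div d"] show ?thesis by simp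
    qed
    then have "(\<Prod>i<d. 2 * z i) = 0" using i d by (intro prod_zero) (auto intro!: bexI[of _ "i mod d"])
    then show False using lam by simp
  qed
  have \<gamma>S: "\<gamma> (Suc i) = \<gamma> i / (2 * z i)" for i
    unfolding \<gamma>_def by (simp add: field_simps)
  have "\<gamma> (Suc i) = \<gamma> (Suc i) * a (Suc i) - \<gamma> i * a i" for i
    using z0[of i] unfolding a(1) \<gamma>S by (simp add: field_simps)
  then have "(\<Sum>i<d. \<gamma> (Suc i)) = (\<Sum>i<d. \<gamma> (Suc i) * a (Suc i) - \<gamma> i * a i)" by (intro sum.cong refl)
  also have "\<dots> = \<gamma> d * a d - \<gamma> 0 * a 0" by (rule telescope_cycle[of "\<lambda>i. \<gamma> i * a i"])
  also have "\<dots> = 0" using lam a(2) by (simp add: \<gamma>_def)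
  finally have s: "(\<Sum>i<d. \<gamma> (Suc i)) = 0" .
  have "(\<Sum>i<d. \<gamma> (Suc i)) - (\<Sum>i<d. \<gamma> i) = \<gamma> d - \<gamma> 0"
    unfolding sum_subtractf[symmetric] by (rule telescope_cycle)
  also have "\<dots> = 0" using lam by (simp add: \<gamma>_def)
  finally have "(\<Sum>i<d. \<gamma> i) = 0" using s by simp
  then show False
    using no_invariant_differential[OF d inj z, of \<gamma> 0] lam \<gamma>S by (simp add: \<gamma>_def)
qed

text \<open>The multiplier of an indifferent cycle moves with non-zero speed in \<open>c\<close>.\<close>

lemma multiplier_transversality:
  fixes z a :: "nat \<Rightarrow> complex" and c :: complex
  assumes d: "d > 0" and inj: "inj_on z {..<d}"
    and z: "\<And>i. z (Suc i) = (z i)\<^sup>2 + c" "z d = z 0"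
    and lam: "cmod (\<Prod>i<d. 2 * z i) = 1" "(\<Prod>i<d. 2 * z i) \<noteq> 1"
    and a: "\<And>i. a (Suc i) = 2 * z i * a i + 1" "a d = a 0"
  shows "(\<Sum>i<d. a i / z i) \<noteq> 0"
proof
  assume s0: "(\<Sum>i<d. a i / z i) = 0"
  \<comment> \<open>\<open>q\<close> solves the recursion with \<open>\<alpha> = 1\<close> and
    initial value 0. Adding the multiple \<open>g0\<close> of the homogeneous solution closes it up,
    which is possible since the multiplier is not 1.\<close>
  define q where "q = rec_nat (0::complex) (\<lambda>i x. x / (2 * z i) - 1 / (2 * (z i)\<^sup>2))"
  have qS: "q 0 = 0" "q (Suc i) = q i / (2 * z i) - 1 / (2 * (z i)\<^sup>2)" for i
    by (simp_all add: q_def)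
  define \<Lambda> where "\<Lambda> = (\<Prod>i<d. 2 * z i)"
  have "cmod \<Lambda> = 1" using lam(1) unfolding \<Lambda>_def .
  then have \<Lambda>: "\<Lambda> \<noteq> 0" "\<Lambda> \<noteq> 1" using lam(2) unfolding \<Lambda>_def[symmetric] by auto
  define g0 where "g0 = q d / (1 - inverse \<Lambda>)"
  define \<gamma> where "\<gamma> i = g0 * inverse (\<Prod>j<i. 2 * z j) + q i" for i
  have z0: "z i \<noteq> 0" if "i < d" for i
  proof
    assume "z i = 0"
    then have "\<Lambda> = 0" unfolding \<Lambda>_def using that by (intro prod_zero) auto
    then show False using \<Lambda> by simp
  qed
  have \<gamma>S: "\<gamma> (Suc i) = \<gamma> i / (2 * z i) - 1 / (2 * (z i)\<^sup>2)" for i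
  proof -
    have "inverse (\<Prod>j<Suc i. 2 * z j) = inverse (\<Prod>j<i. 2 * z j) / (2 * z i)" by (simp add: field_simps)
    then show ?thesis unfolding \<gamma>_def qS by (simp only: add_divide_distrib times_divide_eq_right add_diff_eq)
  qed
  have "\<gamma> d = g0 * inverse \<Lambda> + q d" by (simp add: \<gamma>_def \<Lambda>_def)
  also have "q d = g0 * (1 - inverse \<Lambda>)" using \<Lambda> by (simp add: g0_def)
  also have "g0 * inverse \<Lambda> + g0 * (1 - inverse \<Lambda>) = g0" by (simp add: algebra_simps)
  also have "g0 = \<gamma> 0" by (simp add: \<gamma>_def qS)
  finally have \<gamma>d: "\<gamma> d = \<gamma> 0" .
  \<comment> \<open>The term \<open>a i / z i\<close> is the logarithmic derivative in c of the
    factor \<open>2 * z i\<close> of the multiplier.\<close>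
  have "\<gamma> (Suc i) = (\<gamma> (Suc i) * a (Suc i) - \<gamma> i * a i) + a i / z i" if "i < d" for i
    using z0[OF that] unfolding a(1) \<gamma>S by (simp add: field_simps power2_eq_square)
  then have "(\<Sum>i<d. \<gamma> (Suc i)) = (\<Sum>i<d. (\<gamma> (Suc i) * a (Suc i) - \<gamma> i * a i) + a i / z i)" by (intro sum.cong) auto
  also have "\<dots> = (\<gamma> d * a d - \<gamma> 0 * a 0) + (\<Sum>i<d. a i / z i)"
    unfolding sum.distrib by (simp only: telescope_cycle[of "\<lambda>i. \<gamma> i * a i"])
  also have "\<dots> = 0" using \<gamma>d a(2) s0 by simp
  finally have s: "(\<Sum>i<d. \<gamma> (Suc i)) = 0" .
  have "(\<Sum>i<d. \<gamma> (Suc i)) - (\<Sum>i<d. \<gamma> i) = \<gamma> d - \<gamma> 0"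
    unfolding sum_subtractf[symmetric] by (rule telescope_cycle)
  then have "(\<Sum>i<d. \<gamma> i) = 0" using s \<gamma>d by simp
  then show False
    using no_invariant_differential[OF d inj z lam(1), of \<gamma> 1] \<gamma>S \<gamma>d by simp
qed

section \<open>Dynatomic polynomials of the quadratic family\<close>

lemma sum_Pow_alternating:
  assumes "finite S"
  shows "(\<Sum>A\<in>Pow S. (- 1) ^ card A) = (of_bool (S = {}) :: int)"
  using assms
proof (induction S rule: finite_induct)
  case (insert x S)
  have "(\<Sum>A\<in>Pow (insert x S). (- 1) ^ card A) =
      (\<Sum>A\<in>Pow S. (- 1) ^ card A) + (\<Sum>A\<in>insert x ` Pow S. (- 1) ^ card A :: int)"
    unfolding Pow_insert using insert by (intro sum.union_disjoint) auto
  also have "(\<Sum>A\<in>insert x ` Pow S. (- 1) ^ card A :: int) = (\<Sum>A\<in>Pow S. (- 1) ^ card (insert x A))"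
    using insert by (subst sum.reindex) (auto simp: inj_on_def)
  also have "\<dots> = (\<Sum>A\<in>Pow S. - ((- 1) ^ card A))"
  proof (rule sum.cong[OF refl])
    fix A assume "A \<in> Pow S"
    then have "finite A" "x \<notin> A" using insert finite_subset by auto
    then show "(- 1) ^ card (insert x A) = - ((- 1 :: int) ^ card A)" by simp
  qed
  finally show ?case by (simp add: sum_negf)
qed simp

lemma squarefree_prod_primes:
  assumes "finite S" "\<And>p. p \<in> S \<Longrightarrow> prime (p::nat)"
  shows "squarefree (\<Prod>S)" "prime_factors (\<Prod>S) = S"
proof -
  have "coprime p q" if "p \<in> S" "q \<in> S" "p \<noteq> q" for p q
    using that assms(2) primes_coprime by blast
  then show "squarefree (\<Prod>S)"
    using assms by (intro squarefree_prod_coprime) (auto intro: squarefree_prime)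
  have "prime_factors (\<Prod>S) = (\<Union>p\<in>S. prime_factors p)"
    using assms by (subst prime_factors_prod) (auto simp: image_iff dest: assms(2))
  also have "\<dots> = S" using assms(2) by (auto simp: prime_factorization_prime)
  finally show "prime_factors (\<Prod>S) = S" .
qed

lemma sum_moebius:
  assumes "n > 0"
  shows "(\<Sum>k | k dvd n. Defs.moebius k) = of_bool (n = 1)"
proof -
  have fin: "finite {k. k dvd n}" using assms by simp
  have "(\<Sum>k | k dvd n. Defs.moebius k) = (\<Sum>k | k dvd n \<and> squarefree k. (- 1) ^ card (prime_factors k))"
    using fin by (intro sum.mono_neutral_cong_right) (auto simp: Defs.moebius_def)
  also have "\<dots> = (\<Sum>A\<in>Pow (prime_factors n). (- 1) ^ card A)"
  proof (rule sum.reindex_bij_betw)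
    show "bij_betw prime_factors {k. k dvd n \<and> squarefree k} (Pow (prime_factors n))"
    proof (rule bij_betwI[where g = "\<lambda>S. \<Prod>S"])
      show "prime_factors \<in> {k. k dvd n \<and> squarefree k} \<rightarrow> Pow (prime_factors n)"
        using assms by (auto simp: prime_factors_dvd intro: dvd_trans)
      show "Prod \<in> Pow (prime_factors n) \<rightarrow> {k. k dvd n \<and> squarefree k}"
      proof
        fix S assume S: "S \<in> Pow (prime_factors n)"
        have fS: "finite S" using S finite_subset by blast
        have pS: "\<And>p. p \<in> S \<Longrightarrow> prime p" using S by auto
        have "\<Prod>S dvd n"
        proof (rule multiplicity_le_imp_dvd)
          show "\<Prod>S \<noteq> 0" using fS pS[of 0] by auto
          fix p :: nat assume p: "prime p"
          have "multiplicity p (\<Prod>S) \<le> of_bool (p \<in> S)"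
          proof (cases "p \<in> S")
            case True
            have "multiplicity p (\<Prod>S) \<le> 1"
            proof (rule ccontr)
              assume "\<not> ?thesis"
              then have "p ^ 2 dvd \<Prod>S" by (intro multiplicity_dvd') simp
              then have "p dvd 1" using squarefree_prod_primes(1)[OF fS pS] squarefreeD by blast
              then show False using p by simp
            qed
            then show ?thesis using True by simp
          next
            case False
            then have "\<not> p dvd \<Prod>S"
              using squarefree_prod_primes(2)[OF fS pS] p fS pS
              by (metis in_prime_factors_iff not_squarefree_0 squarefree_prod_primes(1))
            then show ?thesis by (simp add: not_dvd_imp_multiplicity_0)
          qed
          also have "\<dots> \<le> multiplicity p n"
            using S assms p by (auto simp: prime_factors_multiplicity)
          finally show "multiplicity p (\<Prod>S) \<le> multiplicity p n" .
        qed
        then show "\<Prod>S \<in> {k. k dvd n \<and> squarefree k}"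
          using squarefree_prod_primes(1)[OF fS pS] by simp
      qed
      fix k assume k: "k \<in> {k. k dvd n \<and> squarefree k}"
      then have k0: "k \<noteq> 0" using assms by (metis dvd_0_left mem_Collect_eq not_gr_zero)
      have "k = (\<Prod>p\<in>prime_factors k. p ^ multiplicity p k)"
        using k0 by (simp add: prime_factorization_nat[symmetric])
      also have "\<dots> = (\<Prod>p\<in>prime_factors k. p)"
        using k k0 by (intro prod.cong refl)
          (auto simp: squarefree_factorial_semiring'' prime_factors_multiplicity le_Suc_eq dest!: bspec)
      finally show "\<Prod>(prime_factors k) = k" by simp
    next
      fix S assume S: "S \<in> Pow (prime_factors n)"
      show "prime_factors (\<Prod>S) = S"
        using S finite_subset by (intro squarefree_prod_primes(2)) auto
    qed
  qed
  also have "\<dots> = of_bool (prime_factors n = {})" by (rule sum_Pow_alternating) simp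
  also have "prime_factors n = {} \<longleftrightarrow> n = 1"
    using assms by (auto simp: prime_factorization_empty_iff)
  finally show ?thesis .
qed

lemma sum_moebius_multiples:
  assumes "N > 0"
  shows "(\<Sum>k | k dvd N. Defs.moebius (N div k) * of_bool (d dvd k)) = of_bool (d = N)"
proof (cases "d dvd N")
  case False
  then have "(\<Sum>k | k dvd N. Defs.moebius (N div k) * of_bool (d dvd k)) = 0"
    by (intro sum.neutral) (auto dest: dvd_trans)
  then show ?thesis using False by auto
next
  case True
  then obtain n where n: "N = d * n" by blast
  have d0: "d > 0" "n > 0" using assms n by auto
  have "(\<Sum>k | k dvd N. Defs.moebius (N div k) * of_bool (d dvd k)) = (\<Sum>k | k dvd N \<and> d dvd k. Defs.moebius (N div k))"
    using assms by (intro sum.mono_neutral_cong_right) auto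
  also have "\<dots> = (\<Sum>j | j dvd n. Defs.moebius j)"
  proof (rule sum.reindex_bij_witness[where i = "\<lambda>j. d * (n div j)" and j = "\<lambda>k. N div k"])
    fix k assume "k \<in> {k. k dvd N \<and> d dvd k}"
    then obtain l where l: "k = d * l" "l dvd n" using n d0 by auto
    then obtain m where m: "n = l * m" by blast
    have "N div k = m" "l > 0" "m > 0" using l m n d0 by auto
    then show "d * (n div (N div k)) = k" "N div k \<in> {j. j dvd n}" "Defs.moebius (N div k) = Defs.moebius (N div k)"
      using l m by auto
  next
    fix j assume "j \<in> {j. j dvd n}"
    then obtain m where m: "n = j * m" by auto
    then have "j > 0" "m > 0" using d0 by auto
    then show "N div (d * (n div j)) = j" "d * (n div j) \<in> {k. k dvd N \<and> d dvd k}"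
      using m n d0 by auto
  qed
  also have "\<dots> = of_bool (n = 1)" by (rule sum_moebius[OF d0(2)])
  also have "n = 1 \<longleftrightarrow> d = N" using n d0 by auto
  finally show ?thesis .
qed

lemma moebius_cases: "Defs.moebius n = 1 \<or> Defs.moebius n = 0 \<or> Defs.moebius n = - 1"
  unfolding Defs.moebius_def by (auto simp: minus_one_power_iff)

text \<open>Splitting the Moebius product into numerator and denominator gives it a meaning in every
  commutative monoid, so it can be followed through ring homomorphisms without leaving polynomial
  rings.\<close>

definition dyn_num :: "(nat \<Rightarrow> 'a::comm_monoid_mult) \<Rightarrow> nat \<Rightarrow> 'a" where
  "dyn_num u N = (\<Prod>k | k dvd N \<and> Defs.moebius (N div k) = 1. u k)"

definition dyn_den :: "(nat \<Rightarrow> 'a::comm_monoid_mult) \<Rightarrow> nat \<Rightarrow> 'a" where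
  "dyn_den u N = (\<Prod>k | k dvd N \<and> Defs.moebius (N div k) = - 1. u k)"

text \<open>Moebius inversion in the form used for multiplicities and, with \<open>d = 1\<close>,
  for counting divisors.\<close>

lemma sum_num_den:
  fixes m :: "nat \<Rightarrow> nat"
  assumes "N > 0" "\<And>k. k dvd N \<Longrightarrow> m k = of_bool (d dvd k)"
  shows "(\<Sum>k | k dvd N \<and> Defs.moebius (N div k) = 1. m k) =
     (\<Sum>k | k dvd N \<and> Defs.moebius (N div k) = - 1. m k) + of_bool (d = N)"
proof -
  have fin: "finite {k. k dvd N}" using assms by simp
  let ?A = "{k. k dvd N \<and> Defs.moebius (N div k) = 1}" and ?B = "{k. k dvd N \<and> Defs.moebius (N div k) = - 1}"
  have "of_bool (d = N) = (\<Sum>k | k dvd N. Defs.moebius (N div k) * int (m k))"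
    using sum_moebius_multiples[OF assms(1), of d] assms(2) by simp
  also have "\<dots> = (\<Sum>k\<in>?A \<union> ?B. Defs.moebius (N div k) * int (m k))"
  proof (rule sum.mono_neutral_right[OF fin])
    show "\<forall>k\<in>{k. k dvd N} - (?A \<union> ?B). Defs.moebius (N div k) * int (m k) = 0"
    proof
      fix k assume "k \<in> {k. k dvd N} - (?A \<union> ?B)"
      then have "Defs.moebius (N div k) = 0" using moebius_cases[of "N div k"] by blast
      then show "Defs.moebius (N div k) * int (m k) = 0" by simp
    qed
  qed blast
  also have "\<dots> = (\<Sum>k\<in>?A. Defs.moebius (N div k) * int (m k)) + (\<Sum>k\<in>?B. Defs.moebius (N div k) * int (m k))"
    using fin by (intro sum.union_disjoint) auto
  also have "\<dots> = int (\<Sum>k\<in>?A. m k) - int (\<Sum>k\<in>?B. m k)"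
    by (simp add: sum_negf)
  finally have "int (\<Sum>k\<in>?A. m k) = int ((\<Sum>k\<in>?B. m k) + of_bool (d = N))" by simp
  then show ?thesis by (simp only: of_nat_eq_iff)
qed

text \<open>By Moebius inversion of the pattern \<open>of_bool (d dvd k)\<close> a prime survives in
  the quotient only for \<open>d = N\<close>. This is why the dynatomic quotient is a
  polynomial.\<close>

lemma multiplicity_dyn:
  fixes u :: "nat \<Rightarrow> 'a::factorial_ring_gcd"
  assumes "N > 0" "prime p" "\<And>k. k dvd N \<Longrightarrow> u k \<noteq> 0"
    and "\<And>k. k dvd N \<Longrightarrow> multiplicity p (u k) = of_bool (d dvd k)"
  shows "multiplicity p (dyn_num u N) = multiplicity p (dyn_den u N) + of_bool (d = N)"
proof -
  have fin: "finite {k. k dvd N}" using assms by simp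
  have e: "multiplicity p (prod u A) = (\<Sum>k\<in>A. multiplicity p (u k))" if "A \<subseteq> {k. k dvd N}" for A
    using that fin assms(2,3) finite_subset
    by (intro prime_elem_multiplicity_prod_distrib) auto
  have "multiplicity p (dyn_num u N) = (\<Sum>k | k dvd N \<and> Defs.moebius (N div k) = 1. multiplicity p (u k))"
    "multiplicity p (dyn_den u N) = (\<Sum>k | k dvd N \<and> Defs.moebius (N div k) = - 1. multiplicity p (u k))"
    unfolding dyn_num_def dyn_den_def by (rule e, blast)+
  then show ?thesis
    using sum_num_den[OF assms(1), of "\<lambda>k. multiplicity p (u k)" d] assms(4) by simp
qed

lemma dyn_nonzero:
  fixes u :: "nat \<Rightarrow> 'a::idom"
  assumes "N > 0" "\<And>k. k dvd N \<Longrightarrow> u k \<noteq> 0"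
  shows "dyn_num u N \<noteq> 0" "dyn_den u N \<noteq> 0"
proof -
  have fin: "finite {k. k dvd N}" using assms by simp
  have *: "prod u A \<noteq> 0" if "A \<subseteq> {k. k dvd N}" for A
  proof -
    have "finite A" using that fin by (rule finite_subset)
    then show ?thesis using that assms(2) by auto
  qed
  show "dyn_num u N \<noteq> 0" "dyn_den u N \<noteq> 0"
    unfolding dyn_num_def dyn_den_def by (rule *, blast)+
qed

text \<open>The return times are closed under addition and subtraction; \<open>d = 0\<close> covers
  the case of no positive return time. The relation will be equality, congruence modulo a prime, or
  proportionality modulo a prime.\<close>

lemma period_set_multiples:
  fixes R :: "nat \<Rightarrow> nat \<Rightarrow> bool"
  assumes refl: "\<And>i. R i i" and sym: "\<And>i j. R i j \<Longrightarrow> R j i"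
    and trans: "\<And>i j k. R i j \<Longrightarrow> R j k \<Longrightarrow> R i k"
    and shift: "\<And>i j. R i j \<Longrightarrow> R (Suc i) (Suc j)"
  obtains d where "\<And>k. R 0 k \<longleftrightarrow> d dvd k"
proof -
  have shift': "R (i + n) (j + n)" if "R i j" for i j n
    using that by (induction n) (auto intro: shift)
  have add: "R 0 (a + b)" if "R 0 a" "R 0 b" for a b
    using shift'[OF that(1), of b] that(2) trans by (metis add_0)
  have diff: "R 0 b" if "R 0 (a + b)" "R 0 a" for a b
    using shift'[OF that(2), of b] that(1) trans sym by (metis add_0)
  show ?thesis
  proof (cases "\<exists>k>0. R 0 k")
    case False
    then have "R 0 k \<longleftrightarrow> 0 dvd k" for k using refl by (metis dvd_0_left_iff not_gr_zero)
    then show ?thesis using that by blast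
  next
    case True
    define d where "d = (LEAST k. k > 0 \<and> R 0 k)"
    have d: "d > 0" "R 0 d" using LeastI_ex[OF True] unfolding d_def by auto
    have least: "d \<le> k" if "k > 0" "R 0 k" for k unfolding d_def using that by (intro Least_le) simp
    have mult: "R 0 (d * q)" for q by (induction q) (auto simp: refl d add)
    have "R 0 k \<longleftrightarrow> d dvd k" for k
    proof
      assume k: "R 0 k"
      have "R 0 (k mod d)" using diff[of "d * (k div d)" "k mod d"] mult k by simp
      moreover have "k mod d < d" using d by simp
      ultimately have "k mod d = 0" using least[of "k mod d"] by fastforce
      then show "d dvd k" by auto
    qed (auto simp: mult)
    then show ?thesis using that by blast
  qed
qed

section \<open>Orbits and period polynomials of z^2 + c\<close>

definition qorb :: "'a::comm_ring_1 \<Rightarrow> 'a \<Rightarrow> nat \<Rightarrow> 'a" where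
  "qorb c z n = ((\<lambda>x. x\<^sup>2 + c) ^^ n) z"

lemma qorb_0 [simp]: "qorb c z 0 = z"
  and qorb_Suc: "qorb c z (Suc n) = (qorb c z n)\<^sup>2 + c"
  by (simp_all add: qorb_def)

lemma qorb_add: "qorb c z (m + n) = qorb c (qorb c z m) n"
  by (induction n) (simp_all add: qorb_Suc)

lemma (in comm_ring_hom) hom_qorb: "hom (qorb c z n) = qorb (hom c) (hom z) n"
  by (induction n) (simp_all add: qorb_Suc hom_distribs)

text \<open>The outer variable is z, the inner one is the parameter c.\<close>

definition qper :: "nat \<Rightarrow> 'a::comm_ring_1 poly poly" where
  "qper n = qorb [:[:0, 1:]:] [:0, 1:] n - [:0, 1:]"

lemma qorb_diff_dvd_Suc: "qorb c z i - qorb c z j dvd qorb c z (Suc i) - qorb c z (Suc j)"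
proof
  show "qorb c z (Suc i) - qorb c z (Suc j) = (qorb c z i - qorb c z j) * (qorb c z i + qorb c z j)"
    by (simp add: qorb_Suc algebra_simps power2_eq_square)
qed

lemma qorb_poly_monic:
  fixes c :: "'a::idom"
  shows "degree (qorb [:c:] [:0, 1:] n) = 2 ^ n \<and> lead_coeff (qorb [:c:] [:0, 1:] n) = 1"
proof (induction n)
  case (Suc n)
  let ?q = "qorb [:c:] [:0, 1:] n"
  have nz: "?q \<noteq> 0" using Suc by (metis leading_coeff_0_iff zero_neq_one)
  have d: "degree (?q\<^sup>2) = 2 ^ Suc n" using Suc nz by (simp add: degree_power_eq)
  have lt: "degree [:c:] < degree (?q\<^sup>2)" unfolding d by simp
  have "degree (?q\<^sup>2 + [:c:]) = 2 ^ Suc n" using degree_add_eq_left[OF lt] d by simp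
  moreover have "lead_coeff (?q\<^sup>2 + [:c:]) = 1"
  proof -
    have "coeff (?q\<^sup>2 + [:c:]) (2 ^ Suc n) = coeff (?q\<^sup>2) (2 ^ Suc n) + coeff [:c:] (2 ^ Suc n)" by simp
    also have "coeff [:c:] (2 ^ Suc n) = 0" by (intro coeff_eq_0) simp
    also have "coeff (?q\<^sup>2) (2 ^ Suc n) = lead_coeff (?q\<^sup>2)" using d by (simp only:)
    also have "\<dots> = 1" unfolding lead_coeff_power by (simp only: Suc[THEN conjunct2] power_one)
    finally show ?thesis using \<open>degree (?q\<^sup>2 + [:c:]) = 2 ^ Suc n\<close> by (simp only: add_0_right)
  qed
  ultimately show ?case by (simp add: qorb_Suc)
qed simp

lemma qper_monic_gen:
  fixes c :: "'a::idom"
  assumes "n > 0"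
  shows "degree (qorb [:c:] [:0, 1:] n - [:0, 1:]) = 2 ^ n" "lead_coeff (qorb [:c:] [:0, 1:] n - [:0, 1:]) = 1"
proof -
  let ?q = "qorb [:c:] [:0, 1:] n"
  have q: "degree ?q = 2 ^ n" "lead_coeff ?q = 1" using qorb_poly_monic by blast+
  have "(2::nat) ^ 1 \<le> 2 ^ n" using assms by (intro power_increasing) auto
  then have lt: "degree (- [:0, 1::'a:]) < degree ?q" using q by simp
  have "degree (?q + - [:0, 1:]) = degree ?q" by (rule degree_add_eq_left[OF lt])
  then show d: "degree (?q - [:0, 1:]) = 2 ^ n" using q(1) by (simp only: add_uminus_conv_diff)
  have "coeff [:0, 1::'a:] (2 ^ n) = 0" using lt q(1) by (intro coeff_eq_0) simp
  then show "lead_coeff (?q - [:0, 1:]) = 1" using q d by (simp only: coeff_diff) simp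
qed

lemma qper_monic:
  assumes "n > 0"
  shows "degree (qper n :: 'a::idom poly poly) = 2 ^ n" "lead_coeff (qper n :: 'a poly poly) = 1" "qper n \<noteq> (0 :: 'a poly poly)"
proof -
  show "degree (qper n :: 'a::idom poly poly) = 2 ^ n" and l: "lead_coeff (qper n :: 'a poly poly) = 1"
    unfolding qper_def using qper_monic_gen[OF assms] by blast+
  show "qper n \<noteq> (0 :: 'a poly poly)" using l by (metis leading_coeff_0_iff zero_neq_one)
qed

text \<open>Specialises the inner variable and keeps the outer one.\<close>

abbreviation spec :: "'a::comm_ring_1 poly poly \<Rightarrow> 'a \<Rightarrow> 'a poly" where
  "spec P c \<equiv> map_poly (\<lambda>a. poly a c) P"

interpretation spec_hom: comm_ring_hom "\<lambda>P. spec P (c :: 'a::comm_ring_1)" for c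
proof -
  interpret map_poly_comm_ring_hom "\<lambda>a. poly a c" ..
  show "comm_ring_hom (\<lambda>P. spec P c)" by unfold_locales
qed

lemma spec_qper: "spec (qper n) c = qorb [:c:] [:0, 1:] n - [:0, 1:]"
  unfolding qper_def by (simp add: spec_hom.hom_qorb spec_hom.hom_minus map_poly_pCons)

lemma poly_qorb: "poly (qorb [:c:] [:0, 1:] n) z = qorb c z n"
  by (simp add: poly_hom.hom_qorb)

lemma poly_spec_qper: "poly (spec (qper n) c) z = qorb c z n - z"
  by (simp add: spec_qper poly_qorb)

lemma degree_spec_monic:
  assumes "lead_coeff (P :: 'a::comm_ring_1 poly poly) = 1"
  shows "degree (spec P c) = degree P" "lead_coeff (spec P c) = 1"
proof -
  have 1: "coeff (spec P c) (degree P) = 1" using assms by (simp add: coeff_map_poly)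
  then have "degree (spec P c) \<ge> degree P" by (intro le_degree) simp
  moreover have "degree (spec P c) \<le> degree P" by (rule degree_map_poly_le)
  ultimately show "degree (spec P c) = degree P" "lead_coeff (spec P c) = 1" using 1 by auto
qed

lemma qorb_zero_param: "qorb 0 z n = z ^ (2 ^ n)"
  by (induction n) (simp_all add: qorb_Suc power_mult[symmetric] mult.commute)

text \<open>z^n - z is separable: a common divisor with its derivative n z^(n-1) - 1 divides (n - 1)
  z, hence z, hence 1.\<close>

lemma square_dvd_binomial_is_unit:
  fixes q :: "'a::field_char_0 poly"
  assumes "n > 1" "q\<^sup>2 dvd [:0, 1:] ^ n - [:0, 1:]"
  shows "is_unit q"
proof -
  let ?X = "[:0, 1:] :: 'a poly"
  obtain r where r: "?X ^ n - ?X = q\<^sup>2 * r" using assms(2) by blast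
  have "pderiv (?X ^ n - ?X) = of_nat n * ?X ^ (n - 1) - 1"
  proof -
    obtain m where m: "n = Suc m" using assms(1) by (cases n) auto
    have "pderiv (?X ^ Suc m) = smult (of_nat (Suc m)) (?X ^ m) * pderiv ?X" by (rule pderiv_power_Suc)
    also have "\<dots> = of_nat (Suc m) * ?X ^ m" by (simp add: pderiv_pCons of_nat_poly del: of_nat_Suc)
    finally show ?thesis unfolding m by (simp add: pderiv_diff pderiv_pCons one_pCons del: of_nat_Suc power_Suc)
  qed
  moreover have "pderiv (q\<^sup>2 * r) = q * (2 * pderiv q * r + q * pderiv r)"
    by (simp add: pderiv_mult power2_eq_square algebra_simps)
  ultimately have g: "q dvd of_nat n * ?X ^ (n - 1) - 1" using r by (metis dvd_triv_left)
  have f: "q dvd ?X ^ n - ?X" using r by (simp add: power2_eq_square mult.assoc)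
  have Xn: "?X ^ n = ?X * ?X ^ (n - 1)" using assms(1) by (cases n) auto
  have "?X * (of_nat n * ?X ^ (n - 1) - 1) - of_nat n * (?X ^ n - ?X) = of_nat (n - 1) * ?X"
    unfolding Xn using assms(1) by (simp add: algebra_simps of_nat_diff)
  then have "q dvd of_nat (n - 1) * ?X" using f g by (metis dvd_diff dvd_mult)
  then have X: "q dvd ?X"
  proof -
    have "of_nat (n - 1) * ?X = smult (of_nat (n - 1)) ?X" by (simp add: of_nat_poly)
    moreover have "(of_nat (n - 1) :: 'a) \<noteq> 0" using assms(1) by simp
    ultimately show ?thesis
      using \<open>q dvd of_nat (n - 1) * ?X\<close> dvd_smult_cancel[of q "of_nat (n - 1)" ?X] by simp
  qed
  have "q dvd of_nat n * ?X ^ (n - 1)"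
  proof -
    have "?X dvd ?X ^ (n - 1)" using assms(1) by (intro dvd_power) simp
    then show ?thesis using X dvd_trans dvd_mult by blast
  qed
  then have "q dvd of_nat n * ?X ^ (n - 1) - (of_nat n * ?X ^ (n - 1) - 1)" using g by (rule dvd_diff)
  then have "q dvd 1" by simp
  then show ?thesis by simp
qed

lemma monic_dvd_unit_const:
  fixes p q :: "'a::{idom_divide,algebraic_semidom} poly"
  assumes "p dvd q" "lead_coeff q = 1"
  shows "is_unit (lead_coeff p)"
proof -
  obtain r where "q = p * r" using assms(1) by blast
  then have "lead_coeff p * lead_coeff r = 1" using assms(2) by (simp add: lead_coeff_mult)
  then show ?thesis by (metis dvd_triv_left)
qed

lemma degree_spec_unit_lead:
  fixes p :: "'a::field poly poly"
  assumes "is_unit (lead_coeff p)"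
  shows "degree (spec p c) = degree p"
proof -
  obtain a where "lead_coeff p = [:a:]" "a dvd 1" using assms[unfolded is_unit_poly_iff] by (elim exE conjE)
  then have a: "lead_coeff p = [:a:]" "a \<noteq> 0" by auto
  have "coeff (spec p c) (degree p) \<noteq> 0" using a by (simp add: coeff_map_poly)
  then have "degree (spec p c) \<ge> degree p" by (rule le_degree)
  then show ?thesis using degree_map_poly_le[of "\<lambda>a. poly a c" p] by simp
qed

text \<open>The return times of the orbit of z modulo \<open>p\<close> are the multiples of some
  \<open>d\<close>. A square factor would survive the specialisation \<open>c = 0\<close>, where the
  period polynomial is separable; \<open>p\<close> keeps its degree there because its leading
  coefficient divides 1.\<close>

lemma qper_multiplicity:
  fixes p :: "'a::{field_char_0,field_gcd} poly poly"
  assumes "prime p"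
  obtains d where "\<And>k. k > 0 \<Longrightarrow> multiplicity p (qper k) = of_bool (d dvd k)"
proof -
  let ?o = "qorb [:[:0, 1:]:] [:0, 1:] :: nat \<Rightarrow> 'a poly poly"
  obtain d where d: "\<And>k. p dvd ?o 0 - ?o k \<longleftrightarrow> d dvd k"
  proof (rule period_set_multiples[of "\<lambda>i j. p dvd ?o i - ?o j"])
    show "p dvd ?o j - ?o i" if "p dvd ?o i - ?o j" for i j
    proof -
      have "?o j - ?o i = - (?o i - ?o j)" by simp
      then show ?thesis using that by (simp only: dvd_minus_iff)
    qed
    show "p dvd ?o i - ?o k" if "p dvd ?o i - ?o j" "p dvd ?o j - ?o k" for i j k
      using dvd_add[OF that] by simp
    show "p dvd ?o (Suc i) - ?o (Suc j)" if "p dvd ?o i - ?o j" for i j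
      using that qorb_diff_dvd_Suc dvd_trans by blast
  qed auto
  have dv: "p dvd qper k \<longleftrightarrow> d dvd k" for k
  proof -
    have "qper k = - (?o 0 - ?o k)" by (simp add: qper_def)
    then show ?thesis using d[of k] by (simp only: dvd_minus_iff)
  qed
  have "multiplicity p (qper k) = of_bool (d dvd k)" if k: "k > 0" for k
  proof (cases "d dvd k")
    case False
    then show ?thesis using dv by (simp add: not_dvd_imp_multiplicity_0)
  next
    case True
    have nz: "qper k \<noteq> (0 :: 'a poly poly)" using qper_monic[OF k] by blast
    have nu: "\<not> is_unit p" using assms by (meson not_prime_unit)
    have "\<not> p\<^sup>2 dvd qper k"
    proof
      assume sq: "p\<^sup>2 dvd qper k"
      have ul: "is_unit (lead_coeff p)"
        using monic_dvd_unit_const[of p "qper k"] qper_monic[OF k] dv True by blast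
      have "(spec p 0)\<^sup>2 dvd spec (qper k) 0"
      proof -
        obtain r where "qper k = p\<^sup>2 * r" using sq by blast
        then have "spec (qper k) 0 = (spec p 0)\<^sup>2 * spec r 0" by (simp add: spec_hom.hom_mult spec_hom.hom_power)
        then show ?thesis by simp
      qed
      moreover have "spec (qper k) 0 = ([:0, 1:] ^ (2 ^ k) - [:0, 1:] :: 'a poly)"
        by (simp add: spec_qper qorb_zero_param)
      moreover have "(2::nat) ^ k > 1" using one_less_power[of "2::nat" k] k by simp
      ultimately have "is_unit (spec p 0)" using square_dvd_binomial_is_unit by metis
      then have "degree (spec p 0) = 0" by (auto simp: is_unit_poly_iff)
      then have "degree p = 0" using degree_spec_unit_lead[OF ul] by simp
      then have "p = [:lead_coeff p:]" by (metis degree_0_id)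
      then have "is_unit p" using ul by (metis is_unit_const_poly_iff)
      then show False using nu by blast
    qed
    then have "multiplicity p (qper k) < 2" using nz nu by (metis multiplicity_dvd' not_less)
    moreover have "multiplicity p (qper k) > 0"
      using True dv nz nu by (metis multiplicity_gt_zero_iff)
    ultimately show ?thesis using True by simp
  qed
  then show ?thesis using that by blast
qed

lemma multiplicity_qper_quotient:
  fixes P :: "'a::{field_char_0,field_gcd} poly poly"
  assumes N: "N > 0" and P: "P * dyn_den qper N = dyn_num qper N" and p: "prime p"
    and d: "\<And>k. k > 0 \<Longrightarrow> multiplicity p (qper k) = of_bool (d dvd k)"
  shows "multiplicity p P = of_bool (d = N)"
proof -
  have nz: "qper k \<noteq> (0 :: 'a poly poly)" if "k dvd N" for k
    using that N qper_monic(3)[of k] by (metis dvd_0_left_iff gr0I)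
  have m: "multiplicity p (qper k) = of_bool (d dvd k)" if "k dvd N" for k
    using that N d[of k] by (metis dvd_0_left_iff gr0I)
  have P0: "P \<noteq> 0" using P dyn_nonzero(1)[OF N nz] by auto
  have "multiplicity p (dyn_num qper N) = multiplicity p (dyn_den qper N) + of_bool (d = N)"
    by (rule multiplicity_dyn[OF N p nz m])
  moreover have "multiplicity p (dyn_num qper N) = multiplicity p P + multiplicity p (dyn_den qper N)"
    unfolding P[symmetric] using p P0 dyn_nonzero(2)[OF N nz]
    by (intro prime_elem_multiplicity_mult_distrib) auto
  ultimately show ?thesis by simp
qed

lemma qper_quotient_exists:
  assumes N: "N > 0"
  obtains P :: "'a::{field_char_0,field_gcd} poly poly"
  where "P * dyn_den qper N = dyn_num qper N"
proof -
  have nz: "qper k \<noteq> (0 :: 'a poly poly)" if "k dvd N" for k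
    using that N qper_monic(3)[of k] by (metis dvd_0_left_iff gr0I)
  have "dyn_den qper N dvd (dyn_num qper N :: 'a poly poly)"
  proof (rule multiplicity_le_imp_dvd)
    show "dyn_den qper N \<noteq> (0 :: 'a poly poly)" by (rule dyn_nonzero(2)[OF N nz])
    fix p :: "'a poly poly" assume p: "prime p"
    obtain d where d: "\<And>k. k > 0 \<Longrightarrow> multiplicity p (qper k) = of_bool (d dvd k)"
      using qper_multiplicity[OF p] by blast
    have m: "multiplicity p (qper k) = of_bool (d dvd k)" if "k dvd N" for k
      using that N d[of k] by (metis dvd_0_left_iff gr0I)
    show "multiplicity p (dyn_den qper N) \<le> multiplicity p (dyn_num qper N)"
      using multiplicity_dyn[OF N p nz m] by simp
  qed
  then show ?thesis using that by (metis dvdE mult.commute)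
qed

context
  fixes P :: "'a::{field_char_0,field_gcd} poly poly" and N :: nat
  assumes N: "N > 0" and P: "P * dyn_den qper N = dyn_num qper N"
begin

lemma qper_quotient_nonzero: "P \<noteq> 0"
proof -
  have nz: "qper k \<noteq> (0 :: 'a poly poly)" if "k dvd N" for k
    using that N qper_monic(3)[of k] by (metis dvd_0_left_iff gr0I)
  show ?thesis using P dyn_nonzero(1)[OF N nz] by auto
qed

text \<open>A prime factor of \<open>P\<close> has return time \<open>N\<close> and so cannot divide
  \<open>qper d\<close>; hence the multiplicities on the left never add up to more than 1.\<close>

lemma qper_mult_quotient_dvd:
  assumes "d dvd N" "d < N"
  shows "qper d * P dvd qper N"
proof (rule multiplicity_le_imp_dvd)
  have d0: "d > 0" using assms N by (metis dvd_0_left_iff gr0I)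
  show "qper d * P \<noteq> 0" using qper_quotient_nonzero qper_monic(3)[OF d0] by simp
  fix p :: "'a poly poly" assume p: "prime p"
  obtain e where e: "\<And>k. k > 0 \<Longrightarrow> multiplicity p (qper k) = of_bool (e dvd k)"
    using qper_multiplicity[OF p] by blast
  have "multiplicity p (qper d * P) = of_bool (e dvd d) + of_bool (e = N)"
    using p qper_quotient_nonzero qper_monic(3)[OF d0, where 'a='a] e[OF d0] multiplicity_qper_quotient[OF N P p e]
    by (subst prime_elem_multiplicity_mult_distrib) auto
  also have "\<dots> \<le> of_bool (e dvd N)"
  proof -
    have "\<not> (e dvd d \<and> e = N)" using assms d0 by (auto dest: dvd_imp_le)
    moreover have "e dvd d \<Longrightarrow> e dvd N" using assms(1) by (rule dvd_trans[rotated])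
    ultimately show ?thesis by (auto simp: of_bool_def)
  qed
  finally show "multiplicity p (qper d * P) \<le> multiplicity p (qper N)" using e[OF N] by simp
qed

lemma qper_quotient_dvd: "P dvd qper N"
proof (rule multiplicity_le_imp_dvd[OF qper_quotient_nonzero])
  fix p :: "'a poly poly" assume p: "prime p"
  obtain e where e: "\<And>k. k > 0 \<Longrightarrow> multiplicity p (qper k) = of_bool (e dvd k)"
    using qper_multiplicity[OF p] by blast
  show "multiplicity p P \<le> multiplicity p (qper N)"
    using multiplicity_qper_quotient[OF N P p e] e[OF N] by (simp add: of_bool_def)
qed

text \<open>A prime factor of the cofactor has a return time that divides \<open>N\<close> properly,
  hence divides \<open>N div q\<close> for some prime \<open>q\<close>. These divisibilities supply
  the auxiliary norms of the energy argument.\<close>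

lemma qper_cofactor:
  assumes Q0: "qper N = P * Q0"
  shows "q \<in> prime_factors N \<Longrightarrow> qper (N div q) dvd Q0"
    and "Q0 dvd (\<Prod>q\<in>prime_factors N. qper (N div q))"
proof -
  have nz: "Q0 \<noteq> 0" using Q0 qper_monic(3)[OF N, where 'a='a] by auto
  have pos: "N div q > 0" "N div q dvd N" "N div q < N" if "q \<in> prime_factors N" for q
  proof -
    have q: "prime q" "q dvd N" using that by auto
    then show "N div q > 0" using N by (simp add: div_greater_zero_iff dvd_imp_le prime_gt_0_nat)
    show "N div q dvd N" using q by (metis dvd_def dvd_mult_div_cancel mult.commute)
    show "N div q < N" using q N by (intro div_less_dividend prime_gt_1_nat)
  qed
  show "qper (N div q) dvd Q0" if q: "q \<in> prime_factors N" for q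
  proof -
    have "qper (N div q) * P dvd Q0 * P"
      using qper_mult_quotient_dvd[OF pos(2,3)[OF q]] Q0 by (simp add: mult.commute)
    then show ?thesis using qper_quotient_nonzero by simp
  qed
  show "Q0 dvd (\<Prod>q\<in>prime_factors N. qper (N div q))"
  proof (rule multiplicity_le_imp_dvd[OF nz])
    fix p :: "'a poly poly" assume p: "prime p"
    obtain e where e: "\<And>k. k > 0 \<Longrightarrow> multiplicity p (qper k) = of_bool (e dvd k)"
      using qper_multiplicity[OF p] by blast
    have "multiplicity p (qper N :: 'a poly poly) = multiplicity p P + multiplicity p Q0"
      unfolding Q0 using p nz qper_quotient_nonzero by (intro prime_elem_multiplicity_mult_distrib) auto
    then have m: "of_bool (e dvd N) = of_bool (e = N) + multiplicity p Q0"
      using e[OF N] multiplicity_qper_quotient[OF N P p e] by simp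
    have prodm: "multiplicity p (\<Prod>q\<in>prime_factors N. qper (N div q)) = (\<Sum>q\<in>prime_factors N. of_bool (e dvd N div q))"
    proof -
      have "multiplicity p (\<Prod>q\<in>prime_factors N. qper (N div q)) = (\<Sum>q\<in>prime_factors N. multiplicity p (qper (N div q)))"
        using p pos(1) qper_monic(3)[where 'a='a] by (intro prime_elem_multiplicity_prod_distrib) force+
      also have "\<dots> = (\<Sum>q\<in>prime_factors N. of_bool (e dvd N div q))"
        using e pos(1) by (intro sum.cong) auto
      finally show ?thesis .
    qed
    show "multiplicity p Q0 \<le> multiplicity p (\<Prod>q\<in>prime_factors N. qper (N div q))"
    proof (cases "e dvd N \<and> e \<noteq> N")
      case False
      then have "multiplicity p Q0 = 0" using m by (auto simp: of_bool_def split: if_splits)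
      then show ?thesis by simp
    next
      case True
      then obtain n where n: "N = e * n" by blast
      have "n \<noteq> 1" using True n by auto
      then obtain q where q: "prime q" "q dvd n" using prime_factor_nat by blast
      then obtain l where l: "n = q * l" by blast
      have qN: "q \<in> prime_factors N" using q n N by (simp add: prime_factors_dvd)
      have "N div q = e * l" using n l q by (simp add: prime_gt_0_nat)
      then have "e dvd N div q" by simp
      then have "(1::nat) \<le> (\<Sum>q\<in>prime_factors N. of_bool (e dvd N div q))"
        using member_le_sum[of q "prime_factors N" "\<lambda>q. of_bool (e dvd N div q) :: nat"] qN by simp
      moreover have "multiplicity p Q0 = 1" using m True by simp
      ultimately show ?thesis unfolding prodm by simp
    qed
  qed
qed

end

section \<open>Norms\<close>

lemma monic_division:
  fixes f g :: "'a::comm_ring_1 poly"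
  assumes "lead_coeff f = 1"
  obtains q r where "g = f * q + r" "r = 0 \<or> degree r < degree f"
proof -
  obtain q r where qr: "pseudo_divmod g f = (q, r)" by fastforce
  have "f \<noteq> 0" using assms by auto
  from pseudo_divmod[OF this qr] have "g = f * q + r" "r = 0 \<or> degree r < degree f"
    using assms by auto
  then show ?thesis using that by blast
qed

lemma coprime_if_no_common_root:
  fixes f g :: "complex poly"
  assumes "f \<noteq> 0" "\<And>z. poly f z = 0 \<Longrightarrow> poly g z \<noteq> 0"
  shows "coprime f g"
proof (rule ccontr)
  assume "\<not> coprime f g"
  then have nu: "\<not> is_unit (gcd f g)" by (simp only: is_unit_gcd not_False_eq_True)
  have nz: "gcd f g \<noteq> 0" using assms(1) by simp
  have "degree (gcd f g) \<noteq> 0"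
    using nu nz is_unit_iff_degree by metis
  then obtain z where "poly (gcd f g) z = 0"
    using fundamental_theorem_of_algebra[of "gcd f g"] constant_degree[of "gcd f g"] by metis
  then have "poly f z = 0" "poly g z = 0"
    by (metis gcd_dvd1 gcd_dvd2 poly_eq_0_iff_dvd dvd_trans)+
  then show False using assms(2) by blast
qed

text \<open>The norm of \<open>g\<close> is the determinant of multiplication by \<open>g\<close> on \<open>\<complex>[c][z] / (f)\<close>.\<close>

lemma norm_polynomial:
  fixes f g :: "complex poly poly"
  assumes f: "lead_coeff f = 1"
  obtains R :: "complex poly" where
    "\<And>c. card {z. poly (spec f c) z = 0} = degree f \<Longrightarrow>
       poly R c = (\<Prod>z | poly (spec f c) z = 0. poly (spec g c) z)"
    "\<And>c. poly R c = 0 \<Longrightarrow> \<exists>z. poly (spec f c) z = 0 \<and> poly (spec g c) z = 0"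
proof -
  define m where "m = degree f"
  have "\<exists>q r. [:0, 1:] ^ i * g = f * q + r \<and> (r = 0 \<or> degree r < m)" for i
    using monic_division[OF f, of "[:0, 1:] ^ i * g"] unfolding m_def by metis
  then obtain q r where qr: "\<And>i. [:0, 1:] ^ i * g = f * q i + r i" "\<And>i. r i = 0 \<or> degree (r i) < m"
    by metis
  \<comment> \<open>Row \<open>i\<close> holds the coordinates of z^i g modulo \<open>f\<close>; as
    \<open>f\<close> is monic, the division takes place over the polynomials in c.\<close>
  define M :: "complex poly mat" where "M = Matrix.mat m m (\<lambda>(i, j). coeff (r i) j)"
  have M: "M \<in> carrier_mat m m" by (simp add: M_def)
  define Mc where "Mc c = map_mat (\<lambda>a. poly a c) M" for c :: complex
  have Mc: "Mc c \<in> carrier_mat m m" for c by (simp add: Mc_def M)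
  have detMc: "Determinant.det (Mc c) = poly (Determinant.det M) c" for c
    unfolding Mc_def by (rule comm_ring_hom.hom_det[OF poly_hom.comm_ring_hom_axioms])
  have qrc: "[:0, 1:] ^ i * spec g c = spec f c * spec (q i) c + spec (r i) c" for i c
  proof -
    have "spec ([:0, 1:] ^ i * g) c = spec (f * q i + r i) c" by (simp only: qr(1))
    then show ?thesis by (simp add: spec_hom.hom_mult spec_hom.hom_add spec_hom.hom_power map_poly_pCons)
  qed
  have rc: "poly (spec (r i) c) x = (\<Sum>j<m. coeff (spec (r i) c) j * x ^ j)" for i c x
  proof (cases "m = 0")
    case True
    then have "r i = 0" using qr(2)[of i] by simp
    then show ?thesis using True by simp
  next
    case False
    have "degree (spec (r i) c) \<le> m - 1"
      using qr(2)[of i] degree_map_poly_le[of "\<lambda>a. poly a c" "r i"] False by auto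
    then have "{..degree (spec (r i) c)} \<subseteq> {..<m}" using False by auto
    then show ?thesis unfolding poly_altdef
      by (intro sum.mono_neutral_left) (auto simp: coeff_eq_0)
  qed
  have entry: "Mc c $$ (i, j) = coeff (spec (r i) c) j" if "i < m" "j < m" for c i j
    using that by (simp add: Mc_def M_def coeff_map_poly)
  have deg: "degree (spec f c) = m" "spec f c \<noteq> 0" for c
  proof -
    show "degree (spec f c) = m" using degree_spec_monic(1)[OF f] unfolding m_def .
    show "spec f c \<noteq> 0" using degree_spec_monic(2)[OF f, of c] by (metis leading_coeff_0_iff zero_neq_one)
  qed
  show ?thesis
  proof (rule that[of "Determinant.det M"])
    fix c assume card: "card {z. poly (spec f c) z = 0} = degree f"
    let ?Z = "{z. poly (spec f c) z = 0}"
    have finZ: "finite ?Z" by (rule poly_roots_finite[OF deg(2)])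
    obtain a where a: "bij_betw a {..<m} ?Z"
      using finZ card unfolding m_def by (metis bij_betw_from_nat_into_finite)
    have root: "poly (spec f c) (a k) = 0" if "k < m" for k using a that by (auto simp: bij_betw_def)
    \<comment> \<open>The Vandermonde matrix of the roots diagonalises multiplication by
      \<open>g\<close>, with the values of \<open>g\<close> at the roots as eigenvalues.\<close>
    define V :: "complex mat" where "V = Matrix.mat m m (\<lambda>(j, k). a k ^ j)"
    have V: "V \<in> carrier_mat m m" by (simp add: V_def)
    define G :: "complex mat" where "G = Matrix.mat m m (\<lambda>(i, j). if i = j then poly (spec g c) (a j) else 0)"
    have G: "G \<in> carrier_mat m m" by (simp add: G_def)
    have "Mc c * V = V * G"
    proof (rule eq_matI)
      fix i k assume "i < dim_row (V * G)" "k < dim_col (V * G)"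
      then have ik: "i < m" "k < m" using V G by auto
      have "(Mc c * V) $$ (i, k) = (\<Sum>j<m. Mc c $$ (i, j) * V $$ (j, k))"
        using ik Mc[of c] V by (simp add: scalar_prod_def lessThan_atLeast0)
      also have "\<dots> = poly (spec (r i) c) (a k)"
        unfolding rc using ik by (intro sum.cong) (auto simp: entry V_def)
      also have "\<dots> = a k ^ i * poly (spec g c) (a k)"
        using arg_cong[OF qrc[of i c], of "\<lambda>p. poly p (a k)"] root[OF ik(2)] by simp
      also have "\<dots> = (\<Sum>j<m. V $$ (i, j) * G $$ (j, k))"
      proof -
        have "(\<Sum>j<m. V $$ (i, j) * G $$ (j, k)) = (\<Sum>j<m. if j = k then a k ^ i * poly (spec g c) (a k) else 0)"
          using ik by (intro sum.cong) (auto simp: V_def G_def)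
        then show ?thesis using ik by simp
      qed
      also have "\<dots> = (V * G) $$ (i, k)"
        using ik G V by (simp add: scalar_prod_def lessThan_atLeast0)
      finally show "(Mc c * V) $$ (i, k) = (V * G) $$ (i, k)" .
    qed (use Mc[of c] V G in auto)
    then have "Determinant.det (Mc c * V) = Determinant.det (V * G)" by (simp only:)
    then have "Determinant.det (Mc c) * Determinant.det V = Determinant.det V * Determinant.det G"
      by (simp only: Determinant.det_mult[OF Mc V] Determinant.det_mult[OF V G])
    \<comment> \<open>A kernel vector of the transpose would be a non-zero polynomial of degree less
      than \<open>m\<close> with \<open>m\<close> roots.\<close>
    moreover have "Determinant.det V \<noteq> 0"
    proof
      assume "Determinant.det V = 0"
      then have "Determinant.det (transpose_mat V) = 0" using Determinant.det_transpose[OF V] by simp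
      then obtain u where u: "u \<in> carrier_vec m" "u \<noteq> 0\<^sub>v m" "transpose_mat V *\<^sub>v u = 0\<^sub>v m"
        using det_0_iff_vec_prod_zero_field[of "transpose_mat V" m] V by auto
      define h where "h = (\<Sum>j<m. monom (vec_index u j) j)"
      have hc: "coeff h j = (if j < m then vec_index u j else 0)" for j
        by (simp add: h_def coeff_sum)
      have "poly h (a k) = 0" if k: "k < m" for k
      proof -
        have "poly h (a k) = (\<Sum>j<m. V $$ (j, k) * vec_index u j)"
          unfolding h_def poly_sum using k by (intro sum.cong) (auto simp: poly_monom V_def)
        also have "\<dots> = vec_index (transpose_mat V *\<^sub>v u) k"
          using k V u(1) by (simp add: scalar_prod_def lessThan_atLeast0)
        finally show ?thesis using u(3) k by simp
      qed
      moreover have "?Z = a ` {..<m}" using a by (simp add: bij_betw_def)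
      ultimately have sub: "?Z \<subseteq> {x. poly h x = 0}" by (simp only:) auto
      have "h \<noteq> 0"
      proof
        assume "h = 0"
        then have "vec_index u j = 0" if "j < m" for j using hc[of j] that by simp
        then have "u = 0\<^sub>v m" using u(1) by (intro eq_vecI) auto
        then show False using u(2) by simp
      qed
      have "card ?Z \<le> degree h"
        using card_mono[OF poly_roots_finite[OF \<open>h \<noteq> 0\<close>] sub] card_poly_roots_bound[OF \<open>h \<noteq> 0\<close>] by (rule order_trans)
      moreover have "degree h < m" if "m > 0"
      proof -
        have "degree h \<le> m - 1" using hc by (intro degree_le) auto
        then show ?thesis using that by simp
      qed
      moreover have "m > 0" using u(1,2) by (cases "m = 0") auto
      ultimately show False using card unfolding m_def by simp
    qed
    ultimately have "Determinant.det (Mc c) = Determinant.det G"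
      by (metis mult.commute mult_cancel_left)
    also have "\<dots> = (\<Prod>k<m. poly (spec g c) (a k))"
    proof -
      have "upper_triangular G" by (auto simp: G_def)
      then have "Determinant.det G = prod_list (diag_mat G)" using G by (rule det_upper_triangular)
      also have "\<dots> = (\<Prod>k<m. poly (spec g c) (a k))"
        by (simp add: prod_list_diag_prod G_def lessThan_atLeast0)
      finally show ?thesis .
    qed
    also have "\<dots> = (\<Prod>z\<in>?Z. poly (spec g c) z)" by (rule prod.reindex_bij_betw[OF a])
    finally show "poly (Determinant.det M) c = (\<Prod>z\<in>?Z. poly (spec g c) z)" unfolding detMc .
  next
    \<comment> \<open>A kernel vector is a non-zero polynomial \<open>h\<close> of degree less than
      \<open>m\<close> such that \<open>f\<close> divides the product of \<open>h\<close> and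
      \<open>g\<close>. Without a common zero, \<open>f\<close> would divide \<open>h\<close>
      itself.\<close>
    fix c assume "poly (Determinant.det M) c = 0"
    then have "Determinant.det (transpose_mat (Mc c)) = 0" using Determinant.det_transpose[OF Mc] detMc by simp
    then obtain u where u: "u \<in> carrier_vec m" "u \<noteq> 0\<^sub>v m" "transpose_mat (Mc c) *\<^sub>v u = 0\<^sub>v m"
      using det_0_iff_vec_prod_zero_field[of "transpose_mat (Mc c)" m] Mc by auto
    define h where "h = (\<Sum>i<m. monom (vec_index u i) i)"
    have hc: "coeff h j = (if j < m then vec_index u j else 0)" for j
      by (simp add: h_def coeff_sum)
    have m0: "m > 0" using u(1,2) by (cases "m = 0") auto
    have "h \<noteq> 0"
    proof
      assume "h = 0"
      then have "vec_index u j = 0" if "j < m" for j using hc[of j] that by simp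
      then have "u = 0\<^sub>v m" using u(1) by (intro eq_vecI) auto
      then show False using u(2) by simp
    qed
    have "degree h \<le> m - 1" using hc by (intro degree_le) auto
    then have hdeg: "degree h < m" using m0 by simp
    have "(\<Sum>i<m. smult (vec_index u i) (spec (r i) c)) = 0"
    proof (rule poly_eqI)
      fix j
      show "coeff (\<Sum>i<m. smult (vec_index u i) (spec (r i) c)) j = coeff 0 j"
      proof (cases "j < m")
        case True
        have "coeff (\<Sum>i<m. smult (vec_index u i) (spec (r i) c)) j = (\<Sum>i<m. Mc c $$ (i, j) * vec_index u i)"
          using True by (simp add: coeff_sum entry mult.commute)
        also have "\<dots> = vec_index (transpose_mat (Mc c) *\<^sub>v u) j"
          using True Mc[of c] u(1) by (simp add: scalar_prod_def lessThan_atLeast0)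
        finally show ?thesis using u(3) True by simp
      next
        case False
        have "coeff (spec (r i) c) j = 0" for i
          using qr(2)[of i] False by (auto simp: coeff_map_poly coeff_eq_0)
        then show ?thesis by (simp add: coeff_sum)
      qed
    qed
    moreover have "h * spec g c = spec f c * (\<Sum>i<m. smult (vec_index u i) (spec (q i) c)) + (\<Sum>i<m. smult (vec_index u i) (spec (r i) c))"
    proof -
      have "h * spec g c = (\<Sum>i<m. smult (vec_index u i) ([:0, 1:] ^ i * spec g c))"
        by (simp add: h_def sum_distrib_right monom_altdef)
      also have "\<dots> = (\<Sum>i<m. spec f c * smult (vec_index u i) (spec (q i) c) + smult (vec_index u i) (spec (r i) c))"
        by (simp only: qrc smult_add_right mult_smult_right)
      finally show ?thesis by (simp add: sum.distrib sum_distrib_left)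
    qed
    ultimately have dvd: "spec f c dvd h * spec g c" by simp
    show "\<exists>z. poly (spec f c) z = 0 \<and> poly (spec g c) z = 0"
    proof (rule ccontr)
      assume "\<nexists>z. poly (spec f c) z = 0 \<and> poly (spec g c) z = 0"
      then have "coprime (spec f c) (spec g c)" using deg(2) by (intro coprime_if_no_common_root) auto
      then have "spec f c dvd h" using dvd by (simp add: coprime_dvd_mult_left_iff)
      then have "degree (spec f c) \<le> degree h" using \<open>h \<noteq> 0\<close> by (rule dvd_imp_degree_le)
      then show False using hdeg deg by simp
    qed
  qed
qed

section \<open>Periodic points for large negative parameters\<close>

text \<open>For \<open>c = - s\<^sup>2\<close> the periodic points cluster near \<open>s\<close> and
  \<open>- s\<close>; the sign of the real part tells the two groups apart.\<close>

definition itin :: "complex \<Rightarrow> complex \<Rightarrow> nat \<Rightarrow> bool" where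
  "itin c z i \<longleftrightarrow> Re (qorb c z i) > 0"

lemma qorb_Suc_left: "qorb c z (Suc n) = qorb c (z\<^sup>2 + c) n"
  using qorb_add[of c z 1 n] by (simp add: qorb_Suc)

lemma itin_Suc: "itin c z (Suc i) = itin c (z\<^sup>2 + c) i"
  by (simp add: itin_def qorb_Suc_left)

lemma qorb_periodic_mult:
  assumes "qorb c z n = z"
  shows "qorb c z (k * n) = z"
  by (induction k) (use assms in \<open>auto simp: qorb_add\<close>)

lemma qorb_periodic_dvd: "qorb c z d = z \<Longrightarrow> d dvd n \<Longrightarrow> qorb c z n = z"
  using qorb_periodic_mult by (metis dvd_def mult.commute)

lemma qorb_periodic_add: "qorb c z n = z \<Longrightarrow> qorb c z (i + n) = qorb c z i"
  using qorb_add[of c z n i] by (simp add: add.commute)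

lemma qorb_periodic_shift: "qorb c z n = z \<Longrightarrow> qorb c (qorb c z i) n = qorb c z i"
  using qorb_periodic_add[of c z n i] qorb_add[of c z i n] by simp

lemma itin_Per: "qorb c z n = z \<Longrightarrow> itin c z \<in> Per n"
  by (simp add: Per_def itin_def qorb_periodic_add)

lemma pderiv_qorb: "pderiv (qorb [:c:] [:0, 1:] n) = (\<Prod>i<n. 2 * qorb [:c:] [:0, 1:] i)"
  for c :: "'a::idom"
  by (induction n) (simp_all add: qorb_Suc pderiv_add pderiv_pCons pderiv_power one_pCons pderiv_mult power2_eq_square algebra_simps)

context
  fixes s :: real and c :: complex
  assumes s4: "s \<ge> 4" and c: "c = - (complex_of_real s)\<^sup>2"
begin

text \<open>The largest modulus m on the cycle satisfies
  \<open>m\<^sup>2 \<le> m + s\<^sup>2\<close>, which fails beyond \<open>s + 1\<close>.\<close>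

lemma periodic_bounded:
  assumes "qorb c z n = z" "n > 0"
  shows "cmod (qorb c z i) \<le> s + 1"
proof -
  define m where "m = Max ((\<lambda>i. cmod (qorb c z i)) ` {..<n})"
  have le: "cmod (qorb c z i) \<le> m" for i
  proof -
    have "qorb c z i = qorb c z (i mod n)"
      using qorb_add[of c z "i div n * n" "i mod n"] qorb_periodic_mult[OF assms(1), of "i div n"] by simp
    moreover have "cmod (qorb c z (i mod n)) \<le> m"
      unfolding m_def using assms(2) by (intro Max_ge) auto
    ultimately show ?thesis by simp
  qed
  have "m \<in> (\<lambda>i. cmod (qorb c z i)) ` {..<n}" unfolding m_def using assms(2) by (intro Max_in) auto
  then obtain i where i: "m = cmod (qorb c z i)" by blast
  have "(qorb c z i)\<^sup>2 = qorb c z (Suc i) + (complex_of_real s)\<^sup>2" by (simp add: qorb_Suc c)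
  then have "m\<^sup>2 = cmod (qorb c z (Suc i) + (complex_of_real s)\<^sup>2)" by (simp add: i flip: norm_power)
  also have "\<dots> \<le> m + s\<^sup>2"
    using norm_triangle_ineq[of "qorb c z (Suc i)" "(complex_of_real s)\<^sup>2"] le[of "Suc i"] by (simp add: norm_power)
  finally have m2: "m\<^sup>2 \<le> m + s\<^sup>2" .
  have "m \<le> s + 1"
  proof (rule ccontr)
    assume "\<not> m \<le> s + 1"
    then have gt: "m > s + 1" by simp
    have "s * s \<le> s * (s + 1)" using s4 by simp
    also have "\<dots> < (m - 1) * m" using gt s4 by (intro mult_strict_mono) auto
    finally show False using m2 by (simp add: power2_eq_square algebra_simps)
  qed
  then show ?thesis using le[of i] le by (meson order_trans)
qed

text \<open>The image (z - s)(z + s) of a periodic point has modulus at most \<open>s + 1\<close>,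
  and the factor belonging to the opposite sign is at least \<open>s\<close>. The quotient
  \<open>(s + 1) / s\<close> is at most \<open>5/4\<close> for \<open>s \<ge> 4\<close>.\<close>

lemma periodic_near:
  assumes "qorb c z n = z" "n > 0"
  shows "itin c z 0 \<Longrightarrow> cmod (z - s) \<le> 5/4" "\<not> itin c z 0 \<Longrightarrow> cmod (z + s) \<le> 5/4"
proof -
  have "cmod (z\<^sup>2 + c) \<le> s + 1" using periodic_bounded[OF assms, of 1] by (simp add: qorb_Suc)
  moreover have "z\<^sup>2 + c = (z - s) * (z + s)" by (simp add: c power2_eq_square algebra_simps)
  ultimately have p: "cmod (z - s) * cmod (z + s) \<le> s + 1" by (simp add: norm_mult)
  have b: "x \<le> 5/4" if "x * y \<le> s + 1" "y \<ge> s" "x \<ge> 0" for x y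
  proof (rule ccontr)
    assume "\<not> x \<le> 5/4"
    then have "5/4 * s < x * y" using that s4 by (intro mult_less_le_imp_less) auto
    then show False using that(1) s4 by simp
  qed
  show "cmod (z - s) \<le> 5/4" if "itin c z 0"
  proof -
    have "cmod (z + s) \<ge> s" using complex_Re_le_cmod[of "z + s"] that by (simp add: itin_def)
    then show ?thesis using b[OF p] by simp
  qed
  show "cmod (z + s) \<le> 5/4" if "\<not> itin c z 0"
  proof -
    have "cmod (z - s) \<ge> s" using complex_Re_le_cmod[of "s - z"] that by (simp add: itin_def norm_minus_commute)
    then show ?thesis using b[of "cmod (z + s)" "cmod (z - s)"] p by (simp add: mult.commute)
  qed
qed

text \<open>For equal signs the sum is within \<open>5/2\<close> of \<open>2 * s\<close> or
  \<open>- 2 * s\<close>; it is the factor by which the map expands the distance. For different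
  signs the same holds for the difference.\<close>

lemma periodic_sum_bounds:
  assumes "qorb c x n = x" "qorb c y n = y" "n > 0"
  shows "itin c x 0 = itin c y 0 \<Longrightarrow> s \<le> cmod (x + y) \<and> cmod (x + y) \<le> 3 * s"
    and "itin c x 0 \<noteq> itin c y 0 \<Longrightarrow> s \<le> cmod (x - y) \<and> cmod (x - y) \<le> 3 * s"
proof -
  have key: "s \<le> cmod w \<and> cmod w \<le> 3 * s"
    if "cmod (w - complex_of_real (e * (2 * s))) \<le> 5/2" "e = 1 \<or> e = - 1" for w e
  proof -
    have "cmod (complex_of_real (e * (2 * s))) = 2 * s" using that(2) s4 by (auto simp: norm_mult)
    then show ?thesis
      using that(1) s4 norm_triangle_ineq3[of w "complex_of_real (e * (2 * s))"] by linarith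
  qed
  note nx = periodic_near[OF assms(1,3)] and ny = periodic_near[OF assms(2,3)]
  show "s \<le> cmod (x + y) \<and> cmod (x + y) \<le> 3 * s" if "itin c x 0 = itin c y 0"
  proof (cases "itin c x 0")
    case True
    have "x + y - 1 * (2 * s) = (x - s) + (y - s)" by simp
    then have "cmod (x + y - 1 * (2 * s)) \<le> 5/2"
      using norm_triangle_ineq[of "x - s" "y - s"] nx(1) ny(1) True that by simp
    then show ?thesis by (rule key) simp
  next
    case False
    have e: "x + y - (-1) * (2 * s) = (x + s) + (y + s)" by simp
    have "\<not> itin c y 0" using False that by simp
    then have "cmod (x + y - (-1) * (2 * s)) \<le> 5/2"
      unfolding e using norm_triangle_ineq[of "x + s" "y + s"] nx(2)[OF False] ny(2) by linarith
    then show ?thesis by (rule key) simp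
  qed
  show "s \<le> cmod (x - y) \<and> cmod (x - y) \<le> 3 * s" if "itin c x 0 \<noteq> itin c y 0"
  proof (cases "itin c x 0")
    case True
    have "x - y - 1 * (2 * s) = (x - s) - (y + s)" by simp
    then have "cmod (x - y - 1 * (2 * s)) \<le> 5/2"
      using norm_triangle_ineq4[of "x - s" "y + s"] nx(1) ny(2) True that by simp
    then show ?thesis by (rule key) simp
  next
    case False
    have e: "x - y - (-1) * (2 * s) = (x + s) - (y - s)" by simp
    have "itin c y 0" using False that by simp
    then have "cmod (x - y - (-1) * (2 * s)) \<le> 5/2"
      unfolding e using norm_triangle_ineq4[of "x + s" "y - s"] nx(2)[OF False] ny(1) by linarith
    then show ?thesis by (rule key) simp
  qed
qed

lemma periodic_image: "qorb c x n = x \<Longrightarrow> qorb c (x\<^sup>2 + c) n = x\<^sup>2 + c"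
  using qorb_periodic_shift[of c x n 1] by (simp add: qorb_Suc)

lemma diff_image: "cmod ((x\<^sup>2 + c) - (y\<^sup>2 + c)) = cmod (x - y) * cmod (x + y)"
proof -
  have "(x\<^sup>2 + c) - (y\<^sup>2 + c) = (x - y) * (x + y)" by (simp add: power2_eq_square algebra_simps)
  then show ?thesis by (simp add: norm_mult)
qed

text \<open>Each step multiplies the distance by the modulus of \<open>x + y\<close>, which has
  order \<open>s\<close> while the signs agree; after \<open>t\<close> steps the distance itself has
  order \<open>s\<close>.\<close>

lemma periodic_distance:
  assumes "qorb c x n = x" "qorb c y n = y" "n > 0"
    and "agree t (itin c x) (itin c y)" "itin c x t \<noteq> itin c y t"
  shows "s / (3 * s) ^ t \<le> cmod (x - y)" "cmod (x - y) \<le> 3 * s / s ^ t"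
proof -
  have "s / (3 * s) ^ t \<le> cmod (x - y) \<and> cmod (x - y) \<le> 3 * s / s ^ t"
    using assms
  proof (induction t arbitrary: x y)
    case 0
    then show ?case using periodic_sum_bounds(2)[of x n y] by simp
  next
    case (Suc t)
    have ag: "agree t (itin c (x\<^sup>2 + c)) (itin c (y\<^sup>2 + c))"
      unfolding agree_def
    proof (intro allI impI)
      fix i assume "i < t"
      then show "itin c (x\<^sup>2 + c) i = itin c (y\<^sup>2 + c) i"
        using Suc.prems(4) unfolding agree_def itin_Suc[symmetric] by simp
    qed
    have IH: "s / (3 * s) ^ t \<le> cmod (x - y) * cmod (x + y)" "cmod (x - y) * cmod (x + y) \<le> 3 * s / s ^ t"
      using Suc.IH[OF periodic_image[OF Suc.prems(1)] periodic_image[OF Suc.prems(2)] Suc.prems(3) ag] Suc.prems(5)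
      unfolding itin_Suc diff_image by auto
    have "itin c x 0 = itin c y 0" using Suc.prems(4) by (simp add: agree_def)
    from periodic_sum_bounds(1)[OF Suc.prems(1,2,3) this]
    have sb: "s \<le> cmod (x + y)" "cmod (x + y) \<le> 3 * s" by auto
    have s0: "s > 0" using s4 by simp
    have "s / (3 * s) ^ t \<le> cmod (x - y) * (3 * s)"
      using IH(1) mult_left_mono[OF sb(2), of "cmod (x - y)"] by simp
    then have "s / (3 * s) ^ Suc t \<le> cmod (x - y)" using s0 by (simp add: field_simps)
    moreover have "cmod (x - y) * s \<le> 3 * s / s ^ t"
      using IH(2) mult_left_mono[OF sb(1), of "cmod (x - y)"] by simp
    then have "cmod (x - y) \<le> 3 * s / s ^ Suc t" using s0 by (simp add: field_simps)
    ultimately show ?case by blast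
  qed
  then show "s / (3 * s) ^ t \<le> cmod (x - y)" "cmod (x - y) \<le> 3 * s / s ^ t" by auto
qed

text \<open>With equal signs at all times every step expands the distance by at least
  \<open>s\<close>, yet after \<open>n\<close> steps both points have returned.\<close>

lemma itin_inj:
  assumes "qorb c x n = x" "qorb c y n = y" "n > 0" "itin c x = itin c y"
  shows "x = y"
proof -
  have "cmod (x - y) * s ^ k \<le> cmod (qorb c x k - qorb c y k)" for k
  proof (induction k)
    case (Suc k)
    let ?x = "qorb c x k" and ?y = "qorb c y k"
    have per: "qorb c ?x n = ?x" "qorb c ?y n = ?y" using qorb_periodic_shift assms by blast+
    have "itin c ?x 0 = itin c ?y 0" using fun_cong[OF assms(4), of k] by (simp add: itin_def)
    then have sb: "s \<le> cmod (?x + ?y)" using periodic_sum_bounds(1)[OF per assms(3)] by simp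
    have "cmod (x - y) * s ^ Suc k = (cmod (x - y) * s ^ k) * s" by simp
    also have "\<dots> \<le> cmod (?x - ?y) * cmod (?x + ?y)"
      using Suc sb s4 by (intro mult_mono) auto
    also have "\<dots> = cmod (qorb c x (Suc k) - qorb c y (Suc k))" by (simp only: qorb_Suc diff_image)
    finally show ?case .
  qed simp
  from this[of n] have "cmod (x - y) * s ^ n \<le> cmod (x - y)" using assms by simp
  moreover have "s ^ n > 1" using s4 assms(3) by (intro one_less_power) auto
  ultimately have "cmod (x - y) = 0"
    using mult_strict_left_mono[of 1 "s ^ n" "cmod (x - y)"] by (smt (verit) norm_ge_zero mult.right_neutral)
  then show ?thesis by simp
qed

definition "perpts n = {z. qorb c z n = z}"

lemma perpts_eq: "perpts n = {z. poly (spec (qper n) c) z = 0}"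
  by (simp add: perpts_def poly_spec_qper)

text \<open>At a multiple root the multiplier would be 1, but each of its factors exceeds 1 in
  modulus.\<close>

lemma card_perpts:
  assumes "n > 0"
  shows "card (perpts n) = 2 ^ n" "finite (perpts n)"
proof -
  let ?p = "spec (qper n) c"
  have deg: "degree ?p = 2 ^ n" "lead_coeff ?p = 1"
    using qper_monic_gen[OF assms, of c] unfolding spec_qper by auto
  have nz: "?p \<noteq> 0" using deg by auto
  show "finite (perpts n)" unfolding perpts_eq by (rule poly_roots_finite[OF nz])
  have "rsquarefree ?p"
    unfolding rsquarefree_roots
  proof (intro allI notI, elim conjE)
    fix z assume z: "poly ?p z = 0" "poly (pderiv ?p) z = 0"
    then have per: "qorb c z n = z" by (simp add: poly_spec_qper)
    have "pderiv ?p = (\<Prod>i<n. 2 * qorb [:c:] [:0, 1:] i) - 1"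
      unfolding spec_qper by (simp add: pderiv_diff pderiv_qorb pderiv_pCons one_pCons)
    then have "(\<Prod>i<n. 2 * qorb c z i) = 1" using z(2) by (simp add: poly_prod poly_qorb)
    then have "(\<Prod>i<n. cmod (2 * qorb c z i)) = 1" unfolding prod_norm by (simp only: norm_one)
    moreover have "(\<Prod>i<n. cmod (2 * qorb c z i)) > 1"
    proof -
      have big: "cmod (2 * qorb c z i) > 1" for i
      proof -
        let ?x = "qorb c z i"
        have px: "qorb c ?x n = ?x" using qorb_periodic_shift[OF per] .
        have "cmod (?x - s) \<le> 5/4 \<or> cmod (?x + s) \<le> 5/4" using periodic_near[OF px assms] by blast
        then have "cmod ?x \<ge> s - 5/4"
          using norm_triangle_ineq2[of "complex_of_real s" "s - ?x"] norm_triangle_ineq2[of "complex_of_real s" "s + ?x"] s4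
          by (auto simp: norm_minus_commute add.commute)
        then show ?thesis using s4 by (simp add: norm_mult)
      qed
      show ?thesis using big assms by (intro less_1_prod) auto
    qed
    ultimately show False by simp
  qed
  then have "smult (lead_coeff ?p) (\<Prod>z | poly ?p z = 0. [:- z, 1:]) = ?p"
    by (rule complex_poly_decompose_rsquarefree)
  then have "degree (\<Prod>z | poly ?p z = 0. [:- z, 1:]) = 2 ^ n" using deg by (metis smult_1_left)
  moreover have "degree (\<Prod>z | poly ?p z = 0. [:- z, 1:]) = card {z. poly ?p z = 0}"
    by (subst degree_prod_eq_sum_degree) auto
  ultimately show "card (perpts n) = 2 ^ n" unfolding perpts_eq by simp
qed

text \<open>Injectivity together with equal cardinalities \<open>2 ^ n\<close>; no point is
  constructed from its sequence.\<close>

lemma itin_bij: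
  assumes "n > 0"
  shows "bij_betw (itin c) (perpts n) (Per n)"
proof -
  have inj: "inj_on (itin c) (perpts n)"
    using itin_inj[OF _ _ assms] by (intro inj_onI) (auto simp: perpts_def)
  have sub: "itin c ` perpts n \<subseteq> Per n" by (auto simp: perpts_def itin_Per)
  have "card (itin c ` perpts n) = card (Per n)"
    using inj card_perpts[OF assms] card_Per[OF assms] by (simp add: card_image)
  then have "itin c ` perpts n = Per n" using sub finite_Per[OF assms] by (intro card_subset_eq) auto
  then show ?thesis using inj by (simp add: bij_betw_def)
qed

text \<open>The first difference occurs before place \<open>n\<close>, so \<open>3 ^ n\<close>
  absorbs the powers of 3 from \<open>periodic_distance\<close>.\<close>

lemma perpts_dist_bounds:
  assumes "n > 0" "x \<in> perpts n" "y \<in> perpts n" "x \<noteq> y"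
  shows "s powi wt (itin c x) (itin c y) / 3 ^ n \<le> cmod (x - y)"
    and "cmod (x - y) \<le> 3 * s powi wt (itin c x) (itin c y)"
proof -
  let ?t = "fdiff (itin c x) (itin c y)"
  have per: "qorb c x n = x" "qorb c y n = y" using assms by (auto simp: perpts_def)
  have ne: "itin c x \<noteq> itin c y" using itin_inj[OF per assms(1)] assms(4) by blast
  have ag: "agree ?t (itin c x) (itin c y)" using agree_iff_le_fdiff[OF ne] by simp
  have nag: "\<not> agree (Suc ?t) (itin c x) (itin c y)" using agree_iff_le_fdiff[OF ne] by simp
  then have df: "itin c x ?t \<noteq> itin c y ?t" using ag unfolding agree_def by (metis less_Suc_eq)
  note pd = periodic_distance[OF per assms(1) ag df]
  have tn: "?t < n" using fdiff_less[OF itin_Per[OF per(1)] itin_Per[OF per(2)] assms(1) ne] .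
  have s0: "s > 0" using s4 by simp
  have e: "s powi wt (itin c x) (itin c y) = s / s ^ ?t"
    using s0 by (simp add: power_int_diff)
  have "s / s ^ ?t / 3 ^ n \<le> s / (3 * s) ^ ?t"
  proof -
    have "(3::real) ^ ?t \<le> 3 ^ n" using tn by (intro power_increasing) auto
    then have "s / s ^ ?t / 3 ^ n \<le> s / s ^ ?t / 3 ^ ?t" using s0 by (intro divide_left_mono) auto
    then show ?thesis by (simp add: power_mult_distrib mult.commute)
  qed
  then show "s powi wt (itin c x) (itin c y) / 3 ^ n \<le> cmod (x - y)" unfolding e using pd(1) by linarith
  show "cmod (x - y) \<le> 3 * s powi wt (itin c x) (itin c y)" unfolding e using pd(2) by simp
qed

end

section \<open>Factors of a dynatomic polynomial have no common zero\<close>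

lemma poly_spec_altdef: "poly (spec P a) b = (\<Sum>i\<le>degree P. poly (coeff P i) a * b ^ i)"
proof -
  have "poly (spec P a) b = (\<Sum>i\<le>degree (spec P a). coeff (spec P a) i * b ^ i)" by (rule poly_altdef)
  also have "\<dots> = (\<Sum>i\<le>degree P. coeff (spec P a) i * b ^ i)"
    using degree_map_poly_le[of "\<lambda>q. poly q a" P]
    by (intro sum.mono_neutral_left) (auto intro: le_degree)
  finally show ?thesis by (simp add: coeff_map_poly)
qed

lemma spec_path_differentiable:
  fixes P :: "complex poly poly"
  shows "(\<lambda>t. poly (spec P (c + k * t)) (z + v * t)) field_differentiable (at t0)"
proof -
  have "(\<lambda>t. poly p (c + k * t)) field_differentiable (at t0)" for p
  proof -
    have "((\<lambda>t. poly p (c + k * t)) has_field_derivative poly (pderiv p) (c + k * t0) * k) (at t0)"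
      by (rule DERIV_chain2[OF poly_DERIV]) (auto intro!: derivative_eq_intros)
    then show ?thesis unfolding field_differentiable_def by blast
  qed
  then show ?thesis unfolding poly_spec_altdef
    by (intro field_differentiable_sum field_differentiable_mult field_differentiable_power
        field_differentiable_add field_differentiable_const field_differentiable_ident)
qed

text \<open>At a common zero of two factors the product vanishes to second order. Restricting it to
  a line with direction \<open>(k, v)\<close> replaces partial derivatives.\<close>

lemma spec_path_product_derivative:
  fixes P1 P2 P3 :: "complex poly poly"
  assumes "poly (spec P1 c) z = 0" "poly (spec P2 c) z = 0"
  shows "((\<lambda>t. poly (spec (P1 * P2 * P3) (c + k * t)) (z + v * t)) has_field_derivative 0) (at 0)"
proof -
  let ?f = "\<lambda>P t. poly (spec P (c + k * t)) (z + v * t)"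
  obtain D1 D2 D3 where D: "(?f P1 has_field_derivative D1) (at 0)" "(?f P2 has_field_derivative D2) (at 0)"
    "(?f P3 has_field_derivative D3) (at 0)"
    using spec_path_differentiable unfolding field_differentiable_def by meson
  have "((\<lambda>t. ?f P1 t * ?f P2 t * ?f P3 t) has_field_derivative
      (D1 * ?f P2 0 + D2 * ?f P1 0) * ?f P3 0 + D3 * (?f P1 0 * ?f P2 0)) (at 0)"
    by (intro DERIV_mult D)
  then show ?thesis using assms by (simp add: spec_hom.hom_mult)
qed

text \<open>\<open>a\<close> solves the variational equation of the orbit in the direction
  \<open>(k, v)\<close>.\<close>

lemma qorb_path_derivative:
  fixes c z k v :: complex
  assumes "a 0 = v" "\<And>n. a (Suc n) = 2 * qorb c z n * a n + k"
  shows "((\<lambda>t. qorb (c + k * t) (z + v * t) n) has_field_derivative a n) (at 0)"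
proof (induction n)
  case 0
  show ?case using assms(1) by (auto intro!: derivative_eq_intros)
next
  case (Suc n)
  have "((\<lambda>t. (qorb (c + k * t) (z + v * t) n)\<^sup>2 + (c + k * t)) has_field_derivative
      (of_nat 2 * (a n * (qorb (c + k * 0) (z + v * 0) n) ^ (2 - Suc 0)) + k)) (at 0)"
    by (intro DERIV_add DERIV_power Suc) (auto intro!: derivative_eq_intros)
  then show ?case unfolding qorb_Suc assms(2) by (simp add: algebra_simps)
qed

lemma prod_derivative:
  fixes g :: "nat \<Rightarrow> complex \<Rightarrow> complex"
  assumes "\<And>i. i < m \<Longrightarrow> (g i has_field_derivative g' i) (at 0)" "\<And>i. i < m \<Longrightarrow> g i 0 \<noteq> 0"
  shows "((\<lambda>t. \<Prod>i<m. g i t) has_field_derivative (\<Prod>i<m. g i 0) * (\<Sum>i<m. g' i / g i 0)) (at 0)"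
  using assms
proof (induction m)
  case (Suc m)
  have IH: "((\<lambda>t. \<Prod>i<m. g i t) has_field_derivative (\<Prod>i<m. g i 0) * (\<Sum>i<m. g' i / g i 0)) (at 0)"
    using Suc by simp
  have "((\<lambda>t. (\<Prod>i<m. g i t) * g m t) has_field_derivative
      (\<Prod>i<m. g i 0) * (\<Sum>i<m. g' i / g i 0) * g m 0 + g' m * (\<Prod>i<m. g i 0)) (at 0)"
    by (intro DERIV_mult IH Suc.prems(1)) simp
  moreover have "(\<Prod>i<m. g i 0) * (\<Sum>i<m. g' i / g i 0) * g m 0 + g' m * (\<Prod>i<m. g i 0) =
      (\<Prod>i<Suc m. g i 0) * (\<Sum>i<Suc m. g' i / g i 0)"
  proof -
    have alg: "p * t * y + y' * p = (p * y) * (t + y' / y)" if "y \<noteq> 0" for p t y y' :: complex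
    proof -
      have "y * (y' / y) = y'" using that by simp
      then show ?thesis by (metis distrib_left mult.assoc mult.commute)
    qed
    show ?thesis unfolding prod.lessThan_Suc sum.lessThan_Suc
      by (rule alg) (use Suc.prems(2)[of m] in simp)
  qed
  ultimately show ?case by simp
qed simp

lemma prod_lessThan_add: "(\<Prod>i<m + n. f i) = (\<Prod>i<m. f i) * (\<Prod>i<n. f (i + m :: nat) :: 'a::comm_monoid_mult)"
  by (induction n) (simp_all add: mult.assoc add.commute)

lemma sum_lessThan_add: "(\<Sum>i<m + n. f i) = (\<Sum>i<m. f i) + (\<Sum>i<n. f (i + m :: nat) :: 'a::comm_monoid_add)"
  by (induction n) (simp_all add: add.assoc add.commute[of m])

text \<open>The quotient of f^(d r)(z) - z by f^d(z) - z as an explicit polynomial. At a point of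
  period \<open>d\<close> it becomes the geometric sum of the powers of the multiplier.\<close>

definition qcofactor :: "'a::comm_ring_1 \<Rightarrow> 'a \<Rightarrow> nat \<Rightarrow> nat \<Rightarrow> 'a" where
  "qcofactor c z d r = (\<Sum>j<r. \<Prod>i<d * j. qorb c z (d + i) + qorb c z i)"

lemma qorb_diff_shift:
  "qorb c z (d + m) - qorb c z m = (qorb c z d - z) * (\<Prod>i<m. qorb c z (d + i) + qorb c z i)"
proof (induction m)
  case (Suc m)
  have "qorb c z (d + Suc m) - qorb c z (Suc m) = (qorb c z (d + m) - qorb c z m) * (qorb c z (d + m) + qorb c z m)"
    by (simp add: qorb_Suc algebra_simps power2_eq_square)
  then show ?case using Suc by (simp add: mult.assoc)
qed simp

lemma qorb_cofactor: "qorb c z (d * r) - z = (qorb c z d - z) * qcofactor c z d r"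
proof (induction r)
  case (Suc r)
  have "qorb c z (d * Suc r) - z = (qorb c z (d + d * r) - qorb c z (d * r)) + (qorb c z (d * r) - z)"
    by (simp add: add.commute)
  also have "\<dots> = (qorb c z d - z) * qcofactor c z d (Suc r)"
    unfolding Suc.IH qorb_diff_shift[of c z d "d * r"] by (simp add: qcofactor_def algebra_simps)
  finally show ?case .
qed (simp add: qcofactor_def)

lemma (in comm_ring_hom) hom_qcofactor: "hom (qcofactor c z d r) = qcofactor (hom c) (hom z) d r"
  unfolding qcofactor_def by (simp add: hom_distribs hom_qorb)

lemma poly_spec_qcofactor:
  "poly (spec (qcofactor [:[:0, 1:]:] [:0, 1:] d r) c) z = qcofactor c z d r"
  by (simp add: spec_hom.hom_qcofactor poly_hom.hom_qcofactor map_poly_pCons)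

text \<open>Multiplied by \<open>x - 1\<close> the sum collapses to \<open>r\<close>, because the
  plain geometric sum vanishes.\<close>

lemma sum_index_geometric:
  fixes x :: complex
  assumes "x ^ r = 1" "x \<noteq> 1" "r > 0"
  shows "(\<Sum>j<r. of_nat j * x ^ j) \<noteq> 0"
proof -
  have "(x - 1) * (\<Sum>j<n. of_nat j * x ^ j) = of_nat n * x ^ n - x * (\<Sum>j<n. x ^ j)" for n
    by (induction n) (simp_all add: algebra_simps)
  from this[of r] have "(x - 1) * (\<Sum>j<r. of_nat j * x ^ j) = of_nat r - x * (\<Sum>j<r. x ^ j)" using assms by simp
  moreover have "(\<Sum>j<r. x ^ j) = 0" using assms by (simp add: geometric_sum)
  ultimately show ?thesis using assms(3) by auto
qed

text \<open>Let \<open>d\<close> be the exact period of \<open>z\<close>. If \<open>d = N\<close>,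
  both partial derivatives of \<open>qper N\<close> vanish, which is a cycle of multiplier 1 that
  persists to first order. If \<open>d < N\<close>, then \<open>qper d\<close> is divided out: the
  quotient vanishes only if the multiplier is a root of unity other than 1, and its derivative along
  the curve of period-\<open>d\<close> points is a non-zero multiple of the logarithmic derivative
  of the multiplier.\<close>

lemma dynatomic_factors_disjoint:
  fixes P1 P2 :: "complex poly poly"
  assumes N: "N > 0" and P: "P1 * P2 * dyn_den qper N = dyn_num qper N"
    and z1: "poly (spec P1 c) z = 0" and z2: "poly (spec P2 c) z = 0"
  shows False
proof -
  obtain Q0 where Q0: "qper N = P1 * P2 * Q0" using qper_quotient_dvd[OF N P] by blast
  have "poly (spec (qper N) c) z = 0" unfolding Q0 using z1 by (simp add: spec_hom.hom_mult)
  then have perN: "qorb c z N = z" by (simp add: poly_spec_qper)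
  define x where "x i = qorb c z i" for i
  obtain d where d: "\<And>k. x 0 = x k \<longleftrightarrow> d dvd k"
  proof (rule period_set_multiples[of "\<lambda>i j. x i = x j"])
    show "x (Suc i) = x (Suc j)" if "x i = x j" for i j using that by (simp add: x_def qorb_Suc)
  qed auto
  have dN: "d dvd N" using d[of N] perN by (simp add: x_def)
  then have d0: "d > 0" using N by (metis dvd_0_left_iff gr0I)
  have xd: "x d = x 0" using d[of d] by simp
  have xS: "x (Suc i) = (x i)\<^sup>2 + c" for i by (simp add: x_def qorb_Suc)
  have xadd: "x (i + d) = x i" for i by (induction i) (simp_all add: xd xS)
  have inj: "inj_on x {..<d}"
  proof (rule linorder_inj_onI)
    fix i j assume ij: "i < j" "i \<in> {..<d}" "j \<in> {..<d}"
    show "x i \<noteq> x j"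
    proof
      assume eq: "x i = x j"
      have "x (i + n) = x (j + n)" for n by (induction n) (simp_all add: eq xS)
      from this[of "d - j"] have "x (i + (d - j)) = x 0" using ij xd by simp
      then have "d dvd i + (d - j)" using d by metis
      then show False using ij by (auto dest: dvd_imp_le)
    qed
  qed (rule linear)
  define \<Lambda> where "\<Lambda> = (\<Prod>i<d. 2 * x i)"
  have derivx: "((\<lambda>t. qorb (c + k * t) (z + v * t) n) has_field_derivative a n) (at 0)"
    if "a 0 = v" "\<And>n. a (Suc n) = 2 * x n * a n + k" for a k v n
    using qorb_path_derivative[of a v c z k n] that unfolding x_def by blast
  have hom: "a n = v * (\<Prod>i<n. 2 * x i) + b n" if "a 0 = v" "\<And>n. a (Suc n) = 2 * x n * a n + k"
     "b 0 = 0" "\<And>n. b (Suc n) = 2 * x n * b n + k" for a b v k n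
    by (induction n) (simp_all add: that algebra_simps)
  define A where "A = rec_nat (0::complex) (\<lambda>n y. 2 * x n * y + 1)"
  have A: "A 0 = 0" "A (Suc n) = 2 * x n * A n + 1" for n by (simp_all add: A_def)
  show False
  proof (cases "d = N")
    case True
    \<comment> \<open>Direction \<open>(0, 1)\<close>: the derivative in z is the multiplier minus
      1.\<close>
    have "((\<lambda>t. poly (spec (qper N) (c + 0 * t)) (z + 1 * t)) has_field_derivative 0) (at 0)"
      unfolding Q0 by (rule spec_path_product_derivative[OF z1 z2])
    then have "((\<lambda>t. qorb (c + 0 * t) (z + 1 * t) N - (z + 1 * t)) has_field_derivative 0) (at 0)"
      unfolding poly_spec_qper .
    moreover have "((\<lambda>t. qorb (c + 0 * t) (z + 1 * t) N - (z + 1 * t)) has_field_derivative ((\<Prod>i<N. 2 * x i) - 1)) (at 0)"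
    proof (intro DERIV_diff)
      show "((\<lambda>t. qorb (c + 0 * t) (z + 1 * t) N) has_field_derivative (\<Prod>i<N. 2 * x i)) (at 0)"
        by (rule derivx) (simp_all add: mult.commute)
      show "((\<lambda>t. z + 1 * t) has_field_derivative 1) (at 0)" by (auto intro!: derivative_eq_intros)
    qed
    ultimately have lam: "\<Lambda> = 1" unfolding \<Lambda>_def True using DERIV_unique by fastforce
    \<comment> \<open>Direction \<open>(1, 0)\<close>: the derivative in c is the variation
      \<open>A N\<close> with initial value 0.\<close>
    have "((\<lambda>t. poly (spec (qper N) (c + 1 * t)) (z + 0 * t)) has_field_derivative 0) (at 0)"
      unfolding Q0 by (rule spec_path_product_derivative[OF z1 z2])
    then have "((\<lambda>t. qorb (c + 1 * t) (z + 0 * t) N - (z + 0 * t)) has_field_derivative 0) (at 0)"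
      unfolding poly_spec_qper .
    moreover have "((\<lambda>t. qorb (c + 1 * t) (z + 0 * t) N - (z + 0 * t)) has_field_derivative (A N - 0)) (at 0)"
    proof (intro DERIV_diff)
      show "((\<lambda>t. qorb (c + 1 * t) (z + 0 * t) N) has_field_derivative A N) (at 0)"
        by (rule derivx) (simp_all add: A)
      show "((\<lambda>t. z + 0 * t) has_field_derivative 0) (at 0)" by (auto intro!: derivative_eq_intros)
    qed
    ultimately have "A N = 0" using DERIV_unique by fastforce
    then show False
      using parabolic_transversality[OF d0 inj xS xd, of A] lam A True unfolding \<Lambda>_def by simp
  next
    case False
    obtain r where r: "N = d * r" using dN by blast
    have r0: "r > 0" using N r by auto
    have dlt: "d < N" using False dN N by (metis dvd_imp_le le_neq_implies_less)
    define U :: "complex poly poly" where "U = qcofactor [:[:0, 1:]:] [:0, 1:] d r"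
    have U: "qper N = qper d * U" unfolding qper_def U_def r by (rule qorb_cofactor)
    have "qper d * (P1 * P2) dvd qper d * U" using qper_mult_quotient_dvd[OF N P dN dlt] U by simp
    then have "P1 * P2 dvd U" using qper_monic(3)[OF d0, where 'a=complex] by simp
    then obtain E where E: "U = P1 * P2 * E" by blast
    have xx: "qorb c z (d + i) + qorb c z i = 2 * x i" for i
      using xadd[of i] by (simp add: x_def add.commute)
    have prodL: "(\<Prod>i<d * j. 2 * x i) = \<Lambda> ^ j" for j
    proof (induction j)
      case (Suc j)
      have xm: "x (i + d * k) = x i" for i k
      proof (induction k)
        case (Suc k)
        have "x (i + d * Suc k) = x ((i + d * k) + d)" by (simp add: algebra_simps)
        then show ?case using Suc xadd by simp
      qed simp
      have "(\<Prod>i<d * Suc j. 2 * x i) = (\<Prod>i<d * j + d. 2 * x i)" by (simp add: add.commute)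
      also have "\<dots> = (\<Prod>i<d * j. 2 * x i) * (\<Prod>i<d. 2 * x (i + d * j))" by (rule prod_lessThan_add)
      finally have "(\<Prod>i<d * Suc j. 2 * x i) = (\<Prod>i<d * j. 2 * x i) * (\<Prod>i<d. 2 * x (i + d * j))" .
      then show ?case using Suc xm by (simp add: \<Lambda>_def)
    qed simp
    have "poly (spec U c) z = 0" unfolding E using z1 by (simp add: spec_hom.hom_mult)
    then have "qcofactor c z d r = 0" unfolding U_def poly_spec_qcofactor .
    then have geo: "(\<Sum>j<r. \<Lambda> ^ j) = 0" unfolding qcofactor_def xx prodL .
    have L1: "\<Lambda> \<noteq> 1" using geo r0 by auto
    have "(\<Lambda> - 1) * (\<Sum>j<r. \<Lambda> ^ j) = \<Lambda> ^ r - 1" by (rule power_diff_1_eq[symmetric])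
    then have Lr: "\<Lambda> ^ r = 1" using geo by simp
    have normL: "cmod \<Lambda> = 1"
    proof -
      have "cmod \<Lambda> ^ r = 1" using Lr by (metis norm_one norm_power)
      then show ?thesis using r0 power_eq_imp_eq_base[of "cmod \<Lambda>" r 1] by simp
    qed
    then have L0: "\<Lambda> \<noteq> 0" by auto
    \<comment> \<open>This is the speed of \<open>z\<close> in c along the curve of
      period-\<open>d\<close> points; it makes the variation \<open>a\<close> close up.\<close>
    define v where "v = A d / (1 - \<Lambda>)"
    define a where "a = rec_nat v (\<lambda>n y. 2 * x n * y + 1)"
    have a: "a 0 = v" "a (Suc n) = 2 * x n * a n + 1" for n by (simp_all add: a_def)
    have "a d = v * \<Lambda> + A d" unfolding \<Lambda>_def by (rule hom[where k=1]) (simp_all add: a A)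
    also have "A d = v * (1 - \<Lambda>)" using L1 by (simp add: v_def)
    also have "v * \<Lambda> + v * (1 - \<Lambda>) = a 0" by (simp add: a algebra_simps)
    finally have ad: "a d = a 0" .
    have aadd: "a (i + d) = a i" for i by (induction i) (simp_all add: ad a xadd)
    have x0: "x i \<noteq> 0" for i
    proof
      assume "x i = 0"
      moreover have "x (i mod d) = x i"
      proof -
        have "x (j + k * d) = x j" for j k
        proof (induction k)
          case (Suc k)
          have "x (j + Suc k * d) = x ((j + k * d) + d)" by (simp add: algebra_simps)
          then show ?case using Suc xadd by simp
        qed simp
        from this[of "i mod d" "i div d"] show ?thesis by simp
      qed
      ultimately have "\<Lambda> = 0" unfolding \<Lambda>_def using d0 by (intro prod_zero) (auto intro!: bexI[of _ "i mod d"])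
      then show False using L0 by simp
    qed
    define \<sigma> where "\<sigma> = (\<Sum>i<d. a i / x i)"
    have sumS: "(\<Sum>i<d * j. a i / x i) = of_nat j * \<sigma>" for j
    proof (induction j)
      case (Suc j)
      have m: "g (i + d * k) = g i" if "\<And>i. g (i + d) = g i" for g :: "nat \<Rightarrow> complex" and i k
      proof (induction k)
        case (Suc k)
        have "g (i + d * Suc k) = g ((i + d * k) + d)" by (simp add: algebra_simps)
        then show ?case using Suc that by simp
      qed simp
      have "(\<Sum>i<d * Suc j. a i / x i) = (\<Sum>i<d * j + d. a i / x i)" by (simp add: add.commute)
      also have "\<dots> = (\<Sum>i<d * j. a i / x i) + (\<Sum>i<d. a (i + d * j) / x (i + d * j))" by (rule sum_lessThan_add)
      finally have "(\<Sum>i<d * Suc j. a i / x i) = (\<Sum>i<d * j. a i / x i) + (\<Sum>i<d. a (i + d * j) / x (i + d * j))" .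
      then show ?case using Suc m[of a] m[of x] aadd xadd by (simp add: \<sigma>_def algebra_simps)
    qed simp
    have "((\<lambda>t. poly (spec U (c + 1 * t)) (z + v * t)) has_field_derivative 0) (at 0)"
      unfolding E by (rule spec_path_product_derivative[OF z1 z2])
    then have F0: "((\<lambda>t. qcofactor (c + 1 * t) (z + v * t) d r) has_field_derivative 0) (at 0)"
      unfolding U_def poly_spec_qcofactor .
    have "((\<lambda>t. qcofactor (c + 1 * t) (z + v * t) d r) has_field_derivative (\<Sum>j<r. \<Lambda> ^ j * (of_nat j * \<sigma>))) (at 0)"
      unfolding qcofactor_def
    proof (intro DERIV_sum)
      fix j
      let ?g = "\<lambda>i t. qorb (c + 1 * t) (z + v * t) (d + i) + qorb (c + 1 * t) (z + v * t) i"
      have g: "(?g i has_field_derivative (a (d + i) + a i)) (at 0)" for i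
        by (intro DERIV_add derivx) (simp_all add: a)
      have g0: "?g i 0 = 2 * x i" for i using xx by simp
      have "((\<lambda>t. \<Prod>i<d * j. ?g i t) has_field_derivative
          (\<Prod>i<d * j. ?g i 0) * (\<Sum>i<d * j. (a (d + i) + a i) / ?g i 0)) (at 0)"
        by (intro prod_derivative g) (simp only: g0 x0 mult_eq_0_iff, simp add: x0)
      moreover have "(a (d + i) + a i) / ?g i 0 = a i / x i" for i
        unfolding g0 using aadd[of i] by (simp add: add.commute)
      ultimately show "((\<lambda>t. \<Prod>i<d * j. ?g i t) has_field_derivative \<Lambda> ^ j * (of_nat j * \<sigma>)) (at 0)"
        by (simp only: g0 prodL sumS)
    qed
    then have "(\<Sum>j<r. \<Lambda> ^ j * (of_nat j * \<sigma>)) = 0" using F0 DERIV_unique by blast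
    then have "\<sigma> * (\<Sum>j<r. of_nat j * \<Lambda> ^ j) = 0" by (simp add: sum_distrib_left mult_ac)
    then have "\<sigma> = 0" using sum_index_geometric[OF Lr L1 r0] by simp
    then show False
      using multiplier_transversality[OF d0 inj xS xd _ _ a(2) ad] normL L1 unfolding \<Lambda>_def \<sigma>_def by simp
  qed
qed

section \<open>Irreducibility over the complex numbers\<close>

lemma monic_poly_prod_roots:
  fixes p :: "complex poly"
  assumes "lead_coeff p = 1" "card {w. poly p w = 0} = degree p"
  shows "poly p z = (\<Prod>w | poly p w = 0. z - w)"
proof -
  let ?q = "\<Prod>w | poly p w = 0. [:- w, 1:]"
  have p0: "p \<noteq> 0" using assms(1) by auto
  have fin: "finite {w. poly p w = 0}" by (rule poly_roots_finite[OF p0])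
  have dq: "degree ?q = degree p"
    using assms(2) by (subst degree_prod_eq_sum_degree) auto
  have lq: "lead_coeff ?q = 1" by (simp add: lead_coeff_prod)
  have "p = ?q"
  proof (rule poly_eqI_degree_lead_coeff[where n = "degree p" and A = "{w. poly p w = 0}"])
    show "coeff p (degree p) = coeff ?q (degree p)" using lq assms(1) unfolding dq by simp
    show "degree p \<le> card {w. poly p w = 0}" using assms(2) by simp
    show "poly p w = poly ?q w" if "w \<in> {w. poly p w = 0}" for w
    proof -
      have "poly ?q w = 0" unfolding poly_prod using that fin by (intro prod_zero) auto
      then show ?thesis using that by simp
    qed
  qed (simp_all add: dq)
  then have "poly p z = poly ?q z" by simp
  then show ?thesis by (simp add: poly_prod)
qed

definition fib :: "complex poly poly \<Rightarrow> complex \<Rightarrow> complex set" where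
  "fib P c = {z. poly (spec P c) z = 0}"

lemma spec_monic_nonzero: "lead_coeff P = 1 \<Longrightarrow> spec P c \<noteq> 0"
proof
  assume "lead_coeff P = 1" "spec P c = 0"
  then have "poly (lead_coeff P) c = 0"
    using coeff_map_poly[of "\<lambda>a. poly a c" P "degree P"] by simp
  then show False using \<open>lead_coeff P = 1\<close> by simp
qed

lemma finite_fib: "lead_coeff P = 1 \<Longrightarrow> finite (fib P c)"
  unfolding fib_def by (intro poly_roots_finite spec_monic_nonzero)

lemma card_fib_le: "lead_coeff P = 1 \<Longrightarrow> card (fib P c) \<le> degree P"
  unfolding fib_def using degree_spec_monic[of P c] card_poly_roots_bound[OF spec_monic_nonzero] by metis

lemma poly_fib:
  assumes "lead_coeff P = 1" "card (fib P c) = degree P"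
  shows "poly (spec P c) z = (\<Prod>w\<in>fib P c. z - w)"
  unfolding fib_def
  by (rule monic_poly_prod_roots) (use assms degree_spec_monic[of P c] in \<open>auto simp: fib_def\<close>)

lemma fib_mult: "fib (A * B) c = fib A c \<union> fib B c"
  unfolding fib_def by (auto simp: spec_hom.hom_mult)

text \<open>Neither factor can have more zeros than its degree, so a full count for the product
  forces full counts for both factors and disjointness.\<close>

lemma fib_split:
  assumes A: "lead_coeff A = 1" and B: "lead_coeff B = 1" and card: "card (fib (A * B) c) = degree (A * B)"
  shows "card (fib A c) = degree A" "card (fib B c) = degree B" "fib A c \<inter> fib B c = {}"
proof -
  have "degree (A * B) = degree A + degree B" using A B by (intro degree_mult_eq) auto
  then have "card (fib A c \<union> fib B c) = degree A + degree B" using card by (simp add: fib_mult)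
  moreover have "card (fib A c) + card (fib B c) = card (fib A c \<union> fib B c) + card (fib A c \<inter> fib B c)"
    by (rule card_Un_Int) (simp_all add: finite_fib A B)
  moreover note card_fib_le[OF A, of c] card_fib_le[OF B, of c]
  ultimately have "card (fib A c) = degree A \<and> card (fib B c) = degree B \<and> card (fib A c \<inter> fib B c) = 0" by linarith
  then show "card (fib A c) = degree A" "card (fib B c) = degree B" "fib A c \<inter> fib B c = {}"
    using finite_fib[OF A, of c] by (simp_all add: card_eq_0_iff)
qed

lemma poly_lower_bound:
  fixes R :: "complex poly"
  assumes "R \<noteq> 0"
  obtains \<delta> r where "\<delta> > 0" "\<And>z. r \<le> cmod z \<Longrightarrow> \<delta> \<le> cmod (poly R z)"
proof -
  obtain a p where R: "R = pCons a p" by (cases R)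
  show ?thesis
  proof (cases "p = 0")
    case True
    then show ?thesis using assms R that[of "cmod a" 0] by auto
  next
    case False
    then show ?thesis using poly_infinity[OF False, of 1 a] R that[of 1] by auto
  qed
qed

text \<open>The norm is a polynomial in c that is non-zero at \<open>c0\<close>, and a non-zero
  polynomial stays away from 0 near infinity.\<close>

lemma norm_lower_bound:
  assumes f: "lead_coeff f = 1" and c0: "card (fib f c0) = degree f" "\<And>z. z \<in> fib f c0 \<Longrightarrow> poly (spec g c0) z \<noteq> 0"
  obtains \<delta> r where "\<delta> > 0" "\<And>c. r \<le> cmod c \<Longrightarrow> card (fib f c) = degree f \<Longrightarrow>
      \<delta> \<le> (\<Prod>z\<in>fib f c. cmod (poly (spec g c) z))"
proof -
  obtain R where R: "\<And>c. card (fib f c) = degree f \<Longrightarrow> poly R c = (\<Prod>z\<in>fib f c. poly (spec g c) z)"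
    using norm_polynomial[OF f, of g] unfolding fib_def by metis
  have "poly R c0 \<noteq> 0" using R[OF c0(1)] c0(2) finite_fib[OF f, of c0] by simp
  then have "R \<noteq> 0" by auto
  then obtain \<delta> r where "\<delta> > 0" and dr: "\<And>z. r \<le> cmod z \<Longrightarrow> \<delta> \<le> cmod (poly R z)" using poly_lower_bound by metis
  moreover have "\<delta> \<le> (\<Prod>z\<in>fib f c. cmod (poly (spec g c) z))" if "r \<le> cmod c" "card (fib f c) = degree f" for c
    using dr[OF that(1)] R[OF that(2)] by (simp add: prod_norm)
  ultimately show ?thesis using that by blast
qed

text \<open>A norm without zeros is constant by the fundamental theorem of algebra; the added 1
  makes the bound \<open>K\<close> positive.\<close>

lemma norm_upper_bound:
  assumes f: "lead_coeff f = 1" and no: "\<And>c z. poly (spec f c) z = 0 \<Longrightarrow> poly (spec g c) z \<noteq> 0"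
  obtains K where "K > 0" "\<And>c. card (fib f c) = degree f \<Longrightarrow> (\<Prod>z\<in>fib f c. cmod (poly (spec g c) z)) \<le> K"
proof -
  obtain R where R: "\<And>c. card (fib f c) = degree f \<Longrightarrow> poly R c = (\<Prod>z\<in>fib f c. poly (spec g c) z)"
    and R0: "\<And>c. poly R c = 0 \<Longrightarrow> \<exists>z. poly (spec f c) z = 0 \<and> poly (spec g c) z = 0"
    using norm_polynomial[OF f, of g] unfolding fib_def by metis
  have "constant (poly R)" using fundamental_theorem_of_algebra[of R] R0 no by blast
  then have const: "poly R c = poly R 0" for c unfolding constant_def by blast
  have "(\<Prod>z\<in>fib f c. cmod (poly (spec g c) z)) \<le> cmod (poly R 0) + 1" if "card (fib f c) = degree f" for c
    using R[OF that] const[of c] by (simp add: prod_norm)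
  then show ?thesis using that[of "cmod (poly R 0) + 1"] by (simp add: add_nonneg_pos)
qed

lemma power_int_sum:
  fixes s :: real assumes "s \<noteq> 0" "finite Z"
  shows "(\<Prod>z\<in>Z. s powi f z) = s powi (\<Sum>z\<in>Z. f z)"
  using assms(2) by induction (use assms(1) in \<open>simp_all add: power_int_add\<close>)

text \<open>The exponents are integers, so a violation would cost a full factor \<open>s\<close>,
  which exceeds \<open>D\<close>.\<close>

lemma exponent_le:
  fixes s D :: real
  assumes "s powi A \<le> D * s powi B" "D < s" "1 < s"
  shows "A \<le> B"
proof (rule ccontr)
  assume "\<not> A \<le> B"
  then have "s powi (B + 1) \<le> s powi A" using assms(3) by (intro power_int_increasing) auto
  moreover have "s powi (B + 1) = s powi B * s" using assms(3) by (simp add: power_int_add)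
  ultimately have "s powi B * s \<le> D * s powi B" using assms(1) by linarith
  moreover have "s powi B > 0" using assms(3) by (intro zero_less_power_int) simp
  ultimately show False using assms(2) mult_strict_right_mono[of D s "s powi B"] by (simp add: mult.commute)
qed

text \<open>\<open>C\<close> bounds the product of the errors \<open>3 ^ N\<close> over at most
  \<open>2 ^ N * 2 ^ N\<close> pairs; what matters is that it is independent of
  \<open>s\<close>.\<close>

lemma perpts_prod_bounds:
  assumes s: "s \<ge> 4" and c: "c = - (complex_of_real s)\<^sup>2" and N: "N > 0"
    and U: "U \<subseteq> perpts c N" and V: "V \<subseteq> perpts c N" and UV: "U \<inter> V = {}"
  defines "E \<equiv> \<Sum>a\<in>itin c ` U. \<Sum>b\<in>itin c ` V. wt a b" and "C \<equiv> ((3::real) ^ N) ^ (2 ^ N * 2 ^ N)"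
  shows "s powi E / C \<le> (\<Prod>x\<in>U. \<Prod>y\<in>V. cmod (x - y))" and "(\<Prod>x\<in>U. \<Prod>y\<in>V. cmod (x - y)) \<le> C * s powi E"
proof -
  note card = card_perpts[OF s c N]
  have fin: "finite U" "finite V" using U V card(2) finite_subset by auto
  have inj: "inj_on (itin c) U" "inj_on (itin c) V"
    using itin_bij[OF s c N] U V unfolding bij_betw_def by (auto intro: inj_on_subset)
  have E: "E = (\<Sum>(x,y)\<in>U \<times> V. wt (itin c x) (itin c y))"
    unfolding E_def sum.cartesian_product[symmetric] by (simp add: sum.reindex[OF inj(1)] sum.reindex[OF inj(2)])
  let ?f = "\<lambda>(x,y). cmod (x - y)" and ?g = "\<lambda>(x,y). s powi wt (itin c x) (itin c y)" and ?k = "(3::real) ^ N"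
  have prodf: "(\<Prod>x\<in>U. \<Prod>y\<in>V. cmod (x - y)) = (\<Prod>z\<in>U \<times> V. ?f z)" by (simp add: prod.cartesian_product)
  have prodg: "(\<Prod>z\<in>U \<times> V. ?g z) = s powi E"
    unfolding E using power_int_sum[of s "U \<times> V" "\<lambda>(x,y). wt (itin c x) (itin c y)"] s fin
    by (simp add: case_prod_beta)
  have g0: "?g z > 0" for z using s by (auto simp: case_prod_beta intro!: zero_less_power_int)
  have k: "?k \<ge> 3" using N power_increasing[of 1 N "3::real"] by simp
  have low: "?g z / ?k \<le> ?f z" and up: "?f z \<le> ?k * ?g z" if z: "z \<in> U \<times> V" for z
  proof -
    obtain x y where xy: "z = (x, y)" "x \<in> U" "y \<in> V" using z by auto
    have "x \<noteq> y" using xy UV by auto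
    then have b: "s powi wt (itin c x) (itin c y) / 3 ^ N \<le> cmod (x - y)" "cmod (x - y) \<le> 3 * s powi wt (itin c x) (itin c y)"
      using perpts_dist_bounds[OF s c N, of x y] xy U V by auto
    show "?g z / ?k \<le> ?f z" using b xy by simp
    have "3 * ?g z \<le> ?k * ?g z" using k g0[of z] by (intro mult_right_mono) (auto simp: less_imp_le)
    then show "?f z \<le> ?k * ?g z" using b xy by simp
  qed
  have kc: "?k ^ card (U \<times> V) \<le> C"
  proof -
    have "card U \<le> 2 ^ N" "card V \<le> 2 ^ N" using U V card card_mono by metis+
    then have "card (U \<times> V) \<le> 2 ^ N * 2 ^ N" by (simp add: card_cartesian_product mult_le_mono)
    then show ?thesis unfolding C_def using k by (intro power_increasing) auto
  qed
  have E0: "s powi E > 0" using s by (intro zero_less_power_int) simp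
  have kp: "?k ^ card (U \<times> V) > 0" by simp
  have C0: "C > 0" unfolding C_def by simp
  have "s powi E / C \<le> s powi E / ?k ^ card (U \<times> V)"
    using kc E0 kp C0 by (intro divide_left_mono mult_pos_pos) auto
  also have "\<dots> = (\<Prod>z\<in>U \<times> V. ?g z / ?k)" unfolding prodg[symmetric] by (simp add: prod_dividef)
  also have "\<dots> \<le> (\<Prod>z\<in>U \<times> V. ?f z)" using g0 low by (intro prod_mono) (auto simp: less_imp_le)
  finally show "s powi E / C \<le> (\<Prod>x\<in>U. \<Prod>y\<in>V. cmod (x - y))" unfolding prodf .
  have "(\<Prod>z\<in>U \<times> V. ?f z) \<le> (\<Prod>z\<in>U \<times> V. ?k * ?g z)" using up by (intro prod_mono) (auto simp: case_prod_beta)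
  also have "\<dots> = ?k ^ card (U \<times> V) * s powi E" unfolding prodg[symmetric] prod.distrib by simp
  also have "\<dots> \<le> C * s powi E" using kc E0 by (intro mult_right_mono) auto
  finally show "(\<Prod>x\<in>U. \<Prod>y\<in>V. cmod (x - y)) \<le> C * s powi E" unfolding prodf .
qed

text \<open>For all large \<open>s\<close> the norm estimates become the hypotheses of
  \<open>energy_contradiction\<close>. The sets of sign sequences may change with \<open>s\<close>,
  but the constants do not, so one sufficiently large \<open>s\<close> is enough.\<close>

lemma dynatomic_monic_split:
  fixes P1 P2 :: "complex poly poly"
  assumes N1: "N > 1" and m1: "lead_coeff P1 = 1" and m2: "lead_coeff P2 = 1"
    and P: "P1 * P2 * dyn_den qper N = dyn_num qper N"
  shows "degree P1 = 0 \<or> degree P2 = 0"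
proof (rule ccontr)
  assume "\<not> ?thesis"
  then have d1: "degree P1 > 0" and d2: "degree P2 > 0" by auto
  have N: "N > 0" using N1 by simp
  obtain Q0 where Q0: "qper N = P1 * P2 * Q0" using qper_quotient_dvd[OF N P] by blast
  note cof = qper_cofactor[OF N P Q0]
  \<comment> \<open>\<open>E0\<close> completes \<open>Q0\<close> to the product of the lower period
    polynomials; \<open>E p\<close> is what remains of \<open>Q0\<close> after removing the period
    \<open>N div p\<close>.\<close>
  obtain E0 where E0: "(\<Prod>p\<in>prime_factors N. qper (N div p)) = Q0 * E0" using cof(2) by blast
  have "\<exists>E. \<forall>p\<in>prime_factors N. Q0 = qper (N div p) * E p" using cof(1) by (intro bchoice) blast
  then obtain E where E: "\<And>p. p \<in> prime_factors N \<Longrightarrow> Q0 = qper (N div p) * E p" by blast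
  have Nd: "N div p > 0" "N div p dvd N" if "p \<in> prime_factors N" for p
  proof -
    have "p dvd N" using that by auto
    then show "N div p dvd N" by (metis dvd_div_mult_self dvd_triv_left)
    then show "N div p > 0" using N by (metis dvd_0_left_iff gr0I not_gr_zero)
  qed
  have mN: "lead_coeff (qper n :: complex poly poly) = 1" if "n > 0" for n using qper_monic[OF that] by auto
  have m0: "lead_coeff Q0 = 1" using mN[OF N] m1 m2 unfolding Q0 lead_coeff_mult by simp
  have mE: "lead_coeff (E p) = 1" if "p \<in> prime_factors N" for p
    using m0 mN[OF Nd(1)[OF that]] unfolding E[OF that] lead_coeff_mult by simp
  define cc where "cc s = - (complex_of_real s)\<^sup>2" for s
  have pe: "fib (qper n) (cc s) = perpts (cc s) n" if "s \<ge> 4" for s n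
    using perpts_eq[OF that cc_def] unfolding fib_def by simp
  have cardN: "card (fib (qper n) (cc s)) = degree (qper n :: complex poly poly)" if "s \<ge> 4" "n > 0" for s n
    using card_perpts(1)[OF that(1) cc_def that(2)] qper_monic[OF that(2), where 'a=complex] unfolding pe[OF that(1)] by auto
  have parts: "card (fib P1 (cc s)) = degree P1" "card (fib P2 (cc s)) = degree P2" "card (fib Q0 (cc s)) = degree Q0"
    "fib P1 (cc s) \<inter> fib P2 (cc s) = {}" "(fib P1 (cc s) \<union> fib P2 (cc s)) \<inter> fib Q0 (cc s) = {}"
    "perpts (cc s) N = fib P1 (cc s) \<union> fib P2 (cc s) \<union> fib Q0 (cc s)" if s: "s \<ge> 4" for s
  proof -
    have m12: "lead_coeff (P1 * P2) = 1" unfolding lead_coeff_mult using m1 m2 by simp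
    have "card (fib (P1 * P2 * Q0) (cc s)) = degree (P1 * P2 * Q0)" using cardN[OF s N] unfolding Q0 .
    note sp = fib_split[OF m12 m0 this]
    note sp2 = fib_split[OF m1 m2 sp(1)]
    show "card (fib P1 (cc s)) = degree P1" "card (fib P2 (cc s)) = degree P2" "card (fib Q0 (cc s)) = degree Q0"
      "fib P1 (cc s) \<inter> fib P2 (cc s) = {}" using sp sp2 by auto
    show "(fib P1 (cc s) \<union> fib P2 (cc s)) \<inter> fib Q0 (cc s) = {}" using sp(3) unfolding fib_mult .
    show "perpts (cc s) N = fib P1 (cc s) \<union> fib P2 (cc s) \<union> fib Q0 (cc s)"
      unfolding pe[OF s, symmetric] Q0 fib_mult ..
  qed
  have Eparts: "card (fib (E p) (cc s)) = degree (E p)" "perpts (cc s) (N div p) \<inter> fib (E p) (cc s) = {}"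
    "fib Q0 (cc s) = perpts (cc s) (N div p) \<union> fib (E p) (cc s)"
    if s: "s \<ge> 4" and p: "p \<in> prime_factors N" for s p
  proof -
    have "card (fib (qper (N div p) * E p) (cc s)) = degree (qper (N div p) * E p)"
      using parts(3)[OF s] E[OF p] by simp
    note sp = fib_split[OF mN[OF Nd(1)[OF p]] mE[OF p] this]
    show "card (fib (E p) (cc s)) = degree (E p)" "perpts (cc s) (N div p) \<inter> fib (E p) (cc s) = {}"
      using sp unfolding pe[OF s] by auto
    show "fib Q0 (cc s) = perpts (cc s) (N div p) \<union> fib (E p) (cc s)"
      by (subst E[OF p]) (simp add: fib_mult pe[OF s])
  qed
  define C where "C = ((3::real) ^ N) ^ (2 ^ N * 2 ^ N)"
  have C1: "C > 0" unfolding C_def by simp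
  have itin_perpts: "itin (cc s) ` perpts (cc s) n = Per n" if "s \<ge> 4" "n > 0" for s n
    using itin_bij[OF that(1) cc_def that(2)] by (simp add: bij_betw_def)
  have cs: "cmod (cc s) = s\<^sup>2" for s unfolding cc_def by (simp add: norm_power)
  have bigc: "\<forall>\<^sub>F s in at_top. r \<le> cmod (cc s)" for r
  proof -
    have "\<forall>\<^sub>F s in at_top. s \<ge> max r 1" by (rule eventually_ge_at_top)
    then show ?thesis
    proof eventually_elim
      case (elim s)
      then have "s * 1 \<le> s * s" by (intro mult_left_mono) auto
      then show ?case using elim unfolding cs power2_eq_square by linarith
    qed
  qed
  have ev4: "\<forall>\<^sub>F s in at_top. s \<ge> (4::real)" by (rule eventually_ge_at_top)
  let ?S = "\<lambda>Q s. itin (cc s) ` fib Q (cc s)"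
  obtain K where K: "K > 0" "\<And>c. card (fib P1 c) = degree P1 \<Longrightarrow> (\<Prod>z\<in>fib P1 c. cmod (poly (spec P2 c) z)) \<le> K"
    using norm_upper_bound[OF m1, of P2] dynatomic_factors_disjoint[OF N P] by metis
  have H1: "\<forall>\<^sub>F s in at_top. (\<Sum>a\<in>?S P1 s. \<Sum>b\<in>?S P2 s. wt a b) \<le> 0"
    using ev4 eventually_gt_at_top[of "K * C"]
  proof eventually_elim
    case (elim s)
    note s = elim(1)
    let ?E = "\<Sum>a\<in>?S P1 s. \<Sum>b\<in>?S P2 s. wt a b"
    have "s powi ?E / C \<le> (\<Prod>x\<in>fib P1 (cc s). \<Prod>y\<in>fib P2 (cc s). cmod (x - y))"
      unfolding C_def using parts[OF s] by (intro perpts_prod_bounds(1)[OF s cc_def N]) auto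
    also have "\<dots> = (\<Prod>z\<in>fib P1 (cc s). cmod (poly (spec P2 (cc s)) z))"
      unfolding poly_fib[OF m2 parts(2)[OF s]] by (simp add: prod_norm)
    also have "\<dots> \<le> K" by (rule K(2)[OF parts(1)[OF s]])
    finally have "s powi ?E \<le> K * C * s powi 0" using C1 by (simp add: field_simps)
    then show ?case using elim by (intro exponent_le[of s _ "K * C"]) auto
  qed
  have H2: "\<forall>\<^sub>F s in at_top. (\<Sum>b\<in>?S Q s. \<Sum>a\<in>?S Q0 s. wt b a) \<le>
      (\<Sum>p\<in>prime_factors N. \<Sum>b\<in>?S Q s. contact (N div p) b)"
    if mQ: "lead_coeff Q = 1" and cQ: "\<And>s. s \<ge> 4 \<Longrightarrow> card (fib Q (cc s)) = degree Q"
      and QN: "\<And>s. s \<ge> 4 \<Longrightarrow> fib Q (cc s) \<subseteq> perpts (cc s) N"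
      and QQ: "\<And>s. s \<ge> 4 \<Longrightarrow> fib Q (cc s) \<inter> fib Q0 (cc s) = {}" for Q
  proof -
    have prodval: "poly (spec Q0 c) z * poly (spec E0 c) z = (\<Prod>p\<in>prime_factors N. poly (spec (qper (N div p)) c) z)" for c z
    proof -
      have "poly (spec (Q0 * E0) c) z = (\<Prod>p\<in>prime_factors N. poly (spec (qper (N div p)) c) z)"
        unfolding E0[symmetric] by (simp add: spec_hom.hom_prod poly_prod)
      then show ?thesis by (simp add: spec_hom.hom_mult)
    qed
    have dQ: "fib Q (cc s) \<inter> perpts (cc s) (N div p) = {}" if "s \<ge> 4" "p \<in> prime_factors N" for s p
      using QQ[OF that(1)] Eparts(3)[OF that] by auto
    \<comment> \<open>At the parameter -16 the relevant fibres have full size and are disjoint, so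
      the norm of \<open>E0\<close> is not the zero polynomial.\<close>
    have "poly (spec E0 (cc 4)) z \<noteq> 0" if z: "z \<in> fib Q (cc 4)" for z
    proof
      assume "poly (spec E0 (cc 4)) z = 0"
      then have "(\<Prod>p\<in>prime_factors N. poly (spec (qper (N div p)) (cc 4)) z) = 0" using prodval[of "cc 4" z] by simp
      then obtain p where p: "p \<in> prime_factors N" "poly (spec (qper (N div p)) (cc 4)) z = 0" by auto
      then have "z \<in> perpts (cc 4) (N div p)" unfolding pe[of 4, symmetric, simplified] fib_def by simp
      then show False using dQ[of 4 p] p z by auto
    qed
    then obtain \<delta> r where \<delta>: "\<delta> > 0" "\<And>c. r \<le> cmod c \<Longrightarrow> card (fib Q c) = degree Q \<Longrightarrow>
        \<delta> \<le> (\<Prod>z\<in>fib Q c. cmod (poly (spec E0 c) z))"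
      using norm_lower_bound[OF mQ cQ[of 4], of E0] by auto
    let ?w = "card (prime_factors N)"
    show ?thesis using ev4 bigc[of r] eventually_gt_at_top[of "C * C ^ ?w / \<delta>"]
    proof eventually_elim
      case (elim s)
      note s = elim(1)
      let ?c = "cc s"
      let ?A = "\<Sum>b\<in>?S Q s. \<Sum>a\<in>?S Q0 s. wt b a" and ?B = "\<lambda>p. \<Sum>b\<in>?S Q s. contact (N div p) b"
      have bp: "(\<Prod>z\<in>fib Q ?c. cmod (poly (spec (qper (N div p)) ?c) z)) \<le> C * s powi ?B p"
        if p: "p \<in> prime_factors N" for p
      proof -
        note d0 = Nd(1)[OF p]
        have sub: "perpts ?c (N div p) \<subseteq> perpts ?c N"
          using qorb_periodic_dvd[OF _ Nd(2)[OF p]] unfolding perpts_def[OF s cc_def] by blast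
        have "(\<Prod>z\<in>fib Q ?c. cmod (poly (spec (qper (N div p)) ?c) z)) =
            (\<Prod>x\<in>fib Q ?c. \<Prod>y\<in>perpts ?c (N div p). cmod (x - y))"
          unfolding poly_fib[OF mN[OF d0] cardN[OF s d0]] pe[OF s] by (simp add: prod_norm)
        also have "\<dots> \<le> C * s powi (\<Sum>a\<in>?S Q s. \<Sum>b\<in>itin ?c ` perpts ?c (N div p). wt a b)"
          unfolding C_def by (rule perpts_prod_bounds(2)[OF s cc_def N QN[OF s] sub dQ[OF s p]])
        also have "(\<Sum>a\<in>?S Q s. \<Sum>b\<in>itin ?c ` perpts ?c (N div p). wt a b) = ?B p"
          unfolding itin_perpts[OF s d0] contact_def by (simp add: fdiff_commute)
        finally show ?thesis .
      qed
      \<comment> \<open>The norms of \<open>Q0\<close> and \<open>E0\<close> multiply to the product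
        of the norms of the lower period polynomials. As that of \<open>E0\<close> is at least
        \<open>\<delta>\<close>, the exponent of \<open>Q0\<close> is at most the sum of the
        others.\<close>
      have "s powi ?A / C * \<delta> \<le> (\<Prod>x\<in>fib Q ?c. \<Prod>y\<in>fib Q0 ?c. cmod (x - y)) * (\<Prod>z\<in>fib Q ?c. cmod (poly (spec E0 ?c) z))"
      proof (intro mult_mono)
        show "s powi ?A / C \<le> (\<Prod>x\<in>fib Q ?c. \<Prod>y\<in>fib Q0 ?c. cmod (x - y))"
          unfolding C_def using parts(6)[OF s] by (intro perpts_prod_bounds(1)[OF s cc_def N QN[OF s] _ QQ[OF s]]) auto
        show "\<delta> \<le> (\<Prod>z\<in>fib Q ?c. cmod (poly (spec E0 ?c) z))" by (rule \<delta>(2)[OF elim(2) cQ[OF s]])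
      qed (use \<delta>(1) in \<open>auto intro!: prod_nonneg\<close>)
      also have "\<dots> = (\<Prod>z\<in>fib Q ?c. cmod (poly (spec Q0 ?c) z)) * (\<Prod>z\<in>fib Q ?c. cmod (poly (spec E0 ?c) z))"
        unfolding poly_fib[OF m0 parts(3)[OF s]] by (simp add: prod_norm)
      also have "\<dots> = (\<Prod>z\<in>fib Q ?c. cmod (\<Prod>p\<in>prime_factors N. poly (spec (qper (N div p)) ?c) z))"
        unfolding prodval[symmetric] norm_mult prod.distrib ..
      also have "\<dots> = (\<Prod>p\<in>prime_factors N. \<Prod>z\<in>fib Q ?c. cmod (poly (spec (qper (N div p)) ?c) z))"
        unfolding prod_norm[symmetric] by (rule prod.swap)
      also have "\<dots> \<le> (\<Prod>p\<in>prime_factors N. C * s powi ?B p)"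
        using bp by (intro prod_mono) (auto intro!: prod_nonneg)
      also have "\<dots> = C ^ ?w * s powi (\<Sum>p\<in>prime_factors N. ?B p)"
        unfolding prod.distrib using power_int_sum[of s "prime_factors N" ?B] s by simp
      finally have "s powi ?A \<le> (C * C ^ ?w / \<delta>) * s powi (\<Sum>p\<in>prime_factors N. ?B p)"
        using C1 \<delta>(1) by (simp add: field_simps)
      then show ?case using elim by (intro exponent_le) auto
    qed
  qed
  have H3: "\<forall>\<^sub>F s in at_top. 0 \<le> (\<Sum>b\<in>?S Q0 s - Per (N div p). contact (N div p) b)" if p: "p \<in> prime_factors N" for p
  proof -
    note d0 = Nd(1)[OF p]
    have "poly (spec (qper (N div p)) (cc 4)) z \<noteq> 0" if "z \<in> fib (E p) (cc 4)" for z
      using Eparts(2)[of 4 p] p that pe[of 4 "N div p"] unfolding fib_def by auto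
    then obtain \<delta> r where \<delta>: "\<delta> > 0" "\<And>c. r \<le> cmod c \<Longrightarrow> card (fib (E p) c) = degree (E p) \<Longrightarrow>
        \<delta> \<le> (\<Prod>z\<in>fib (E p) c. cmod (poly (spec (qper (N div p)) c) z))"
      using norm_lower_bound[OF mE[OF p] Eparts(1)[of 4 p], of "qper (N div p)"] p by auto
    show ?thesis using ev4 bigc[of r] eventually_gt_at_top[of "C / \<delta>"]
    proof eventually_elim
      case (elim s)
      note s = elim(1)
      let ?c = "cc s"
      have inj: "inj_on (itin ?c) (perpts ?c N)" using itin_bij[OF s cc_def N] by (simp add: bij_betw_def)
      have sub: "perpts ?c (N div p) \<subseteq> perpts ?c N" "fib (E p) ?c \<subseteq> perpts ?c N"
        using parts(6)[OF s] Eparts(3)[OF s p] by auto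
      have "?S Q0 s - Per (N div p) = itin ?c ` (fib Q0 ?c - perpts ?c (N div p))"
        unfolding itin_perpts[OF s d0, symmetric]
        using parts(6)[OF s] sub by (intro inj_on_image_set_diff[OF inj, symmetric]) auto
      also have "fib Q0 ?c - perpts ?c (N div p) = fib (E p) ?c" using Eparts(2,3)[OF s p] by auto
      finally have set: "?S Q0 s - Per (N div p) = ?S (E p) s" .
      let ?B = "\<Sum>b\<in>?S (E p) s. contact (N div p) b"
      have "\<delta> \<le> (\<Prod>z\<in>fib (E p) ?c. cmod (poly (spec (qper (N div p)) ?c) z))"
        by (rule \<delta>(2)[OF elim(2) Eparts(1)[OF s p]])
      also have "\<dots> = (\<Prod>x\<in>fib (E p) ?c. \<Prod>y\<in>perpts ?c (N div p). cmod (x - y))"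
        unfolding poly_fib[OF mN[OF d0] cardN[OF s d0]] pe[OF s] by (simp add: prod_norm)
      also have "\<dots> \<le> C * s powi (\<Sum>a\<in>?S (E p) s. \<Sum>b\<in>itin ?c ` perpts ?c (N div p). wt a b)"
        unfolding C_def using Eparts(2)[OF s p] sub by (intro perpts_prod_bounds(2)[OF s cc_def N]) auto
      also have "(\<Sum>a\<in>?S (E p) s. \<Sum>b\<in>itin ?c ` perpts ?c (N div p). wt a b) = ?B"
        unfolding itin_perpts[OF s d0] contact_def by (simp add: fdiff_commute)
      finally have "s powi 0 \<le> C / \<delta> * s powi ?B" using \<delta>(1) by (simp add: field_simps)
      then have "0 \<le> ?B" using elim by (intro exponent_le[of s 0 "C / \<delta>"]) auto
      then show ?case unfolding set .
    qed
  qed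
  have H2a: "\<forall>\<^sub>F s in at_top. (\<Sum>b\<in>?S P1 s. \<Sum>a\<in>?S Q0 s. wt b a) \<le>
      (\<Sum>p\<in>prime_factors N. \<Sum>b\<in>?S P1 s. contact (N div p) b)"
  proof (rule H2[OF m1])
    fix s :: real assume s: "s \<ge> 4"
    show "card (fib P1 (cc s)) = degree P1" "fib P1 (cc s) \<subseteq> perpts (cc s) N" "fib P1 (cc s) \<inter> fib Q0 (cc s) = {}"
      using parts[OF s] by auto
  qed
  have H2b: "\<forall>\<^sub>F s in at_top. (\<Sum>b\<in>?S P2 s. \<Sum>a\<in>?S Q0 s. wt b a) \<le>
      (\<Sum>p\<in>prime_factors N. \<Sum>b\<in>?S P2 s. contact (N div p) b)"
  proof (rule H2[OF m2])
    fix s :: real assume s: "s \<ge> 4"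
    show "card (fib P2 (cc s)) = degree P2" "fib P2 (cc s) \<subseteq> perpts (cc s) N" "fib P2 (cc s) \<inter> fib Q0 (cc s) = {}"
      using parts[OF s] by auto
  qed
  have H3': "\<forall>\<^sub>F s in at_top. \<forall>p\<in>prime_factors N. 0 \<le> (\<Sum>b\<in>?S Q0 s - Per (N div p). contact (N div p) b)"
    using H3 by (intro eventually_ball_finite) auto
  have "\<forall>\<^sub>F s::real in at_top. False"
    using ev4 H1 H2a H2b H3'
  proof eventually_elim
    case (elim s)
    note s = elim(1)
    let ?c = "cc s"
    have inj: "inj_on (itin ?c) (perpts ?c N)" using itin_bij[OF s cc_def N] by (simp add: bij_betw_def)
    have PerN: "Per N = ?S P1 s \<union> ?S P2 s \<union> ?S Q0 s"
      unfolding itin_perpts[OF s N, symmetric] parts(6)[OF s] image_Un ..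
    have disj: "itin ?c ` A \<inter> itin ?c ` B = {}" if "A \<subseteq> perpts ?c N" "B \<subseteq> perpts ?c N" "A \<inter> B = {}" for A B
      using inj_on_image_Int[OF inj that(1,2)] that(3) by simp
    have i12: "?S P1 s \<inter> ?S P2 s = {}" using parts[OF s] by (intro disj) auto
    have i10: "?S P1 s \<inter> ?S Q0 s = {}" using parts[OF s] by (intro disj) auto
    have i20: "?S P2 s \<inter> ?S Q0 s = {}" using parts[OF s] by (intro disj) auto
    have low: "Per (N div p) \<subseteq> ?S Q0 s" if p: "p \<in> prime_factors N" for p
      unfolding itin_perpts[OF s Nd(1)[OF p], symmetric] Eparts(3)[OF s p] by auto
    show False
    proof (rule energy_contradiction[OF N1, of "?S P1 s" "?S P2 s" "?S Q0 s"])
      show "?S P1 s \<subseteq> Per N" "?S P2 s \<subseteq> Per N" using PerN by auto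
      show "?S P1 s \<inter> ?S P2 s = {}" by (rule i12)
      show "?S P1 s \<noteq> {}" using parts(1)[OF s] d1 by auto
      show "?S P2 s \<noteq> {}" using parts(2)[OF s] d2 by auto
      show "?S Q0 s = Per N - (?S P1 s \<union> ?S P2 s)" using PerN i10 i20 by auto
      show "(\<Sum>a\<in>?S P1 s. \<Sum>b\<in>?S P2 s. wt a b) \<le> 0" by (rule elim(2))
      show "Per (N div p) \<subseteq> ?S Q0 s" if "p \<in> prime_factors N" for p by (rule low[OF that])
      show "0 \<le> (\<Sum>b\<in>?S Q0 s - Per (N div p). contact (N div p) b)" if "p \<in> prime_factors N" for p
        using elim(5) that by blast
      show "(\<Sum>b\<in>S. \<Sum>a\<in>?S Q0 s. wt b a) \<le> (\<Sum>p\<in>prime_factors N. \<Sum>b\<in>S. contact (N div p) b)"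
        if "S \<in> {?S P1 s, ?S P2 s}" for S
        using that elim(3,4) by (elim insertE emptyE) simp_all
    qed
  qed
  then show False by simp
qed

section \<open>Embedding the algebraic closure of a number field into the complex numbers\<close>

text \<open>Graph of a ring homomorphism defined on a subring. As differences stay in the graph,
  single-valuedness reduces to the condition at 0. Inclusion of graphs is the order for Zorn's
  lemma.\<close>

definition subring_graph :: "('l::field \<times> complex) set \<Rightarrow> bool" where
  "subring_graph G \<longleftrightarrow> (1, 1) \<in> G \<and>
     (\<forall>a b a' b'. (a, b) \<in> G \<longrightarrow> (a', b') \<in> G \<longrightarrow>
        (a + a', b + b') \<in> G \<and> (a * a', b * b') \<in> G \<and> (- a, - b) \<in> G) \<and>
     (\<forall>b. (0, b) \<in> G \<longrightarrow> b = 0)"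

lemma subring_graphD:
  assumes "subring_graph G"
  shows "(1, 1) \<in> G" "(a, b) \<in> G \<Longrightarrow> (a', b') \<in> G \<Longrightarrow> (a + a', b + b') \<in> G"
    "(a, b) \<in> G \<Longrightarrow> (a', b') \<in> G \<Longrightarrow> (a * a', b * b') \<in> G"
    "(a, b) \<in> G \<Longrightarrow> (- a, - b) \<in> G" "(0, b) \<in> G \<Longrightarrow> b = 0" "(0, 0) \<in> G"
    "(a, b) \<in> G \<Longrightarrow> (a', b') \<in> G \<Longrightarrow> (a - a', b - b') \<in> G"
    "(a, b) \<in> G \<Longrightarrow> (a, b') \<in> G \<Longrightarrow> b = b'"
proof -
  note d = assms[unfolded subring_graph_def]
  show one: "(1, 1) \<in> G" using d by blast
  show add: "(a + a', b + b') \<in> G" if "(a, b) \<in> G" "(a', b') \<in> G" for a b a' b' using d that by blast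
  show "(a * a', b * b') \<in> G" if "(a, b) \<in> G" "(a', b') \<in> G" using d that by blast
  show neg: "(- a, - b) \<in> G" if "(a, b) \<in> G" for a b using d that by blast
  show sv: "b = 0" if "(0, b) \<in> G" for b using d that by blast
  show "(0, 0) \<in> G" using add[OF one neg[OF one]] by simp
  show diff: "(a - a', b - b') \<in> G" if "(a, b) \<in> G" "(a', b') \<in> G" for a b a' b'
    using add[OF that(1) neg[OF that(2)]] by simp
  show "b = b'" if "(a, b) \<in> G" "(a, b') \<in> G" using sv[of "b - b'"] diff[OF that] by simp
qed

definition graph_polys :: "('l::field \<times> complex) set \<Rightarrow> 'l poly \<Rightarrow> complex poly \<Rightarrow> bool" where
  "graph_polys G p q \<longleftrightarrow> (\<forall>i. (coeff p i, coeff q i) \<in> G)"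

context
  fixes G :: "('l::field \<times> complex) set"
  assumes G: "subring_graph G"
begin

lemma subring_graph_sum:
  "finite A \<Longrightarrow> (\<And>i. i \<in> A \<Longrightarrow> (f i, g i) \<in> G) \<Longrightarrow> (sum f A, sum g A) \<in> G"
  by (induction A rule: finite_induct) (auto simp: subring_graphD[OF G])

lemma graph_polys_closed:
  assumes "graph_polys G p q" "graph_polys G p' q'"
  shows "graph_polys G (p + p') (q + q')" "graph_polys G (p * p') (q * q')" "graph_polys G (- p) (- q)"
  using assms unfolding graph_polys_def coeff_mult
  by (auto intro!: subring_graph_sum subring_graphD(2,3,4)[OF G])

lemma graph_polys_const: "(a, b) \<in> G \<Longrightarrow> graph_polys G [:a:] [:b:]"
  unfolding graph_polys_def by (auto simp: coeff_pCons subring_graphD(6)[OF G] split: nat.split)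

lemma graph_polys_monom: "(a, b) \<in> G \<Longrightarrow> graph_polys G (monom a k) (monom b k)"
  unfolding graph_polys_def by (auto simp: coeff_monom subring_graphD(6)[OF G])

lemma graph_polys_degree: "graph_polys G p q \<Longrightarrow> degree q \<le> degree p"
  unfolding graph_polys_def using subring_graphD(5)[OF G]
  by (intro degree_le) (metis coeff_eq_0)

text \<open>Adjoining an algebraic element: its image is a root of the image of its minimal polynomial.\<close>

lemma subring_graph_extend:
  assumes inv: "\<And>a b. (a, b) \<in> G \<Longrightarrow> a \<noteq> 0 \<Longrightarrow> inverse a \<in> Domain G"
    and alg: "p \<noteq> 0" "\<And>i. coeff p i \<in> Domain G" "poly p x = 0"
  obtains G' where "subring_graph G'" "G \<subseteq> G'" "x \<in> Domain G'"
proof -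
  \<comment> \<open>Monic relations for \<open>x\<close> over the domain of the graph;
    \<open>m\<close> below has least degree among them. Inverses in the domain make every relation
    monic.\<close>
  define M where "M p = (\<exists>q. graph_polys G p q \<and> lead_coeff p = 1 \<and> poly p x = 0)" for p
  have normalise: "\<exists>q. M q \<and> degree q = degree r" if r: "graph_polys G r r'" "r \<noteq> 0" "poly r x = 0" for r r'
  proof -
    have "(lead_coeff r, coeff r' (degree r)) \<in> G" using r(1) unfolding graph_polys_def by blast
    then have "inverse (lead_coeff r) \<in> Domain G" using inv r(2) by (metis leading_coeff_0_iff)
    then obtain b where b: "(inverse (lead_coeff r), b) \<in> G" by (elim DomainE)
    have "M ([:inverse (lead_coeff r):] * r)"
      unfolding M_def using graph_polys_closed(2)[OF graph_polys_const[OF b] r(1)] r by auto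
    moreover have "degree ([:inverse (lead_coeff r):] * r) = degree r" using r(2) by simp
    ultimately show ?thesis by blast
  qed
  have "\<exists>q. \<forall>i. (coeff p i, q i) \<in> G" using alg(2) by (intro choice) blast
  then obtain q0 where q0: "\<And>i. (coeff p i, q0 i) \<in> G" by blast
  have "q0 i = 0" if "i > degree p" for i
    using q0[of i] that subring_graphD(5)[OF G] by (simp add: coeff_eq_0)
  then have "coeff (Abs_poly q0) = q0" by (intro coeff_Abs_poly) auto
  then have "graph_polys G p (Abs_poly q0)" unfolding graph_polys_def using q0 by simp
  from normalise[OF this alg(1,3)] have "\<exists>q. M q" by blast
  then obtain m where m: "M m" "\<And>r. M r \<Longrightarrow> degree m \<le> degree r"
    using exists_least_iff[of "\<lambda>n. \<exists>q. M q \<and> degree q = n"] by (metis not_le)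
  from m(1) obtain m' where m': "graph_polys G m m'" and lm: "lead_coeff m = 1" and mx: "poly m x = 0"
    unfolding M_def by blast
  have low: "r = 0" if "graph_polys G r r'" "poly r x = 0" "degree r < degree m" for r r'
    using normalise[OF that(1) _ that(2)] m(2) that(3) by (metis not_le)
  have dm: "degree m > 0"
  proof (rule ccontr)
    assume "\<not> ?thesis"
    then have "m = [:1:]" using lm by (metis degree_eq_zeroE not_gr_zero lead_coeff_pCons(2))
    then show False using mx by simp
  qed
  have lm': "coeff m' (degree m) = 1"
    using m' lm subring_graphD(8)[OF G _ subring_graphD(1)[OF G]] unfolding graph_polys_def by metis
  then have "degree m' = degree m" using graph_polys_degree[OF m'] le_degree[of m' "degree m"] by simp
  then have "\<not> constant (poly m')" using dm by (simp add: constant_degree)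
  then obtain y where y: "poly m' y = 0" using fundamental_theorem_of_algebra by blast
  \<comment> \<open>Well-definedness of the extension: division by \<open>m\<close>, carried out in
    parallel on both sides of the graph, lowers the degree until minimality forces the relation to
    be 0.\<close>
  have sv: "poly q y = 0" if "graph_polys G p q" "poly p x = 0" for p q
    using that
  proof (induction "degree p" arbitrary: p q rule: less_induct)
    case less
    show ?case
    proof (cases "degree p < degree m")
      case True
      then have "p = 0" using low less.prems by blast
      then have "q = 0" using less.prems(1) subring_graphD(5)[OF G] unfolding graph_polys_def
        by (intro poly_eqI) simp
      then show ?thesis by simp
    next
      case False
      define k where "k = degree p - degree m"
      let ?a = "lead_coeff p" and ?b = "coeff q (degree p)"
      let ?p = "p + - (monom ?a k * m)" and ?q = "q + - (monom ?b k * m')"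
      have ab: "(?a, ?b) \<in> G" using less.prems(1) unfolding graph_polys_def by blast
      have R: "graph_polys G ?p ?q"
        by (rule graph_polys_closed(1)[OF less.prems(1) graph_polys_closed(3)[OF graph_polys_closed(2)[OF graph_polys_monom[OF ab] m'] m']])
      have px: "poly ?p x = 0" using less.prems mx by simp
      have qy: "poly q y = poly ?q y" using y by simp
      have m0: "m \<noteq> 0" using lm by auto
      have top: "coeff (monom ?a k * m) (degree p) = ?a"
        using False lm by (simp add: coeff_monom_mult k_def)
      have dle: "degree (monom ?a k * m) \<le> degree p"
        using False degree_mult_le[of "monom ?a k" m] degree_monom_le[of ?a k] by (simp add: k_def)
      have "degree ?p < degree p"
      proof -
        have "degree ?p \<le> degree p" using dle by (intro degree_add_le) auto
        moreover have "coeff ?p (degree p) = 0" using top by simp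
        moreover have "degree p > 0" using False dm by simp
        ultimately show ?thesis by (metis degree_0 leading_coeff_0_iff le_neq_implies_less)
      qed
      from qy less.hyps[OF this R px] show ?thesis by (rule trans)
    qed
  qed
  define G' where "G' = {(poly p x, poly q y) | p q. graph_polys G p q}"
  have sub: "G \<subseteq> G'"
  proof
    fix z assume "z \<in> G"
    then show "z \<in> G'" unfolding G'_def
      using graph_polys_const[of "fst z" "snd z"] by (auto intro!: exI[of _ "[:fst z:]"] exI[of _ "[:snd z:]"])
  qed
  have xin: "x \<in> Domain G'"
    using graph_polys_monom[OF subring_graphD(1)[OF G], of 1] unfolding G'_def
    by (auto intro!: exI[of _ "monom 1 1"] simp: poly_monom)
  have "subring_graph G'"
    unfolding subring_graph_def
  proof (intro conjI allI impI)
    show "(1, 1) \<in> G'" using sub subring_graphD(1)[OF G] by blast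
    fix a b a' b' assume "(a, b) \<in> G'" "(a', b') \<in> G'"
    then obtain p q p' q' where *: "a = poly p x" "b = poly q y" "graph_polys G p q"
      "a' = poly p' x" "b' = poly q' y" "graph_polys G p' q'" unfolding G'_def by blast
    show "(a + a', b + b') \<in> G'" unfolding G'_def * poly_add[symmetric] using graph_polys_closed(1)[OF *(3,6)] by blast
    show "(a * a', b * b') \<in> G'" unfolding G'_def * poly_mult[symmetric] using graph_polys_closed(2)[OF *(3,6)] by blast
    show "(- a, - b) \<in> G'" unfolding G'_def * poly_minus[symmetric] using graph_polys_closed(3)[OF *(3,6)] by blast
  next
    fix b assume "(0, b) \<in> G'"
    then show "b = 0" unfolding G'_def using sv by auto
  qed
  then show ?thesis using that sub xin by blast
qed

end

text \<open>Zorn's lemma for the graphs that extend \<open>h0\<close>. The domain of a maximal graph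
  is closed under inverses because its elements are algebraic over \<open>F\<close>, so every
  further element could be adjoined.\<close>

lemma algebraic_complex_embedding:
  fixes F :: "'l::field set" and h0 :: "'l \<Rightarrow> complex"
  assumes F: "1 \<in> F" "\<And>a b. a \<in> F \<Longrightarrow> b \<in> F \<Longrightarrow> a + b \<in> F" "\<And>a b. a \<in> F \<Longrightarrow> b \<in> F \<Longrightarrow> a * b \<in> F"
      "\<And>a. a \<in> F \<Longrightarrow> - a \<in> F" "\<And>a. a \<in> F \<Longrightarrow> inverse a \<in> F"
    and h0: "h0 1 = 1" "\<And>a b. a \<in> F \<Longrightarrow> b \<in> F \<Longrightarrow> h0 (a + b) = h0 a + h0 b"
      "\<And>a b. a \<in> F \<Longrightarrow> b \<in> F \<Longrightarrow> h0 (a * b) = h0 a * h0 b"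
    and alg: "\<And>x. \<exists>p. p \<noteq> 0 \<and> (\<forall>i. coeff p i \<in> F) \<and> poly p x = 0"
  obtains h :: "'l \<Rightarrow> complex" where "comm_ring_hom h"
proof -
  define \<A> where "\<A> = {G. subring_graph G \<and> (\<forall>a\<in>F. (a, h0 a) \<in> G)}"
  have F0: "0 \<in> F" using F(2)[OF F(1) F(4)[OF F(1)]] by simp
  have h00: "h0 0 = 0" using h0(2)[OF F0 F0] by simp
  have h0m: "h0 (- a) = - h0 a" if "a \<in> F" for a
  proof -
    have "h0 a + h0 (- a) = 0" using h0(2)[OF that F(4)[OF that]] h00 by simp
    then show ?thesis by (simp add: eq_neg_iff_add_eq_0 add.commute)
  qed
  have "(\<lambda>a. (a, h0 a)) ` F \<in> \<A>"
    unfolding \<A>_def subring_graph_def using F h0 h00 h0m by (auto simp: image_iff)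
  then have ne: "\<A> \<noteq> {}" by blast
  have "\<exists>M\<in>\<A>. \<forall>G\<in>\<A>. M \<subseteq> G \<longrightarrow> G = M"
  proof (rule subset_Zorn_nonempty[OF ne])
    fix \<C> assume C: "\<C> \<noteq> {}" "subset.chain \<A> \<C>"
    then have CA: "\<And>G. G \<in> \<C> \<Longrightarrow> subring_graph G" "\<And>G a. G \<in> \<C> \<Longrightarrow> a \<in> F \<Longrightarrow> (a, h0 a) \<in> G"
      unfolding subset_chain_def \<A>_def by auto
    have two: "\<exists>G\<in>\<C>. u \<in> G \<and> v \<in> G" if uv: "u \<in> \<Union>\<C>" "v \<in> \<Union>\<C>" for u v
    proof -
      obtain G1 G2 where g: "G1 \<in> \<C>" "u \<in> G1" "G2 \<in> \<C>" "v \<in> G2" using uv by blast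
      then have "G1 \<subseteq> G2 \<or> G2 \<subseteq> G1" using C(2) unfolding subset_chain_def by blast
      then show ?thesis using g by blast
    qed
    have "subring_graph (\<Union>\<C>)"
      unfolding subring_graph_def
    proof (intro conjI allI impI)
      show "(1, 1) \<in> \<Union>\<C>" using C(1) CA(1) subring_graphD(1) by blast
      fix a b a' b' assume "(a, b) \<in> \<Union>\<C>" "(a', b') \<in> \<Union>\<C>"
      then obtain G where g: "G \<in> \<C>" "(a, b) \<in> G" "(a', b') \<in> G" using two by blast
      note D = subring_graphD[OF CA(1)[OF g(1)]]
      show "(a + a', b + b') \<in> \<Union>\<C>" "(a * a', b * b') \<in> \<Union>\<C>" "(- a, - b) \<in> \<Union>\<C>"
        using g D(2,3)[OF g(2,3)] D(4)[OF g(2)] by blast+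
    next
      fix b assume "(0, b) \<in> \<Union>\<C>"
      then show "b = 0" using CA(1) subring_graphD(5) by blast
    qed
    then show "\<Union>\<C> \<in> \<A>" unfolding \<A>_def using C(1) CA(2) by blast
  qed
  then obtain M where M: "M \<in> \<A>" "\<And>G. G \<in> \<A> \<Longrightarrow> M \<subseteq> G \<Longrightarrow> G = M" by blast
  have sM: "subring_graph M" and FM: "\<And>a. a \<in> F \<Longrightarrow> (a, h0 a) \<in> M" using M(1) unfolding \<A>_def by auto
  note D = subring_graphD[OF sM]
  \<comment> \<open>In a relation of least degree over \<open>F\<close> the constant term is not 0,
    so the relation can be solved for the inverse.\<close>
  have inv: "inverse a \<in> Domain M" if ab: "(a, b) \<in> M" "a \<noteq> 0" for a b
  proof -
    define alg' where "alg' p \<longleftrightarrow> p \<noteq> 0 \<and> (\<forall>i. coeff p i \<in> F) \<and> poly p a = 0" for p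
    have "\<exists>p. alg' p" unfolding alg'_def by (rule alg)
    then obtain p0 where "alg' p0" ..
    from ex_has_least_nat[of alg', OF this, of degree]
    have "\<exists>p. alg' p \<and> (\<forall>r. alg' r \<longrightarrow> degree p \<le> degree r)" .
    then obtain p where p0: "alg' p \<and> (\<forall>r. alg' r \<longrightarrow> degree p \<le> degree r)" ..
    then have p: "alg' p" "\<And>r. alg' r \<Longrightarrow> degree p \<le> degree r" by simp_all
    obtain c0 r where pr: "p = pCons c0 r" by (cases p)
    have cr: "coeff r i \<in> F" for i using p(1) unfolding alg'_def pr by (metis coeff_pCons_Suc)
    have c0F: "c0 \<in> F" using p(1) unfolding alg'_def pr by (metis coeff_pCons_0)
    have eq: "c0 + a * poly r a = 0" using p(1) unfolding alg'_def pr by simp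
    have "c0 \<noteq> 0"
    proof
      assume "c0 = 0"
      then have "alg' r" using p(1) eq ab(2) cr unfolding alg'_def pr by auto
      moreover have "r \<noteq> 0" using \<open>c0 = 0\<close> p(1) unfolding alg'_def pr by auto
      ultimately show False using p(2)[of r] unfolding pr by simp
    qed
    then have "inverse a = - inverse c0 * poly r a" using eq ab(2)
      by (simp add: field_simps eq_neg_iff_add_eq_0)
    moreover have "poly r a \<in> Domain M"
    proof -
      have "graph_polys M r (map_poly h0 r)"
        unfolding graph_polys_def using FM cr by (simp add: coeff_map_poly h00)
      then have "(\<Sum>i\<le>degree r. coeff r i * a ^ i, \<Sum>i\<le>degree r. coeff (map_poly h0 r) i * b ^ i) \<in> M"
      proof (intro subring_graph_sum[OF sM] D(3))
        fix i
        show "(a ^ i, b ^ i) \<in> M" by (induction i) (simp_all add: D ab)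
      qed (auto simp: graph_polys_def)
      then show ?thesis unfolding poly_altdef by blast
    qed
    moreover have "- inverse c0 \<in> Domain M" using FM[OF F(4)[OF F(5)[OF c0F]]] by blast
    ultimately show ?thesis using D(3) by (metis Domain.simps)
  qed
  have dom: "x \<in> Domain M" for x
  proof -
    obtain p where p: "p \<noteq> 0" "\<And>i. coeff p i \<in> F" "poly p x = 0" using alg by blast
    have cp: "coeff p i \<in> Domain M" for i using FM[OF p(2)[of i]] by blast
    obtain G' where G': "subring_graph G'" "M \<subseteq> G'" "x \<in> Domain G'"
      by (rule subring_graph_extend[OF sM _ p(1) cp p(3)]) (auto intro: inv)
    then have "G' \<in> \<A>" unfolding \<A>_def using FM by blast
    then show ?thesis using M(2)[OF _ G'(2)] G'(3) by simp
  qed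
  then have "\<forall>x. \<exists>y. (x, y) \<in> M" by blast
  from choice[OF this] obtain h where h: "\<And>x. (x, h x) \<in> M" by blast
  have "comm_ring_hom h"
  proof unfold_locales
    fix x y
    show "h (x + y) = h x + h y" by (rule D(8)[OF h D(2)[OF h h]])
    show "h (x * y) = h x * h y" by (rule D(8)[OF h D(3)[OF h h]])
    show "h 0 = 0" by (rule D(8)[OF h D(6)])
    show "h 1 = 1" by (rule D(8)[OF h D(1)])
  qed
  then show ?thesis using that by blast
qed

text \<open>The powers with exponents up to \<open>card B\<close> either repeat or are linearly
  dependent over the rationals; both cases yield a polynomial.\<close>

lemma number_field_algebraic:
  assumes "number_field TYPE('k::field_char_0)"
  shows "\<exists>p. p \<noteq> 0 \<and> (\<forall>i. coeff p i \<in> range of_rat) \<and> poly p (x::'k) = 0"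
proof -
  interpret V: vector_space "\<lambda>(q::rat) (x::'k). of_rat q * x"
    by unfold_locales (simp_all add: algebra_simps of_rat_add of_rat_mult)
  obtain B :: "'k set" where B: "finite B" "V.span B = UNIV"
    using assms unfolding number_field_def by blast
  define n where "n = card B"
  have r: "1 \<in> range (of_rat :: rat \<Rightarrow> 'k)" "0 \<in> range (of_rat :: rat \<Rightarrow> 'k)" "- 1 \<in> range (of_rat :: rat \<Rightarrow> 'k)"
    by (auto intro: range_eqI[of _ _ 1] range_eqI[of _ _ 0] range_eqI[of _ _ "- 1"])
  show ?thesis
  proof (cases "inj_on (\<lambda>i. x ^ i) {..n}")
    case False
    then obtain i j where ij: "i \<noteq> j" "x ^ i = x ^ j" unfolding inj_on_def by blast
    let ?p = "monom 1 i - monom 1 j :: 'k poly"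
    have "coeff ?p i = 1" using ij by simp
    then have "?p \<noteq> 0" by (metis coeff_0 zero_neq_one)
    moreover have "poly ?p x = 0" using ij by (simp add: poly_monom)
    moreover have "coeff ?p k \<in> range of_rat" for k using r by (auto simp: coeff_monom)
    ultimately show ?thesis by blast
  next
    case True
    let ?S = "(\<lambda>i. x ^ i) ` {..n}"
    have "card ?S = Suc n" using True by (simp add: card_image)
    then have "V.dependent ?S" using V.independent_span_bound[OF B(1), of ?S] B(2) n_def by auto
    then obtain S u where S: "finite S" "S \<subseteq> ?S" "\<exists>v\<in>S. u v \<noteq> 0" "(\<Sum>v\<in>S. of_rat (u v) * v) = 0"
      unfolding V.dependent_explicit by blast
    define J where "J = {i\<in>{..n}. x ^ i \<in> S}"
    have SJ: "S = (\<lambda>i. x ^ i) ` J" using S(2) unfolding J_def by auto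
    have injJ: "inj_on (\<lambda>i. x ^ i) J" using True by (rule inj_on_subset) (auto simp: J_def)
    have fJ: "finite J" unfolding J_def by simp
    define p :: "'k poly" where "p = (\<Sum>i\<in>J. monom (of_rat (u (x ^ i))) i)"
    have cp: "coeff p k = (if k \<in> J then of_rat (u (x ^ k)) else 0)" for k
      unfolding p_def coeff_sum coeff_monom using fJ by (simp add: sum.delta')
    obtain k where k: "k \<in> J" "u (x ^ k) \<noteq> 0" using S(3) SJ by blast
    have "coeff p k \<noteq> 0" using k by (simp add: cp)
    then have "p \<noteq> 0" by auto
    moreover have "poly p x = (\<Sum>v\<in>S. of_rat (u v) * v)"
      unfolding p_def SJ sum.reindex[OF injJ] by (simp add: poly_sum poly_monom)
    moreover have "coeff p i \<in> range of_rat" for i unfolding cp using r by auto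
    ultimately show ?thesis using S(4) by auto
  qed
qed

text \<open>Two extensions: from the rationals to \<open>'k\<close>, then from \<open>'k\<close> to
  its closure.\<close>

lemma alg_closure_complex_embedding:
  assumes "number_field TYPE('k::field_char_0)"
  obtains h :: "'k::field_char_0 alg_closure \<Rightarrow> complex" where "comm_ring_hom h"
proof -
  define F where "F = range (of_rat :: rat \<Rightarrow> 'k)"
  define h0 :: "'k \<Rightarrow> complex" where "h0 a = of_rat (THE q. of_rat q = a)" for a
  have h0: "h0 (of_rat q) = of_rat q" for q unfolding h0_def by simp
  obtain g :: "'k \<Rightarrow> complex" where "comm_ring_hom g"
  proof (rule algebraic_complex_embedding[of F h0])
    show "1 \<in> F" unfolding F_def by (rule range_eqI[of _ _ 1]) simp
    show "a + b \<in> F" "a * b \<in> F" "h0 (a + b) = h0 a + h0 b" "h0 (a * b) = h0 a * h0 b" if "a \<in> F" "b \<in> F" for a b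
      using that h0 unfolding F_def by (auto simp flip: of_rat_add of_rat_mult)
    show "- a \<in> F" "inverse a \<in> F" if "a \<in> F" for a
      using that unfolding F_def by (auto simp flip: of_rat_minus of_rat_inverse)
    show "h0 1 = 1" using h0[of 1] by simp
    show "\<exists>p. p \<noteq> 0 \<and> (\<forall>i. coeff p i \<in> F) \<and> poly p x = 0" for x
      unfolding F_def by (rule number_field_algebraic[OF assms])
  qed
  then interpret g: comm_ring_hom g .
  define g0 where "g0 = g \<circ> of_ac"
  have g0: "g0 (to_ac a) = g a" for a by (simp add: g0_def)
  obtain h :: "'k alg_closure \<Rightarrow> complex" where "comm_ring_hom h"
  proof (rule algebraic_complex_embedding[of "range to_ac" g0])
    show "1 \<in> range (to_ac :: 'k \<Rightarrow> _)" by (rule range_eqI[of _ _ 1]) simp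
    show "a + b \<in> range to_ac" "a * b \<in> range to_ac" "g0 (a + b) = g0 a + g0 b" "g0 (a * b) = g0 a * g0 b"
      if "a \<in> range to_ac" "b \<in> range to_ac" for a b :: "'k alg_closure"
      using that by (auto simp flip: to_ac_add to_ac_mult simp: g0 g.hom_add g.hom_mult)
    show "- a \<in> range to_ac" "inverse a \<in> range to_ac" if "a \<in> range to_ac" for a :: "'k alg_closure"
      using that by (auto simp flip: to_ac_minus to_ac_inverse)
    show "g0 1 = 1" using g0[of 1] by simp
    show "\<exists>p. p \<noteq> 0 \<and> (\<forall>i. coeff p i \<in> range to_ac) \<and> poly p x = 0" for x :: "'k alg_closure"
    proof -
      obtain p :: "'k poly" where "p \<noteq> 0" "poly (map_poly to_ac p) x = 0" by (rule alg_closure_algebraic)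
      then show ?thesis by (intro exI[of _ "map_poly to_ac p"]) (auto simp: coeff_map_poly map_poly_eq_0_iff)
    qed
  qed
  then show ?thesis using that by blast
qed

section \<open>Quadratic rational maps over commutative rings\<close>

instance alg_closure :: (field) field_gcd ..

lemma lead_coeff_dyn_qper:
  assumes "N > 0"
  shows "lead_coeff (dyn_den qper N :: 'a::idom poly poly) = 1" "lead_coeff (dyn_num qper N :: 'a poly poly) = 1"
proof -
  have pos: "k > 0" if "k dvd N" for k using that assms by (metis dvd_0_left_iff gr0I not_gr_zero)
  show "lead_coeff (dyn_den qper N :: 'a::idom poly poly) = 1" "lead_coeff (dyn_num qper N :: 'a poly poly) = 1"
    unfolding dyn_den_def dyn_num_def lead_coeff_prod
    by (intro prod.neutral ballI qper_monic(2) pos, simp)+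
qed

lemma (in comm_ring_hom) hom_dyn:
  "hom (dyn_num u N) = dyn_num (\<lambda>k. hom (u k)) N" "hom (dyn_den u N) = dyn_den (\<lambda>k. hom (u k)) N"
  unfolding dyn_num_def dyn_den_def by (rule hom_prod)+

lemma comm_ring_hom_map_poly:
  assumes "comm_ring_hom h"
  shows "comm_ring_hom (map_poly h)"
proof -
  interpret h: comm_ring_hom h by (rule assms)
  interpret h1: map_poly_comm_ring_hom h ..
  show ?thesis by unfold_locales
qed

text \<open>The leading coefficients have product 1 and can be exchanged to make both factors monic;
  a homomorphism to the complex numbers then keeps the degrees.\<close>

lemma qper_quotient_irreducible:
  fixes P A B :: "'k::field_char_0 alg_closure poly poly"
  assumes nf: "number_field TYPE('k)" and N1: "N > 1" and P: "P * dyn_den qper N = dyn_num qper N" and AB: "P = A * B"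
  shows "degree A = 0 \<or> degree B = 0"
proof -
  have N: "N > 0" using N1 by simp
  have "lead_coeff P * lead_coeff (dyn_den qper N :: 'k alg_closure poly poly) = lead_coeff (dyn_num qper N :: 'k alg_closure poly poly)"
    unfolding P[symmetric] lead_coeff_mult ..
  then have "lead_coeff P = 1" using lead_coeff_dyn_qper[OF N, where 'a = "'k alg_closure"] by simp
  then have ab: "lead_coeff A * lead_coeff B = 1" unfolding AB lead_coeff_mult .
  define A' B' where "A' = smult (lead_coeff B) A" and "B' = smult (lead_coeff A) B"
  have lA: "lead_coeff A' = 1" "lead_coeff B' = 1" unfolding A'_def B'_def lead_coeff_smult using ab by (simp_all add: mult.commute)
  have AB': "A' * B' = P" unfolding A'_def B'_def AB using ab by (simp add: mult.commute)
  have dA: "degree A' = degree A" "degree B' = degree B" using ab unfolding A'_def B'_def by auto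
  obtain h :: "'k alg_closure \<Rightarrow> complex" where h: "comm_ring_hom h" using alg_closure_complex_embedding[OF nf] .
  interpret h: comm_ring_hom h by (rule h)
  interpret H: comm_ring_hom "map_poly (map_poly h)" by (intro comm_ring_hom_map_poly h)
  let ?H = "map_poly (map_poly h)"
  have q: "?H (qper k) = qper k" for k
    unfolding qper_def by (simp add: H.hom_qorb H.hom_minus map_poly_pCons)
  have "?H A' * ?H B' * dyn_den qper N = dyn_num qper N"
    using arg_cong[OF P, of ?H] unfolding AB'[symmetric] by (simp only: H.hom_mult H.hom_dyn q)
  note prod = this
  have H: "degree (?H C) = degree C" "lead_coeff (?H C) = 1" if "lead_coeff C = 1" for C
  proof -
    have "C \<noteq> 0" using that by auto
    then show "degree (?H C) = degree C" using that by (intro degree_map_poly) simp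
    then show "lead_coeff (?H C) = 1" using that by (simp add: coeff_map_poly)
  qed
  show ?thesis using dynatomic_monic_split[OF N1 H(2)[OF lA(1)] H(2)[OF lA(2)] prod] H(1)[OF lA(1)] H(1)[OF lA(2)] dA by simp
qed

section \<open>Orbits in homogeneous coordinates modulo primes\<close>

definition qstep :: "(nat \<Rightarrow> 'a::comm_ring_1) \<Rightarrow> 'a \<times> 'a \<Rightarrow> 'a \<times> 'a" where
  "qstep w v = (w 0 * fst v ^ 2 + w 1 * (fst v * snd v) + w 2 * snd v ^ 2,
     w 3 * fst v ^ 2 + w 4 * (fst v * snd v) + w 5 * snd v ^ 2)"

definition orb :: "(nat \<Rightarrow> 'a::comm_ring_1) \<Rightarrow> 'a \<times> 'a \<Rightarrow> nat \<Rightarrow> 'a \<times> 'a" where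
  "orb w v n = (qstep w ^^ n) v"

definition cross :: "'a::comm_ring_1 \<times> 'a \<Rightarrow> 'a \<times> 'a \<Rightarrow> 'a" where
  "cross u v = snd v * fst u - fst v * snd u"

definition per :: "(nat \<Rightarrow> 'a::comm_ring_1) \<Rightarrow> 'a \<times> 'a \<Rightarrow> nat \<Rightarrow> 'a" where
  "per w v n = cross (orb w v n) v"

definition res6 :: "(nat \<Rightarrow> 'a::comm_ring_1) \<Rightarrow> 'a" where
  "res6 w = (w 0 * w 5 - w 2 * w 3) ^ 2 - (w 0 * w 4 - w 1 * w 3) * (w 1 * w 5 - w 2 * w 4)"

lemma orb_0 [simp]: "orb w v 0 = v" and orb_Suc: "orb w v (Suc n) = qstep w (orb w v n)"
  by (simp_all add: orb_def)

lemma orb_Suc_left: "orb w v (Suc n) = orb w (qstep w v) n"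
  by (simp add: orb_def funpow_swap1)

context comm_ring_hom
begin

lemma hom_qstep: "map_prod hom hom (qstep w v) = qstep (\<lambda>i. hom (w i)) (map_prod hom hom v)"
  by (simp add: qstep_def hom_distribs)

lemma hom_orb: "map_prod hom hom (orb w v n) = orb (\<lambda>i. hom (w i)) (map_prod hom hom v) n"
  by (induction n) (simp_all add: orb_Suc hom_qstep)

lemma hom_per: "hom (per w v n) = per (\<lambda>i. hom (w i)) (map_prod hom hom v) n"
  unfolding per_def hom_orb[symmetric] by (simp add: cross_def hom_distribs)

lemma hom_res6: "hom (res6 w) = res6 (\<lambda>i. hom (w i))"
  by (simp add: res6_def hom_distribs)

end

text \<open>The multipliers are cofactors of the first and last column of the Sylvester matrix.\<close>

lemma res6_cubes:
  "res6 w * fst v ^ 3 =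
     ((w 0 * w 5 ^ 2 - w 1 * w 4 * w 5 + w 2 * w 4 ^ 2 - w 2 * w 3 * w 5) * fst v - w 5 * (w 1 * w 5 - w 2 * w 4) * snd v) * fst (qstep w v) +
     ((w 1 ^ 2 * w 5 - w 1 * w 2 * w 4 - w 0 * w 2 * w 5 + w 2 ^ 2 * w 3) * fst v + w 2 * (w 1 * w 5 - w 2 * w 4) * snd v) * snd (qstep w v)"
  "res6 w * snd v ^ 3 =
     ((w 2 * w 3 ^ 2 - w 1 * w 4 * w 3 + w 0 * w 4 ^ 2 - w 0 * w 5 * w 3) * snd v - w 3 * (w 1 * w 3 - w 0 * w 4) * fst v) * fst (qstep w v) +
     ((w 1 ^ 2 * w 3 - w 1 * w 0 * w 4 - w 2 * w 0 * w 3 + w 0 ^ 2 * w 5) * snd v + w 0 * (w 1 * w 3 - w 0 * w 4) * fst v) * snd (qstep w v)"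
  unfolding res6_def qstep_def by (simp_all add: algebra_simps power2_eq_square power3_eq_cube)

text \<open>A congruence form of the fact that the map acts on projective points; it makes
  proportionality modulo a prime invariant under the shift.\<close>

lemma cross_qstep:
  "cross (qstep w u) (qstep w v) = cross u v * ((w 0 * w 4 - w 1 * w 3) * fst u * fst v +
     (w 0 * w 5 - w 2 * w 3) * (fst u * snd v + snd u * fst v) + (w 1 * w 5 - w 2 * w 4) * snd u * snd v)"
  unfolding cross_def qstep_def by (simp add: algebra_simps power2_eq_square)

text \<open>A Pluecker relation: proportionality modulo a prime is transitive through any
  \<open>v\<close> whose entries are not both divisible by it.\<close>

lemma cross_trans:
  "fst v * cross u t = fst u * cross v t + fst t * cross u v"
  "snd v * cross u t = snd u * cross v t + snd t * cross u v"
  unfolding cross_def by (simp_all add: algebra_simps)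

text \<open>Good reduction: by \<open>res6_cubes\<close> a prime that divides both coordinates of an
  image but not the resultant already divides both coordinates of the point.\<close>

lemma orb_not_both_dvd:
  assumes p: "prime_elem p" and r: "\<not> p dvd res6 w" and v: "\<not> (p dvd fst v \<and> p dvd snd v)"
  shows "\<not> (p dvd fst (orb w v n) \<and> p dvd snd (orb w v n))"
proof (induction n)
  case (Suc n)
  show ?case
  proof
    assume "p dvd fst (orb w v (Suc n)) \<and> p dvd snd (orb w v (Suc n))"
    then have d: "p dvd fst (qstep w (orb w v n))" "p dvd snd (qstep w (orb w v n))" by (simp_all add: orb_Suc)
    have "p dvd res6 w * fst (orb w v n) ^ 3" "p dvd res6 w * snd (orb w v n) ^ 3"
      unfolding res6_cubes by (rule dvd_add[OF dvd_mult[OF d(1)] dvd_mult[OF d(2)]])+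
    then have "p dvd fst (orb w v n) \<and> p dvd snd (orb w v n)"
      using r prime_elem_dvd_multD[OF p] prime_elem_dvd_power[OF p] by blast
    then show False using Suc by blast
  qed
qed (use v in simp)

lemma per_dvd_multiples:
  assumes p: "prime_elem p" and r: "\<not> p dvd res6 w" and v: "\<not> (p dvd fst v \<and> p dvd snd v)"
  obtains d where "\<And>k. p dvd per w v k \<longleftrightarrow> d dvd k"
proof (rule period_set_multiples[of "\<lambda>i j. p dvd cross (orb w v i) (orb w v j)"])
  have swap: "cross u t = - cross t u" for u t by (simp add: cross_def algebra_simps)
  show sym: "p dvd cross (orb w v j) (orb w v i)" if "p dvd cross (orb w v i) (orb w v j)" for i j
    using that by (subst swap) simp
  show "p dvd cross (orb w v i) (orb w v i)" for i by (simp add: cross_def)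
  show "p dvd cross (orb w v (Suc i)) (orb w v (Suc j))" if "p dvd cross (orb w v i) (orb w v j)" for i j
    unfolding orb_Suc cross_qstep using that by simp
  show "p dvd cross (orb w v i) (orb w v k)"
    if "p dvd cross (orb w v i) (orb w v j)" "p dvd cross (orb w v j) (orb w v k)" for i j k
  proof -
    have "p dvd fst (orb w v j) * cross (orb w v i) (orb w v k)" "p dvd snd (orb w v j) * cross (orb w v i) (orb w v k)"
      unfolding cross_trans[of "orb w v j"] using that by simp_all
    then show ?thesis using orb_not_both_dvd[OF p r v, of j] p by (auto simp: prime_elem_dvd_mult_iff)
  qed
  fix d assume d: "\<And>k. p dvd cross (orb w v 0) (orb w v k) \<longleftrightarrow> d dvd k"
  have "p dvd per w v k \<longleftrightarrow> d dvd k" for k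
    unfolding per_def d[symmetric] by (subst swap) simp
  then show thesis by (rule that)
qed

section \<open>Top coefficients and affine charts\<close>

lemma coeff_mult_top:
  fixes p q :: "'a::comm_ring_1 poly"
  assumes "degree p \<le> m" "degree q \<le> n"
  shows "coeff (p * q) (m + n) = coeff p m * coeff q n"
proof -
  have "coeff (p * q) (m + n) = (\<Sum>i\<le>m + n. coeff p i * coeff q (m + n - i))" by (rule coeff_mult)
  also have "\<dots> = (\<Sum>i\<in>{m}. coeff p i * coeff q (m + n - i))"
  proof (rule sum.mono_neutral_right)
    show "\<forall>i\<in>{..m + n} - {m}. coeff p i * coeff q (m + n - i) = 0"
    proof
      fix i assume i: "i \<in> {..m + n} - {m}"
      show "coeff p i * coeff q (m + n - i) = 0"
      proof (cases "i > m")
        case True then show ?thesis using assms(1) by (simp add: coeff_eq_0)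
      next
        case False
        then have "m + n - i > n" using i by auto
        then show ?thesis using assms(2) by (simp add: coeff_eq_0)
      qed
    qed
  qed auto
  finally show ?thesis by simp
qed

lemma qstep_poly_top:
  fixes w :: "nat \<Rightarrow> 'a::comm_ring_1"
  assumes "degree (fst v) \<le> m" "degree (snd v) \<le> m"
  shows "degree (fst (qstep (\<lambda>i. [:w i:]) v)) \<le> m + m" "degree (snd (qstep (\<lambda>i. [:w i:]) v)) \<le> m + m"
    "(coeff (fst (qstep (\<lambda>i. [:w i:]) v)) (m + m), coeff (snd (qstep (\<lambda>i. [:w i:]) v)) (m + m)) =
       qstep w (coeff (fst v) m, coeff (snd v) m)"
proof -
  have d: "degree (fst v * fst v) \<le> m + m" "degree (fst v * snd v) \<le> m + m" "degree (snd v * snd v) \<le> m + m"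
    using assms by (auto intro!: order_trans[OF degree_mult_le] add_mono)
  have s: "degree (smult a p) \<le> m + m" if "degree p \<le> m + m" for a :: 'a and p
    using degree_smult_le[of a p] that by simp
  show "degree (fst (qstep (\<lambda>i. [:w i:]) v)) \<le> m + m" "degree (snd (qstep (\<lambda>i. [:w i:]) v)) \<le> m + m"
    unfolding qstep_def using d by (auto simp: power2_eq_square intro!: degree_add_le s)
  show "(coeff (fst (qstep (\<lambda>i. [:w i:]) v)) (m + m), coeff (snd (qstep (\<lambda>i. [:w i:]) v)) (m + m)) =
       qstep w (coeff (fst v) m, coeff (snd v) m)"
    unfolding qstep_def using coeff_mult_top[OF assms(1) assms(1)] coeff_mult_top[OF assms(1,2)] coeff_mult_top[OF assms(2) assms(2)]
    by (simp add: power2_eq_square)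
qed

text \<open>The pair of top coefficients is itself an orbit, namely that of the point at infinity of
  the parametrised line.\<close>

lemma orb_poly_top:
  fixes w :: "nat \<Rightarrow> 'a::comm_ring_1"
  assumes "degree (fst v) \<le> 1" "degree (snd v) \<le> 1"
  shows "degree (fst (orb (\<lambda>i. [:w i:]) v n)) \<le> 2 ^ n \<and> degree (snd (orb (\<lambda>i. [:w i:]) v n)) \<le> 2 ^ n \<and>
    (coeff (fst (orb (\<lambda>i. [:w i:]) v n)) (2 ^ n), coeff (snd (orb (\<lambda>i. [:w i:]) v n)) (2 ^ n)) =
       orb w (coeff (fst v) 1, coeff (snd v) 1) n"
proof (induction n)
  case (Suc n)
  have e: "(2::nat) ^ Suc n = 2 ^ n + 2 ^ n" by simp
  show ?case unfolding orb_Suc e using Suc qstep_poly_top[of "orb (\<lambda>i. [:w i:]) v n" "2 ^ n" w] by simp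
qed (use assms in simp)

lemma per_poly_top:
  fixes w :: "nat \<Rightarrow> 'a::comm_ring_1"
  assumes "degree (fst v) \<le> 1" "degree (snd v) \<le> 1"
  shows "degree (per (\<lambda>i. [:w i:]) v n) \<le> 2 ^ n + 1"
    "coeff (per (\<lambda>i. [:w i:]) v n) (2 ^ n + 1) = per w (coeff (fst v) 1, coeff (snd v) 1) n"
proof -
  let ?o = "orb (\<lambda>i. [:w i:]) v n"
  have o: "degree (fst ?o) \<le> 2 ^ n" "degree (snd ?o) \<le> 2 ^ n"
    "orb w (coeff (fst v) 1, coeff (snd v) 1) n = (coeff (fst ?o) (2 ^ n), coeff (snd ?o) (2 ^ n))"
    using orb_poly_top[OF assms, of w n] by auto
  show "degree (per (\<lambda>i. [:w i:]) v n) \<le> 2 ^ n + 1"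
    unfolding per_def cross_def
    using order_trans[OF degree_mult_le add_mono[OF assms(2) o(1)]] order_trans[OF degree_mult_le add_mono[OF assms(1) o(2)]]
    by (intro degree_diff_le) simp_all
  show "coeff (per (\<lambda>i. [:w i:]) v n) (2 ^ n + 1) = per w (coeff (fst v) 1, coeff (snd v) 1) n"
    unfolding per_def cross_def o(3)
    using coeff_mult_top[OF assms(2) o(1)] coeff_mult_top[OF assms(1) o(2)] by simp
qed

text \<open>The period polynomials in the affine chart \<open>z \<mapsto> [z : 1 + \<kappa> z]\<close>; its point at infinity is
  \<open>[1 : \<kappa>]\<close>.\<close>

definition zper :: "(nat \<Rightarrow> 'a::comm_ring_1) \<Rightarrow> 'a \<Rightarrow> nat \<Rightarrow> 'a poly" where
  "zper w \<kappa> n = per (\<lambda>i. [:w i:]) ([:0, 1:], [:1, \<kappa>:]) n"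

lemma zper_top: "degree (zper w \<kappa> n) \<le> 2 ^ n + 1" "coeff (zper w \<kappa> n) (2 ^ n + 1) = per w (1, \<kappa>) n"
  unfolding zper_def using per_poly_top[of "([:0, 1:], [:1, \<kappa>:])" w n] by auto

lemma degree_zper: "per w (1, \<kappa>) n \<noteq> 0 \<Longrightarrow> degree (zper w \<kappa> n) = 2 ^ n + 1"
  using zper_top[of w \<kappa> n] le_degree[of "zper w \<kappa> n" "2 ^ n + 1"] by simp

lemma (in comm_ring_hom) map_poly_zper: "map_poly hom (zper w \<kappa> n) = zper (\<lambda>i. hom (w i)) (hom \<kappa>) n"
proof -
  interpret M: comm_ring_hom "map_poly hom" by (rule comm_ring_hom_map_poly) unfold_locales
  have c: "map_poly hom [:a:] = [:hom a:]" for a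
    by (rule poly_eqI) (simp add: coeff_map_poly coeff_pCons split: nat.split)
  have "map_poly hom [:0, 1:] = [:0, 1:]" "map_poly hom [:1, \<kappa>:] = [:1, hom \<kappa>:]"
    by (rule poly_eqI, simp add: coeff_map_poly coeff_pCons split: nat.split)+
  then show ?thesis unfolding zper_def M.hom_per c by simp
qed

lemma poly_zper: "poly (zper w \<kappa> n) z = per w (z, 1 + z * \<kappa>) n"
  unfolding zper_def poly_hom.hom_per by simp

text \<open>The coefficients of \<open>z\<^sup>2 + c\<close> in the coordinate of the chart, so that \<open>[1 : \<kappa>]\<close> is its
  fixed critical point.\<close>

definition wM :: "'a::comm_ring_1 \<Rightarrow> 'a \<Rightarrow> nat \<Rightarrow> 'a" where
  "wM c \<kappa> i = (if i = 0 then 1 + c * \<kappa>\<^sup>2 else if i = 1 then - 2 * c * \<kappa> else if i = 2 then c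
     else if i = 3 then \<kappa>\<^sup>2 + \<kappa> * (1 + c * \<kappa>\<^sup>2) else if i = 4 then - 2 * \<kappa> - 2 * c * \<kappa>\<^sup>2 else if i = 5 then 1 + \<kappa> * c else 0)"

lemma (in comm_ring_hom) hom_wM: "hom (wM c \<kappa> i) = wM (hom c) (hom \<kappa>) i"
  by (simp add: wM_def hom_distribs)

text \<open>No scaling factor appears, so the period polynomials of the family at
  \<open>t = 0\<close> are equal to \<open>qper\<close> and not merely proportional to it.\<close>

lemma orb_wM: "orb (wM c \<kappa>) (z, 1 + \<kappa> * z) n = (qorb c z n, 1 + \<kappa> * qorb c z n)"
  by (induction n) (simp_all add: orb_Suc qorb_Suc qstep_def wM_def algebra_simps power2_eq_square)

lemma per_wM: "per (wM c \<kappa>) (z, 1 + \<kappa> * z) n = qorb c z n - z"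
  unfolding per_def orb_wM cross_def by (simp add: algebra_simps)

lemma zper_wM: "zper (wM c \<kappa>) \<kappa> n = qorb [:c:] [:0, 1:] n - [:0, 1:]"
proof -
  have c: "comm_ring_hom (\<lambda>a::'a. [:a:])" by unfold_locales (simp_all add: one_pCons)
  have w: "(\<lambda>i. [:wM c \<kappa> i:]) = wM [:c:] [:\<kappa>:]" by (rule ext) (rule comm_ring_hom.hom_wM[OF c])
  have "[:1, \<kappa>:] = 1 + [:\<kappa>:] * [:0, 1:]" by (simp add: one_pCons)
  then show ?thesis unfolding zper_def w using per_wM[of "[:c:]" "[:\<kappa>:]" "[:0, 1:]" n] by simp
qed

text \<open>By pseudo-division a non-zero element \<open>m\<close> of least degree in the ideal of
  \<open>p\<close> and \<open>q\<close> divides every element up to a constant factor. If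
  \<open>m\<close> had positive degree, then \<open>p\<close> would divide it and hence a constant
  multiple of \<open>q\<close>.\<close>

lemma prime_poly_bezout:
  fixes p q :: "'a::idom poly"
  assumes p: "prime_elem p" and dp: "degree p > 0" and npq: "\<not> p dvd q"
  obtains r u v where "r \<noteq> 0" "[:r:] = u * p + v * q"
proof -
  define J where "J = {f. \<exists>u v. f = u * p + v * q}"
  have p0: "p \<noteq> 0" using dp by auto
  have "p = 1 * p + 0 * q" "q = 0 * p + 1 * q" by simp_all
  then have pJ: "p \<in> J" "q \<in> J" unfolding J_def by blast+
  have J: "smult a f - m * g \<in> J" if fJ: "f \<in> J" and mJ: "m \<in> J" for f m g a
  proof -
    obtain u v where "f = u * p + v * q" using fJ unfolding J_def by blast
    moreover obtain u' v' where "m = u' * p + v' * q" using mJ unfolding J_def by blast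
    ultimately have "smult a f - m * g = ([:a:] * u - u' * g) * p + ([:a:] * v - v' * g) * q"
      by (simp add: algebra_simps smult_add_right)
    then show ?thesis unfolding J_def by blast
  qed
  have "p \<in> J \<and> p \<noteq> 0" using pJ p0 by blast
  from ex_has_least_nat[of "\<lambda>f. f \<in> J \<and> f \<noteq> 0", OF this, of degree]
  obtain m where m: "m \<in> J" "m \<noteq> 0" and least: "\<And>f. f \<in> J \<Longrightarrow> f \<noteq> 0 \<Longrightarrow> degree m \<le> degree f" by blast
  have divides: "\<exists>a g. a \<noteq> 0 \<and> smult a f = m * g" if "f \<in> J" for f
  proof -
    obtain a g where ag: "a \<noteq> 0" "smult a f = m * g + pseudo_mod f m" using pseudo_mod(1)[OF m(2), of f] by blast
    then have eq: "pseudo_mod f m = smult a f - m * g" by simp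
    have "pseudo_mod f m \<in> J" unfolding eq by (rule J[OF that m(1)])
    then have "pseudo_mod f m = 0" using pseudo_mod(2)[OF m(2), of f] least by (metis not_le)
    then show ?thesis using ag by auto
  qed
  have "degree m = 0"
  proof (rule ccontr)
    assume dm: "degree m \<noteq> 0"
    obtain a g where ag: "a \<noteq> 0" "smult a p = m * g" using divides[OF pJ(1)] by blast
    have "p dvd m * g" unfolding ag(2)[symmetric] by (rule dvd_smult) simp
    then have "p dvd m \<or> p dvd g" using p by (simp add: prime_elem_dvd_mult_iff)
    moreover have "\<not> p dvd g"
    proof
      assume "p dvd g"
      then obtain g' where "g = p * g'" by blast
      then have "p * [:a:] = p * (m * g')" using ag(2) by (simp add: mult_ac)
      then have e: "[:a:] = m * g'" using p0 by (simp only: mult_cancel_left) simp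
      then have "g' \<noteq> 0" using ag(1) by auto
      then have "degree [:a:] = degree m + degree g'" unfolding e using m(2) by (rule degree_mult_eq[rotated])
      then show False using dm by simp
    qed
    ultimately have pm: "p dvd m" by blast
    obtain b k where bk: "b \<noteq> 0" "smult b q = m * k" using divides[OF pJ(2)] by blast
    have "p dvd [:b:] * q" using pm bk(2) by simp
    then have "p dvd [:b:]" using npq prime_elem_dvd_multD[OF p] by blast
    then have "degree p \<le> degree [:b:]" using bk(1) by (intro dvd_imp_degree_le) auto
    then show False using dp by simp
  qed
  then obtain r where r: "m = [:r:]" by (rule degree_eq_zeroE)
  obtain u v where "m = u * p + v * q" using m(1) unfolding J_def by blast
  moreover have "r \<noteq> 0" using r m(2) by auto
  ultimately show ?thesis using that[of r u v] r by simp
qed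

lemma prime_factor_pos_degree:
  fixes f :: "'a::{factorial_ring_gcd,semiring_gcd_mult_normalize} poly"
  assumes "degree f > 0"
  shows "\<exists>q. prime q \<and> q dvd f \<and> degree q > 0"
  using assms
proof (induction f rule: prime_divisors_induct)
  case (unit f)
  then have "degree f = 0" by (simp add: is_unit_iff_degree poly_dvd_1)
  then show ?case using unit by simp
next
  case (factor p f)
  show ?case
  proof (cases "degree p > 0")
    case True then show ?thesis using factor by auto
  next
    case False
    then have "degree f > 0" using factor.prems degree_mult_le[of p f] by simp
    then show ?thesis using factor.IH by (meson dvd_mult)
  qed
qed simp

lemma bivariate_nonzero_point:
  fixes B :: "'a::field_char_0 poly poly"
  assumes "B \<noteq> 0"
  obtains t c where "poly (poly B [:t:]) c \<noteq> 0"
proof -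
  have "finite {x. poly B x = 0}" by (rule poly_roots_finite[OF assms])
  then have "finite ((\<lambda>t. [:t:]) -` {x. poly B x = 0})" by (rule finite_vimageI) (simp add: inj_def)
  then obtain t where t: "poly B [:t:] \<noteq> 0" using infinite_UNIV_char_0[where 'a='a] ex_new_if_finite by blast
  have "finite {x. poly (poly B [:t:]) x = 0}" by (rule poly_roots_finite[OF t])
  then obtain c where "poly (poly B [:t:]) c \<noteq> 0" using infinite_UNIV_char_0[where 'a='a] ex_new_if_finite by blast
  then show ?thesis using that by blast
qed

section \<open>A two-parameter family joining two rational maps to the quadratic family\<close>

text \<open>Interpolates between \<open>w2\<close> at \<open>t = - 1\<close>, the polynomial \<open>z\<^sup>2 + c\<close> at \<open>t = 0\<close> and \<open>w1\<close> at \<open>t = 1\<close>.\<close>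

definition fam :: "(nat \<Rightarrow> 'a::field) \<Rightarrow> (nat \<Rightarrow> 'a) \<Rightarrow> 'a \<Rightarrow> 'a \<Rightarrow> 'a \<Rightarrow> nat \<Rightarrow> 'a" where
  "fam w1 w2 \<kappa> t c i = (1 - t\<^sup>2) * wM c \<kappa> i + ((t\<^sup>2 + t) / 2) * w1 i + ((t\<^sup>2 - t) / 2) * w2 i"

text \<open>The same family with indeterminates \<open>c\<close> (inner) and \<open>t\<close> (outer).\<close>

definition famA :: "(nat \<Rightarrow> 'a::field) \<Rightarrow> (nat \<Rightarrow> 'a) \<Rightarrow> 'a \<Rightarrow> nat \<Rightarrow> 'a poly poly" where
  "famA w1 w2 \<kappa> i = (1 - [:0, 1:]\<^sup>2) * wM [:[:0, 1:]:] [:[:\<kappa>:]:] i +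
     ([:0, 1:]\<^sup>2 + [:0, 1:]) * [:[:w1 i / 2:]:] + ([:0, 1:]\<^sup>2 - [:0, 1:]) * [:[:w2 i / 2:]:]"

lemma poly_famA: "poly (poly (famA w1 w2 \<kappa> i) [:t:]) c = fam w1 w2 \<kappa> t c i"
  unfolding famA_def fam_def by (simp add: poly_hom.hom_wM field_simps)

lemma famA_0: "poly (famA w1 w2 \<kappa> i) 0 = wM [:0, 1:] [:\<kappa>:] i"
  unfolding famA_def by (simp add: poly_hom.hom_wM)

lemma fam_1: "fam w1 w2 \<kappa> 1 c = (w1 :: nat \<Rightarrow> 'a::field_char_0)" "fam w1 w2 \<kappa> (- 1) c = (w2 :: nat \<Rightarrow> 'a)"
  by (rule ext, simp add: fam_def)+

abbreviation spec2 :: "'a::comm_ring_1 poly poly poly \<Rightarrow> 'a \<Rightarrow> 'a \<Rightarrow> 'a poly" where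
  "spec2 D t c \<equiv> spec (spec D [:t:]) c"

interpretation spec2_hom: comm_ring_hom "\<lambda>D. spec2 D (t :: 'a::comm_ring_1) c" for t c
  by unfold_locales (simp_all add: spec_hom.hom_add spec_hom.hom_mult)

lemma spec_zper: "spec (zper w \<kappa> k) x = zper (\<lambda>i. poly (w i) x) (poly \<kappa> x) k"
  by (rule comm_ring_hom.map_poly_zper) unfold_locales

lemma spec_const: "spec [:a:] x = [:poly a x:]"
  by (rule poly_eqI) (simp add: coeff_map_poly coeff_pCons split: nat.split)

lemma smult_eq_const_mult: "smult a p = [:a:] * p"
  by simp

lemma degree_spec_le: "degree (spec p x) \<le> degree p"
  by (rule degree_map_poly_le)

text \<open>The Moebius values of the divisors of \<open>N > 1\<close> sum to 0, so raising all
  degrees by 1 does not change the degree of the quotient.\<close>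

lemma sum_num_den_card:
  assumes "N > 1"
  shows "(\<Sum>k | k dvd N \<and> Defs.moebius (N div k) = 1. f k + 1) + (\<Sum>k | k dvd N \<and> Defs.moebius (N div k) = - 1. f k)
    = (\<Sum>k | k dvd N \<and> Defs.moebius (N div k) = 1. f k) + (\<Sum>k | k dvd N \<and> Defs.moebius (N div k) = - 1. f k + 1 :: nat)"
proof -
  have "(\<Sum>k | k dvd N \<and> Defs.moebius (N div k) = 1. 1::nat) = (\<Sum>k | k dvd N \<and> Defs.moebius (N div k) = - 1. 1)"
    using sum_num_den[of N "\<lambda>_. 1" 1] assms by simp
  then show ?thesis by (simp only: sum.distrib)
qed

text \<open>The term \<open>2 ^ N\<close> outweighs all smaller powers of 2 together.\<close>

lemma degree_den_less_num:
  assumes "N > 1"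
  shows "(\<Sum>k | k dvd N \<and> Defs.moebius (N div k) = - 1. 2 ^ k) < (\<Sum>k | k dvd N \<and> Defs.moebius (N div k) = 1. 2 ^ k :: nat)"
proof -
  have fin: "finite {k. k dvd N}" using assms by simp
  have m1: "Defs.moebius 1 = 1" by (simp add: Defs.moebius_def)
  have "(\<Sum>k | k dvd N \<and> Defs.moebius (N div k) = - 1. 2 ^ k :: nat) \<le> (\<Sum>k<N. 2 ^ k)"
  proof (rule sum_mono2)
    show "{k. k dvd N \<and> Defs.moebius (N div k) = - 1} \<subseteq> {..<N}"
    proof
      fix k assume k: "k \<in> {k. k dvd N \<and> Defs.moebius (N div k) = - 1}"
      then have "k \<noteq> N" using assms m1 by auto
      moreover have "k \<le> N" using k assms by (auto intro: dvd_imp_le)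
      ultimately show "k \<in> {..<N}" by simp
    qed
  qed auto
  also have "(\<Sum>k<N. 2 ^ k :: nat) < 2 ^ N" by (induction N) auto
  also have "2 ^ N \<le> (\<Sum>k | k dvd N \<and> Defs.moebius (N div k) = 1. 2 ^ k :: nat)"
    using fin m1 assms by (intro member_le_sum) auto
  finally show ?thesis .
qed

lemma degree_dyn:
  fixes u :: "nat \<Rightarrow> 'a::idom poly"
  assumes "\<And>k. k dvd N \<Longrightarrow> u k \<noteq> 0" "\<And>k. k dvd N \<Longrightarrow> degree (u k) = f k"
  shows "degree (dyn_num u N) = (\<Sum>k | k dvd N \<and> Defs.moebius (N div k) = 1. f k)"
    "degree (dyn_den u N) = (\<Sum>k | k dvd N \<and> Defs.moebius (N div k) = - 1. f k)"
  unfolding dyn_num_def dyn_den_def using assms by (auto simp: degree_prod_eq_sum_degree intro!: sum.cong)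

context
  fixes w1 w2 :: "nat \<Rightarrow> 'a::{field_char_0,field_gcd,alg_closed_field}" and \<kappa> :: 'a and N :: nat
  assumes N1: "N > 1"
    and irr: "\<And>P A B :: 'a poly poly. P * dyn_den qper N = dyn_num qper N \<Longrightarrow> P = A * B \<Longrightarrow> degree A = 0 \<or> degree B = 0"
    and res1: "res6 w1 \<noteq> 0" and res2: "res6 w2 \<noteq> 0"
    and top1: "\<And>k. k dvd N \<Longrightarrow> per w1 (1, \<kappa>) k \<noteq> 0" and top2: "\<And>k. k dvd N \<Longrightarrow> per w2 (1, \<kappa>) k \<noteq> 0"
begin

private abbreviation "W \<equiv> famA w1 w2 \<kappa>"
text \<open>The variables are c (innermost), t, and the chart coordinate z (outermost).\<close>

private abbreviation "U \<equiv> zper W [:[:\<kappa>:]:]"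

private lemma N0: "N > 0" using N1 by simp

private lemma pos_dvd: "k dvd N \<Longrightarrow> k > 0"
  using N0 by (metis dvd_0_left_iff gr0I not_gr_zero)

private lemma spec_U_0: "spec (U k) 0 = qper k"
  unfolding spec_zper famA_0 by (simp add: zper_wM qper_def)

private lemma spec2_U: "spec2 (U k) t c = zper (fam w1 w2 \<kappa> t c) \<kappa> k"
  unfolding spec_zper poly_famA by simp

private lemma eval_per_W: "poly (poly (per W (1, [:[:\<kappa>:]:]) k) [:t:]) c = per (fam w1 w2 \<kappa> t c) (1, \<kappa>) k"
  unfolding poly_hom.hom_per by (simp add: poly_famA)

private lemma eval_res_W: "poly (poly (res6 W) [:t:]) c = res6 (fam w1 w2 \<kappa> t c)"
  unfolding poly_hom.hom_res6 poly_famA ..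

private lemma per_W_nz: "k dvd N \<Longrightarrow> per W (1, [:[:\<kappa>:]:]) k \<noteq> 0"
  using eval_per_W[of k 1 0] top1[of k] by (auto simp: fam_1)

private lemma res_W_nz: "res6 W \<noteq> 0"
  using eval_res_W[of 1 0] res1 by (auto simp: fam_1)

private lemma degree_U: "k dvd N \<Longrightarrow> degree (U k) = 2 ^ k + 1"
  by (rule degree_zper[OF per_W_nz])

private lemma U_nz: "k dvd N \<Longrightarrow> U k \<noteq> 0"
  using degree_U[of k] by auto

text \<open>The resultant of the family is non-zero and free of z, so \<open>p\<close> does not
  divide it and the return times are the multiples of some \<open>d\<close>. Squares are excluded at
  \<open>t = 0\<close>.\<close>

private lemma U_multiplicity:
  fixes p :: "'a poly poly poly"
  assumes p: "prime p" and dp: "degree p > 0"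
  obtains d where "\<And>k. k dvd N \<Longrightarrow> multiplicity p (U k) = of_bool (d dvd k)"
proof -
  have pe: "prime_elem p" using p by simp
  have pc: "\<not> p dvd [:a:]" if "a \<noteq> 0" for a
  proof
    assume "p dvd [:a:]"
    then have "degree p \<le> degree [:a:]" using that by (intro dvd_imp_degree_le) auto
    then show False using dp by simp
  qed
  have c: "comm_ring_hom (\<lambda>a::'a poly poly. [:a:])" by unfold_locales (simp_all add: one_pCons)
  have r: "\<not> p dvd res6 (\<lambda>i. [:W i:])"
    unfolding comm_ring_hom.hom_res6[OF c, symmetric] by (rule pc[OF res_W_nz])
  have v: "\<not> (p dvd fst ([:0, 1:], [:1, [:[:\<kappa>:]:]:]) \<and> p dvd snd ([:0, 1:], [:1, [:[:\<kappa>:]:]:]))"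
  proof
    assume a: "p dvd fst ([:0, 1:], [:1, [:[:\<kappa>:]:]:]) \<and> p dvd snd ([:0, 1:], [:1, [:[:\<kappa>:]:]:])"
    have "[:1:] = [:1, [:[:\<kappa>:]:]:] - [:[:[:\<kappa>:]:]:] * [:0, 1:]" by simp
    then have "p dvd [:1:]" using a by (metis dvd_diff dvd_mult fst_conv snd_conv)
    then show False using pc[of 1] by simp
  qed
  obtain d where d: "\<And>k. p dvd U k \<longleftrightarrow> d dvd k"
    unfolding zper_def using per_dvd_multiples[OF pe r v] by blast
  have "multiplicity p (U k) = of_bool (d dvd k)" if k: "k dvd N" for k
  proof (cases "p dvd U k")
    case False
    then show ?thesis using d by (simp add: not_dvd_imp_multiplicity_0)
  next
    case True
    have "\<not> p ^ 2 dvd U k"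
    proof
      assume "p ^ 2 dvd U k"
      then obtain q where q: "U k = p ^ 2 * q" by blast
      have qp: "qper k = spec p 0 ^ 2 * spec q 0"
        unfolding spec_U_0[symmetric] q by (simp only: spec_hom.hom_mult spec_hom.hom_power)
      have k0: "k > 0" by (rule pos_dvd[OF k])
      have nz: "spec p 0 \<noteq> 0" "spec q 0 \<noteq> 0" using qp qper_monic(3)[OF k0, where 'a='a] by auto
      have "q \<noteq> 0" "p \<noteq> 0" using q U_nz[OF k] by auto
      then have "2 ^ k + 1 = 2 * degree p + degree q"
        using degree_U[OF k] unfolding q by (simp add: degree_mult_eq degree_power_eq)
      moreover have "2 ^ k = 2 * degree (spec p 0) + degree (spec q 0)"
        using qper_monic(1)[OF k0, where 'a='a] nz unfolding qp by (simp add: degree_mult_eq degree_power_eq)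
      moreover note degree_spec_le[of 0 p] degree_spec_le[of 0 q]
      \<comment> \<open>\<open>U k\<close> loses exactly one degree at \<open>t = 0\<close>. A loss
        in \<open>p ^ 2\<close> would be even, so it takes place in \<open>q\<close>, and
        \<open>p\<close> keeps its degree.\<close>
      ultimately have "degree (spec p 0) = degree p" by linarith
      then have "degree (spec p 0) > 0" using dp by simp
      then obtain f where f: "prime f" "f dvd spec p 0" using prime_factor_pos_degree by blast
      have "f ^ 2 dvd qper k" unfolding qp using f(2) by (intro dvd_mult2 dvd_power_same)
      then have "2 \<le> multiplicity f (qper k)"
        using f(1) qper_monic(3)[OF k0, where 'a='a] by (intro multiplicity_geI) auto
      moreover obtain e where "\<And>k. k > 0 \<Longrightarrow> multiplicity f (qper k) = of_bool (e dvd k)"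
        by (rule qper_multiplicity[OF f(1)]) blast
      ultimately show False using k0 by (cases "e dvd k") simp_all
    qed
    then have "multiplicity p (U k) < 2" using multiplicity_dvd'[of 2 p "U k"] by (metis not_le)
    moreover have "multiplicity p (U k) \<ge> 1"
      using True p U_nz[OF k] by (intro multiplicity_geI) auto
    ultimately show ?thesis using True d by simp
  qed
  then show ?thesis by (rule that)
qed

text \<open>Return times do not control primes free of z. These are collected in the content
  \<open>e\<close> of the denominator, and only the primitive part is divided out.\<close>

private lemma dyn_U_quotient:
  obtains e :: "'a poly poly" and D where "smult e (dyn_num U N) = D * dyn_den U N" "[:e:] dvd dyn_den U N"
proof -
  let ?n = "dyn_num U N" and ?d = "dyn_den U N"
  have nz: "?n \<noteq> 0" "?d \<noteq> 0" using dyn_nonzero[OF N0, of U] U_nz by auto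
  let ?d' = "primitive_part ?d"
  have d'0: "?d' \<noteq> 0" using nz by simp
  have dec: "smult (Polynomial.content ?d) ?d' = ?d" by (rule content_times_primitive_part)
  have "?d' dvd ?n"
  proof (rule multiplicity_le_imp_dvd[OF d'0])
    fix p :: "'a poly poly poly" assume p: "prime p"
    show "multiplicity p ?d' \<le> multiplicity p ?n"
    proof (cases "degree p = 0")
      case True
      then obtain a where a: "p = [:a:]" by (rule degree_eq_zeroE)
      have "\<not> p dvd ?d'"
      proof
        assume "p dvd ?d'"
        then have "a dvd Polynomial.content ?d'" unfolding a const_poly_dvd_iff_dvd_content .
        then have "a dvd 1" using nz(2) by simp
        then have "is_unit p" unfolding a by (simp add: is_unit_const_poly_iff)
        then show False using p by (metis not_prime_unit)
      qed
      then show ?thesis by (simp add: not_dvd_imp_multiplicity_0)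
    next
      case False
      then obtain d where d: "\<And>k. k dvd N \<Longrightarrow> multiplicity p (U k) = of_bool (d dvd k)"
        using U_multiplicity[OF p] by blast
      have "?d' dvd ?d" by (subst (2) dec[symmetric]) (rule dvd_smult, simp)
      then have "multiplicity p ?d' \<le> multiplicity p ?d" using nz(2) by (rule dvd_imp_multiplicity_le)
      also have "\<dots> \<le> multiplicity p ?n" using multiplicity_dyn[OF N0 p U_nz d] by simp
      finally show ?thesis .
    qed
  qed
  then obtain D where D: "?n = ?d' * D" by blast
  have "smult (Polynomial.content ?d) ?n = D * smult (Polynomial.content ?d) ?d'"
    unfolding D mult_smult_right by (simp only: mult.commute)
  then have "smult (Polynomial.content ?d) ?n = D * ?d" unfolding dec .
  moreover have "[:Polynomial.content ?d:] dvd ?d" by (simp add: const_poly_dvd_iff_dvd_content)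
  ultimately show ?thesis by (rule that)
qed

text \<open>\<open>D\<close> specialises at \<open>t = 0\<close> to a unit times the irreducible
  \<open>P\<close> without loss of degree, so a prime factor \<open>E\<close> of positive degree is
  all of \<open>D\<close> up to a factor free of z. If \<open>E\<close> did not divide
  \<open>H1 * H2\<close>, a Bezout relation would give a good point of the family where
  \<open>E\<close> vanishes and the product does not.\<close>

lemma family_irreducible:
  fixes H1 H2 :: "'a poly poly poly"
  assumes hyp: "\<And>t c z d. res6 (fam w1 w2 \<kappa> t c) \<noteq> 0 \<Longrightarrow> (\<And>k. k dvd N \<Longrightarrow> per (fam w1 w2 \<kappa> t c) (1, \<kappa>) k \<noteq> 0) \<Longrightarrow>
      d * dyn_den (zper (fam w1 w2 \<kappa> t c) \<kappa>) N = dyn_num (zper (fam w1 w2 \<kappa> t c) \<kappa>) N \<Longrightarrow> poly d z = 0 \<Longrightarrow>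
      poly (spec2 H1 t c) z * poly (spec2 H2 t c) z = 0"
  obtains d1 d2 where "d1 * dyn_den (zper w1 \<kappa>) N = dyn_num (zper w1 \<kappa>) N" "d2 * dyn_den (zper w2 \<kappa>) N = dyn_num (zper w2 \<kappa>) N"
    "degree d1 > 0" "degree d2 > 0"
    "(\<forall>z c. poly d1 z = 0 \<longrightarrow> poly (spec2 H1 1 c) z = 0) \<or> (\<forall>z c. poly d2 z = 0 \<longrightarrow> poly (spec2 H2 (- 1) c) z = 0)"
proof -
  obtain e D where eD: "smult e (dyn_num U N) = D * dyn_den U N" and edvd: "[:e:] dvd dyn_den U N"
    by (rule dyn_U_quotient)
  let ?A = "{k. k dvd N \<and> Defs.moebius (N div k) = 1}" and ?B = "{k. k dvd N \<and> Defs.moebius (N div k) = - 1}"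
  obtain P :: "'a poly poly" where P: "P * dyn_den qper N = dyn_num qper N" using qper_quotient_exists[OF N0] by blast
  have den0: "dyn_den qper N \<noteq> (0 :: 'a poly poly)" "dyn_num qper N \<noteq> (0 :: 'a poly poly)"
    using dyn_nonzero[OF N0, of "qper :: nat \<Rightarrow> 'a poly poly"] qper_monic(3)[OF pos_dvd] by auto
  have s0: "spec (dyn_num U N) 0 = dyn_num qper N" "spec (dyn_den U N) 0 = dyn_den qper N"
    unfolding spec_hom.hom_dyn spec_U_0 by simp_all
  \<comment> \<open>\<open>e\<close> divides the denominator, whose specialisation at
    \<open>t = 0\<close> is monic; hence \<open>poly e 0\<close> is a unit.\<close>
  have e0dvd: "[:poly e 0:] dvd (dyn_den qper N :: 'a poly poly)"
    using spec_hom.hom_dvd[OF edvd, of 0] unfolding s0 spec_const .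
  then have "is_unit (lead_coeff [:poly e 0:])" by (rule monic_dvd_unit_const) (rule lead_coeff_dyn_qper[OF N0])
  then have "is_unit (poly e 0)" by simp
  then obtain \<epsilon> where \<epsilon>: "poly e 0 * \<epsilon> = 1" by (metis dvdE)
  have "[:poly e 0:] * P * dyn_den qper N = spec D 0 * dyn_den qper N"
    using arg_cong[OF eD, of "\<lambda>f. spec f 0"]
    by (simp only: spec_hom.hom_mult smult_eq_const_mult spec_const s0 P mult.assoc)
  then have sD: "spec D 0 = [:poly e 0:] * P" unfolding mult_right_cancel[OF den0(1)] by (rule sym)
  have P0: "P \<noteq> 0" using P den0 by auto
  have dP: "degree P + (\<Sum>k\<in>?B. 2 ^ k) = (\<Sum>k\<in>?A. 2 ^ k)"
  proof -
    have "degree P + degree (dyn_den qper N :: 'a poly poly) = degree (dyn_num qper N :: 'a poly poly)"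
      unfolding P[symmetric] using P0 den0(1) by (simp add: degree_mult_eq)
    then show ?thesis using degree_dyn[of N "qper :: nat \<Rightarrow> 'a poly poly" "\<lambda>k. 2 ^ k"] qper_monic(1,3)[OF pos_dvd, where 'a='a] by simp
  qed
  have e0: "e \<noteq> 0" using \<epsilon> by auto
  have nzU: "dyn_num U N \<noteq> 0" "dyn_den U N \<noteq> 0" using dyn_nonzero[OF N0, of U] U_nz by auto
  have D0: "D \<noteq> 0" using eD e0 nzU by auto
  have degD: "degree D = degree P"
  proof -
    have "degree D + degree (dyn_den U N) = degree (smult e (dyn_num U N))"
      unfolding eD using D0 nzU by (simp add: degree_mult_eq)
    also have "\<dots> = degree (dyn_num U N)" using e0 by simp
    finally have "degree D + (\<Sum>k\<in>?B. 2 ^ k + 1) = (\<Sum>k\<in>?A. 2 ^ k + 1)"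
      using degree_dyn[of N U "\<lambda>k. 2 ^ k + 1"] U_nz degree_U by simp
    then show ?thesis using dP sum_num_den_card[OF N1, of "\<lambda>k. 2 ^ k"] by linarith
  qed
  have posP: "degree P > 0" using dP degree_den_less_num[OF N1] by linarith
  then obtain E where E: "prime E" "E dvd D" "degree E > 0" using prime_factor_pos_degree[of D] degD by auto
  obtain b where b: "D = E * b" using E(2) by blast
  have b0: "b \<noteq> 0" "E \<noteq> 0" using b D0 by auto
  have sEb: "[:poly e 0:] * P = spec E 0 * spec b 0" using sD unfolding b spec_hom.hom_mult by simp
  have unit_e: "[:\<epsilon>:] * [:poly e 0:] = 1" using \<epsilon> by (simp add: mult.commute one_pCons)
  have "P = [:\<epsilon>:] * ([:poly e 0:] * P)" unfolding mult.assoc[symmetric] unit_e by simp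
  then have Pf: "P = ([:\<epsilon>:] * spec E 0) * spec b 0" unfolding sEb by (simp add: mult.assoc)
  have sp0: "[:\<epsilon>:] * spec E 0 \<noteq> 0" "spec b 0 \<noteq> 0" using Pf P0 by auto
  have "degree P = degree ([:\<epsilon>:] * spec E 0) + degree (spec b 0)" by (subst Pf, rule degree_mult_eq[OF sp0])
  moreover have "degree ([:\<epsilon>:] * spec E 0) \<le> degree E"
    by (rule order_trans[OF degree_mult_le]) (simp add: degree_spec_le)
  moreover have "degree P = degree E + degree b" using degD b b0 by (simp add: degree_mult_eq)
  moreover note degree_spec_le[of 0 b]
  ultimately have "degree ([:\<epsilon>:] * spec E 0) = degree E" "degree (spec b 0) = degree b" by linarith+
  then have "degree b = 0" using irr[OF P Pf] E(3) by simp
  then obtain b' where b': "b = [:b':]" by (rule degree_eq_zeroE)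
  have DE: "D = smult b' E" unfolding b b' by (simp add: mult.commute)
  let ?F = "fam w1 w2 \<kappa>"
  have ev: "smult (poly (poly e [:t:]) c) (dyn_num (zper (?F t c) \<kappa>) N) = spec2 D t c * dyn_den (zper (?F t c) \<kappa>) N" for t c
    using arg_cong[OF eD, of "\<lambda>f. spec2 f t c"]
    by (simp only: smult_eq_const_mult spec2_hom.hom_mult spec_const spec2_hom.hom_dyn spec2_U)
  have quot: "smult (inverse (poly (poly e [:t:]) c)) (spec2 D t c) * dyn_den (zper (?F t c) \<kappa>) N = dyn_num (zper (?F t c) \<kappa>) N"
    if "poly (poly e [:t:]) c \<noteq> 0" for t c
    using ev[of t c] that by (simp flip: ev)
  \<comment> \<open>Where infinity is not periodic, the denominator is non-zero and so is its
    divisor \<open>e\<close>; a degree count then shows that \<open>D\<close> does not degenerate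
    either.\<close>
  have special: "poly (poly e [:t:]) c \<noteq> 0 \<and> poly (poly b' [:t:]) c \<noteq> 0 \<and> degree (spec2 D t c) = degree P"
    if top: "\<And>k. k dvd N \<Longrightarrow> per (?F t c) (1, \<kappa>) k \<noteq> 0" for t c
  proof -
    have dz: "degree (zper (?F t c) \<kappa> k) = 2 ^ k + 1" if "k dvd N" for k by (rule degree_zper[OF top[OF that]])
    then have zz: "zper (?F t c) \<kappa> k \<noteq> 0" if "k dvd N" for k using that by fastforce
    note nz = dyn_nonzero[OF N0, of "zper (?F t c) \<kappa>", OF zz]
    have "[:poly (poly e [:t:]) c:] dvd dyn_den (zper (?F t c) \<kappa>) N"
      using spec2_hom.hom_dvd[OF edvd, of c t] unfolding spec_const spec2_hom.hom_dyn spec2_U .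
    then have e1: "poly (poly e [:t:]) c \<noteq> 0" using nz by auto
    have sd0: "spec2 D t c \<noteq> 0" using ev[of t c] e1 nz by auto
    then have b1: "poly (poly b' [:t:]) c \<noteq> 0"
      unfolding DE smult_eq_const_mult spec2_hom.hom_mult spec_const by auto
    have "degree (spec2 D t c) + degree (dyn_den (zper (?F t c) \<kappa>) N) = degree (dyn_num (zper (?F t c) \<kappa>) N)"
      using arg_cong[OF ev[of t c], of degree] e1 nz sd0 by (simp add: degree_mult_eq)
    then have "degree (spec2 D t c) + (\<Sum>k\<in>?B. 2 ^ k + 1) = (\<Sum>k\<in>?A. 2 ^ k + 1)"
      using degree_dyn[of N "zper (?F t c) \<kappa>" "\<lambda>k. 2 ^ k + 1"] zz dz by simp
    then have "degree (spec2 D t c) = degree P" using dP sum_num_den_card[OF N1, of "\<lambda>k. 2 ^ k"] by linarith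
    then show ?thesis using e1 b1 by simp
  qed
  have "E dvd H1 * H2"
  proof (rule ccontr)
    assume "\<not> E dvd H1 * H2"
    then obtain r u v where r: "r \<noteq> 0" "[:r:] = u * E + v * (H1 * H2)"
      using prime_poly_bezout[of E "H1 * H2"] E by (metis prime_imp_prime_elem)
    \<comment> \<open>One polynomial in t and c that collects the conditions on a good parameter:
      the Bezout constant, the resultant, the multiplier \<open>e\<close>, the chart, and the
      leading coefficient of \<open>E\<close>.\<close>
    define g where "g = r * res6 W * e * (\<Prod>k | k dvd N. per W (1, [:[:\<kappa>:]:]) k) * lead_coeff E"
    have "g \<noteq> 0" unfolding g_def using r(1) res_W_nz e0 per_W_nz b0 N0 by simp
    then obtain t c where g: "poly (poly g [:t:]) c \<noteq> 0" by (rule bivariate_nonzero_point)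
    have g1: "poly (poly r [:t:]) c \<noteq> 0" "res6 (?F t c) \<noteq> 0" "poly (poly e [:t:]) c \<noteq> 0" "poly (poly (lead_coeff E) [:t:]) c \<noteq> 0"
      and g2: "(\<Prod>k | k dvd N. per (?F t c) (1, \<kappa>) k) \<noteq> 0"
      using g unfolding g_def by (auto simp: eval_res_W poly_prod eval_per_W)
    have top: "per (?F t c) (1, \<kappa>) k \<noteq> 0" if "k dvd N" for k using g2 that N0 by simp
    have "coeff (spec2 E t c) (degree E) \<noteq> 0" using g1(4) by (simp add: coeff_map_poly)
    then have "degree E \<le> degree (spec2 E t c)" by (rule le_degree)
    then obtain z where z: "poly (spec2 E t c) z = 0" using E(3) alg_closed_imp_poly_has_root[of "spec2 E t c"] by auto
    have "poly (spec2 D t c) z = 0" unfolding b spec2_hom.hom_mult using z by simp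
    then have "poly (spec2 H1 t c) z * poly (spec2 H2 t c) z = 0"
      by (intro hyp[OF g1(2) top quot[OF g1(3)]]) simp_all
    then have "poly (spec2 [:r:] t c) z = 0" unfolding r(2) using z
      by (simp add: spec2_hom.hom_add spec2_hom.hom_mult)
    then show False using g1(1) by (simp add: spec_const)
  qed
  then have E12: "E dvd H1 \<or> E dvd H2" using E(1) by (simp add: prime_dvd_mult_iff)
  have special1: "poly (poly e [:1:]) c \<noteq> 0 \<and> poly (poly b' [:1:]) c \<noteq> 0 \<and> degree (spec2 D 1 c) = degree P" for c
    by (rule special) (simp add: fam_1 top1)
  have special2: "poly (poly e [:- 1:]) c \<noteq> 0 \<and> poly (poly b' [:- 1:]) c \<noteq> 0 \<and> degree (spec2 D (- 1) c) = degree P" for c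
    by (rule special) (simp add: fam_1 top2)
  define q where "q t = smult (inverse (poly (poly e [:t:]) 0)) (spec2 D t 0)" for t
  have q1: "q 1 * dyn_den (zper w1 \<kappa>) N = dyn_num (zper w1 \<kappa>) N" using quot[of 1 0] special1 unfolding q_def fam_1 by blast
  have q2: "q (- 1) * dyn_den (zper w2 \<kappa>) N = dyn_num (zper w2 \<kappa>) N" using quot[of "- 1" 0] special2 unfolding q_def fam_1 by blast
  have dq: "degree (q 1) > 0" "degree (q (- 1)) > 0" using special1[of 0] special2[of 0] posP unfolding q_def by auto
  \<comment> \<open>At \<open>t = 1\<close> and \<open>t = - 1\<close> the map no longer depends on
    c; as the quotient is unique, \<open>q t\<close>, formed at \<open>c = 0\<close>, represents it
    for every c.\<close>
  have vanish: "poly (spec2 H t c) z = 0"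
    if EH: "E dvd H" and sp: "\<And>c. poly (poly e [:t:]) c \<noteq> 0 \<and> poly (poly b' [:t:]) c \<noteq> 0"
      and w: "\<And>c. ?F t c = w" and top: "\<And>k. k dvd N \<Longrightarrow> per w (1, \<kappa>) k \<noteq> 0" and z: "poly (q t) z = 0" for H t c z w
  proof -
    have zz: "zper w \<kappa> k \<noteq> 0" if "k dvd N" for k using degree_zper[OF top[OF that]] by fastforce
    have nz: "dyn_den (zper w \<kappa>) N \<noteq> 0" using dyn_nonzero(2)[OF N0, of "zper w \<kappa>"] zz by blast
    have "q t * dyn_den (zper w \<kappa>) N = smult (inverse (poly (poly e [:t:]) c)) (spec2 D t c) * dyn_den (zper w \<kappa>) N"
      using quot[of t 0] quot[of t c] sp unfolding q_def w by simp
    then have "q t = smult (inverse (poly (poly e [:t:]) c)) (spec2 D t c)" unfolding mult_right_cancel[OF nz] .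
    then have "poly (spec2 D t c) z = 0" using z sp[of c] by simp
    then have "poly (spec2 E t c) z = 0" using sp[of c]
      unfolding DE smult_eq_const_mult spec2_hom.hom_mult spec_const by simp
    moreover obtain K where "H = E * K" using EH by blast
    ultimately show ?thesis by (simp add: spec2_hom.hom_mult)
  qed
  have "(\<forall>z c. poly (q 1) z = 0 \<longrightarrow> poly (spec2 H1 1 c) z = 0) \<or> (\<forall>z c. poly (q (- 1)) z = 0 \<longrightarrow> poly (spec2 H2 (- 1) c) z = 0)"
    using E12
  proof
    assume "E dvd H1"
    then show ?thesis using vanish[of H1 1 w1] special1 top1 fam_1(1) by blast
  next
    assume "E dvd H2"
    then show ?thesis using vanish[of H2 "- 1" w2] special2 top2 fam_1(2) by blast
  qed
  then show ?thesis using that[OF q1 q2 dq] by blast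
qed

end

section \<open>Identification of the dynatomic polynomials and conclusion\<close>

text \<open>Expansion along the first row in a form that can be iterated by rewriting down to the
  empty matrix.\<close>

lemma det_mat_Suc:
  fixes f :: "nat \<times> nat \<Rightarrow> 'a::comm_ring_1"
  shows "Determinant.det (Matrix.mat (Suc n) (Suc n) f) =
    (\<Sum>j<Suc n. f (0, j) * ((- 1) ^ j * Determinant.det (Matrix.mat n n (\<lambda>(a, b). f (Suc a, if b < j then b else Suc b)))))"
proof -
  let ?A = "Matrix.mat (Suc n) (Suc n) f"
  have "Determinant.det ?A = (\<Sum>j<Suc n. ?A $$ (0, j) * cofactor ?A 0 j)"
    by (rule laplace_expansion_row) auto
  also have "\<dots> = (\<Sum>j<Suc n. f (0, j) * ((- 1) ^ j * Determinant.det (Matrix.mat n n (\<lambda>(a, b). f (Suc a, if b < j then b else Suc b)))))"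
  proof (rule sum.cong[OF refl])
    fix j assume "j \<in> {..<Suc n}"
    then have j: "j < Suc n" by simp
    have "mat_delete ?A 0 j = Matrix.mat n n (\<lambda>(a, b). f (Suc a, if b < j then b else Suc b))"
      unfolding mat_delete_def by (rule eq_matI) auto
    then show "?A $$ (0, j) * cofactor ?A 0 j =
        f (0, j) * ((- 1) ^ j * Determinant.det (Matrix.mat n n (\<lambda>(a, b). f (Suc a, if b < j then b else Suc b))))"
      using j by (simp add: cofactor_def)
  qed
  finally show ?thesis .
qed

lemma form_resultant_2: "form_resultant 2 (num_form 2 w) (den_form 2 w) = res6 w"
proof -
  have p: "poly (num_form 2 w) 1 = [:w 2, w 1, w 0:]" "poly (den_form 2 w) 1 = [:w 5, w 4, w 3:]"
    unfolding num_form_def den_form_def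
    by (simp_all add: numeral_2_eq_2 const2_def varX_def varY_def eval_nat_numeral one_pCons)
  have four: "(2::nat) + 2 = Suc (Suc (Suc (Suc 0)))" by simp
  have z: "Determinant.det (Matrix.mat 0 0 f) = 1" for f :: "nat \<times> nat \<Rightarrow> 'a"
    by (rule det_dim_zero) simp
  show ?thesis
    unfolding form_resultant_def p sylvester_mat_sub_def four det_mat_Suc z res6_def
    by (simp add: numeral_2_eq_2 coeff_pCons algebra_simps power2_eq_square)
qed

lemma spec_linear: "spec [:a, b:] x = [:poly a x, poly b x:]"
  by (rule poly_eqI) (simp add: coeff_map_poly coeff_pCons split: nat.split)

lemma poly_spec_swap: "poly (spec P a) b = poly (poly P [:b:]) a"
  by (induction P) (simp_all add: map_poly_pCons)

interpretation eval2_hom: comm_ring_hom "\<lambda>P. eval2 P x (y :: 'a::field)" for x y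
  by unfold_locales (simp_all add: eval2_def)

lemma eval2_basic: "eval2 (const2 a) x y = a" "eval2 varX x y = x" "eval2 varY x y = y"
  by (simp_all add: eval2_def const2_def varX_def varY_def)

lemma eval2_subst2: "eval2 (subst2 P A B) x y = eval2 P (eval2 A x y) (eval2 B x y)"
proof -
  let ?e = "\<lambda>P. eval2 P x y"
  have inner: "?e (poly (map_poly const2 q) A) = poly q (?e A)" for q
  proof -
    have "?e (poly (map_poly const2 q) A) = poly (map_poly ?e (map_poly const2 q)) (?e A)"
      by (rule eval2_hom.poly_map_poly[symmetric])
    also have "map_poly ?e (map_poly const2 q) = q"
      by (rule poly_eqI) (simp add: coeff_map_poly const2_def eval2_def)
    finally show ?thesis .
  qed
  have "?e (subst2 P A B) = poly (map_poly ?e (map_poly (\<lambda>q. poly (map_poly const2 q) A) P)) (?e B)"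
    unfolding subst2_def by (rule eval2_hom.poly_map_poly[symmetric])
  also have "map_poly ?e (map_poly (\<lambda>q. poly (map_poly const2 q) A) P) = spec P (?e A)"
    by (rule poly_eqI) (simp add: coeff_map_poly inner)
  also have "poly (spec P (?e A)) (?e B) = eval2 P (?e A) (?e B)"
    unfolding poly_spec_swap eval2_def ..
  finally show ?thesis .
qed

lemma eval2_forms: "(eval2 (num_form 2 w) x y, eval2 (den_form 2 w) x y) = qstep w (x, y)"
  unfolding num_form_def den_form_def qstep_def
  by (simp add: eval2_hom.hom_add eval2_hom.hom_mult eval2_basic eval_nat_numeral mult.assoc)

lemma eval2_iterate:
  "(eval2 (fst (iterate (num_form 2 w) (den_form 2 w) n)) x y, eval2 (snd (iterate (num_form 2 w) (den_form 2 w) n)) x y) = orb w (x, y) n"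
proof (induction n arbitrary: x y)
  case (Suc n)
  show ?case unfolding iterate.simps fst_conv snd_conv eval2_subst2 Suc.IH orb_Suc_left eval2_forms[symmetric] ..
qed (simp add: eval2_basic)

lemma eval2_period_poly: "eval2 (period_poly (num_form 2 w) (den_form 2 w) n) x y = per w (x, y) n"
proof -
  have "orb w (x, y) n = (eval2 (fst (iterate (num_form 2 w) (den_form 2 w) n)) x y, eval2 (snd (iterate (num_form 2 w) (den_form 2 w) n)) x y)"
    by (rule eval2_iterate[symmetric])
  then show ?thesis unfolding period_poly_def per_def cross_def
    by (simp add: eval2_hom.hom_minus eval2_hom.hom_mult eval2_basic)
qed

text \<open>Multiplied by the equation of the excluded line, the difference of the two polynomials
  vanishes at every point.\<close>

lemma eval2_eqI:
  fixes A B :: "'a::field_char_0 poly2"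
  assumes "\<And>x y. y - \<kappa> * x \<noteq> 0 \<Longrightarrow> eval2 A x y = eval2 B x y"
  shows "A = B"
proof (rule ccontr)
  assume "A \<noteq> B"
  have "eval2 (varY - const2 \<kappa> * varX) 0 1 = (1 :: 'a)"
    by (simp add: eval2_hom.hom_minus eval2_hom.hom_mult eval2_basic)
  then have "varY - const2 \<kappa> * varX \<noteq> (0 :: 'a poly2)" by (metis eval2_hom.hom_zero zero_neq_one)
  then have "(A - B) * (varY - const2 \<kappa> * varX) \<noteq> 0" using \<open>A \<noteq> B\<close> by simp
  then obtain y x where "poly (poly ((A - B) * (varY - const2 \<kappa> * varX)) [:y:]) x \<noteq> 0" by (rule bivariate_nonzero_point)
  then have "(eval2 A x y - eval2 B x y) * (y - \<kappa> * x) \<noteq> 0"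
    unfolding eval2_def[symmetric] by (simp add: eval2_hom.hom_minus eval2_hom.hom_mult eval2_basic)
  then show False using assms[of y x] by auto
qed

text \<open>In the fraction field the Moebius product is numerator over denominator. Polynomials
  embed there, so the definite description has \<open>Q\<close> as its only solution.\<close>

lemma dynatomic_poly_eqI:
  fixes F G :: "'a::field poly2"
  assumes N: "N > 0" and nz: "\<And>k. k dvd N \<Longrightarrow> period_poly F G k \<noteq> 0"
    and Q: "Q * dyn_den (period_poly F G) N = dyn_num (period_poly F G) N"
  shows "dynatomic_poly F G N = Q"
proof -
  let ?u = "period_poly F G" and ?fr = "\<lambda>p :: 'a poly2. Fraction_Field.Fract p 1"
  have fin: "finite {k. k dvd N}" using N by simp
  have fr_mult: "?fr (p * q) = ?fr p * ?fr q" for p q by simp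
  have fr_prod: "?fr (prod f S) = (\<Prod>k\<in>S. ?fr (f k))" for f and S :: "nat set"
    by (induction S rule: infinite_finite_induct) (simp_all add: One_fract_def[symmetric] del: mult_fract add: fr_mult)
  have fr_inj: "?fr p = ?fr q \<longleftrightarrow> p = q" for p q by (simp add: eq_fract)
  let ?A = "{k. k dvd N \<and> Defs.moebius (N div k) = 1}" and ?B = "{k. k dvd N \<and> Defs.moebius (N div k) = - 1}"
  have "(\<Prod>k | k dvd N. ?fr (?u k) powi Defs.moebius (N div k)) = (\<Prod>k\<in>?A \<union> ?B. ?fr (?u k) powi Defs.moebius (N div k))"
  proof (rule prod.mono_neutral_right[OF fin])
    show "\<forall>k\<in>{k. k dvd N} - (?A \<union> ?B). ?fr (?u k) powi Defs.moebius (N div k) = 1"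
    proof
      fix k assume "k \<in> {k. k dvd N} - (?A \<union> ?B)"
      then have "Defs.moebius (N div k) = 0" using moebius_cases[of "N div k"] by blast
      then show "?fr (?u k) powi Defs.moebius (N div k) = 1" by simp
    qed
  qed blast
  also have "\<dots> = (\<Prod>k\<in>?A. ?fr (?u k) powi Defs.moebius (N div k)) * (\<Prod>k\<in>?B. ?fr (?u k) powi Defs.moebius (N div k))"
    using fin by (intro prod.union_disjoint) auto
  also have "(\<Prod>k\<in>?A. ?fr (?u k) powi Defs.moebius (N div k)) = ?fr (dyn_num ?u N)"
    unfolding dyn_num_def fr_prod by (rule prod.cong) auto
  also have "(\<Prod>k\<in>?B. ?fr (?u k) powi Defs.moebius (N div k)) = inverse (?fr (dyn_den ?u N))"
    unfolding dyn_den_def fr_prod prod_inversef[symmetric] o_def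
    by (rule prod.cong) (auto simp del: inverse_fract simp: power_int_minus)
  also have "?fr (dyn_num ?u N) * inverse (?fr (dyn_den ?u N)) = ?fr Q"
  proof -
    have "?fr (dyn_den ?u N) \<noteq> ?fr 0" unfolding fr_inj by (rule dyn_nonzero(2)[OF N nz])
    then have "?fr (dyn_den ?u N) \<noteq> 0" unfolding Zero_fract_def .
    then have inv: "?fr (dyn_den ?u N) * inverse (?fr (dyn_den ?u N)) = 1" by (rule division_ring_class.right_inverse)
    show ?thesis unfolding Q[symmetric] fr_mult mult.assoc inv by (rule mult_1_right)
  qed
  finally have val: "(\<Prod>k | k dvd N. ?fr (?u k) powi Defs.moebius (N div k)) = ?fr Q" .
  show ?thesis unfolding dynatomic_poly_def val fr_inj by (rule the_equality) simp_all
qed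

lemma orb_scale_point: "orb w (t * x, t * y) n = (t ^ 2 ^ n * fst (orb w (x, y) n), t ^ 2 ^ n * snd (orb w (x, y) n))"
proof (induction n)
  case (Suc n)
  have e: "t ^ 2 ^ Suc n = (t ^ 2 ^ n) ^ 2" by (simp add: power_mult[symmetric] mult.commute)
  show ?case unfolding orb_Suc Suc.IH e by (simp add: qstep_def algebra_simps power2_eq_square)
qed simp

lemma per_scale_point: "per w (t * x, t * y) n = t ^ (2 ^ n + 1) * per w (x, y) n"
  unfolding per_def orb_scale_point cross_def by (simp add: algebra_simps)

lemma orb_scale_map: "orb (\<lambda>i. r * w i) v n = (r ^ (2 ^ n - 1) * fst (orb w v n), r ^ (2 ^ n - 1) * snd (orb w v n))"
proof (induction n)
  case (Suc n)
  obtain m where m: "(2::nat) ^ n = Suc m" using not0_implies_Suc[of "2 ^ n"] by auto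
  have E: "(2::nat) ^ Suc n - 1 = Suc ((2 ^ n - 1) + (2 ^ n - 1))" unfolding power_Suc m by simp
  have e: "r ^ (2 ^ Suc n - 1) = r * (r ^ (2 ^ n - 1) * r ^ (2 ^ n - 1))" unfolding E by (simp only: power_Suc power_add)
  show ?case unfolding orb_Suc Suc.IH e by (simp add: qstep_def algebra_simps power2_eq_square)
qed simp

lemma per_scale_map: "per (\<lambda>i. r * w i) v n = r ^ (2 ^ n - 1) * per w v n"
  unfolding per_def orb_scale_map cross_def by (simp add: algebra_simps)

lemma zper_scale_map: "zper (\<lambda>i. r * w i) \<kappa> n = smult (r ^ (2 ^ n - 1)) (zper w \<kappa> n)"
proof -
  have "(\<lambda>i. [:r * w i:]) = (\<lambda>i. [:r:] * [:w i:])" by auto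
  then show ?thesis unfolding zper_def using per_scale_map[of "[:r:]" "\<lambda>i. [:w i:]"]
    by (simp add: poly_const_pow)
qed

lemma dyn_smult:
  fixes u :: "nat \<Rightarrow> 'a::field poly"
  shows "dyn_num (\<lambda>k. smult (f k) (u k)) N = smult (dyn_num f N) (dyn_num u N)"
    "dyn_den (\<lambda>k. smult (f k) (u k)) N = smult (dyn_den f N) (dyn_den u N)"
  unfolding dyn_num_def dyn_den_def by (rule prod_smult)+

text \<open>\<open>Q\<close> is the homogenisation of \<open>d\<close> in the chart coordinate x /
  (y - \<kappa> x). It agrees with the dynatomic polynomial off the line at infinity, where the
  powers of the scaling factor match because the degrees of numerator and denominator differ by
  \<open>degree d\<close>.\<close>

lemma dynatomic_eval:
  fixes w :: "nat \<Rightarrow> 'a::field_char_0"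
  assumes N: "N > 0" and top: "\<And>k. k dvd N \<Longrightarrow> per w (1, \<kappa>) k \<noteq> 0"
    and d: "d * dyn_den (zper w \<kappa>) N = dyn_num (zper w \<kappa>) N" and t: "t \<noteq> 0"
  shows "eval2 (dynatomic_poly (num_form 2 w) (den_form 2 w) N) (t * z) (t * (1 + z * \<kappa>)) = t ^ degree d * poly d z"
proof -
  let ?n = "degree d" and ?u = "period_poly (num_form 2 w) (den_form 2 w)"
  define Q where "Q = (\<Sum>i\<le>?n. const2 (coeff d i) * varX ^ i * (varY - const2 \<kappa> * varX) ^ (?n - i))"
  have evQ: "eval2 Q (s * x) (s * (1 + x * \<kappa>)) = s ^ ?n * poly d x" for s x
  proof -
    have "eval2 Q (s * x) (s * (1 + x * \<kappa>)) = (\<Sum>i\<le>?n. coeff d i * (s * x) ^ i * s ^ (?n - i))"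
      unfolding Q_def by (simp add: eval2_hom.hom_sum eval2_hom.hom_mult eval2_hom.hom_power eval2_hom.hom_minus eval2_basic algebra_simps)
    also have "\<dots> = (\<Sum>i\<le>?n. s ^ ?n * (coeff d i * x ^ i))"
    proof (rule sum.cong[OF refl])
      fix i assume "i \<in> {..?n}"
      then have "s ^ ?n = s ^ i * s ^ (?n - i)" by (simp flip: power_add)
      then show "coeff d i * (s * x) ^ i * s ^ (?n - i) = s ^ ?n * (coeff d i * x ^ i)" by (simp add: power_mult_distrib)
    qed
    finally show ?thesis by (simp add: poly_altdef sum_distrib_left)
  qed
  have evu: "eval2 (?u k) (s * x) (s * (1 + x * \<kappa>)) = s ^ (2 ^ k + 1) * poly (zper w \<kappa> k) x" for s x k
    unfolding eval2_period_poly per_scale_point poly_zper ..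
  have nzu: "?u k \<noteq> 0" if "k dvd N" for k
  proof
    assume "?u k = 0"
    then have "eval2 (?u k) 1 \<kappa> = 0" by (simp add: eval2_def)
    then show False using top[OF that] unfolding eval2_period_poly by simp
  qed
  let ?A = "{k. k dvd N \<and> Defs.moebius (N div k) = 1}" and ?B = "{k. k dvd N \<and> Defs.moebius (N div k) = - 1}"
  have dz: "degree (zper w \<kappa> k) = 2 ^ k + 1" if "k dvd N" for k by (rule degree_zper[OF top[OF that]])
  have zz: "zper w \<kappa> k \<noteq> 0" if "k dvd N" for k using dz[OF that] by fastforce
  note nz = dyn_nonzero[OF N, of "zper w \<kappa>", OF zz]
  have d0: "d \<noteq> 0" using d nz by auto
  have "degree d + degree (dyn_den (zper w \<kappa>) N) = degree (dyn_num (zper w \<kappa>) N)"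
    unfolding d[symmetric] using d0 nz by (simp add: degree_mult_eq)
  then have ex: "?n + (\<Sum>k\<in>?B. 2 ^ k + 1) = (\<Sum>k\<in>?A. 2 ^ k + 1)"
    using degree_dyn[of N "zper w \<kappa>" "\<lambda>k. 2 ^ k + 1"] zz dz by simp
  have "Q * dyn_den ?u N = dyn_num ?u N"
  proof (rule eval2_eqI[of \<kappa>])
    fix x y assume s: "y - \<kappa> * x \<noteq> 0"
    define s where "s = y - \<kappa> * x"
    have xy: "x = s * (x / s)" "y = s * (1 + (x / s) * \<kappa>)" using s by (simp_all add: s_def field_simps)
    have "eval2 (Q * dyn_den ?u N) (s * (x / s)) (s * (1 + (x / s) * \<kappa>)) = s ^ ?n * poly d (x / s) * (\<Prod>k\<in>?B. s ^ (2 ^ k + 1) * poly (zper w \<kappa> k) (x / s))"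
      unfolding eval2_hom.hom_mult evQ dyn_den_def eval2_hom.hom_prod evu ..
    also have "\<dots> = s ^ (?n + (\<Sum>k\<in>?B. 2 ^ k + 1)) * poly (d * dyn_den (zper w \<kappa>) N) (x / s)"
      unfolding dyn_den_def by (simp add: prod.distrib power_sum power_add poly_prod)
    also have "\<dots> = (\<Prod>k\<in>?A. s ^ (2 ^ k + 1) * poly (zper w \<kappa> k) (x / s))"
      unfolding ex d dyn_num_def by (simp add: prod.distrib power_sum poly_prod)
    also have "\<dots> = eval2 (dyn_num ?u N) (s * (x / s)) (s * (1 + (x / s) * \<kappa>))"
      unfolding dyn_num_def eval2_hom.hom_prod evu ..
    finally show "eval2 (Q * dyn_den ?u N) x y = eval2 (dyn_num ?u N) x y" unfolding xy[symmetric] .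
  qed
  then have "dynatomic_poly (num_form 2 w) (den_form 2 w) N = Q" using dynatomic_poly_eqI[OF N nzu] by blast
  then show ?thesis using evQ by simp
qed

lemma orb_nonzero:
  fixes w :: "nat \<Rightarrow> 'a::field"
  assumes "res6 w \<noteq> 0" "v \<noteq> (0, 0)"
  shows "orb w v n \<noteq> (0, 0)"
proof (induction n)
  case (Suc n)
  show ?case
  proof
    assume "orb w v (Suc n) = (0, 0)"
    then have q: "qstep w (orb w v n) = (0, 0)" by (simp add: orb_Suc)
    have "res6 w * fst (orb w v n) ^ 3 = 0" "res6 w * snd (orb w v n) ^ 3 = 0"
      unfolding res6_cubes q by simp_all
    then have "orb w v n = (0, 0)" using assms(1) by (simp add: prod_eq_iff)
    then show False using Suc by blast
  qed
qed (use assms in simp)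

text \<open>No iterate of a quadratic rational map is the identity.\<close>

lemma per_chart_nonzero:
  fixes w :: "nat \<Rightarrow> 'a::alg_closed_field"
  assumes "res6 w \<noteq> 0" "k > 0"
  shows "per (\<lambda>i. [:w i:]) (1, [:0, 1:]) k \<noteq> 0"
proof
  let ?o = "orb (\<lambda>i. [:w i:]) (1, [:0, 1:]) k"
  assume "per (\<lambda>i. [:w i:]) (1, [:0, 1:]) k = 0"
  \<comment> \<open>If the iterate were the identity, a zero of the first form would be a common
    zero of both. So the first form is constant, and then both top coefficients vanish, which is a
    common zero at infinity.\<close>
  then have g: "snd ?o = [:0, 1:] * fst ?o" by (simp add: per_def cross_def)
  have ev: "(poly (fst ?o) t, poly (snd ?o) t) = orb w (1, t) k" for t
  proof -
    have "map_prod (\<lambda>p. poly p t) (\<lambda>p. poly p t) ?o = orb w (1, t) k" unfolding poly_hom.hom_orb by simp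
    then show ?thesis by (simp add: map_prod_def split_beta)
  qed
  have "degree (fst ?o) = 0"
  proof (rule ccontr)
    assume "degree (fst ?o) \<noteq> 0"
    then obtain t where "poly (fst ?o) t = 0" using alg_closed_imp_poly_has_root by blast
    then have "orb w (1, t) k = (0, 0)" unfolding ev[symmetric] g by simp
    then show False using orb_nonzero[OF assms(1), of "(1, t)" k] by simp
  qed
  then obtain a where a: "fst ?o = [:a:]" by (rule degree_eq_zeroE)
  have "(2::nat) ^ 1 \<le> 2 ^ k" using assms(2) by (intro power_increasing) auto
  then have k2: "(2::nat) \<le> 2 ^ k" by simp
  have "coeff (fst ?o) (2 ^ k) = 0" unfolding a by (rule coeff_eq_0) simp
  moreover have "coeff (snd ?o) (2 ^ k) = 0" unfolding g a by (rule coeff_eq_0) (use k2 in \<open>simp add: degree_pCons_eq_if\<close>)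
  ultimately have "orb w (0, 1) k = (0, 0)"
    using orb_poly_top[of "(1, [:0, 1:])" w k] by simp
  then show False using orb_nonzero[OF assms(1), of "(0, 1)" k] by simp
qed

definition chart_point :: "'a::field \<Rightarrow> 'a \<Rightarrow> nat \<Rightarrow> 'a" where
  "chart_point \<kappa> z i = (if i = 0 then z else if i = 1 then 1 + z * \<kappa> else 0)"

text \<open>\<open>formal_period\<close> tests all representatives. Rescaling the map by
  \<open>r\<close> multiplies the \<open>k\<close>-th period polynomial by
  \<open>r ^ (2 ^ k - 1)\<close>, hence the quotient by a non-zero constant.\<close>

lemma chart_point_in_Rat_period:
  fixes w :: "nat \<Rightarrow> 'a::field_char_0"
  assumes N: "N > 0" and w: "\<And>i. i > 5 \<Longrightarrow> w i = 0" and res: "res6 w \<noteq> 0"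
    and top: "\<And>k. k dvd N \<Longrightarrow> per w (1, \<kappa>) k \<noteq> 0"
    and d: "d * dyn_den (zper w \<kappa>) N = dyn_num (zper w \<kappa>) N" and z: "poly d z = 0"
  shows "(proj_class (chart_point \<kappa> z), proj_class w) \<in> Rat_period 2 N"
proof -
  have "chart_point \<kappa> z \<noteq> (\<lambda>_. 0)"
  proof
    assume "chart_point \<kappa> z = (\<lambda>_. 0)"
    then have "chart_point \<kappa> z 0 = 0" "chart_point \<kappa> z 1 = 0" by simp_all
    then show False by (simp add: chart_point_def)
  qed
  then have v: "proj_class (chart_point \<kappa> z) \<in> proj_space 1"
    unfolding proj_space_def by (auto simp: chart_point_def intro!: exI[of _ "chart_point \<kappa> z"])
  have "w \<noteq> (\<lambda>_. 0)" using res by (auto simp: res6_def)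
  then have w5: "proj_class w \<in> proj_space 5" unfolding proj_space_def using w by blast
  have res_scale: "res6 (\<lambda>i. r * w i) = r ^ 4 * res6 w" for r
    by (simp add: res6_def algebra_simps power2_eq_square eval_nat_numeral)
  have rat: "proj_class w \<in> Rat 2"
    unfolding Rat_def using w5 res by (auto simp: form_resultant_2 proj_class_def res_scale)
  have "formal_period 2 N (proj_class (chart_point \<kappa> z)) (proj_class w)"
    unfolding formal_period_def
  proof (intro ballI)
    fix v' w' assume v': "v' \<in> proj_class (chart_point \<kappa> z)" and w': "w' \<in> proj_class w"
    obtain s where s: "s \<noteq> 0" "v' = (\<lambda>i. s * chart_point \<kappa> z i)" using v' unfolding proj_class_def by blast
    obtain r where r: "r \<noteq> 0" "w' = (\<lambda>i. r * w i)" using w' unfolding proj_class_def by blast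
    let ?f = "\<lambda>k. r ^ (2 ^ k - 1)"
    have f0: "dyn_den ?f N \<noteq> 0" using r(1) by (intro dyn_nonzero(2)[OF N]) simp
    have top': "per w' (1, \<kappa>) k \<noteq> 0" if "k dvd N" for k unfolding r(2) per_scale_map using top[OF that] r(1) by simp
    have zp: "zper w' \<kappa> = (\<lambda>k. smult (?f k) (zper w \<kappa> k))" unfolding r(2) zper_scale_map ..
    have "smult (dyn_num ?f N / dyn_den ?f N) d * dyn_den (zper w' \<kappa>) N = dyn_num (zper w' \<kappa>) N"
      unfolding zp dyn_smult d[symmetric] using f0 by simp
    from dynatomic_eval[OF N top' this s(1), of z]
    show "eval2 (dynatomic_poly (num_form 2 w') (den_form 2 w') N) (v' 0) (v' 1) = 0"
      using z unfolding s(2) by (simp add: chart_point_def)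
  qed
  then show ?thesis unfolding Rat_period_def using v rat by simp
qed

text \<open>Substitutes polynomials in c, t and z for the variables, which turns an equation on the
  product of projective spaces into one on the family.\<close>

definition bipoly_lift :: "'a::field bipoly \<Rightarrow> (nat \<Rightarrow> 'a poly poly poly) \<Rightarrow> (nat \<Rightarrow> 'a poly poly poly) \<Rightarrow> 'a poly poly poly" where
  "bipoly_lift p v w = (\<Sum>e \<in> Poly_Mapping.keys p. [:[:[:Poly_Mapping.lookup p e:]:]:] *
     (\<Prod>k \<in> Poly_Mapping.keys e. case_sum v w k ^ Poly_Mapping.lookup e k))"

lemma eval_bipoly_lift:
  fixes p :: "'a::field bipoly"
  shows "poly (spec2 (bipoly_lift p v w) t c) z =
    bipoly_eval p (\<lambda>i. poly (spec2 (v i) t c) z) (\<lambda>i. poly (spec2 (w i) t c) z)"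
proof -
  interpret h: comm_ring_hom "\<lambda>D. poly (spec2 D t c) z"
    by unfold_locales (simp_all add: spec2_hom.hom_add spec2_hom.hom_mult)
  have k: "poly (spec2 [:[:[:a:]:]:] t c) z = a" for a by (simp add: spec_const)
  have "poly (spec2 (case_sum v w i) t c) z = case_sum (\<lambda>i. poly (spec2 (v i) t c) z) (\<lambda>i. poly (spec2 (w i) t c) z) i" for i
    by (cases i) simp_all
  then show ?thesis unfolding bipoly_lift_def bipoly_eval_def
    by (simp only: h.hom_sum h.hom_mult h.hom_prod h.hom_power k)
qed

lemma irreducible_space_quotient:
  assumes "irreducible_space Q"
  shows "irreducible_space (quotient_topology Q q)"
proof -
  have cont: "continuous_map Q (quotient_topology Q q) q"
    by (rule quotient_imp_continuous_map[OF quotient_map_quotient_topology])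
  show ?thesis unfolding irreducible_space_def
  proof (intro conjI allI impI)
    show "topspace (quotient_topology Q q) \<noteq> {}"
      using assms unfolding irreducible_space_def topspace_quotient_topology by blast
    fix C D assume CD: "closedin (quotient_topology Q q) C \<and> closedin (quotient_topology Q q) D \<and> C \<union> D = topspace (quotient_topology Q q)"
    let ?C = "{x \<in> topspace Q. q x \<in> C}" and ?D = "{x \<in> topspace Q. q x \<in> D}"
    have "closedin Q ?C" "closedin Q ?D" using closedin_continuous_map_preimage[OF cont] CD by blast+
    moreover have "?C \<union> ?D = topspace Q" using CD unfolding topspace_quotient_topology by blast
    ultimately have "?C = topspace Q \<or> ?D = topspace Q" using assms unfolding irreducible_space_def by blast
    moreover have "C \<subseteq> q ` topspace Q" "D \<subseteq> q ` topspace Q" using CD unfolding topspace_quotient_topology by blast+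
    ultimately show "C = topspace (quotient_topology Q q) \<or> D = topspace (quotient_topology Q q)"
      unfolding topspace_quotient_topology by blast
  qed
qed

text \<open>All conditions exclude the zeros of one non-zero polynomial \<open>B\<close> in
  \<open>\<kappa>\<close>: the periodicity conditions because no iterate is the identity, the other
  two to keep the given points away from infinity.\<close>

lemma exists_chart:
  fixes w1 w2 :: "nat \<Rightarrow> 'a::{field_char_0,alg_closed_field}"
  assumes N: "N > 0" and "res6 w1 \<noteq> 0" "res6 w2 \<noteq> 0" "(x1, y1) \<noteq> (0, 0)" "(x2, y2) \<noteq> (0, 0)"
  obtains \<kappa> where "\<And>k. k dvd N \<Longrightarrow> per w1 (1, \<kappa>) k \<noteq> 0" "\<And>k. k dvd N \<Longrightarrow> per w2 (1, \<kappa>) k \<noteq> 0"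
    "y1 - \<kappa> * x1 \<noteq> 0" "y2 - \<kappa> * x2 \<noteq> 0"
proof -
  let ?p = "\<lambda>w k. per (\<lambda>i. [:w i:]) (1, [:0, 1:]) k"
  have pos: "k > 0" if "k dvd N" for k using that N by (metis dvd_0_left_iff gr0I not_gr_zero)
  have fin: "finite {k. k dvd N}" using N by simp
  define B where "B = (\<Prod>k | k dvd N. ?p w1 k * ?p w2 k) * ([:y1, - x1:] * [:y2, - x2:])"
  have "?p w1 k * ?p w2 k \<noteq> 0" if "k dvd N" for k
    using per_chart_nonzero[OF assms(2) pos[OF that]] per_chart_nonzero[OF assms(3) pos[OF that]] by (rule no_zero_divisors)
  then have "(\<Prod>k | k dvd N. ?p w1 k * ?p w2 k) \<noteq> 0" using fin by (simp only: prod_zero_iff) blast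
  moreover have "[:y1, - x1:] \<noteq> 0" "[:y2, - x2:] \<noteq> 0" using assms(4,5) by auto
  ultimately have "B \<noteq> 0" unfolding B_def by (intro no_zero_divisors)
  then have "finite {x. poly B x = 0}" by (rule poly_roots_finite)
  then obtain \<kappa> where \<kappa>: "poly B \<kappa> \<noteq> 0" using infinite_UNIV_char_0[where 'a='a] ex_new_if_finite by blast
  have ev: "poly (?p w k) \<kappa> = per w (1, \<kappa>) k" for w k unfolding poly_hom.hom_per by simp
  have "(\<Prod>k | k dvd N. per w1 (1, \<kappa>) k * per w2 (1, \<kappa>) k) \<noteq> 0" and l: "y1 - \<kappa> * x1 \<noteq> 0" "y2 - \<kappa> * x2 \<noteq> 0"
    using \<kappa> unfolding B_def poly_mult poly_prod ev by auto
  then have "per w1 (1, \<kappa>) k \<noteq> 0" "per w2 (1, \<kappa>) k \<noteq> 0" if "k dvd N" for k using that fin by auto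
  then show ?thesis using l that by blast
qed

lemma Rat_periodD:
  assumes "(\<alpha>, \<phi>) \<in> Rat_period 2 N" "v \<in> \<alpha>" "w \<in> \<phi>"
  shows "(v 0, v 1) \<noteq> (0, 0)" "\<And>i. i > 1 \<Longrightarrow> v i = 0" "\<And>i. i > 5 \<Longrightarrow> w i = 0" "res6 w \<noteq> 0"
    "eval2 (dynatomic_poly (num_form 2 w) (den_form 2 w) N) (v 0) (v 1) = 0"
proof -
  have a: "\<alpha> \<in> proj_space 1" "\<phi> \<in> proj_space 5" "\<forall>w\<in>\<phi>. form_resultant 2 (num_form 2 w) (den_form 2 w) \<noteq> 0"
    "formal_period 2 N \<alpha> \<phi>" using assms(1) unfolding Rat_period_def Rat_def by auto
  obtain v0 where v0: "\<alpha> = proj_class v0" "v0 \<noteq> (\<lambda>_. 0)" "\<forall>i>1. v0 i = 0" using a(1) unfolding proj_space_def by blast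
  obtain s where s: "s \<noteq> 0" "v = (\<lambda>i. s * v0 i)" using assms(2) unfolding v0(1) proj_class_def by blast
  show v1: "v i = 0" if "i > 1" for i using that v0(3) s by simp
  show "(v 0, v 1) \<noteq> (0, 0)"
  proof
    assume "(v 0, v 1) = (0, 0)"
    then have "v0 0 = 0" "v0 1 = 0" using s by auto
    then have "v0 i = 0" for i using v0(3) by (cases "i > 1") (auto simp: not_less le_Suc_eq)
    then show False using v0(2) by auto
  qed
  obtain w0 where w0: "\<phi> = proj_class w0" "\<forall>i>5. w0 i = 0" using a(2) unfolding proj_space_def by blast
  then show "w i = 0" if "i > 5" for i using assms(3) that unfolding w0(1) proj_class_def by auto
  show "res6 w \<noteq> 0" using a(3) assms(3) form_resultant_2 by metis
  show "eval2 (dynatomic_poly (num_form 2 w) (den_form 2 w) N) (v 0) (v 1) = 0"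
    using a(4) assms(2,3) unfolding formal_period_def by blast
qed

lemma fam_high:
  assumes "\<And>i. i > 5 \<Longrightarrow> w1 i = 0" "\<And>i. i > 5 \<Longrightarrow> w2 i = 0" "i > 5"
  shows "fam w1 w2 \<kappa> t c i = 0"
  using assms by (simp add: fam_def wM_def)

text \<open>Joining the squaring map to itself and taking zero for both functions,
  \<open>family_irreducible\<close> supplies a dynatomic quotient of positive degree, which has a
  root.\<close>

lemma Rat_period_nonempty:
  assumes N1: "N > 1"
    and irr: "\<And>P A B :: 'a::{field_char_0,field_gcd,alg_closed_field} poly poly. P * dyn_den qper N = dyn_num qper N \<Longrightarrow> P = A * B \<Longrightarrow> degree A = 0 \<or> degree B = 0"
  shows "(Rat_period 2 N :: ('a proj_point \<times> 'a proj_point) set) \<noteq> {}"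
proof -
  define w :: "nat \<Rightarrow> 'a" where "w i = of_bool (i = 0 \<or> i = 5)" for i
  have N: "N > 0" using N1 by simp
  have res: "res6 w \<noteq> 0" by (simp add: res6_def w_def)
  obtain \<kappa> where top: "\<And>k. k dvd N \<Longrightarrow> per w (1, \<kappa>) k \<noteq> 0"
    by (rule exists_chart[OF N res res, of 0 1 0 1]) auto
  obtain d where d: "d * dyn_den (zper w \<kappa>) N = dyn_num (zper w \<kappa>) N" "degree d > 0"
    by (rule family_irreducible[where ?H1.0 = 0 and ?H2.0 = 0, OF N1 irr res res top top]) auto
  obtain z where "poly d z = 0" using alg_closed_imp_poly_has_root[OF d(2)] by blast
  from chart_point_in_Rat_period[OF N _ res top d(1) this] show ?thesis by (force simp: w_def)
qed

text \<open>If neither closed set were everything, an equation \<open>p\<close> of the first would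
  fail at a point over \<open>w1\<close> and an equation \<open>q\<close> of the second at a point
  over \<open>w2\<close>. Lifted to the family joining \<open>w1\<close> and \<open>w2\<close>,
  their product vanishes on the dynatomic zero set, so one of them vanishes over its own map,
  contrary to its choice.\<close>

lemma Rat_period_irreducible:
  assumes N1: "N > 1"
    and irr: "\<And>P A B :: 'a::{field_char_0,field_gcd,alg_closed_field} poly poly. P * dyn_den qper N = dyn_num qper N \<Longrightarrow> P = A * B \<Longrightarrow> degree A = 0 \<or> degree B = 0"
  shows "irreducible_space (subtopology (zariski_topology 1 5) (Rat_period 2 N :: ('a proj_point \<times> 'a proj_point) set))"
proof -
  let ?X = "Rat_period 2 N :: ('a proj_point \<times> 'a proj_point) set"
  have N: "N > 0" using N1 by simp
  have "?X \<subseteq> topspace (zariski_topology 1 5)"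
    unfolding topspace_zariski_topology Rat_period_def Rat_def by auto
  then have top: "topspace (subtopology (zariski_topology 1 5) ?X) = ?X" by (rule topspace_subtopology_subset)
  show ?thesis unfolding irreducible_space_def top
  proof (intro conjI allI impI)
    show "?X \<noteq> {}" by (rule Rat_period_nonempty[OF N1 irr])
    fix C D assume CD: "closedin (subtopology (zariski_topology 1 5) ?X) C \<and> closedin (subtopology (zariski_topology 1 5) ?X) D \<and> C \<union> D = ?X"
    obtain S1 where S1: "\<forall>p\<in>S1. bihomogeneous 1 5 p" "C = zero_locus 1 5 S1 \<inter> ?X"
      using CD unfolding closedin_subtopology closedin_zariski_topology by blast
    obtain S2 where S2: "\<forall>p\<in>S2. bihomogeneous 1 5 p" "D = zero_locus 1 5 S2 \<inter> ?X"
      using CD unfolding closedin_subtopology closedin_zariski_topology by blast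
    have witness: "\<exists>\<alpha> \<phi> p v w. (\<alpha>, \<phi>) \<in> ?X \<and> p \<in> S \<and> v \<in> \<alpha> \<and> w \<in> \<phi> \<and> bipoly_eval p v w \<noteq> 0"
      if "zero_locus 1 5 S \<inter> ?X \<noteq> ?X" for S
    proof -
      have "\<not> ?X \<subseteq> zero_locus 1 5 S" using that by blast
      then obtain x where "x \<in> ?X" "x \<notin> zero_locus 1 5 S" by blast
      then obtain \<alpha> \<phi> where x: "(\<alpha>, \<phi>) \<in> ?X" "(\<alpha>, \<phi>) \<notin> zero_locus 1 5 S" by (cases x) blast
      have "\<alpha> \<in> proj_space 1 \<and> \<phi> \<in> proj_space 5" using x(1) unfolding Rat_period_def Rat_def by auto
      then show ?thesis using x unfolding zero_locus_def by blast
    qed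
    show "C = ?X \<or> D = ?X"
    proof (rule ccontr)
      assume neg: "\<not> (C = ?X \<or> D = ?X)"
      obtain \<alpha>1 \<phi>1 p v1 w1 where p: "(\<alpha>1, \<phi>1) \<in> ?X" "p \<in> S1" "v1 \<in> \<alpha>1" "w1 \<in> \<phi>1" "bipoly_eval p v1 w1 \<noteq> 0"
        using witness[of S1] neg S1(2) by blast
      obtain \<alpha>2 \<phi>2 q v2 w2 where q: "(\<alpha>2, \<phi>2) \<in> ?X" "q \<in> S2" "v2 \<in> \<alpha>2" "w2 \<in> \<phi>2" "bipoly_eval q v2 w2 \<noteq> 0"
        using witness[of S2] neg S2(2) by blast
      note P = Rat_periodD[OF p(1,3,4)] and Q = Rat_periodD[OF q(1,3,4)]
      obtain \<kappa> where \<kappa>: "\<And>k. k dvd N \<Longrightarrow> per w1 (1, \<kappa>) k \<noteq> 0" "\<And>k. k dvd N \<Longrightarrow> per w2 (1, \<kappa>) k \<noteq> 0"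
        "v1 1 - \<kappa> * v1 0 \<noteq> 0" "v2 1 - \<kappa> * v2 0 \<noteq> 0"
        by (rule exists_chart[OF N P(4) Q(4) P(1) Q(1)]) blast
      define V :: "nat \<Rightarrow> 'a poly poly poly" where
        "V i = (if i = 0 then [:0, 1:] else if i = 1 then [:1, [:[:\<kappa>:]:]:] else 0)" for i
      define lift where "lift r = bipoly_lift r V (\<lambda>i. [:famA w1 w2 \<kappa> i:])" for r
      have evV: "(\<lambda>i. poly (spec2 (V i) t c) z) = chart_point \<kappa> z" for t c z
        by (rule ext) (simp add: V_def chart_point_def spec_linear)
      have evW: "(\<lambda>i. poly (spec2 [:famA w1 w2 \<kappa> i:] t c) z) = fam w1 w2 \<kappa> t c" for t c z
        by (rule ext) (simp add: spec_const poly_famA)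
      have evl: "poly (spec2 (lift r) t c) z = bipoly_eval r (chart_point \<kappa> z) (fam w1 w2 \<kappa> t c)" for r t c z
        unfolding lift_def eval_bipoly_lift evV evW ..
      have self: "u \<in> proj_class u" for u :: "nat \<Rightarrow> 'a" unfolding proj_class_def by (auto intro!: exI[of _ 1])
      have hyp: "poly (spec2 (lift p) t c) z * poly (spec2 (lift q) t c) z = 0"
        if "res6 (fam w1 w2 \<kappa> t c) \<noteq> 0" "\<And>k. k dvd N \<Longrightarrow> per (fam w1 w2 \<kappa> t c) (1, \<kappa>) k \<noteq> 0"
          "d * dyn_den (zper (fam w1 w2 \<kappa> t c) \<kappa>) N = dyn_num (zper (fam w1 w2 \<kappa> t c) \<kappa>) N" "poly d z = 0" for t c z d
      proof -
        have "(proj_class (chart_point \<kappa> z), proj_class (fam w1 w2 \<kappa> t c)) \<in> ?X"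
          using fam_high[OF P(3) Q(3)] by (intro chart_point_in_Rat_period[OF N _ that])
        then have "(proj_class (chart_point \<kappa> z), proj_class (fam w1 w2 \<kappa> t c)) \<in> zero_locus 1 5 S1 \<union> zero_locus 1 5 S2"
          using CD S1(2) S2(2) by blast
        then have "bipoly_eval p (chart_point \<kappa> z) (fam w1 w2 \<kappa> t c) = 0 \<or> bipoly_eval q (chart_point \<kappa> z) (fam w1 w2 \<kappa> t c) = 0"
          using p(2) q(2) self unfolding zero_locus_def by blast
        then show ?thesis unfolding evl by auto
      qed
      obtain d1 d2 where d: "d1 * dyn_den (zper w1 \<kappa>) N = dyn_num (zper w1 \<kappa>) N" "d2 * dyn_den (zper w2 \<kappa>) N = dyn_num (zper w2 \<kappa>) N"
        and disj: "(\<forall>z c. poly d1 z = 0 \<longrightarrow> poly (spec2 (lift p) 1 c) z = 0) \<or> (\<forall>z c. poly d2 z = 0 \<longrightarrow> poly (spec2 (lift q) (- 1) c) z = 0)"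
        by (rule family_irreducible[OF N1 irr P(4) Q(4) \<kappa>(1,2) hyp]) blast
      \<comment> \<open>Off infinity the vector \<open>v\<close> is a multiple of a chart point, and
        by \<open>dynatomic_eval\<close> the coordinate of that point is a root of
        \<open>dd\<close>.\<close>
      have final: False
        if r: "bihomogeneous 1 5 r" "bipoly_eval r v w \<noteq> 0" and v: "v 1 - \<kappa> * v 0 \<noteq> 0" "\<And>i. i > 1 \<Longrightarrow> v i = 0"
          and w: "eval2 (dynatomic_poly (num_form 2 w) (den_form 2 w) N) (v 0) (v 1) = 0" "\<And>k. k dvd N \<Longrightarrow> per w (1, \<kappa>) k \<noteq> 0"
          and dd: "dd * dyn_den (zper w \<kappa>) N = dyn_num (zper w \<kappa>) N"
          and van: "\<And>z. poly dd z = 0 \<Longrightarrow> bipoly_eval r (chart_point \<kappa> z) w = 0" for r v w dd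
      proof -
        define s where "s = v 1 - \<kappa> * v 0"
        define z where "z = v 0 / s"
        have s0: "s \<noteq> 0" using v(1) unfolding s_def .
        have e: "v 0 = s * z" "v 1 = s * (1 + z * \<kappa>)" using s0 unfolding z_def by (simp_all add: field_simps s_def)
        have "poly dd z = 0" using dynatomic_eval[OF N w(2) dd s0, of z] w(1) s0 unfolding e by simp
        then have "bipoly_eval r (chart_point \<kappa> z) w = 0" by (rule van)
        moreover have "v = (\<lambda>i. s * chart_point \<kappa> z i)"
        proof
          fix i show "v i = s * chart_point \<kappa> z i"
            using e v(2)[of i] by (cases "i = 0"; cases "i = 1") (simp_all add: chart_point_def)
        qed
        then have "v \<in> proj_class (chart_point \<kappa> z)" using s0 unfolding proj_class_def by blast
        ultimately show False using bipoly_eval_proj_class[OF r(1), of "chart_point \<kappa> z" w] self[of w] r(2) by blast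
      qed
      from disj show False
      proof
        assume "\<forall>z c. poly d1 z = 0 \<longrightarrow> poly (spec2 (lift p) 1 c) z = 0"
        then show False using final[of p v1 w1 d1] S1(1) p \<kappa> P d(1) unfolding evl fam_1 by blast
      next
        assume "\<forall>z c. poly d2 z = 0 \<longrightarrow> poly (spec2 (lift q) (- 1) c) z = 0"
        then show False using final[of q v2 w2 d2] S2(1) q \<kappa> Q d(2) unfolding evl fam_1 by blast
      qed
    qed
  qed
qed

theorem mainTheorem1:
  fixes N :: nat
  assumes "number_field TYPE('k::field_char_0)"
    and "N > 1"
  shows "irreducible_space
    (moduli_space 2 N :: ('k alg_closure proj_point \<times> 'k alg_closure proj_point) set topology)"
proof -
  have "irreducible_space (subtopology (zariski_topology 1 5)
      (Rat_period 2 N :: ('k alg_closure proj_point \<times> 'k alg_closure proj_point) set))"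
    by (rule Rat_period_irreducible[OF assms(2) qper_quotient_irreducible[OF assms]])
  then show ?thesis unfolding moduli_space_def by (intro irreducible_space_quotient) simp
qed

end
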